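(* Let $\alpha\in(0,1]$, let $c,\varepsilon\in\mathbb{R}$ with $|\varepsilon|<1$, and let $0<\delta<1$. Let $\Omega=\{(x,y)\in\mathbb{R}^2: 0<x<1,\ -\pi<y<\pi\}$. Let $\varphi\in C^{3+\delta}[-\pi,\pi]$ and $\psi\in C^{2+\delta}[-\pi,\pi]$ satisfy $\varphi(-\pi)=-\varphi(\pi)$, $\varphi'(-\pi)=-\varphi'(\pi)$, $\psi(-\pi)=-\psi(\pi)$, $\psi'(-\pi)=-\psi'(\pi)$. Then there exists a unique regular solution $u$, with $u_y\in C(\bar\Omega)$, of $$D_x^\alpha D_x^\alpha u(x,y)+u_{yy}(x,y)-\varepsilon u_{yy}(x,-y)-c^2u(x,y)=0,\quad (x,y)\in\Omega,$$ satisfying $$u(0,y)=\varphi(y),\quad u(1,y)=\psi(y),\quad -\pi\le y\le\pi,$$ $$u(x,-\pi)=-u(x,\pi),\quad u_y(x,-\pi)=-u_y(x,\pi),\quad 0\le x\le 1,$$ and it can be written in the form $$u(x,y)=\sum_{k=0}^\infty\left[\varphi_{2k}C_{\mu_{2k}}(x)+\psi_{2k}S_{\mu_{2k}}(x)\right]Y_{2k}(y)+\sum_{k=0}^\infty\left[\varphi_{2k+1}C_{\mu_{2k+1}}(x)+\psi_{2k+1}S_{\mu_{2k+1}}(x)\right]Y_{2k+1}(y).$$ Here, for $k=0,1,\dots$, $Y_{2k+1}(y)=\sin\left(k+\tfrac12\right)y$, $Y_{2k}(y)=\cos\left(k+\tfrac12\right)y$, $\lambda_{2k+1}=(1+\varepsilon)\left(k+\tfrac12\right)^2$,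 $\lambda_{2k}=(1-\varepsilon)\left(k+\tfrac12\right)^2$; and for every index $n\ge0$, $\mu_n=\sqrt{\lambda_n+c^2}$, while $\varphi_n,\psi_n$ are the Fourier coefficients of $\varphi,\psi$ with respect to $Y_n$.
   Context: $D_x^\alpha$ is the Caputo derivative in $x$ of order $\alpha$: for $0<\alpha<1$, $D_x^\alpha u(x,y)=\frac{1}{\Gamma(1-\alpha)}\int_0^x (x-s)^{-\alpha}\frac{\partial u}{\partial s}(s,y)\,ds$, and $D_x^1=\partial/\partial x$. A regular solution of the equation is a function $u\in C(\bar\Omega)$ such that $D_x^\alpha u,\ D_x^\alpha D_x^\alpha u,\ u_{yy}\in C(\Omega)$ and the equation holds in $\Omega$. $C^{m+\delta}[-\pi,\pi]$ is the Hölder space of $m$ times continuously differentiable functions whose $m$-th derivative is Hölder continuous with exponent $\delta$. The Fourier coefficient of $f$ with respect to $Y_n$ is $f_n=\left(\int_{-\pi}^{\pi}f(y)Y_n(y)\,dy\right)\big/\left(\int_{-\pi}^{\pi}Y_n(y)^2\,dy\right)$. The Mittag-Leffler type function is $E_{\alpha,\beta}(z)=\sum_{k=0}^\infty\frac{z^k}{\Gamma(\alpha k+\beta)}$. For $\mu>0$ and $t\in[0,1]$, $$C_\mu(t)=\frac{E_{\alpha,1}(\mu)E_{\alpha,1}(-\mu t^\alpha)-E_{\alpha,1}(-\mu)E_{\alpha,1}(\mu t^\alpha)}{2\mu E_{2\alpha,\alpha+1}(\mu^2)},\qquad S_\mu(t)=\frac{t^\alpha E_{2\alpha,\alpha+1}(\mu^2t^{2\alpha})}{E_{2\alpha,\alpha+1}(\mu^2)}.$$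 *)

theory Defs
  imports "HOL-Analysis.Analysis"
begin

definition Omega :: "(real \<times> real) set"
  where "Omega = {0<..<1} \<times> {-pi<..<pi}"

text \<open>
  Derivative relative to a set; on a closed interval it is one-sided at the endpoints.
\<close>

definition deriv_within :: "real set \<Rightarrow> (real \<Rightarrow> real) \<Rightarrow> real \<Rightarrow> real"
  where "deriv_within S f y = vector_derivative f (at y within S)"

definition hoelder_space :: "nat \<Rightarrow> real \<Rightarrow> real set \<Rightarrow> (real \<Rightarrow> real) set"
  where "hoelder_space m \<delta> S =
    {f. (\<forall>i<m. (deriv_within S ^^ i) f differentiable_on S)
      \<and> continuous_on S ((deriv_within S ^^ m) f)
      \<and> (\<exists>K. \<forall>x\<in>S. \<forall>y\<in>S.
            \<bar>(deriv_within S ^^ m) f x - (deriv_within S ^^ m) f y\<bar> \<le> K * \<bar>x - y\<bar> powr \<delta>)}"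

text \<open>
  The Caputo derivative of order \<open>\<alpha> \<in> (0,1]\<close> with base point 0. Both \<open>deriv\<close> and the Lebesgue
  integral are total functions, so \<open>caputo \<alpha> f x\<close> is meaningful only under
  \<open>has_caputo \<alpha> f x\<close>. No differentiability at 0 is asked for: \<open>f'\<close> typically behaves like
  \<open>s powr (\<alpha> - 1)\<close> there.
\<close>

definition caputo :: "real \<Rightarrow> (real \<Rightarrow> real) \<Rightarrow> real \<Rightarrow> real"
  where "caputo \<alpha> f x =
    (if \<alpha> = 1 then deriv f x
     else 1 / Gamma (1 - \<alpha>) * (LBINT s:{0<..<x}. (x - s) powr (-\<alpha>) * deriv f s))"

definition has_caputo :: "real \<Rightarrow> (real \<Rightarrow> real) \<Rightarrow> real \<Rightarrow> bool"
  where "has_caputo \<alpha> f x \<longleftrightarrow>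
    (if \<alpha> = 1 then f differentiable (at x)
     else (\<forall>s\<in>{0<..<x}. f differentiable (at s))
        \<and> set_integrable lborel {0<..<x} (\<lambda>s. (x - s) powr (-\<alpha>) * deriv f s))"

definition caputo_x :: "real \<Rightarrow> (real \<Rightarrow> real \<Rightarrow> real) \<Rightarrow> real \<Rightarrow> real \<Rightarrow> real"
  where "caputo_x \<alpha> u x y = caputo \<alpha> (\<lambda>s. u s y) x"

definition has_caputo_x :: "real \<Rightarrow> (real \<Rightarrow> real \<Rightarrow> real) \<Rightarrow> real \<Rightarrow> real \<Rightarrow> bool"
  where "has_caputo_x \<alpha> u x y \<longleftrightarrow> has_caputo \<alpha> (\<lambda>s. u s y) x"

definition partial_yy :: "(real \<Rightarrow> real \<Rightarrow> real) \<Rightarrow> real \<Rightarrow> real \<Rightarrow> real"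
  where "partial_yy u x y = deriv (deriv (u x)) y"

text \<open>The first \<open>y\<close>-derivative on the closed rectangle, one-sided at \<open>y = \<plusminus>\<pi>\<close>.\<close>

definition partial_y :: "(real \<Rightarrow> real \<Rightarrow> real) \<Rightarrow> real \<Rightarrow> real \<Rightarrow> real"
  where "partial_y u x y = deriv_within {-pi..pi} (u x) y"

definition regular_solution :: "real \<Rightarrow> real \<Rightarrow> real \<Rightarrow> (real \<Rightarrow> real \<Rightarrow> real) \<Rightarrow> bool"
  where "regular_solution \<alpha> \<epsilon> c u \<longleftrightarrow>
      continuous_on (closure Omega) (\<lambda>(x, y). u x y)
    \<and> (\<forall>(x, y)\<in>Omega. has_caputo_x \<alpha> u x y)
    \<and> continuous_on Omega (\<lambda>(x, y). caputo_x \<alpha> u x y)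
    \<and> (\<forall>(x, y)\<in>Omega. has_caputo_x \<alpha> (caputo_x \<alpha> u) x y)
    \<and> continuous_on Omega (\<lambda>(x, y). caputo_x \<alpha> (caputo_x \<alpha> u) x y)
    \<and> (\<forall>(x, y)\<in>Omega. u x differentiable (at y) \<and> deriv (u x) differentiable (at y))
    \<and> continuous_on Omega (\<lambda>(x, y). partial_yy u x y)
    \<and> (\<forall>(x, y)\<in>Omega.
         caputo_x \<alpha> (caputo_x \<alpha> u) x y + partial_yy u x y - \<epsilon> * partial_yy u x (-y)
           - c\<^sup>2 * u x y = 0)"

definition problem_solution ::
    "real \<Rightarrow> real \<Rightarrow> real \<Rightarrow> (real \<Rightarrow> real) \<Rightarrow> (real \<Rightarrow> real) \<Rightarrow> (real \<Rightarrow> real \<Rightarrow> real) \<Rightarrow> bool"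
  where "problem_solution \<alpha> \<epsilon> c \<phi> \<psi> u \<longleftrightarrow>
      regular_solution \<alpha> \<epsilon> c u
    \<and> (\<forall>(x, y)\<in>closure Omega. u x differentiable (at y within {-pi..pi}))
    \<and> continuous_on (closure Omega) (\<lambda>(x, y). partial_y u x y)
    \<and> (\<forall>y\<in>{-pi..pi}. u 0 y = \<phi> y \<and> u 1 y = \<psi> y)
    \<and> (\<forall>x\<in>{0..1}. u x (-pi) = - u x pi \<and> partial_y u x (-pi) = - partial_y u x pi)"

definition mittag_leffler :: "real \<Rightarrow> real \<Rightarrow> real \<Rightarrow> real"
  where "mittag_leffler \<alpha> \<beta> z = (\<Sum>k. z ^ k / Gamma (\<alpha> * real k + \<beta>))"

definition C_fun :: "real \<Rightarrow> real \<Rightarrow> real \<Rightarrow> real"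
  where "C_fun \<alpha> \<mu> t =
    (mittag_leffler \<alpha> 1 \<mu> * mittag_leffler \<alpha> 1 (- \<mu> * t powr \<alpha>)
       - mittag_leffler \<alpha> 1 (- \<mu>) * mittag_leffler \<alpha> 1 (\<mu> * t powr \<alpha>))
    / (2 * \<mu> * mittag_leffler (2 * \<alpha>) (\<alpha> + 1) (\<mu>\<^sup>2))"

definition S_fun :: "real \<Rightarrow> real \<Rightarrow> real \<Rightarrow> real"
  where "S_fun \<alpha> \<mu> t =
    t powr \<alpha> * mittag_leffler (2 * \<alpha>) (\<alpha> + 1) (\<mu>\<^sup>2 * t powr (2 * \<alpha>))
    / mittag_leffler (2 * \<alpha>) (\<alpha> + 1) (\<mu>\<^sup>2)"

definition Y :: "nat \<Rightarrow> real \<Rightarrow> real"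
  where "Y n y =
    (if even n then cos ((real (n div 2) + 1/2) * y) else sin ((real (n div 2) + 1/2) * y))"

definition eigenval :: "real \<Rightarrow> nat \<Rightarrow> real"
  where "eigenval \<epsilon> n =
    (if even n then (1 - \<epsilon>) * (real (n div 2) + 1/2)\<^sup>2 else (1 + \<epsilon>) * (real (n div 2) + 1/2)\<^sup>2)"

definition mu :: "real \<Rightarrow> real \<Rightarrow> nat \<Rightarrow> real"
  where "mu \<epsilon> c n = sqrt (eigenval \<epsilon> n + c\<^sup>2)"

definition fourier_coeff :: "(real \<Rightarrow> real) \<Rightarrow> nat \<Rightarrow> real"
  where "fourier_coeff f n =
    (LBINT y:{-pi..pi}. f y * Y n y) / (LBINT y:{-pi..pi}. (Y n y)\<^sup>2)"

definition series_term ::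
    "real \<Rightarrow> real \<Rightarrow> real \<Rightarrow> (real \<Rightarrow> real) \<Rightarrow> (real \<Rightarrow> real) \<Rightarrow> nat \<Rightarrow> real \<Rightarrow> real \<Rightarrow> real"
  where "series_term \<alpha> \<epsilon> c \<phi> \<psi> n x y =
    (fourier_coeff \<phi> n * C_fun \<alpha> (mu \<epsilon> c n) x + fourier_coeff \<psi> n * S_fun \<alpha> (mu \<epsilon> c n) x) * Y n y"

end

theory Submission imports Defs begin

text \<open>
  The reflection \<open>y \<mapsto> -y\<close> acts on \<open>Y n\<close> as \<open>1\<close> or \<open>-1\<close>, so the coefficient \<open>W\<close> of a solution with
  respect to \<open>Y n\<close> should satisfy \<open>D D W = \<mu>\<^sup>2 W\<close>, \<open>D\<close> being the Caputo derivative and \<open>\<mu> = mu \<epsilon> c n\<close>.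
  With \<open>E m t = E\<^sub>\<alpha>(m t\<^sup>\<alpha>)\<close>, the functions \<open>S = (E \<mu> - E (-\<mu>)) / (E \<mu> 1 - E (-\<mu>) 1)\<close> and \<open>E (-\<mu>)\<close> are
  independent solutions, and \<open>C = E (-\<mu>) - E (-\<mu>) 1 * S\<close>.

  Existence. \<open>E (-\<mu>)\<close> decreases and is \<open>O(1 / (\<mu> t\<^sup>\<alpha>))\<close>; \<open>S\<close> increases and, by log-convexity of \<open>\<Gamma>\<close>, is
  \<open>O(1 / \<mu>\<^sup>2)\<close> on \<open>[0, b]\<close> for every \<open>b < 1\<close>. Since the Fourier coefficients multiplied by their
  frequencies are absolutely summable, all series converge locally uniformly in the interior.
  Monotonicity of the two families bounds the mass of the singular Caputo integrals by the Caputo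
  derivatives themselves, which justifies termwise fractional differentiation.

  Uniqueness. A regular solution gives no bound on \<open>D D u\<close> near \<open>x = 0\<close> that is uniform in \<open>y\<close>, so
  projecting the equation onto \<open>Y n\<close> is not immediate. For each \<open>y\<close>, applying a fractional integral to
  \<open>u\<close> yields \<open>g y * x powr (2 - \<alpha>) + J\<^sup>2 (D D u)\<close>, and integrating over a \<open>y\<close>-interval commutes with \<open>J\<^sup>2\<close> up
  to a linear term \<open>b * x\<close> depending on the interval; scaling \<open>x\<close> with the length of the interval shows
  that \<open>b\<close> has small second differences and vanishes. Hence \<open>W - W 0 = \<gamma> x\<^sup>\<alpha> + \<mu>\<^sup>2 J\<^bsup>2\<alpha>\<^esup> W\<close>, a Volterra
  equation whose solutions with zero boundary values vanish because \<open>S 1 \<noteq> 0\<close>; completeness of the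
  \<open>Y n\<close> concludes.
\<close>

section \<open>Riemann--Liouville integrals\<close>

text \<open>Caputo derivatives are moved to fractional integrals, where Fubini's theorem and the
  semigroup law hold. The orders 1 - alpha and 2 - 2 alpha degenerate for alpha = 1, which is
  therefore treated apart. That E(-mu) decreases is shown by contradiction: at a first zero of its
  derivative the Caputo integral would change at a rate bounded away from 0, whereas D E = -mu E
  makes that rate 0. In the uniqueness part the projected equation first holds for the fractional
  integral of order 2 - 2 alpha of a mode; a further integral of order 2 alpha turns it into a twice
  integrated Volterra equation that asks for nothing beyond continuity. The scaling is x^alpha = l
  for intervals of length l: all errors are then of size x^2, and division by x leaves second
  differences of order l^(1 / alpha), an exponent above 1 for alpha < 1. For alpha = 1 a linear term
  is harmless, because x^(2 - alpha) is itself linear.\<close>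

definition RL :: "real \<Rightarrow> (real \<Rightarrow> real) \<Rightarrow> real \<Rightarrow> real"
  where "RL a f x = 1 / Gamma a * (LBINT s:{0<..<x}. (x - s) powr (a - 1) * f s)"

lemma Gamma_pos_nonzero [simp]: "0 < x \<Longrightarrow> Gamma x \<noteq> (0 :: real)"
  using Gamma_real_pos[of x] by linarith

text \<open>The affine substitution s = r + (x - r) t in the Beta integral on the unit interval.
  Lebesgue measure with an indicator is the form in which it enters Fubini's theorem.\<close>

lemma has_bochner_integral_Beta:
  fixes a b r x :: real
  assumes a: "0 < a" and b: "0 < b" and rx: "r < x"
  shows "has_bochner_integral lborel
    (\<lambda>s. indicator {r<..<x} s * ((x - s) powr (a - 1) * (s - r) powr (b - 1)))
    (Beta a b * (x - r) powr (a + b - 1))"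
proof -
  let ?g = "\<lambda>t::real. t powr (b - 1) * (1 - t) powr (a - 1)"
  have hi: "(?g has_integral Beta b a) {0<..<1}"
    using has_integral_Beta_real[OF b a] by (simp add: has_integral_Icc_iff_Ioo)
  then have "?g absolutely_integrable_on {0<..<1}"
    by (intro nonnegative_absolutely_integrable_1) auto
  then have leb: "set_integrable lebesgue {0<..<1} ?g" .
  have m: "(\<lambda>t. indicator {0<..<1} t * ?g t) \<in> borel_measurable lborel" by measurable
  have int: "integrable lborel (\<lambda>t. indicator {0<..<1} t * ?g t)"
    using leb m unfolding set_integrable_def by (simp add: integrable_completion)
  have "(LINT t|lborel. indicator {0<..<1} t * ?g t) = Beta b a"
    using has_integral_set_lebesgue[OF leb] hi m
    unfolding set_lebesgue_integral_def by (simp add: integral_completion has_integral_unique)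
  with int have h: "has_bochner_integral lborel (\<lambda>t. indicator {0<..<1} t * ?g t) (Beta b a)"
    by (simp add: has_bochner_integral_iff)
  have c: "1 / (x - r) \<noteq> 0" using rx by simp
  have "has_bochner_integral lborel
      (\<lambda>s. indicator {0<..<1} (- r / (x - r) + 1 / (x - r) * s) * ?g (- r / (x - r) + 1 / (x - r) * s))
      (Beta b a /\<^sub>R \<bar>1 / (x - r)\<bar>)"
    by (rule iffD1[OF lborel_has_bochner_integral_real_affine_iff[OF c,
          of "\<lambda>t. indicator {0<..<1} t * ?g t" "Beta b a" "- r / (x - r)"] h])
  then have "has_bochner_integral lborel
      (\<lambda>s. (x - r) powr (a + b - 2) * (indicator {0<..<1} (- r / (x - r) + 1 / (x - r) * s) * ?g (- r / (x - r) + 1 / (x - r) * s)))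
      ((x - r) powr (a + b - 2) * (Beta b a /\<^sub>R \<bar>1 / (x - r)\<bar>))"
    by (rule has_bochner_integral_mult_right)
  moreover have "(x - r) powr (a + b - 2) * (Beta b a /\<^sub>R \<bar>1 / (x - r)\<bar>) = Beta a b * (x - r) powr (a + b - 1)"
  proof -
    have "(x - r) powr (a + b - 1) = (x - r) powr (a + b - 2) * (x - r) powr 1"
      by (subst powr_add [symmetric]) simp
    then show ?thesis using rx by (simp add: Beta_commute)
  qed
  moreover have "(x - r) powr (a + b - 2) * (indicator {0<..<1} (- r / (x - r) + 1 / (x - r) * s) * ?g (- r / (x - r) + 1 / (x - r) * s))
     = indicator {r<..<x} s * ((x - s) powr (a - 1) * (s - r) powr (b - 1))" for s
  proof -
    have e1: "- r / (x - r) + 1 / (x - r) * s = (s - r) / (x - r)" by (simp add: diff_divide_distrib)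
    have e2: "1 - (s - r) / (x - r) = (x - s) / (x - r)" using rx by (simp add: field_simps)
    have e3: "(s - r) / (x - r) \<in> {0<..<1} \<longleftrightarrow> s \<in> {r<..<x}" using rx by (auto simp: field_simps)
    have e4: "(x - r) powr (a + b - 2) = (x - r) powr (b - 1) * (x - r) powr (a - 1)"
      by (simp add: powr_add [symmetric] algebra_simps)
    show ?thesis
    proof (cases "s \<in> {r<..<x}")
      case True
      then have "((s - r) / (x - r)) powr (b - 1) = (s - r) powr (b - 1) / (x - r) powr (b - 1)"
        "((x - s) / (x - r)) powr (a - 1) = (x - s) powr (a - 1) / (x - r) powr (a - 1)"
        by (auto simp: powr_divide)
      then show ?thesis using True rx unfolding e1 e2 e4 by (simp add: e3 indicator_def)
    next
      case False
      then show ?thesis unfolding e1 using e3 by (simp add: indicator_def)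
    qed
  qed
  ultimately show ?thesis by simp
qed

lemma RL_semigroup_aux:
  fixes a b x :: real and f :: "real \<Rightarrow> real"
  assumes a: "0 < a" and b: "0 < b" and x: "0 < x"
    and f: "set_integrable lborel {0<..<x} (\<lambda>r. (x - r) powr (a + b - 1) * f r)"
  shows "RL a (RL b f) x = RL (a + b) f x"
    and "set_integrable lborel {0<..<x} (\<lambda>s. (x - s) powr (a - 1) * RL b f s)"
proof -
  define f' where "f' r = indicator {0<..<x} r * f r" for r
  have f'm: "f' \<in> borel_measurable lborel"
  proof -
    \<comment> \<open>Only the product with the kernel is known to be measurable; multiplying by the
      reciprocal power recovers \<open>f\<close> on the interval.\<close>
    have "(\<lambda>r. (x - r) powr (-(a + b - 1)) * (indicator {0<..<x} r * ((x - r) powr (a + b - 1) * f r))) \<in> borel_measurable lborel"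
      using borel_measurable_integrable[OF f[unfolded set_integrable_def]]
      by (intro borel_measurable_times[of "\<lambda>r. (x - r) powr (-(a + b - 1))"]) simp_all
    also have "(\<lambda>r. (x - r) powr (-(a + b - 1)) * (indicator {0<..<x} r * ((x - r) powr (a + b - 1) * f r))) = f'"
      by (auto simp: f'_def indicator_def fun_eq_iff mult.assoc [symmetric] powr_add [symmetric])
    finally show ?thesis .
  qed
  note f'm [measurable]
  define F where "F = (\<lambda>(r, s). if 0 < r \<and> r < s \<and> s < x then (x - s) powr (a - 1) * (s - r) powr (b - 1) * f' r else 0)"
  have Fm [measurable]: "F \<in> borel_measurable (lborel \<Otimes>\<^sub>M lborel)"
    unfolding F_def by measurable
  have sec: "has_bochner_integral lborel (\<lambda>s. norm (F (r, s))) (indicator {0<..<x} r * (Beta a b * ((x - r) powr (a + b - 1) * \<bar>f r\<bar>)))"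
   and sec2: "has_bochner_integral lborel (\<lambda>s. F (r, s)) (indicator {0<..<x} r * (Beta a b * ((x - r) powr (a + b - 1) * f r)))" for r
  proof -
    have "F (r, s) = f' r * (indicator {r<..<x} s * ((x - s) powr (a - 1) * (s - r) powr (b - 1)))" for s
      by (auto simp: F_def f'_def indicator_def)
    moreover have "norm (F (r, s)) = \<bar>f' r\<bar> * (indicator {r<..<x} s * ((x - s) powr (a - 1) * (s - r) powr (b - 1)))" for s
      by (auto simp: F_def f'_def indicator_def abs_mult)
    moreover have "has_bochner_integral lborel (\<lambda>s. c * (indicator {r<..<x} s * ((x - s) powr (a - 1) * (s - r) powr (b - 1))))
       (c * (Beta a b * (x - r) powr (a + b - 1)))" if "r < x" for c
      using has_bochner_integral_Beta[OF a b that] by (rule has_bochner_integral_mult_right)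
    note * = calculation this
    show "has_bochner_integral lborel (\<lambda>s. norm (F (r, s))) (indicator {0<..<x} r * (Beta a b * ((x - r) powr (a + b - 1) * \<bar>f r\<bar>)))"
      using *(3)[of "\<bar>f' r\<bar>"] unfolding *(2) by (cases "r \<in> {0<..<x}") (auto simp: f'_def mult_ac)
    show "has_bochner_integral lborel (\<lambda>s. F (r, s)) (indicator {0<..<x} r * (Beta a b * ((x - r) powr (a + b - 1) * f r)))"
      using *(3)[of "f' r"] unfolding *(1) by (cases "r \<in> {0<..<x}") (auto simp: f'_def mult_ac)
  qed
  have Fint: "integrable (lborel \<Otimes>\<^sub>M lborel) F"
  proof (rule lborel_pair.Fubini_integrable)
    have "integrable lborel (\<lambda>r. Beta a b * \<bar>indicator {0<..<x} r * ((x - r) powr (a + b - 1) * f r)\<bar>)"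
      using f unfolding set_integrable_def by (intro integrable_mult_right integrable_abs) simp
    also have "(\<lambda>r. Beta a b * \<bar>indicator {0<..<x} r * ((x - r) powr (a + b - 1) * f r)\<bar>)
       = (\<lambda>r. LINT s|lborel. norm (F (r, s)))"
      using has_bochner_integral_integral_eq[OF sec] by (auto simp: fun_eq_iff indicator_def abs_mult)
    finally show "integrable lborel (\<lambda>r. LINT s|lborel. norm (F (r, s)))" .
    show "AE r in lborel. integrable lborel (\<lambda>s. F (r, s))"
      using sec2 by (auto simp: has_bochner_integral_iff)
  qed simp
  have inner: "(LINT r|lborel. F (r, s)) = Gamma b * (indicator {0<..<x} s * ((x - s) powr (a - 1) * RL b f s))" for s
  proof (cases "s \<in> {0<..<x}")
    case True
    have "(LINT r|lborel. F (r, s)) = (LINT r|lborel. (x - s) powr (a - 1) * (indicator {0<..<s} r * ((s - r) powr (b - 1) * f r)))"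
      using True by (intro Bochner_Integration.integral_cong) (auto simp: F_def f'_def indicator_def)
    then show ?thesis using True b by (simp add: RL_def set_lebesgue_integral_def)
  next
    case False
    then have "F (r, s) = 0" for r by (auto simp: F_def)
    with False show ?thesis by simp
  qed
  have "integrable lborel (\<lambda>s. LINT r|lborel. F (r, s))"
    using lborel_pair.integrable_snd[of "\<lambda>r s. F (r, s)"] Fint by simp
  then have "integrable lborel (\<lambda>s. 1 / Gamma b * (Gamma b * (indicator {0<..<x} s * ((x - s) powr (a - 1) * RL b f s))))"
    unfolding inner by (rule integrable_mult_right)
  then show "set_integrable lborel {0<..<x} (\<lambda>s. (x - s) powr (a - 1) * RL b f s)"
    using Gamma_real_pos[OF b] by (simp add: set_integrable_def)
  have "(LINT s|lborel. LINT r|lborel. F (r, s)) = (LINT r|lborel. LINT s|lborel. F (r, s))"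
    using lborel_pair.Fubini_integral[of "\<lambda>r s. F (r, s)"] Fint by simp
  also have "\<dots> = (LINT r|lborel. Beta a b * (indicator {0<..<x} r * ((x - r) powr (a + b - 1) * f r)))"
    using has_bochner_integral_integral_eq[OF sec2] by (simp add: mult_ac)
  finally have "Gamma b * (LINT s|lborel. indicator {0<..<x} s * ((x - s) powr (a - 1) * RL b f s)) =
     Beta a b * (LINT r|lborel. indicator {0<..<x} r * ((x - r) powr (a + b - 1) * f r))"
    unfolding inner by simp
  then show "RL a (RL b f) x = RL (a + b) f x"
    using Gamma_real_pos[OF a] Gamma_real_pos[OF b] Gamma_real_pos[of "a + b"] a b
    unfolding RL_def set_lebesgue_integral_def Beta_def
    by (simp add: field_simps)
qed

lemma set_integrable_powr_mult:
  fixes f :: "real \<Rightarrow> real"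
  assumes "set_integrable lborel {0<..<x} f" "0 \<le> c"
  shows "set_integrable lborel {0<..<x} (\<lambda>r. (x - r) powr c * f r)"
proof (rule set_integrable_bound[where f = "\<lambda>r. x powr c * f r"])
  show "set_integrable lborel {0<..<x} (\<lambda>r. x powr c * f r)"
    using assms by simp
  have "(\<lambda>r. (x - r) powr c * (indicator {0<..<x} r * f r)) \<in> borel_measurable lborel"
    using borel_measurable_integrable[OF assms(1)[unfolded set_integrable_def]]
    by (intro borel_measurable_times[of "\<lambda>r. (x - r) powr c"]) simp_all
  then show "set_borel_measurable lborel {0<..<x} (\<lambda>r. (x - r) powr c * f r)"
    by (simp add: set_borel_measurable_def mult_ac)
  show "AE r in lborel. r \<in> {0<..<x} \<longrightarrow> norm ((x - r) powr c * f r) \<le> norm (x powr c * f r)"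
    using assms(2) by (auto simp: abs_mult intro!: mult_right_mono powr_mono2)
qed

text \<open>For a + b at least 1 the kernel of the composite is bounded, so integrability of
  \<open>f\<close> itself suffices.\<close>

lemma RL_semigroup:
  assumes "0 < a" "0 < b" "1 \<le> a + b" "0 < x" "set_integrable lborel {0<..<x} f"
  shows "RL a (RL b f) x = RL (a + b) f x"
    and "set_integrable lborel {0<..<x} (\<lambda>s. (x - s) powr (a - 1) * RL b f s)"
  using RL_semigroup_aux[of a b x f] set_integrable_powr_mult[of x f "a + b - 1"] assms by auto

lemma RL_cong:
  assumes "\<And>s. s \<in> {0<..<x} \<Longrightarrow> f s = g s"
  shows "RL a f x = RL a g x"
proof -
  have "(LBINT s:{0<..<x}. (x - s) powr (a - 1) * f s) = (LBINT s:{0<..<x}. (x - s) powr (a - 1) * g s)"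
    using assms by (intro set_lebesgue_integral_cong) auto
  then show ?thesis by (simp add: RL_def)
qed

lemma RL_1: "RL 1 f x = (LBINT s:{0<..<x}. f s)"
  unfolding RL_def set_lebesgue_integral_def
  by (auto intro!: Bochner_Integration.integral_cong simp: indicator_def)

lemma RL_cmult: "RL a (\<lambda>s. c * f s) x = c * RL a f x"
  unfolding RL_def set_lebesgue_integral_def
  by (simp add: mult.left_commute[of _ c])

lemma RL_add:
  assumes "set_integrable lborel {0<..<x} (\<lambda>s. (x - s) powr (a - 1) * f s)"
    and "set_integrable lborel {0<..<x} (\<lambda>s. (x - s) powr (a - 1) * g s)"
  shows "RL a (\<lambda>s. f s + g s) x = RL a f x + RL a g x"
proof -
  have "(LBINT s:{0<..<x}. (x - s) powr (a - 1) * (f s + g s)) =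
      (LBINT s:{0<..<x}. (x - s) powr (a - 1) * f s) + (LBINT s:{0<..<x}. (x - s) powr (a - 1) * g s)"
    using set_integral_add(2)[OF assms] by (simp add: distrib_left)
  then show ?thesis by (simp add: RL_def add_divide_distrib)
qed

lemma RL_diff:
  assumes "set_integrable lborel {0<..<x} (\<lambda>s. (x - s) powr (a - 1) * f s)"
    and "set_integrable lborel {0<..<x} (\<lambda>s. (x - s) powr (a - 1) * g s)"
  shows "RL a (\<lambda>s. f s - g s) x = RL a f x - RL a g x"
proof -
  have "(LBINT s:{0<..<x}. (x - s) powr (a - 1) * (f s - g s)) =
      (LBINT s:{0<..<x}. (x - s) powr (a - 1) * f s) - (LBINT s:{0<..<x}. (x - s) powr (a - 1) * g s)"
    using set_integral_diff(2)[OF assms] by (simp add: right_diff_distrib)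
  then show ?thesis by (simp add: RL_def diff_divide_distrib)
qed

lemma RL_mono:
  assumes "0 < a" "set_integrable lborel {0<..<x} (\<lambda>s. (x - s) powr (a - 1) * f s)"
    and "set_integrable lborel {0<..<x} (\<lambda>s. (x - s) powr (a - 1) * g s)"
    and "\<And>s. s \<in> {0<..<x} \<Longrightarrow> f s \<le> g s"
  shows "RL a f x \<le> RL a g x"
  unfolding RL_def using assms
  by (intro mult_left_mono set_integral_mono) (auto intro: mult_left_mono simp: less_imp_le)

lemma RL_powr:
  assumes a: "0 < a" and b: "0 < b" and x: "0 < x"
  shows "RL a (\<lambda>s. s powr (b - 1)) x = Gamma b / Gamma (a + b) * x powr (a + b - 1)"
    and "set_integrable lborel {0<..<x} (\<lambda>s. (x - s) powr (a - 1) * s powr (b - 1))"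
proof -
  note h = has_bochner_integral_Beta[OF a b x]
  then show "set_integrable lborel {0<..<x} (\<lambda>s. (x - s) powr (a - 1) * s powr (b - 1))"
    by (simp add: set_integrable_def has_bochner_integral_iff)
  show "RL a (\<lambda>s. s powr (b - 1)) x = Gamma b / Gamma (a + b) * x powr (a + b - 1)"
    using h Gamma_real_pos[OF a] unfolding RL_def set_lebesgue_integral_def
    by (simp add: has_bochner_integral_iff Beta_def)
qed

lemma RL_one:
  assumes a: "0 < a" and x: "0 < x"
  shows "RL a (\<lambda>s. 1) x = x powr a / Gamma (a + 1)"
    and "set_integrable lborel {0<..<x} (\<lambda>s. (x - s) powr (a - 1))"
proof -
  have "RL a (\<lambda>s. 1) x = RL a (\<lambda>s. s powr (1 - 1)) x" by (rule RL_cong) auto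
  then show "RL a (\<lambda>s. 1) x = x powr a / Gamma (a + 1)"
    using RL_powr(1)[OF a _ x, of 1] by simp
  have "set_integrable lborel {0<..<x} (\<lambda>s. (x - s) powr (a - 1) * s powr (1 - 1))"
    using RL_powr(2)[OF a _ x, of 1] by simp
  also have "?this \<longleftrightarrow> set_integrable lborel {0<..<x} (\<lambda>s. (x - s) powr (a - 1))"
    by (rule set_integrable_cong) auto
  finally show "set_integrable lborel {0<..<x} (\<lambda>s. (x - s) powr (a - 1))" .
qed

lemma RL_bounded:
  assumes a: "0 < a" and x: "0 < x"
    and m: "set_borel_measurable lborel {0<..<x} f"
    and M: "\<And>s. s \<in> {0<..<x} \<Longrightarrow> \<bar>f s\<bar> \<le> M"
  shows "set_integrable lborel {0<..<x} (\<lambda>s. (x - s) powr (a - 1) * f s)"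
    and "\<bar>RL a f x\<bar> \<le> M * x powr a / Gamma (a + 1)"
proof -
  have iM: "set_integrable lborel {0<..<x} (\<lambda>s. (x - s) powr (a - 1) * M)"
    using RL_one(2)[OF a x] by simp
  show i: "set_integrable lborel {0<..<x} (\<lambda>s. (x - s) powr (a - 1) * f s)"
  proof (rule set_integrable_bound[OF iM])
    have "(\<lambda>r. (x - r) powr (a - 1) * (indicator {0<..<x} r * f r)) \<in> borel_measurable lborel"
      using m unfolding set_borel_measurable_def
      by (intro borel_measurable_times[of "\<lambda>r. (x - r) powr (a - 1)"]) simp_all
    then show "set_borel_measurable lborel {0<..<x} (\<lambda>s. (x - s) powr (a - 1) * f s)"
      by (simp add: set_borel_measurable_def mult_ac)
    show "AE s in lborel. s \<in> {0<..<x} \<longrightarrow> norm ((x - s) powr (a - 1) * f s) \<le> norm ((x - s) powr (a - 1) * M)"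
    proof (intro AE_I2 impI)
      fix s assume "s \<in> {0<..<x}"
      then have "\<bar>f s\<bar> \<le> \<bar>M\<bar>" using M[of s] by linarith
      then show "norm ((x - s) powr (a - 1) * f s) \<le> norm ((x - s) powr (a - 1) * M)"
        by (simp add: abs_mult mult_left_mono)
    qed
  qed
  have "\<bar>LBINT s:{0<..<x}. (x - s) powr (a - 1) * f s\<bar> \<le> (LBINT s:{0<..<x}. \<bar>(x - s) powr (a - 1) * f s\<bar>)"
    using i set_integral_norm_bound[OF i] by simp
  also have "\<dots> \<le> (LBINT s:{0<..<x}. (x - s) powr (a - 1) * M)"
  proof (intro set_integral_mono set_integrable_abs i iM)
    fix s assume "s \<in> {0<..<x}"
    then show "\<bar>(x - s) powr (a - 1) * f s\<bar> \<le> (x - s) powr (a - 1) * M"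
      using M[of s] by (simp add: abs_mult mult_left_mono)
  qed
  finally have "\<bar>RL a f x\<bar> \<le> RL a (\<lambda>s. M * 1) x"
    using Gamma_real_pos[OF a] by (simp add: RL_def abs_mult field_simps)
  then show "\<bar>RL a f x\<bar> \<le> M * x powr a / Gamma (a + 1)"
    unfolding RL_cmult using RL_one(1)[OF a x] by simp
qed

text \<open>\<open>f\<close> may be singular at 0; integrability up to every point below
  \<open>X\<close> and continuity at \<open>x\<close> carry the fundamental theorem of
  calculus.\<close>

lemma RL_1_has_derivative:
  fixes f :: "real \<Rightarrow> real"
  assumes i: "\<And>x. x \<in> {0<..<X} \<Longrightarrow> set_integrable lborel {0<..<x} f"
    and c: "continuous_on {0<..<X} f" and x: "x \<in> {0<..<X}"
  shows "(RL 1 f has_real_derivative f x) (at x)"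
proof -
  \<comment> \<open>An endpoint beyond \<open>x\<close> makes \<open>x\<close> interior, so that the
    derivative within the interval is two-sided.\<close>
  define x1 where "x1 = (x + X) / 2"
  have x1: "x < x1" "x1 \<in> {0<..<X}" using x by (auto simp: x1_def)
  have eq: "RL 1 f z = integral {0..z} f" if "z \<in> {0<..<X}" for z
    using set_borel_integral_eq_integral(2)[OF i[OF that]]
    by (simp add: RL_1 integral_open_interval_real)
  have int: "f integrable_on {0..x1}"
    using set_borel_integral_eq_integral(1)[OF i[OF x1(2)]]
    by (simp add: integrable_on_Icc_iff_Ioo)
  have "((\<lambda>z. integral {0..z} f) has_vector_derivative f x) (at x within {0..x1})"
  proof -
    have "continuous (at x within {0..x1}) f"
      using continuous_on_interior[OF c, of x] x by (auto intro: continuous_within_subset[of x UNIV])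
    moreover have "x \<in> {0..x1} - {}" using x x1(1) by simp
    ultimately show ?thesis
      using integral_has_vector_derivative_continuous_at[OF int, of x "{}"]
      by (metis Diff_empty finite.emptyI)
  qed
  then have "((\<lambda>z. integral {0..z} f) has_real_derivative f x) (at x)"
    using x x1 at_within_interior[of x "{0..x1}"] by (simp add: has_real_derivative_iff_has_vector_derivative)
  moreover have "\<forall>\<^sub>F z in nhds x. z \<in> {0<..<X}"
    using x by (intro eventually_nhds_in_open) auto
  then have "\<forall>\<^sub>F z in nhds x. RL 1 f z = integral {0..z} f"
    by eventually_elim (rule eq)
  ultimately show ?thesis
    using DERIV_cong_ev[OF refl _ refl, of "RL 1 f" "\<lambda>z. integral {0..z} f" x "f x"] by blast
qed

section \<open>Caputo derivatives and their integrated form\<close>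

lemma caputo_linear:
  assumes f: "has_caputo \<alpha> f x" and g: "has_caputo \<alpha> g x"
  shows "caputo \<alpha> (\<lambda>s. a * f s + b * g s) x = a * caputo \<alpha> f x + b * caputo \<alpha> g x"
    and "has_caputo \<alpha> (\<lambda>s. a * f s + b * g s) x"
proof -
  have d: "deriv (\<lambda>s. a * f s + b * g s) s = a * deriv f s + b * deriv g s" "(\<lambda>s. a * f s + b * g s) differentiable (at s)"
    if "f differentiable (at s)" "g differentiable (at s)" for s
  proof -
    have "((\<lambda>s. a * f s + b * g s) has_real_derivative a * deriv f s + b * deriv g s) (at s)"
      using that by (intro DERIV_add DERIV_cmult) (simp_all add: DERIV_deriv_iff_real_differentiable)
    then show "deriv (\<lambda>s. a * f s + b * g s) s = a * deriv f s + b * deriv g s" "(\<lambda>s. a * f s + b * g s) differentiable (at s)"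
      by (auto simp: DERIV_imp_deriv real_differentiable_def)
  qed
  have "caputo \<alpha> (\<lambda>s. a * f s + b * g s) x = a * caputo \<alpha> f x + b * caputo \<alpha> g x \<and> has_caputo \<alpha> (\<lambda>s. a * f s + b * g s) x"
  proof (cases "\<alpha> = 1")
    case True
    then show ?thesis using f g d[of x] by (simp add: caputo_def has_caputo_def)
  next
    case False
    have df: "f differentiable (at s)" "g differentiable (at s)" if "s \<in> {0<..<x}" for s
      using f g False that by (auto simp: has_caputo_def)
    have fi: "set_integrable lborel {0<..<x} (\<lambda>s. a * ((x - s) powr (- \<alpha>) * deriv f s))"
      and gi: "set_integrable lborel {0<..<x} (\<lambda>s. b * ((x - s) powr (- \<alpha>) * deriv g s))"
      using f g False by (auto simp: has_caputo_def intro!: set_integrable_mult_right)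
    have e: "(x - s) powr (- \<alpha>) * deriv (\<lambda>s. a * f s + b * g s) s = a * ((x - s) powr (- \<alpha>) * deriv f s) + b * ((x - s) powr (- \<alpha>) * deriv g s)"
      if "s \<in> {0<..<x}" for s using d(1)[OF df[OF that]] by (simp add: algebra_simps)
    have "set_integrable lborel {0<..<x} (\<lambda>s. (x - s) powr (- \<alpha>) * deriv (\<lambda>s. a * f s + b * g s) s) \<longleftrightarrow>
        set_integrable lborel {0<..<x} (\<lambda>s. a * ((x - s) powr (- \<alpha>) * deriv f s) + b * ((x - s) powr (- \<alpha>) * deriv g s))"
      by (rule set_integrable_cong) (use e in auto)
    then have "has_caputo \<alpha> (\<lambda>s. a * f s + b * g s) x"
      using set_integral_add(1)[OF fi gi] d(2)[OF df] False by (simp add: has_caputo_def)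
    moreover have "(LBINT s:{0<..<x}. (x - s) powr (- \<alpha>) * deriv (\<lambda>s. a * f s + b * g s) s) =
        (LBINT s:{0<..<x}. a * ((x - s) powr (- \<alpha>) * deriv f s) + b * ((x - s) powr (- \<alpha>) * deriv g s))"
      by (rule set_lebesgue_integral_cong) (use e in auto)
    then have "caputo \<alpha> (\<lambda>s. a * f s + b * g s) x = a * caputo \<alpha> f x + b * caputo \<alpha> g x"
      using set_integral_add(2)[OF fi gi] False by (simp add: caputo_def add_divide_distrib)
    ultimately show ?thesis by simp
  qed
  then show "caputo \<alpha> (\<lambda>s. a * f s + b * g s) x = a * caputo \<alpha> f x + b * caputo \<alpha> g x"
    and "has_caputo \<alpha> (\<lambda>s. a * f s + b * g s) x" by auto
qed

lemma caputo_cdivide: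
  assumes "has_caputo \<alpha> f x"
  shows "caputo \<alpha> (\<lambda>t. f t / c) x = caputo \<alpha> f x / c" and "has_caputo \<alpha> (\<lambda>t. f t / c) x"
  using caputo_linear[OF assms assms, of "1 / c" 0] by simp_all

text \<open>Write J^a for \<open>RL a\<close>. The Caputo derivative is J^(1 - alpha) of f', and its
  existence at every x makes f' integrable from 0 on. Hence f has a limit f0 at 0 and f - f0 = J f';
  commuting the two integrals gives J^(1 - alpha) (f - f0) = J (D f). The limit f0 is not assumed to
  be the value \<open>f 0\<close>.\<close>

lemma caputo_integrated:
  fixes f :: "real \<Rightarrow> real"
  assumes al: "0 < \<alpha>" "\<alpha> < 1" and X: "0 < X" and hc: "\<And>x. x \<in> {0<..<X} \<Longrightarrow> has_caputo \<alpha> f x"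
  obtains f0 where "(f \<longlongrightarrow> f0) (at_right 0)"
    and "\<And>x. x \<in> {0<..<X} \<Longrightarrow> set_integrable lborel {0<..<x} (\<lambda>s. (x - s) powr (- \<alpha>) * (f s - f0))"
    and "\<And>x. x \<in> {0<..<X} \<Longrightarrow> set_integrable lborel {0<..<x} (caputo \<alpha> f)"
    and "\<And>x. x \<in> {0<..<X} \<Longrightarrow> RL (1 - \<alpha>) (\<lambda>s. f s - f0) x = RL 1 (caputo \<alpha> f) x"
proof -
  have dif: "(f has_real_derivative deriv f s) (at s)" if "s \<in> {0<..<X}" for s
  proof -
    define x where "x = (s + X) / 2"
    then have "s < x" "x < X" using that by auto
    then show ?thesis using hc[of x] that al
      by (auto simp: has_caputo_def DERIV_deriv_iff_real_differentiable)
  qed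
  have int: "set_integrable lborel {0<..<x} (deriv f)" if x: "x \<in> {0<..<X}" for x
  proof -
    have k: "set_integrable lborel {0<..<x} (\<lambda>s. (x - s) powr (-\<alpha>) * deriv f s)"
      using hc[OF x] al by (auto simp: has_caputo_def)
    \<comment> \<open>The bounded factor (x - s)^alpha removes the kernel.\<close>
    have "set_integrable lborel {0<..<x} (\<lambda>s. (x - s) powr \<alpha> * ((x - s) powr (-\<alpha>) * deriv f s))"
      by (rule set_integrable_powr_mult[OF k]) (use al in auto)
    also have "?this \<longleftrightarrow> ?thesis"
      by (rule set_integrable_cong) (auto simp: mult.assoc [symmetric] powr_add [symmetric])
    finally show ?thesis .
  qed
  have hk: "deriv f integrable_on {0..x}" if x: "x \<in> {0<..<X}" for x
    using set_borel_integral_eq_integral(1)[OF int[OF x]]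
    by (simp add: integrable_on_Icc_iff_Ioo)
  have RL1: "RL 1 (deriv f) x = integral {0..x} (deriv f)" if "x \<in> {0<..<X}" for x
    using set_borel_integral_eq_integral(2)[OF int[OF that]]
    by (simp add: RL_1 integral_open_interval_real)
  \<comment> \<open>The constant of integration, read off at an interior point.\<close>
  define f0 where "f0 = f (X/2) - integral {0..X/2} (deriv f)"
  have incr: "integral {0..y} (deriv f) - integral {0..x} (deriv f) = f y - f x" if "x \<in> {0<..<X}" "y \<in> {0<..<X}" "x \<le> y" for x y
  proof -
    have "(deriv f has_integral f y - f x) {x..y}"
      using that dif by (intro fundamental_theorem_of_calculus)
        (auto simp flip: has_real_derivative_iff_has_vector_derivative intro: has_field_derivative_at_within)
    then have "integral {x..y} (deriv f) = f y - f x" by (rule integral_unique)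
    then show ?thesis
      using Henstock_Kurzweil_Integration.integral_combine[OF _ that(3) hk[OF that(2)]] that by auto
  qed
  have rep: "f x = f0 + integral {0..x} (deriv f)" if x: "x \<in> {0<..<X}" for x
    using incr[of x "X/2"] incr[of "X/2" x] x X by (cases "x \<le> X/2") (auto simp: f0_def)
  have "continuous_on {0..X/2} (\<lambda>x. integral {0..x} (deriv f))"
    using X by (intro indefinite_integral_continuous_1 hk) auto
  moreover have "0 \<in> {0..X/2}" using X by simp
  ultimately have "((\<lambda>x. integral {0..x} (deriv f)) \<longlongrightarrow> integral {0..0} (deriv f)) (at 0 within {0..X/2})"
    unfolding continuous_on_def by (rule bspec)
  then have "((\<lambda>x. integral {0..x} (deriv f)) \<longlongrightarrow> 0) (at_right 0)"
    using X by (simp add: at_within_Icc_at_right)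
  then have "((\<lambda>x. f0 + integral {0..x} (deriv f)) \<longlongrightarrow> f0 + 0) (at_right 0)"
    by (intro tendsto_intros)
  moreover have "\<forall>\<^sub>F x in at_right 0. f0 + integral {0..x} (deriv f) = f x"
    using eventually_at_right_real[OF X] by eventually_elim (use rep in auto)
  ultimately have lim: "(f \<longlongrightarrow> f0) (at_right 0)"
    using Lim_transform_eventually[of "\<lambda>x. f0 + integral {0..x} (deriv f)" "f0 + 0" "at_right 0" f] by simp
  have cap: "caputo \<alpha> f = RL (1 - \<alpha>) (deriv f)"
    using al by (simp add: caputo_def RL_def fun_eq_iff)
  show ?thesis
  proof
    show "(f \<longlongrightarrow> f0) (at_right 0)" by (rule lim)
    fix x assume x: "x \<in> {0<..<X}"
    have "set_integrable lborel {0<..<x} (\<lambda>s. (x - s) powr (1 - \<alpha> - 1) * RL 1 (deriv f) s)"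
      using al x int by (intro RL_semigroup(2)) auto
    also have "?this \<longleftrightarrow> set_integrable lborel {0<..<x} (\<lambda>s. (x - s) powr (- \<alpha>) * (f s - f0))"
      by (rule set_integrable_cong) (use x rep in \<open>auto simp: RL1\<close>)
    finally show "set_integrable lborel {0<..<x} (\<lambda>s. (x - s) powr (- \<alpha>) * (f s - f0))" .
    have "set_integrable lborel {0<..<x} (\<lambda>s. (x - s) powr (1 - 1) * caputo \<alpha> f s)"
      unfolding cap using al x int by (intro RL_semigroup(2)) auto
    also have "?this \<longleftrightarrow> set_integrable lborel {0<..<x} (caputo \<alpha> f)"
      by (rule set_integrable_cong) auto
    finally show "set_integrable lborel {0<..<x} (caputo \<alpha> f)" .
    have "RL (1 - \<alpha>) (\<lambda>s. f s - f0) x = RL (1 - \<alpha>) (RL 1 (deriv f)) x"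
      using x rep by (intro RL_cong) (auto simp: RL1)
    also have "\<dots> = RL (1 - \<alpha> + 1) (deriv f) x"
      using al x int by (intro RL_semigroup(1)) auto
    also have "\<dots> = RL 1 (RL (1 - \<alpha>) (deriv f)) x"
      using al x int by (subst RL_semigroup(1)) (auto simp: add.commute)
    finally show "RL (1 - \<alpha>) (\<lambda>s. f s - f0) x = RL 1 (caputo \<alpha> f) x"
      by (simp add: cap)
  qed
qed

section \<open>Mittag-Leffler series\<close>

text \<open>Termwise integration: up to the factor \<open>Gamma b\<close>, \<open>smi\<close> is the
  sum of the integrals of the absolute values of the terms.\<close>

lemma RL_series:
  fixes c p :: "nat \<Rightarrow> real"
  assumes b: "0 < b" and x: "0 < x" and p: "\<And>k. 0 < p k"
    and sm: "\<And>s. s \<in> {0<..<x} \<Longrightarrow> summable (\<lambda>k. \<bar>c k\<bar> * s powr (p k - 1))"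
    and smi: "summable (\<lambda>k. \<bar>c k\<bar> * (Gamma (p k) / Gamma (b + p k) * x powr (b + p k - 1)))"
  shows "set_integrable lborel {0<..<x} (\<lambda>s. (x - s) powr (b - 1) * (\<Sum>k. c k * s powr (p k - 1)))"
    and "RL b (\<lambda>s. \<Sum>k. c k * s powr (p k - 1)) x =
      (\<Sum>k. c k * (Gamma (p k) / Gamma (b + p k) * x powr (b + p k - 1)))"
proof -
  define h where "h k s = indicator {0<..<x} s * ((x - s) powr (b - 1) * (c k * s powr (p k - 1)))" for k s
  define I where "I k = Gamma b * (Gamma (p k) / Gamma (b + p k) * x powr (b + p k - 1))" for k
  have base: "has_bochner_integral lborel (\<lambda>s. indicator {0<..<x} s * ((x - s) powr (b - 1) * s powr (p k - 1))) (I k)" for k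
    using has_bochner_integral_Beta[OF b p[of k] x] by (simp add: I_def Beta_def mult.assoc)
  have hi: "has_bochner_integral lborel (h k) (c k * I k)" for k
    using has_bochner_integral_mult_right[OF base, of "c k" k] by (simp add: h_def [abs_def] mult_ac)
  have hn: "has_bochner_integral lborel (\<lambda>s. norm (h k s)) (\<bar>c k\<bar> * I k)" for k
    using has_bochner_integral_mult_right[OF base, of "\<bar>c k\<bar>" k]
    by (simp add: h_def [abs_def] abs_mult mult_ac)
  have i1: "integrable lborel (h k)" for k using hi by (simp add: has_bochner_integral_iff)
  have sup: "summable (\<lambda>k. norm (h k s))" for s
  proof (cases "s \<in> {0<..<x}")
    case True
    then show ?thesis using summable_mult[OF sm[OF True], of "(x - s) powr (b - 1)"]
      by (simp add: h_def abs_mult mult_ac)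
  qed (simp add: h_def)
  have i2: "AE s in lborel. summable (\<lambda>k. norm (h k s))" using sup by auto
  have i3: "summable (\<lambda>k. LINT s|lborel. norm (h k s))"
    using summable_mult[OF smi, of "Gamma b"] hn by (simp add: has_bochner_integral_iff I_def mult_ac)
  have eq: "(\<Sum>k. h k s) = indicator {0<..<x} s * ((x - s) powr (b - 1) * (\<Sum>k. c k * s powr (p k - 1)))" for s
  proof (cases "s \<in> {0<..<x}")
    case True
    have "summable (\<lambda>k. norm (c k * s powr (p k - 1)))" using sm[OF True] by (simp add: abs_mult)
    then have "summable (\<lambda>k. c k * s powr (p k - 1))" by (rule summable_norm_cancel)
    then show ?thesis using True by (simp add: h_def suminf_mult)
  qed (simp add: h_def)
  show "set_integrable lborel {0<..<x} (\<lambda>s. (x - s) powr (b - 1) * (\<Sum>k. c k * s powr (p k - 1)))"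
    using integrable_suminf[OF i1 i2 i3] unfolding eq by (simp add: set_integrable_def)
  have "(LINT s|lborel. (\<Sum>k. h k s)) = (\<Sum>k. c k * I k)"
    using integral_suminf[OF i1 i2 i3] hi by (simp add: has_bochner_integral_iff)
  also have "\<dots> = (\<Sum>k. Gamma b * (c k * (Gamma (p k) / Gamma (b + p k) * x powr (b + p k - 1))))"
    by (simp add: I_def mult_ac)
  also have "\<dots> = Gamma b * (\<Sum>k. c k * (Gamma (p k) / Gamma (b + p k) * x powr (b + p k - 1)))"
  proof (rule suminf_mult, rule summable_norm_cancel)
    show "summable (\<lambda>k. norm (c k * (Gamma (p k) / Gamma (b + p k) * x powr (b + p k - 1))))"
      using smi p b Gamma_real_pos by (simp add: abs_mult less_imp_le add_pos_pos)
  qed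
  finally show "RL b (\<lambda>s. \<Sum>k. c k * s powr (p k - 1)) x =
      (\<Sum>k. c k * (Gamma (p k) / Gamma (b + p k) * x powr (b + p k - 1)))"
    using b unfolding eq by (simp add: RL_def set_lebesgue_integral_def)
qed

text \<open>Euler's integral restricted to [L, L + 1], where the integrand is at least the left-hand
  side. As \<open>L\<close> is free, Gamma outgrows every geometric sequence.\<close>

lemma Gamma_lower_bound:
  fixes z L :: real
  assumes z: "1 \<le> z" and L: "0 < L"
  shows "L powr (z - 1) * exp (- (L + 1)) \<le> Gamma z"
proof -
  have G: "((\<lambda>t. t powr (z - 1) / exp t) has_integral Gamma z) {0..}"
    using z by (intro Gamma_integral_real) simp
  have "((\<lambda>t. L powr (z - 1) * exp (- (L + 1))) has_integral (L powr (z - 1) * exp (- (L + 1)))) {L..L+1}"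
    using has_integral_const_real[of "L powr (z - 1) * exp (- (L + 1))" L "L + 1"] by simp
  then have "((\<lambda>t. if t \<in> {L..L+1} then L powr (z - 1) * exp (- (L + 1)) else 0)
      has_integral (L powr (z - 1) * exp (- (L + 1)))) {0..}"
    using L by (subst has_integral_restrict) auto
  then show ?thesis
    by (rule has_integral_le[OF _ G])
      (use z L in \<open>auto simp: divide_inverse exp_minus [symmetric] intro!: mult_mono powr_mono2\<close>)
qed

text \<open>Power series in \<open>t powr \<alpha>\<close>; integer powers of \<open>t powr \<alpha>\<close> are used because
  \<open>0 powr 0 = 0\<close>.\<close>

definition mlp :: "real \<Rightarrow> (nat \<Rightarrow> real) \<Rightarrow> real \<Rightarrow> real"
  where "mlp \<alpha> a t = (\<Sum>k. a k / Gamma (\<alpha> * real k + 1) * (t powr \<alpha>) ^ k)"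

text \<open>At most geometric growth: a class of coefficients that is stable under the shifts and
  index weights produced by fractional integration and differentiation, and for which division by
  Gamma gives an entire series.\<close>

definition geo :: "(nat \<Rightarrow> real) \<Rightarrow> bool"
  where "geo a \<longleftrightarrow> (\<exists>C M. 0 \<le> M \<and> (\<forall>k. \<bar>a k\<bar> \<le> C * M ^ k))"

lemma summable_power_div_Gamma:
  fixes \<alpha> M :: real
  assumes \<alpha>: "0 < \<alpha>" and M: "0 \<le> M"
  shows "summable (\<lambda>k. M ^ k / Gamma (\<alpha> * real k + 1))"
proof (rule summable_comparison_test')
  \<comment> \<open>With \<open>L powr \<alpha> = 2 * M + 1\<close> the Gamma bound exceeds a
    multiple of (2 M + 1)^k, which leaves the ratio 1/2; the summand 1 keeps \<open>L\<close>
    positive for M = 0.\<close>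
  define L where "L = (2 * M + 1) powr (1 / \<alpha>)"
  have L: "0 < L" "L powr \<alpha> = 2 * M + 1" using \<alpha> M by (auto simp: L_def powr_powr)
  show "summable (\<lambda>k. exp (L + 1) * (1/2 :: real) ^ k)"
    by (intro summable_mult summable_geometric) simp
  fix k :: nat assume "0 \<le> k"
  have "(2 * M + 1) ^ k * exp (- (L + 1)) = L powr (\<alpha> * real k + 1 - 1) * exp (- (L + 1))"
    using M by (simp add: powr_powr [symmetric] L powr_realpow)
  also have "\<dots> \<le> Gamma (\<alpha> * real k + 1)"
    using \<alpha> L by (intro Gamma_lower_bound) auto
  finally have g: "(2 * M + 1) ^ k * exp (- (L + 1)) \<le> Gamma (\<alpha> * real k + 1)" .
  have "M ^ k = (2 * M) ^ k * (1/2) ^ k" by (simp add: power_mult_distrib power_one_over)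
  also have "\<dots> \<le> (2 * M + 1) ^ k * (1/2) ^ k"
    using M by (intro mult_right_mono power_mono) auto
  also have "\<dots> = exp (L + 1) * (1/2) ^ k * ((2 * M + 1) ^ k * exp (- (L + 1)))"
    using exp_minus_inverse[of "L + 1"] by (simp add: mult_ac)
  also have "\<dots> \<le> exp (L + 1) * (1/2) ^ k * Gamma (\<alpha> * real k + 1)"
    using g by (intro mult_left_mono) auto
  finally show "norm (M ^ k / Gamma (\<alpha> * real k + 1)) \<le> exp (L + 1) * (1/2) ^ k"
    using M \<alpha> by (simp add: divide_le_eq add_nonneg_pos abs_mult)
qed

lemma mlp_summable_abs:
  assumes \<alpha>: "0 < \<alpha>" and a: "geo a"
  shows "summable (\<lambda>k. \<bar>a k\<bar> / Gamma (\<alpha> * real k + 1) * \<bar>z\<bar> ^ k)"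
proof -
  obtain C M where M: "0 \<le> M" and C: "\<And>k. \<bar>a k\<bar> \<le> C * M ^ k" using a by (auto simp: geo_def)
  show ?thesis
  proof (rule summable_comparison_test')
    show "summable (\<lambda>k. C * ((M * \<bar>z\<bar>) ^ k / Gamma (\<alpha> * real k + 1)))"
      using \<alpha> M by (intro summable_mult summable_power_div_Gamma) auto
    fix k :: nat assume "0 \<le> k"
    have "0 < Gamma (\<alpha> * real k + 1)" using \<alpha> by (simp add: add_nonneg_pos)
    then have "\<bar>a k\<bar> / Gamma (\<alpha> * real k + 1) * \<bar>z\<bar> ^ k \<le> (C * M ^ k) / Gamma (\<alpha> * real k + 1) * \<bar>z\<bar> ^ k"
      by (intro mult_right_mono divide_right_mono C) auto
    with \<open>0 < Gamma (\<alpha> * real k + 1)\<close>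
    show "norm (\<bar>a k\<bar> / Gamma (\<alpha> * real k + 1) * \<bar>z\<bar> ^ k) \<le> C * ((M * \<bar>z\<bar>) ^ k / Gamma (\<alpha> * real k + 1))"
      by (simp add: power_mult_distrib)
  qed
qed

lemma mlp_summable:
  assumes \<alpha>: "0 < \<alpha>" and a: "geo a"
  shows "summable (\<lambda>k. a k / Gamma (\<alpha> * real k + 1) * z ^ k)"
proof (rule summable_norm_cancel)
  have "0 < Gamma (\<alpha> * real k + 1)" for k using \<alpha> by (simp add: add_nonneg_pos)
  then show "summable (\<lambda>k. norm (a k / Gamma (\<alpha> * real k + 1) * z ^ k))"
    using mlp_summable_abs[OF assms, of z] by (simp add: abs_mult power_abs less_imp_le)
qed

section \<open>Closure properties of geometric growth and termwise fractional calculus\<close>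

lemma geo_power [simp]: "geo (\<lambda>k. m ^ k)"
  unfolding geo_def by (intro exI[of _ 1] exI[of _ "\<bar>m\<bar>"]) (auto simp: power_abs)

lemma geo_cmult: "geo a \<Longrightarrow> geo (\<lambda>k. c * a k)"
  unfolding geo_def
proof clarify
  fix C M :: real assume M: "0 \<le> M" "\<forall>k. \<bar>a k\<bar> \<le> C * M ^ k"
  have "\<bar>c * a k\<bar> \<le> (\<bar>c\<bar> * C) * M ^ k" for k
    using M mult_left_mono[of "\<bar>a k\<bar>" "C * M ^ k" "\<bar>c\<bar>"] by (simp add: abs_mult mult_ac)
  with M show "\<exists>C M. 0 \<le> M \<and> (\<forall>k. \<bar>c * a k\<bar> \<le> C * M ^ k)" by blast
qed

lemma geo_bounded_mult:
  assumes "geo a" "\<And>k. \<bar>b k\<bar> \<le> \<bar>a k\<bar>"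
  shows "geo b"
  using assms unfolding geo_def by (meson order_trans)

lemma geo_Suc: assumes "geo a" shows "geo (\<lambda>k. a (Suc k))"
proof -
  obtain C M where M: "0 \<le> M" and C: "\<And>k. \<bar>a k\<bar> \<le> C * M ^ k" using assms by (auto simp: geo_def)
  have "\<bar>a (Suc k)\<bar> \<le> (C * M) * M ^ k" for k using C[of "Suc k"] by (simp add: mult.assoc)
  with M show ?thesis unfolding geo_def by blast
qed

lemma geo_shift: assumes "geo a" shows "geo (\<lambda>k. if k = 0 then 0 else a (k - 1))"
proof -
  obtain C M where M: "0 \<le> M" and C: "\<And>k. \<bar>a k\<bar> \<le> C * M ^ k" using assms by (auto simp: geo_def)
  have C0: "0 \<le> C" using C[of 0] by simp
  \<comment> \<open>The base \<open>M + 1\<close> is at least 1, so that passing from the exponent k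
    - 1 to k cannot decrease its powers, as it could for \<open>M\<close>.\<close>
  have "\<bar>if k = 0 then 0 else a (k - 1)\<bar> \<le> C * (M + 1) ^ k" for k
  proof (cases k)
    case (Suc j)
    have "\<bar>a j\<bar> \<le> C * M ^ j" by (rule C)
    also have "\<dots> \<le> C * (M + 1) ^ Suc j"
    proof (intro mult_left_mono C0)
      have "M ^ j \<le> (M + 1) ^ j" using M by (intro power_mono) auto
      also have "\<dots> \<le> (M + 1) ^ Suc j" using M by (intro power_increasing) auto
      finally show "M ^ j \<le> (M + 1) ^ Suc j" .
    qed
    finally show ?thesis using Suc by simp
  qed (use C0 in simp)
  with M show ?thesis unfolding geo_def by (intro exI[of _ C] exI[of _ "M + 1"]) auto
qed

lemma geo_times_index: assumes "geo a" shows "geo (\<lambda>k. c * real k * a k)"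
proof -
  obtain C M where M: "0 \<le> M" and C: "\<And>k. \<bar>a k\<bar> \<le> C * M ^ k" using assms by (auto simp: geo_def)
  have "\<bar>real k * a k\<bar> \<le> C * (2 * M) ^ k" for k
  proof -
    have "real k \<le> 2 ^ k" using of_nat_less_two_power[of k] by (simp add: less_imp_le)
    then have "\<bar>real k * a k\<bar> \<le> 2 ^ k * (C * M ^ k)"
      unfolding abs_mult by (intro mult_mono) (use C in auto)
    then show ?thesis by (simp add: power_mult_distrib mult_ac)
  qed
  then have "geo (\<lambda>k. real k * a k)" unfolding geo_def using M
    by (intro exI[of _ C] exI[of _ "2 * M"]) auto
  from geo_cmult[OF this, of c] show ?thesis by (simp add: mult.assoc)
qed

context
  fixes \<alpha> :: real
  assumes \<alpha>: "0 < \<alpha>"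
begin

lemma Gamma_index_pos: "0 < Gamma (\<alpha> * real k + 1)"
  using \<alpha> by (simp add: add_nonneg_pos)

lemma mlp_at_0 [simp]: "mlp \<alpha> a 0 = a 0"
proof -
  have "mlp \<alpha> a 0 = (\<Sum>k. (a k / Gamma (\<alpha> * real k + 1)) * 0 ^ k)" by (simp add: mlp_def)
  also have "\<dots> = a 0" by (subst powser_zero) simp
  finally show ?thesis .
qed

lemma mlp_add: "geo a \<Longrightarrow> geo b \<Longrightarrow> mlp \<alpha> (\<lambda>k. a k + b k) t = mlp \<alpha> a t + mlp \<alpha> b t"
  unfolding mlp_def
  using suminf_add[OF mlp_summable[OF \<alpha>, of a "t powr \<alpha>"] mlp_summable[OF \<alpha>, of b "t powr \<alpha>"]]
  by (simp add: add_divide_distrib distrib_right)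

lemma mlp_cmult: "geo a \<Longrightarrow> mlp \<alpha> (\<lambda>k. c * a k) t = c * mlp \<alpha> a t"
  unfolding mlp_def
  using suminf_mult[OF mlp_summable[OF \<alpha>, of a "t powr \<alpha>"], of c] by (simp add: mult.assoc)

lemma mlp_nonneg: "geo a \<Longrightarrow> (\<And>k. 0 \<le> a k) \<Longrightarrow> 0 \<le> mlp \<alpha> a t"
  unfolding mlp_def using Gamma_index_pos
  by (intro suminf_nonneg mlp_summable \<alpha>) (auto simp: less_imp_le)

lemma mlp_le: "geo a \<Longrightarrow> geo b \<Longrightarrow> (\<And>k. a k \<le> b k) \<Longrightarrow> mlp \<alpha> a t \<le> mlp \<alpha> b t"
  unfolding mlp_def using Gamma_index_pos
  by (intro suminf_le mlp_summable \<alpha>) (auto simp: less_imp_le intro!: mult_right_mono divide_right_mono)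

lemma mlp_mono: "geo a \<Longrightarrow> (\<And>k. 0 \<le> a k) \<Longrightarrow> 0 \<le> s \<Longrightarrow> s \<le> t \<Longrightarrow> mlp \<alpha> a s \<le> mlp \<alpha> a t"
  unfolding mlp_def using Gamma_index_pos \<alpha>
  by (intro suminf_le mlp_summable) (auto simp: less_imp_le intro!: divide_right_mono mult_left_mono power_mono powr_mono2)

lemma isCont_mlp_series: "geo a \<Longrightarrow> isCont (\<lambda>z. \<Sum>k. a k / Gamma (\<alpha> * real k + 1) * z ^ k) z"
  by (rule isCont_powser_converges_everywhere) (rule mlp_summable[OF \<alpha>])

lemma continuous_on_mlp: "geo a \<Longrightarrow> continuous_on {0..} (mlp \<alpha> a)"
proof -
  assume a: "geo a"
  have "continuous_on UNIV (\<lambda>z. \<Sum>k. a k / Gamma (\<alpha> * real k + 1) * z ^ k)"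
    using isCont_mlp_series[OF a] by (simp add: continuous_at_imp_continuous_on)
  moreover have "continuous_on {0..} (\<lambda>t::real. t powr \<alpha>)"
    using \<alpha> by (intro continuous_on_powr' continuous_intros) auto
  ultimately show ?thesis unfolding mlp_def [abs_def]
    by (rule continuous_on_compose2) simp
qed

text \<open>The Euler operator t d/dt multiplies the k-th coefficient by alpha k. A series divided
  by t stays within \<open>mlp\<close>, although the derivative itself may behave like t^(alpha - 1)
  at 0.\<close>

lemma mlp_has_derivative:
  assumes a: "geo a" and t: "0 < t"
  shows "(mlp \<alpha> a has_real_derivative mlp \<alpha> (\<lambda>k. \<alpha> * real k * a k) t / t) (at t)"
proof -
  define c where "c k = a k / Gamma (\<alpha> * real k + 1)" for k
  have sm: "summable (\<lambda>k. c k * z ^ k)" for z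
    unfolding c_def by (rule mlp_summable[OF \<alpha> a])
  define z where "z = t powr \<alpha>"
  have z: "0 < z" using t by (simp add: z_def)
  have d: "((\<lambda>z. \<Sum>k. c k * z ^ k) has_real_derivative (\<Sum>k. diffs c k * z ^ k)) (at z)"
    by (rule termdiffs_strong_converges_everywhere) (rule sm)
  have sd: "summable (\<lambda>k. diffs c k * z ^ k)"
    by (rule termdiff_converges_all) (rule sm)
  have "(\<lambda>k. real k * c k * z ^ (k - Suc 0)) sums (\<Sum>k. diffs c k * z ^ k)"
    using diffs_equiv[OF sd] by simp
  then have "(\<lambda>k. (\<alpha> * z) * (real k * c k * z ^ (k - Suc 0))) sums ((\<alpha> * z) * (\<Sum>k. diffs c k * z ^ k))"
    by (rule sums_mult)
  moreover have "(\<alpha> * z) * (real k * c k * z ^ (k - Suc 0)) = \<alpha> * real k * a k / Gamma (\<alpha> * real k + 1) * z ^ k" for k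
    by (cases k) (auto simp: c_def)
  ultimately have s: "mlp \<alpha> (\<lambda>k. \<alpha> * real k * a k) t = \<alpha> * z * (\<Sum>k. diffs c k * z ^ k)"
    by (simp add: mlp_def z_def sums_iff)
  have "((\<lambda>t. t powr \<alpha>) has_real_derivative (\<alpha> * t powr (\<alpha> - 1))) (at t)"
    using t by (rule has_real_derivative_powr)
  then have "((\<lambda>t. \<Sum>k. c k * (t powr \<alpha>) ^ k) has_real_derivative ((\<Sum>k. diffs c k * z ^ k) * (\<alpha> * t powr (\<alpha> - 1)))) (at t)"
    unfolding z_def
    by (rule DERIV_chain2[where f = "\<lambda>z. \<Sum>k. c k * z ^ k" and g = "\<lambda>t. t powr \<alpha>", OF d[unfolded z_def]])
  moreover have "(\<Sum>k. diffs c k * z ^ k) * (\<alpha> * t powr (\<alpha> - 1)) = mlp \<alpha> (\<lambda>k. \<alpha> * real k * a k) t / t"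
    using t by (simp add: s z_def powr_diff)
  ultimately show ?thesis by (simp add: mlp_def [abs_def] c_def)
qed

lemma mlp_powr: "0 < t \<Longrightarrow> mlp \<alpha> a t = (\<Sum>k. a k / Gamma (\<alpha> * real k + 1) * t powr (\<alpha> * real k))"
  by (simp add: mlp_def powr_powr [symmetric] powr_realpow)

text \<open>The Gamma normalisation makes J^alpha map each basis function to the next one, so
  fractional integration is a right shift of the coefficients.\<close>

lemma RL_mlp:
  assumes a: "geo a" and x: "0 < x"
  shows "RL \<alpha> (mlp \<alpha> a) x = mlp \<alpha> (\<lambda>k. if k = 0 then 0 else a (k - 1)) x"
    and "set_integrable lborel {0<..<x} (\<lambda>s. (x - s) powr (\<alpha> - 1) * mlp \<alpha> a s)"
proof -
  define c where "c k = a k / Gamma (\<alpha> * real k + 1)" for k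
  define p where "p k = \<alpha> * real k + 1" for k
  have p: "0 < p k" for k using \<alpha> by (simp add: p_def add_nonneg_pos)
  have mp: "mlp \<alpha> a s = (\<Sum>k. c k * s powr (p k - 1))" if "s \<in> {0<..<x}" for s
    using that by (simp add: mlp_powr c_def p_def)
  let ?b = "\<lambda>k. if k = 0 then 0 else a (k - 1)"
  have trm: "\<gamma> / Gamma (\<alpha> * real k + 1) * (Gamma (p k) / Gamma (\<alpha> + p k) * x powr (\<alpha> + p k - 1))
    = \<gamma> / Gamma (\<alpha> * real (Suc k) + 1) * (x powr \<alpha>) ^ Suc k" for \<gamma> k
  proof -
    have "Gamma (\<alpha> * real k + 1) \<noteq> 0" using Gamma_index_pos[of k] by simp
    moreover have "x powr (\<alpha> + p k - 1) = (x powr \<alpha>) ^ Suc k"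
      using x by (simp add: p_def powr_add powr_powr [symmetric] powr_realpow)
    ultimately show ?thesis by (simp add: p_def algebra_simps)
  qed
  have sm: "summable (\<lambda>k. \<bar>c k\<bar> * s powr (p k - 1))" if "s \<in> {0<..<x}" for s
    using mlp_summable_abs[OF \<alpha> a, of "s powr \<alpha>"] that Gamma_index_pos
    by (simp add: c_def p_def powr_powr [symmetric] powr_realpow less_imp_le)
  have "summable (\<lambda>k. \<bar>?b (Suc k)\<bar> / Gamma (\<alpha> * real (Suc k) + 1) * \<bar>x powr \<alpha>\<bar> ^ Suc k)"
    using mlp_summable_abs[OF \<alpha> geo_shift[OF a], of "x powr \<alpha>"] by (subst summable_Suc_iff)
  then have smi: "summable (\<lambda>k. \<bar>c k\<bar> * (Gamma (p k) / Gamma (\<alpha> + p k) * x powr (\<alpha> + p k - 1)))"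
    using trm[of "\<bar>a _\<bar>"] Gamma_index_pos x by (simp add: c_def less_imp_le)
  have R: "set_integrable lborel {0<..<x} (\<lambda>s. (x - s) powr (\<alpha> - 1) * (\<Sum>k. c k * s powr (p k - 1)))"
    "RL \<alpha> (\<lambda>s. \<Sum>k. c k * s powr (p k - 1)) x = (\<Sum>k. c k * (Gamma (p k) / Gamma (\<alpha> + p k) * x powr (\<alpha> + p k - 1)))"
    using RL_series[where c = c and p = p and b = \<alpha> and x = x, OF \<alpha> x p _ smi] sm by blast+
  have "set_integrable lborel {0<..<x} (\<lambda>s. (x - s) powr (\<alpha> - 1) * mlp \<alpha> a s) \<longleftrightarrow>
     set_integrable lborel {0<..<x} (\<lambda>s. (x - s) powr (\<alpha> - 1) * (\<Sum>k. c k * s powr (p k - 1)))"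
    by (rule set_integrable_cong) (auto simp: mp)
  with R(1) show "set_integrable lborel {0<..<x} (\<lambda>s. (x - s) powr (\<alpha> - 1) * mlp \<alpha> a s)" by simp
  have "RL \<alpha> (mlp \<alpha> a) x = RL \<alpha> (\<lambda>s. \<Sum>k. c k * s powr (p k - 1)) x"
    by (rule RL_cong) (rule mp)
  also have "\<dots> = (\<Sum>k. ?b (Suc k) / Gamma (\<alpha> * real (Suc k) + 1) * (x powr \<alpha>) ^ Suc k)"
  proof -
    have "c k * (Gamma (p k) / Gamma (\<alpha> + p k) * x powr (\<alpha> + p k - 1)) =
        ?b (Suc k) / Gamma (\<alpha> * real (Suc k) + 1) * (x powr \<alpha>) ^ Suc k" for k
      using trm[of "a k" k] by (simp add: c_def)
    then show ?thesis unfolding R(2) by (simp only:)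
  qed
  also have "\<dots> = mlp \<alpha> ?b x"
    unfolding mlp_def using suminf_split_head[OF mlp_summable[OF \<alpha> geo_shift[OF a], of "x powr \<alpha>"]] by simp
  finally show "RL \<alpha> (mlp \<alpha> a) x = mlp \<alpha> ?b x" .
qed

lemma mlp_Suc_eq:
  assumes a: "geo a"
  shows "mlp \<alpha> (\<lambda>k. \<alpha> * real k * a k) t =
    (\<Sum>k. \<alpha> * real (Suc k) * a (Suc k) / Gamma (\<alpha> * real (Suc k) + 1) * (t powr \<alpha>) ^ Suc k)"
  unfolding mlp_def using suminf_split_head[OF mlp_summable[OF \<alpha> geo_times_index[OF a, of \<alpha>], of "t powr \<alpha>"]] by simp

text \<open>The left shift that undoes \<open>RL_mlp\<close>; the constant term is killed. The
  exponents of f' start at alpha - 1, and J^(1 - alpha) raises each of them to a multiple of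
  alpha.\<close>

lemma caputo_mlp:
  assumes \<alpha>1: "\<alpha> \<le> 1" and a: "geo a" and x: "0 < x"
  shows "caputo \<alpha> (mlp \<alpha> a) x = mlp \<alpha> (\<lambda>k. a (Suc k)) x"
    and "has_caputo \<alpha> (mlp \<alpha> a) x"
proof -
  have der: "deriv (mlp \<alpha> a) s = mlp \<alpha> (\<lambda>k. \<alpha> * real k * a k) s / s" if "0 < s" for s
    using mlp_has_derivative[OF a that] by (rule DERIV_imp_deriv)
  have dif: "mlp \<alpha> a differentiable (at s)" if "0 < s" for s
    using mlp_has_derivative[OF a that] real_differentiable_def by blast
  have "caputo \<alpha> (mlp \<alpha> a) x = mlp \<alpha> (\<lambda>k. a (Suc k)) x \<and> has_caputo \<alpha> (mlp \<alpha> a) x"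
  proof (cases "\<alpha> = 1")
    case True
    have "Gamma (2 + real k) = (1 + real k) * Gamma (1 + real k)" for k
    proof -
      have "1 + real k \<notin> \<int>\<^sub>\<le>\<^sub>0" using nonpos_Ints_nonpos[of "1 + real k"] by force
      then show ?thesis using Gamma_plus1[of "1 + real k"] by (simp add: add_ac)
    qed
    then have "mlp \<alpha> (\<lambda>k. \<alpha> * real k * a k) x = (\<Sum>k. x * (a (Suc k) / Gamma (\<alpha> * real k + 1) * (x powr \<alpha>) ^ k))"
      unfolding mlp_Suc_eq[OF a] using True x by (intro suminf_cong) (simp add: add_ac)
    also have "\<dots> = x * mlp \<alpha> (\<lambda>k. a (Suc k)) x"
      unfolding mlp_def by (rule suminf_mult) (rule mlp_summable[OF \<alpha> geo_Suc[OF a]])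
    finally show ?thesis using True dif[OF x] x der[OF x] by (simp add: caputo_def has_caputo_def)
  next
    case False
    with \<alpha>1 have \<alpha>1: "\<alpha> < 1" by simp
    then have b: "0 < 1 - \<alpha>" by simp
    \<comment> \<open>Indices start at the second coefficient: \<open>p k - 1\<close> is the
      exponent in the derivative of (t^alpha)^(k + 1).\<close>
    define c where "c k = \<alpha> * real (Suc k) * a (Suc k) / Gamma (\<alpha> * real (Suc k) + 1)" for k
    define p where "p k = \<alpha> * real (Suc k)" for k
    have p: "0 < p k" for k using \<alpha> by (simp add: p_def)
    have pw: "s * s powr (p k - 1) = (s powr \<alpha>) ^ Suc k" if "0 < s" for s k
    proof -
      have "(s powr \<alpha>) ^ Suc k = s powr (1 + (p k - 1))"
        using that by (simp add: p_def powr_powr powr_realpow [symmetric] del: power_Suc)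
      then show ?thesis using that by (simp only: powr_add) simp
    qed
    have mp: "deriv (mlp \<alpha> a) s = (\<Sum>k. c k * s powr (p k - 1))" if s: "s \<in> {0<..<x}" for s
    proof -
      have sc: "summable (\<lambda>k. c k * (s powr \<alpha>) ^ Suc k)"
        using mlp_summable[OF \<alpha> geo_times_index[OF a, of \<alpha>], of "s powr \<alpha>"]
        unfolding c_def by (subst (asm) summable_Suc_iff [symmetric])
      have "deriv (mlp \<alpha> a) s = (\<Sum>k. c k * (s powr \<alpha>) ^ Suc k) / s"
        using s unfolding c_def by (subst der) (auto simp: mlp_Suc_eq[OF a])
      also have "\<dots> = (\<Sum>k. c k * (s powr \<alpha>) ^ Suc k / s)"
        using sc by (rule suminf_divide [symmetric])
      also have "\<dots> = (\<Sum>k. c k * s powr (p k - 1))"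
        using s by (simp only: pw[of s, symmetric] greaterThanLessThan_iff) simp
      finally show ?thesis .
    qed
    have sm: "summable (\<lambda>k. \<bar>c k\<bar> * s powr (p k - 1))" if s: "s \<in> {0<..<x}" for s
    proof -
      have "summable (\<lambda>k. \<bar>c k\<bar> * (s powr \<alpha>) ^ Suc k)"
        using mlp_summable_abs[OF \<alpha> geo_times_index[OF a, of \<alpha>], of "s powr \<alpha>"] Gamma_index_pos \<alpha>
        unfolding c_def by (subst (asm) summable_Suc_iff [symmetric]) (simp add: less_imp_le abs_mult del: power_Suc of_nat_Suc)
      then have "summable (\<lambda>k. \<bar>c k\<bar> * (s powr \<alpha>) ^ Suc k / s)" by (rule summable_divide)
      then show ?thesis using s by (simp only: pw[of s, symmetric] greaterThanLessThan_iff) simp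
    qed
    have trm: "\<bar>c k\<bar> * (Gamma (p k) / Gamma (1 - \<alpha> + p k) * x powr (1 - \<alpha> + p k - 1)) = \<bar>a (Suc k)\<bar> / Gamma (\<alpha> * real k + 1) * (x powr \<alpha>) ^ k"
      "c k * (Gamma (p k) / Gamma (1 - \<alpha> + p k) * x powr (1 - \<alpha> + p k - 1)) = a (Suc k) / Gamma (\<alpha> * real k + 1) * (x powr \<alpha>) ^ k" for k
    proof -
      have "p k \<notin> \<int>\<^sub>\<le>\<^sub>0" using p[of k] nonpos_Ints_nonpos by force
      then have G: "Gamma (\<alpha> * real (Suc k) + 1) = p k * Gamma (p k)"
        using Gamma_plus1[of "p k"] by (simp add: p_def)
      have e: "1 - \<alpha> + p k = \<alpha> * real k + 1" by (simp add: p_def algebra_simps)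
      have e': "x powr (\<alpha> * real k) = (x powr \<alpha>) ^ k"
        using x by (simp add: powr_powr [symmetric] powr_realpow)
      have nz: "p k \<noteq> 0" "Gamma (p k) \<noteq> 0" using p[of k] by (auto simp del: )
      have ck: "c k = p k * a (Suc k) / (p k * Gamma (p k))" unfolding G [symmetric] by (simp add: c_def p_def)
      show "c k * (Gamma (p k) / Gamma (1 - \<alpha> + p k) * x powr (1 - \<alpha> + p k - 1)) = a (Suc k) / Gamma (\<alpha> * real k + 1) * (x powr \<alpha>) ^ k"
        unfolding e ck using nz by (simp add: e')
      show "\<bar>c k\<bar> * (Gamma (p k) / Gamma (1 - \<alpha> + p k) * x powr (1 - \<alpha> + p k - 1)) = \<bar>a (Suc k)\<bar> / Gamma (\<alpha> * real k + 1) * (x powr \<alpha>) ^ k"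
        unfolding e ck using nz p[of k] by (simp add: e' abs_mult less_imp_le)
    qed
    have smi: "summable (\<lambda>k. \<bar>c k\<bar> * (Gamma (p k) / Gamma (1 - \<alpha> + p k) * x powr (1 - \<alpha> + p k - 1)))"
      unfolding trm using mlp_summable_abs[OF \<alpha> geo_Suc[OF a], of "x powr \<alpha>"] by simp
    have R: "set_integrable lborel {0<..<x} (\<lambda>s. (x - s) powr (1 - \<alpha> - 1) * (\<Sum>k. c k * s powr (p k - 1)))"
      "RL (1 - \<alpha>) (\<lambda>s. \<Sum>k. c k * s powr (p k - 1)) x =
        (\<Sum>k. c k * (Gamma (p k) / Gamma (1 - \<alpha> + p k) * x powr (1 - \<alpha> + p k - 1)))"
      using RL_series[where c = c and p = p and b = "1 - \<alpha>" and x = x, OF b x p _ smi] sm by blast+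
    have "set_integrable lborel {0<..<x} (\<lambda>s. (x - s) powr (1 - \<alpha> - 1) * deriv (mlp \<alpha> a) s) \<longleftrightarrow>
       set_integrable lborel {0<..<x} (\<lambda>s. (x - s) powr (1 - \<alpha> - 1) * (\<Sum>k. c k * s powr (p k - 1)))"
      by (rule set_integrable_cong) (auto simp: mp)
    with R(1) have i: "set_integrable lborel {0<..<x} (\<lambda>s. (x - s) powr (- \<alpha>) * deriv (mlp \<alpha> a) s)" by simp
    have "caputo \<alpha> (mlp \<alpha> a) x = RL (1 - \<alpha>) (deriv (mlp \<alpha> a)) x"
      using \<alpha>1 by (simp add: caputo_def RL_def)
    also have "\<dots> = RL (1 - \<alpha>) (\<lambda>s. \<Sum>k. c k * s powr (p k - 1)) x"
      by (rule RL_cong) (rule mp)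
    also have "\<dots> = mlp \<alpha> (\<lambda>k. a (Suc k)) x" unfolding R(2) trm mlp_def ..
    finally show ?thesis using i dif \<alpha>1 by (simp add: has_caputo_def)
  qed
  then show "caputo \<alpha> (mlp \<alpha> a) x = mlp \<alpha> (\<lambda>k. a (Suc k)) x" "has_caputo \<alpha> (mlp \<alpha> a) x" by auto
qed

end

section \<open>The solutions of the mode equation\<close>

definition mle :: "real \<Rightarrow> real \<Rightarrow> real \<Rightarrow> real"
  where "mle \<alpha> m = mlp \<alpha> (\<lambda>k. m ^ k)"

lemma mittag_leffler_eq_mle: "mittag_leffler \<alpha> 1 (m * t powr \<alpha>) = mle \<alpha> m t"
  by (simp add: mittag_leffler_def mle_def mlp_def power_mult_distrib)

text \<open>Meant for the kernel (tau - s)^(-alpha): a shift changes it at least proportionally to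
  the shift. The slope at the mean value point is bounded below by the one at
  \<open>T\<close>.\<close>

lemma powr_neg_diff_lower:
  fixes u v T a :: real
  assumes "0 < u" "u < v" "v \<le> T" "0 < a"
  shows "(v - u) * (a * T powr (- a - 1)) \<le> u powr (- a) - v powr (- a)"
proof -
  have "\<And>x. u \<le> x \<Longrightarrow> x \<le> v \<Longrightarrow> ((\<lambda>x. x powr (- a)) has_real_derivative (- a * x powr (- a - 1))) (at x)"
    using assms by (intro has_real_derivative_powr) auto
  from MVT2[OF assms(2) this] obtain z where z: "u < z" "z < v"
    "v powr (- a) - u powr (- a) = (v - u) * (- a * z powr (- a - 1))" by auto
  have "T powr (- a - 1) \<le> z powr (- a - 1)"
    using z assms by (intro powr_mono2') auto
  then have "(v - u) * (a * T powr (- a - 1)) \<le> (v - u) * (a * z powr (- a - 1))"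
    using assms by (intro mult_left_mono) auto
  with z(3) show ?thesis by simp
qed

text \<open>Splits t E'(t) into a positive power of t and a power series in z = t^alpha. The latter
  is continuous up to z = 0, where its sign is that of the coefficient with index 1.\<close>

lemma mlp_index_eq:
  assumes \<alpha>: "0 < \<alpha>" and a: "geo a"
  shows "mlp \<alpha> (\<lambda>k. \<alpha> * real k * a k) t =
    \<alpha> * t powr \<alpha> * (\<Sum>k. diffs (\<lambda>k. a k / Gamma (\<alpha> * real k + 1)) k * (t powr \<alpha>) ^ k)"
proof -
  define c where "c k = a k / Gamma (\<alpha> * real k + 1)" for k
  have sm: "summable (\<lambda>k. c k * z ^ k)" for z
    unfolding c_def by (rule mlp_summable[OF \<alpha> a])
  define z where "z = t powr \<alpha>"
  have sd: "summable (\<lambda>k. diffs c k * z ^ k)"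
    by (rule termdiff_converges_all) (rule sm)
  have "(\<lambda>k. real k * c k * z ^ (k - Suc 0)) sums (\<Sum>k. diffs c k * z ^ k)"
    using diffs_equiv[OF sd] by simp
  then have "(\<lambda>k. (\<alpha> * z) * (real k * c k * z ^ (k - Suc 0))) sums ((\<alpha> * z) * (\<Sum>k. diffs c k * z ^ k))"
    by (rule sums_mult)
  moreover have "(\<alpha> * z) * (real k * c k * z ^ (k - Suc 0)) = \<alpha> * real k * a k / Gamma (\<alpha> * real k + 1) * z ^ k" for k
    by (cases k) (auto simp: c_def)
  ultimately have "mlp \<alpha> (\<lambda>k. \<alpha> * real k * a k) t = \<alpha> * z * (\<Sum>k. diffs c k * z ^ k)"
    by (simp add: mlp_def z_def sums_iff)
  then show ?thesis by (simp add: z_def c_def [abs_def])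
qed

context
  fixes \<alpha> :: real
  assumes \<alpha>: "0 < \<alpha>"
begin

lemma mle_0 [simp]: "mle \<alpha> m 0 = 1"
  using \<alpha> by (simp add: mle_def)

lemma continuous_on_mle: "continuous_on {0..} (mle \<alpha> m)"
  unfolding mle_def by (rule continuous_on_mlp[OF \<alpha>]) simp

lemma mle_has_derivative:
  "0 < t \<Longrightarrow> (mle \<alpha> m has_real_derivative mlp \<alpha> (\<lambda>k. \<alpha> * real k * m ^ k) t / t) (at t)"
  unfolding mle_def by (rule mlp_has_derivative[OF \<alpha>]) simp_all

lemma caputo_mle:
  assumes "\<alpha> \<le> 1" "0 < x"
  shows "caputo \<alpha> (mle \<alpha> m) x = m * mle \<alpha> m x" and "has_caputo \<alpha> (mle \<alpha> m) x"
  using caputo_mlp[OF \<alpha> assms(1) geo_power assms(2), of m] mlp_cmult[OF \<alpha> geo_power, of m m x]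
  by (simp_all add: mle_def)

lemma mle_integral_eq:
  assumes x: "0 < x"
  shows "mle \<alpha> m x = 1 + m * RL \<alpha> (mle \<alpha> m) x"
proof -
  let ?s = "\<lambda>k. if k = 0 then 0 else m ^ (k - 1)"
  have g: "geo ?s" by (rule geo_shift) simp
  have "m * RL \<alpha> (mle \<alpha> m) x = mlp \<alpha> (\<lambda>k. m * ?s k) x"
    unfolding mle_def by (simp add: RL_mlp[OF \<alpha> _ x] mlp_cmult[OF \<alpha> g])
  moreover have "1 = mlp \<alpha> (\<lambda>k. 0 ^ k) x"
    unfolding mlp_def by (subst suminf_finite[of "{0}"]) auto
  moreover have "mlp \<alpha> (\<lambda>k. 0 ^ k) x + mlp \<alpha> (\<lambda>k. m * ?s k) x = mlp \<alpha> (\<lambda>k. 0 ^ k + m * ?s k) x"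
    by (rule mlp_add[OF \<alpha>, symmetric]) (auto intro: geo_cmult g)
  moreover have "(\<lambda>k. 0 ^ k + m * ?s k) = (\<lambda>k. m ^ k)"
    by (auto simp: fun_eq_iff power_eq_if)
  ultimately show ?thesis by (simp add: mle_def)
qed

text \<open>The equation for q(t) = t E'(t), from k = 1 + (k - 1) in the coefficient alpha k m^k. It
  converts the sign of q into a bound for q.\<close>

lemma mle_index_integral_eq:
  assumes x: "0 < x"
  shows "mlp \<alpha> (\<lambda>k. \<alpha> * real k * m ^ k) x =
    \<alpha> * (mle \<alpha> m x - 1) + m * RL \<alpha> (mlp \<alpha> (\<lambda>k. \<alpha> * real k * m ^ k)) x"
proof -
  let ?f = "\<lambda>k. \<alpha> * real k * m ^ k"
  let ?s = "\<lambda>k. if k = 0 then 0 else m ^ (k - 1)"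
  let ?t = "\<lambda>k. if k = 0 then 0 else ?f (k - 1)"
  have g: "geo ?s" by (rule geo_shift) simp
  have gf: "geo ?f" by (rule geo_times_index) simp
  have gt: "geo ?t" using geo_shift[OF gf] .
  have "mle \<alpha> m x - 1 = mlp \<alpha> (\<lambda>k. m * ?s k) x"
    unfolding mle_integral_eq[OF x, of m] unfolding mle_def by (simp add: RL_mlp[OF \<alpha> _ x] mlp_cmult[OF \<alpha> g])
  then have "\<alpha> * (mle \<alpha> m x - 1) = mlp \<alpha> (\<lambda>k. \<alpha> * (m * ?s k)) x"
    by (simp only: mlp_cmult[OF \<alpha> geo_cmult[OF g]])
  moreover have "m * RL \<alpha> (mlp \<alpha> ?f) x = mlp \<alpha> (\<lambda>k. m * ?t k) x"
    by (simp only: RL_mlp[OF \<alpha> gf x] mlp_cmult[OF \<alpha> gt])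
  moreover have "mlp \<alpha> (\<lambda>k. \<alpha> * (m * ?s k)) x + mlp \<alpha> (\<lambda>k. m * ?t k) x = mlp \<alpha> (\<lambda>k. \<alpha> * (m * ?s k) + m * ?t k) x"
    by (rule mlp_add[OF \<alpha>, symmetric]) (intro geo_cmult g gt)+
  moreover have "(\<lambda>k. \<alpha> * (m * ?s k) + m * ?t k) = ?f"
  proof
    fix k show "\<alpha> * (m * ?s k) + m * ?t k = ?f k"
      by (cases k) (auto simp: algebra_simps)
  qed
  ultimately show ?thesis by simp
qed

text \<open>Let \<open>\<tau>\<close> be the first zero of the derivative \<open>\<phi>\<close> of
  E, which is negative before it. Up to a factor, D E at x is G x, the integral of (x - s)^(-alpha)
  times \<open>\<phi> s\<close>. Moving x from \<open>\<tau> - k\<close> to \<open>\<tau>\<close>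
  weakens the kernel on the old interval, where \<open>\<phi>\<close> is negative, and so raises G
  by at least a multiple of k; the new piece costs only O(k^(2 - alpha)), since
  \<open>\<phi>\<close> vanishes linearly at \<open>\<tau>\<close>. But G is a multiple of E, so its
  slope at \<open>\<tau>\<close> is 0.\<close>

lemma mle_deriv_neg_aux:
  assumes \<alpha>1: "\<alpha> < 1" and m: "m < 0" and t: "0 < t"
  shows "mlp \<alpha> (\<lambda>k. \<alpha> * real k * m ^ k) t < 0"
proof (rule ccontr)
  assume neg: "\<not> mlp \<alpha> (\<lambda>k. \<alpha> * real k * m ^ k) t < 0"
  define q where "q = mlp \<alpha> (\<lambda>k. \<alpha> * real k * m ^ k)"
  define c where "c k = m ^ k / Gamma (\<alpha> * real k + 1)" for k
  define D where "D z = (\<Sum>k. diffs c k * z ^ k)" for z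
  have Dcont: "isCont D z" for z
    unfolding D_def
  proof (rule isCont_powser_converges_everywhere, rule termdiff_converges_all)
    show "summable (\<lambda>k. c k * z ^ k)" for z
      unfolding c_def by (rule mlp_summable[OF \<alpha>]) simp
  qed
  have Dco: "continuous_on A D" for A
    using Dcont by (simp add: continuous_at_imp_continuous_on)
  have q: "q s = \<alpha> * s powr \<alpha> * D (s powr \<alpha>)" for s
    using mlp_index_eq[OF \<alpha> geo_power, of m s] by (simp add: q_def D_def c_def [abs_def])
  have D0: "D 0 < 0"
  proof -
    have "D 0 = diffs c 0" unfolding D_def by (rule powser_zero)
    then show ?thesis using m \<alpha> by (simp add: diffs_def c_def divide_neg_pos)
  qed
  define z1 where "z1 = t powr \<alpha>"
  have "0 < \<alpha> * t powr \<alpha>" using t \<alpha> by simp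
  then have z1: "0 < z1" "0 \<le> D z1" using neg t q[of t]
    by (auto simp: z1_def q_def not_less zero_le_mult_iff)
  \<comment> \<open>The zeros of \<open>D\<close> in the interval form a compact set; the least one
    is positive because \<open>D 0 < 0\<close>, and \<open>D\<close> is negative before it.\<close>
  define Z where "Z = {z \<in> {0..z1}. D z = 0}"
  have "\<exists>z\<ge>0. z \<le> z1 \<and> D z = 0"
    using D0 z1 Dcont by (intro IVT) auto
  then have Zne: "Z \<noteq> {}" by (auto simp: Z_def)
  have "closed Z" unfolding Z_def
    by (intro continuous_closed_preimage_constant Dco) simp
  moreover have "bounded Z" unfolding Z_def by (rule bounded_subset[of "{0..z1}"]) auto
  ultimately have "compact Z" by (simp add: compact_eq_bounded_closed)
  then obtain z0 where z0: "z0 \<in> Z" and z0min: "\<And>z. z \<in> Z \<Longrightarrow> z0 \<le> z"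
    using compact_attains_inf[OF _ Zne] by blast
  have z0': "0 < z0" "z0 \<le> z1" "D z0 = 0" using z0 D0 by (auto simp: Z_def order_le_less)
  have Dneg: "D z < 0" if "0 \<le> z" "z < z0" for z
  proof (rule ccontr)
    assume "\<not> D z < 0"
    then have "\<exists>y\<ge>0. y \<le> z \<and> D y = 0" using that D0 Dcont by (intro IVT) auto
    then show False using z0min that z0' unfolding Z_def by force
  qed
  define \<tau> where "\<tau> = z0 powr (1 / \<alpha>)"
  have \<tau>: "0 < \<tau>" "\<tau> powr \<alpha> = z0" using z0' \<alpha> by (auto simp: \<tau>_def powr_powr)
  define \<phi> where "\<phi> s = q s / s" for s
  have \<phi>neg: "\<phi> s < 0" if "0 < s" "s < \<tau>" for s
  proof -
    have "s powr \<alpha> < z0" using that \<alpha> \<tau>(2) powr_less_mono2[of \<alpha> s \<tau>] by simp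
    then show ?thesis using that \<alpha> Dneg[of "s powr \<alpha>"]
      by (auto simp: \<phi>_def q divide_less_0_iff mult_less_0_iff)
  qed
  have \<phi>\<tau>: "\<phi> \<tau> = 0" by (simp add: \<phi>_def q \<tau> z0')
  have edf: "(mle \<alpha> m has_real_derivative \<phi> s) (at s)" if "0 < s" for s
    using mle_has_derivative[OF that, of m] by (simp add: \<phi>_def q_def)
  have qdf: "(q has_real_derivative mlp \<alpha> (\<lambda>k. \<alpha> * real k * (\<alpha> * real k * m ^ k)) s / s) (at s)" if "0 < s" for s
    unfolding q_def using that by (intro mlp_has_derivative[OF \<alpha>] geo_times_index) auto
  have \<phi>df: "\<exists>d. (\<phi> has_real_derivative d) (at s)" if "0 < s" for s
    unfolding \<phi>_def [abs_def] using DERIV_divide[OF qdf[OF that] DERIV_ident] that by auto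
  obtain d where d: "(\<phi> has_real_derivative d) (at \<tau>)" using \<phi>df[OF \<tau>(1)] by auto
  \<comment> \<open>A linear bound for \<open>\<phi>\<close> near its zero, from the difference
    quotient there.\<close>
  define C where "C = \<bar>d\<bar> + 1"
  have C: "0 < C" by (simp add: C_def)
  have "((\<lambda>s. \<bar>\<phi> s / (s - \<tau>)\<bar>) \<longlongrightarrow> \<bar>d\<bar>) (at \<tau>)"
    using d \<phi>\<tau> by (intro tendsto_rabs) (simp add: has_field_derivative_iff)
  then have "\<forall>\<^sub>F s in at \<tau>. \<bar>\<phi> s / (s - \<tau>)\<bar> < C"
    by (rule order_tendstoD) (simp add: C_def)
  then obtain \<delta>0 where \<delta>0: "0 < \<delta>0" "\<And>s. s \<noteq> \<tau> \<Longrightarrow> \<bar>s - \<tau>\<bar> < \<delta>0 \<Longrightarrow> \<bar>\<phi> s / (s - \<tau>)\<bar> < C"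
    unfolding eventually_at dist_real_def by blast
  have \<phi>C: "\<bar>\<phi> s\<bar> \<le> C * (\<tau> - s)" if "s < \<tau>" "\<tau> - s < \<delta>0" for s
    using \<delta>0(2)[of s] that by (auto simp: abs_divide divide_less_eq)
  \<comment> \<open>A window away from both 0 and \<open>\<tau>\<close>, on which
    \<open>\<phi>\<close> lies below a negative constant; its length tau/4 enters the gain in
    \<open>key\<close>.\<close>
  have "continuous_on {\<tau>/4..\<tau>/2} \<phi>"
  proof (rule continuous_at_imp_continuous_on, rule ballI)
    fix s assume "s \<in> {\<tau>/4..\<tau>/2}"
    then have "0 < s" using \<tau> by simp
    then show "isCont \<phi> s" using \<phi>df[of s] DERIV_isCont by blast
  qed
  then obtain y where y: "y \<in> {\<tau>/4..\<tau>/2}" "\<And>s. s \<in> {\<tau>/4..\<tau>/2} \<Longrightarrow> \<phi> s \<le> \<phi> y"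
    using continuous_attains_sup[of "{\<tau>/4..\<tau>/2}" \<phi>] \<tau> by auto
  define \<eta> where "\<eta> = - \<phi> y"
  have \<eta>: "0 < \<eta>" "\<And>s. s \<in> {\<tau>/4..\<tau>/2} \<Longrightarrow> \<phi> s \<le> - \<eta>"
    using y \<phi>neg[of y] \<tau> by (auto simp: \<eta>_def)
  \<comment> \<open>The least absolute slope of u^(-alpha) for 0 < u <= tau.\<close>
  define c1 where "c1 = \<alpha> * \<tau> powr (- \<alpha> - 1)"
  have c1: "0 < c1" using \<alpha> \<tau> by (simp add: c1_def)
  define G where "G x = Gamma (1 - \<alpha>) * (m * mle \<alpha> m x)" for x
  have Gint: "has_bochner_integral lborel (\<lambda>s. indicator {0<..<x} s * ((x - s) powr (- \<alpha>) * \<phi> s)) (G x)" if "0 < x" for x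
  proof -
    have ds: "deriv (mle \<alpha> m) s = \<phi> s" if "0 < s" for s
      using edf[OF that] by (rule DERIV_imp_deriv)
    have "set_integrable lborel {0<..<x} (\<lambda>s. (x - s) powr (- \<alpha>) * deriv (mle \<alpha> m) s)"
      using caputo_mle(2)[OF _ that, of m] \<alpha>1 by (simp add: has_caputo_def)
    then have "integrable lborel (\<lambda>s. indicator {0<..<x} s * ((x - s) powr (- \<alpha>) * deriv (mle \<alpha> m) s))"
      by (simp add: set_integrable_def)
    moreover have "(LINT s|lborel. indicator {0<..<x} s * ((x - s) powr (- \<alpha>) * deriv (mle \<alpha> m) s)) = G x"
      using caputo_mle(1)[OF _ that, of m] \<alpha>1
      by (simp add: caputo_def set_lebesgue_integral_def G_def divide_eq_eq mult_ac)
    moreover have "(\<lambda>s. indicator {0<..<x} s * ((x - s) powr (- \<alpha>) * deriv (mle \<alpha> m) s)) =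
        (\<lambda>s. indicator {0<..<x} s * ((x - s) powr (- \<alpha>) * \<phi> s))"
      by (auto simp: fun_eq_iff indicator_def ds)
    ultimately show ?thesis by (simp add: has_bochner_integral_iff)
  qed
  have key: "k * (c1 * \<eta> * (\<tau> / 4)) - C * k powr (1 - \<alpha>) * k \<le> G \<tau> - G (\<tau> - k)"
    if k: "0 < k" "k < \<tau> / 2" "k < \<delta>0" for k
  proof -
    \<comment> \<open>\<open>?B\<close> is a step function below the difference \<open>?D\<close> of
      the two integrands; its integral is the claimed lower bound.\<close>
    let ?B = "\<lambda>s. k * c1 * \<eta> * indicator {\<tau>/4..\<tau>/2} s - C * k powr (1 - \<alpha>) * indicator {\<tau>-k..\<tau>} s"
    let ?D = "\<lambda>s. indicator {0<..<\<tau>} s * ((\<tau> - s) powr (- \<alpha>) * \<phi> s) - indicator {0<..<\<tau>-k} s * ((\<tau> - k - s) powr (- \<alpha>) * \<phi> s)"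
    have i1: "has_bochner_integral lborel ?D (G \<tau> - G (\<tau> - k))"
      using k \<tau> by (intro has_bochner_integral_diff Gint) auto
    have "has_bochner_integral lborel (\<lambda>s. k * c1 * \<eta> * indicator {\<tau>/4..\<tau>/2} s) (k * c1 * \<eta> * (\<tau>/2 - \<tau>/4))"
      using \<tau> by (intro has_bochner_integral_mult_right) (auto simp: has_bochner_integral_iff)
    moreover have "has_bochner_integral lborel (\<lambda>s. C * k powr (1 - \<alpha>) * indicator {\<tau>-k..\<tau>} s) (C * k powr (1 - \<alpha>) * k)"
      using k by (intro has_bochner_integral_mult_right) (auto simp: has_bochner_integral_iff)
    ultimately have i2: "has_bochner_integral lborel ?B (k * c1 * \<eta> * (\<tau>/2 - \<tau>/4) - C * k powr (1 - \<alpha>) * k)"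
      by (rule has_bochner_integral_diff)
    have le: "?B s \<le> ?D s" for s
    proof -
      have Cp: "0 \<le> C * k powr (1 - \<alpha>)" using C by simp
      consider "s \<le> 0 \<or> \<tau> \<le> s" | "0 < s" "s < \<tau> - k" | "0 < s" "\<tau> - k \<le> s" "s < \<tau>" by linarith
      then show ?thesis
      proof cases
        case 1
        then show ?thesis using Cp \<tau> k by (auto simp: indicator_def)
      next
        case 2
        have p: "k * c1 \<le> (\<tau> - k - s) powr (- \<alpha>) - (\<tau> - s) powr (- \<alpha>)"
          using powr_neg_diff_lower[of "\<tau> - k - s" "\<tau> - s" \<tau> \<alpha>] 2 k \<alpha> by (simp add: c1_def)
        have pn: "0 \<le> - \<phi> s" using \<phi>neg[of s] 2 k by simp
        have D: "?D s = ((\<tau> - k - s) powr (- \<alpha>) - (\<tau> - s) powr (- \<alpha>)) * (- \<phi> s)"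
          using 2 k by (simp add: algebra_simps)
        have kc: "0 \<le> k * c1" using k c1 by simp
        show ?thesis
        proof (cases "s \<in> {\<tau>/4..\<tau>/2}")
          case True
          have "k * c1 * \<eta> \<le> ((\<tau> - k - s) powr (- \<alpha>) - (\<tau> - s) powr (- \<alpha>)) * (- \<phi> s)"
            using p kc \<eta>(2)[OF True] \<eta>(1) by (intro mult_mono) auto
          then show ?thesis unfolding D using True 2 by simp
        next
          case False
          have "0 \<le> ((\<tau> - k - s) powr (- \<alpha>) - (\<tau> - s) powr (- \<alpha>)) * (- \<phi> s)"
            using p kc pn by (intro mult_nonneg_nonneg) auto
          then show ?thesis unfolding D using False 2 by simp
        qed
      next
        case 3
        have "(\<tau> - s) powr (- \<alpha>) * (- \<phi> s) \<le> (\<tau> - s) powr (- \<alpha>) * (C * (\<tau> - s))"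
          using \<phi>C[of s] 3 k by (intro mult_left_mono) auto
        also have "\<dots> = C * (\<tau> - s) powr (1 - \<alpha>)"
          using 3 by (simp add: powr_diff powr_minus field_simps)
        also have "\<dots> \<le> C * k powr (1 - \<alpha>)"
          using 3 \<alpha>1 C by (intro mult_left_mono powr_mono2) auto
        finally have "(\<tau> - s) powr (- \<alpha>) * (- \<phi> s) \<le> C * k powr (1 - \<alpha>)" .
        moreover have "s \<notin> {\<tau>/4..\<tau>/2}" using 3 k by auto
        ultimately show ?thesis using 3 by simp
      qed
    qed
    have "k * c1 * \<eta> * (\<tau>/2 - \<tau>/4) - C * k powr (1 - \<alpha>) * k \<le> G \<tau> - G (\<tau> - k)"
      using i1 i2 le unfolding has_bochner_integral_iff
      by (metis (no_types, lifting) integral_mono)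
    then show ?thesis by (simp add: mult_ac)
  qed
  define w where "w = c1 * \<eta> * (\<tau> / 4)"
  have w: "0 < w" using c1 \<eta> \<tau> by (simp add: w_def)
  have "(G has_real_derivative Gamma (1 - \<alpha>) * (m * \<phi> \<tau>)) (at \<tau>)"
    unfolding G_def [abs_def] by (intro DERIV_cmult edf \<tau>)
  then have "(G has_real_derivative 0) (at \<tau>)" by (simp add: \<phi>\<tau>)
  then have "((\<lambda>s. \<bar>(G s - G \<tau>) / (s - \<tau>)\<bar>) \<longlongrightarrow> \<bar>0\<bar>) (at \<tau>)"
    by (intro tendsto_rabs) (simp add: has_field_derivative_iff)
  then have "\<forall>\<^sub>F s in at \<tau>. \<bar>(G s - G \<tau>) / (s - \<tau>)\<bar> < w / 2"
    by (rule order_tendstoD) (use w in simp)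
  then obtain \<delta>1 where \<delta>1: "0 < \<delta>1" "\<And>s. s \<noteq> \<tau> \<Longrightarrow> \<bar>s - \<tau>\<bar> < \<delta>1 \<Longrightarrow> \<bar>(G s - G \<tau>) / (s - \<tau>)\<bar> < w / 2"
    unfolding eventually_at dist_real_def by blast
  \<comment> \<open>The last entry makes C k^(1 - alpha) at most w / 2, so that the loss stays below
    half of the gain.\<close>
  define k where "k = min (min (\<tau> / 4) (\<delta>0 / 2)) (min (\<delta>1 / 2) ((w / (2 * C)) powr (1 / (1 - \<alpha>))))"
  have k: "0 < k" "k < \<tau> / 2" "k < \<delta>0" "k < \<delta>1" "k \<le> (w / (2 * C)) powr (1 / (1 - \<alpha>))"
    using \<tau> \<delta>0 \<delta>1 w C by (auto simp: k_def)
  have "k powr (1 - \<alpha>) \<le> ((w / (2 * C)) powr (1 / (1 - \<alpha>))) powr (1 - \<alpha>)"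
    using k \<alpha>1 by (intro powr_mono2) auto
  also have "\<dots> = w / (2 * C)" using w C \<alpha>1 by (simp add: powr_powr)
  finally have "C * k powr (1 - \<alpha>) \<le> w / 2" using C by (simp add: field_simps)
  then have "C * k powr (1 - \<alpha>) * k \<le> w / 2 * k" using k by (intro mult_right_mono) auto
  moreover have "G \<tau> - G (\<tau> - k) < w / 2 * k"
  proof -
    have "\<bar>G (\<tau> - k) - G \<tau>\<bar> * 2 < w * k"
      using \<delta>1(2)[of "\<tau> - k"] k by (simp add: abs_divide divide_less_eq)
    moreover have "G \<tau> - G (\<tau> - k) \<le> \<bar>G (\<tau> - k) - G \<tau>\<bar>" by simp
    ultimately show ?thesis by simp
  qed
  ultimately show False
    using key[OF k(1) k(2) k(3)] mult_pos_pos[OF k(1) w] unfolding w_def [symmetric] by (simp add: mult.commute)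
qed

lemma mle_one_eq_exp: "mle 1 m t = exp (m * t)" if "0 \<le> t"
proof -
  have "mle 1 m t = (\<Sum>k. (m * t) ^ k /\<^sub>R fact k)"
    unfolding mle_def mlp_def
  proof (intro suminf_cong)
    fix k
    show "m ^ k / Gamma (1 * real k + 1) * (t powr 1) ^ k = (m * t) ^ k /\<^sub>R fact k"
      using that Gamma_fact[of k, where 'a = real] by (cases "t = 0") (auto simp: power_mult_distrib divide_inverse add.commute power_0_left)
  qed
  then show ?thesis by (simp add: exp_def)
qed

context
  fixes \<mu> :: real
  assumes \<alpha>1: "\<alpha> \<le> 1" and \<mu>: "0 < \<mu>"
begin

lemma mle_deriv_nonpos:
  assumes t: "0 < t"
  shows "mlp \<alpha> (\<lambda>k. \<alpha> * real k * (- \<mu>) ^ k) t \<le> 0"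
proof (cases "\<alpha> = 1")
  case True
  have "((\<lambda>t. exp (- \<mu> * t)) has_real_derivative mlp \<alpha> (\<lambda>k. \<alpha> * real k * (- \<mu>) ^ k) t / t) (at t)"
    by (rule has_field_derivative_transform_within_open[OF mle_has_derivative[OF t, of "- \<mu>"], of "{0<..}"])
      (use t True in \<open>auto simp: mle_one_eq_exp\<close>)
  moreover have "((\<lambda>t. exp (- \<mu> * t)) has_real_derivative exp (- \<mu> * t) * (- \<mu>)) (at t)"
    by (auto intro!: derivative_eq_intros)
  ultimately have "mlp \<alpha> (\<lambda>k. \<alpha> * real k * (- \<mu>) ^ k) t / t = exp (- \<mu> * t) * (- \<mu>)"
    by (rule DERIV_unique)
  also have "\<dots> \<le> 0" using \<mu> by (simp add: mult_nonneg_nonpos)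
  finally show ?thesis using t by (simp add: divide_le_0_iff)
next
  case False
  then show ?thesis using mle_deriv_neg_aux[of "- \<mu>" t] \<alpha>1 \<mu> t by simp
qed

text \<open>For alpha < 1 the Caputo derivative is a fractional integral of E' <= 0, hence
  nonpositive, and it equals -mu E.\<close>

lemma mle_nonneg:
  assumes t: "0 \<le> t" shows "0 \<le> mle \<alpha> (- \<mu>) t"
proof (cases "t = 0 \<or> \<alpha> = 1")
  case True
  then show ?thesis using mle_one_eq_exp[of t "- \<mu>"] t by auto
next
  case False
  then have t: "0 < t" and \<alpha>1': "\<alpha> < 1" using t \<alpha>1 by auto
  have "RL (1 - \<alpha>) (deriv (mle \<alpha> (- \<mu>))) t = - \<mu> * mle \<alpha> (- \<mu>) t"
    using caputo_mle(1)[OF \<alpha>1 t, of "- \<mu>"] \<alpha>1' by (simp add: caputo_def RL_def)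
  moreover have "(LBINT s:{0<..<t}. (t - s) powr (1 - \<alpha> - 1) * deriv (mle \<alpha> (- \<mu>)) s) \<le> 0"
  proof -
    have "0 \<le> (LINT s|lborel. - (indicator {0<..<t} s *\<^sub>R ((t - s) powr (1 - \<alpha> - 1) * deriv (mle \<alpha> (- \<mu>)) s)))"
    proof (rule integral_nonneg_AE)
      show "AE s in lborel. 0 \<le> - (indicator {0<..<t} s *\<^sub>R ((t - s) powr (1 - \<alpha> - 1) * deriv (mle \<alpha> (- \<mu>)) s))"
      proof (rule AE_I2)
        fix s
        have "deriv (mle \<alpha> (- \<mu>)) s \<le> 0" if "0 < s"
          using DERIV_imp_deriv[OF mle_has_derivative[OF that, of "- \<mu>"]] mle_deriv_nonpos[OF that] that
          by (simp add: divide_le_0_iff)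
        then show "0 \<le> - (indicator {0<..<t} s *\<^sub>R ((t - s) powr (1 - \<alpha> - 1) * deriv (mle \<alpha> (- \<mu>)) s))"
          by (auto simp: indicator_def mult_nonneg_nonpos)
      qed
    qed
    then show ?thesis by (simp add: set_lebesgue_integral_def)
  qed
  then have "RL (1 - \<alpha>) (deriv (mle \<alpha> (- \<mu>))) t \<le> 0"
    using \<alpha>1' unfolding RL_def by (simp add: divide_le_0_iff)
  ultimately show ?thesis using \<mu> by (simp add: zero_le_mult_iff mult_le_0_iff)
qed

lemma mle_antimono:
  assumes "0 \<le> s" "s \<le> t" shows "mle \<alpha> (- \<mu>) t \<le> mle \<alpha> (- \<mu>) s"
proof (rule DERIV_nonpos_imp_decreasing_open[OF assms(2)])
  fix x assume "s < x" "x < t"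
  then have x: "0 < x" using assms by simp
  show "\<exists>y. (mle \<alpha> (- \<mu>) has_real_derivative y) (at x) \<and> y \<le> 0"
    using mle_has_derivative[OF x, of "- \<mu>"] mle_deriv_nonpos[OF x] x
    by (intro exI[of _ "mlp \<alpha> (\<lambda>k. \<alpha> * real k * (- \<mu>) ^ k) x / x"]) (auto simp: divide_le_0_iff)
next
  show "continuous_on {s..t} (mle \<alpha> (- \<mu>))"
    using continuous_on_mle by (rule continuous_on_subset) (use assms in auto)
qed

lemma mle_le_1: "0 \<le> t \<Longrightarrow> mle \<alpha> (- \<mu>) t \<le> 1"
  using mle_antimono[of 0 t] by simp

text \<open>By monotonicity J^alpha E at t is at least E(t) t^alpha / Gamma(alpha + 1), while mu
  J^alpha E = 1 - E <= 1.\<close>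

lemma mle_decay:
  assumes t: "0 < t"
  shows "mle \<alpha> (- \<mu>) t \<le> Gamma (\<alpha> + 1) / (\<mu> * t powr \<alpha>)"
proof -
  have i: "set_integrable lborel {0<..<t} (\<lambda>s. (t - s) powr (\<alpha> - 1) * mle \<alpha> (- \<mu>) s)"
    unfolding mle_def by (rule RL_mlp(2)[OF \<alpha> _ t]) simp
  have "RL \<alpha> (\<lambda>s. mle \<alpha> (- \<mu>) t * 1) t \<le> RL \<alpha> (mle \<alpha> (- \<mu>)) t"
    using \<alpha> t RL_one(2)[OF \<alpha> t] i by (intro RL_mono) (auto intro: mle_antimono)
  then have "mle \<alpha> (- \<mu>) t * (t powr \<alpha> / Gamma (\<alpha> + 1)) \<le> RL \<alpha> (mle \<alpha> (- \<mu>)) t"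
    unfolding RL_cmult RL_one(1)[OF \<alpha> t] by simp
  then have "\<mu> * (mle \<alpha> (- \<mu>) t * (t powr \<alpha> / Gamma (\<alpha> + 1))) \<le> \<mu> * RL \<alpha> (mle \<alpha> (- \<mu>)) t"
    using \<mu> by (intro mult_left_mono) auto
  also have "\<dots> \<le> 1"
    using mle_integral_eq[OF t, of "- \<mu>"] mle_nonneg[of t] t by simp
  finally show ?thesis using \<mu> t \<alpha> Gamma_real_pos[of "\<alpha> + 1"] by (simp add: field_simps)
qed

text \<open>For q = t E' <= 0 the equation q = alpha (E - 1) - mu J^alpha q gives q >= alpha (E - 1)
  >= -alpha, uniformly in mu.\<close>

lemma mle_deriv_bound:
  assumes t: "0 < t"
  shows "\<bar>mlp \<alpha> (\<lambda>k. \<alpha> * real k * (- \<mu>) ^ k) t\<bar> \<le> \<alpha>"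
proof -
  let ?f = "mlp \<alpha> (\<lambda>k. \<alpha> * real k * (- \<mu>) ^ k)"
  have i: "set_integrable lborel {0<..<t} (\<lambda>s. (t - s) powr (\<alpha> - 1) * ?f s)"
    by (rule RL_mlp(2)[OF \<alpha> _ t]) (intro geo_times_index geo_power)
  have "RL \<alpha> ?f t \<le> RL \<alpha> (\<lambda>s. 0 * 1) t"
    using \<alpha> t i mle_deriv_nonpos by (intro RL_mono) (auto simp: set_integrable_def)
  then have "RL \<alpha> ?f t \<le> 0" unfolding RL_cmult by simp
  then have "0 \<le> - \<mu> * RL \<alpha> ?f t" using \<mu> by (simp add: mult_nonneg_nonpos)
  then have "\<alpha> * (mle \<alpha> (- \<mu>) t - 1) \<le> ?f t"
    using mle_index_integral_eq[OF t, of "- \<mu>"] by simp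
  moreover have "- \<alpha> \<le> \<alpha> * (mle \<alpha> (- \<mu>) t - 1)"
    using \<alpha> mle_nonneg[of t] t by (simp add: algebra_simps)
  ultimately show ?thesis using mle_deriv_nonpos[OF t] by simp
qed

end

end

section \<open>Odd and even parts of the Mittag-Leffler function\<close>

lemma geo_Suc_index: assumes "geo a" shows "geo (\<lambda>k. (1 + real k) * a k)"
proof -
  obtain C M where M: "0 \<le> M" "\<And>k. \<bar>a k\<bar> \<le> C * M ^ k" using assms by (auto simp: geo_def)
  have "\<bar>(1 + real k) * a k\<bar> \<le> C * (2 * M) ^ k" for k
  proof -
    have "Suc k \<le> 2 ^ k" by (rule Suc_leI) (rule less_exp)
    then have "real (Suc k) \<le> 2 ^ k" by (metis of_nat_le_iff of_nat_numeral of_nat_power)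
    then have "\<bar>(1 + real k) * a k\<bar> \<le> 2 ^ k * (C * M ^ k)"
      unfolding abs_mult by (intro mult_mono) (use M in auto)
    then show ?thesis by (simp add: power_mult_distrib mult_ac)
  qed
  then show ?thesis unfolding geo_def using M(1) by (intro exI[of _ C] exI[of _ "2 * M"]) auto
qed

lemma sum_pair_block: "sum f {n * 2..<n * 2 + 2} = f (2 * n) + f (2 * n + 1)" for f :: "nat \<Rightarrow> real"
proof -
  have "{n * 2..<n * 2 + 2} = {2 * n, 2 * n + 1}" by auto
  then show ?thesis by simp
qed

lemma sums_odd_part:
  assumes "\<And>k. even k \<Longrightarrow> f k = (0 :: real)" "summable f"
  shows "suminf f = (\<Sum>k. f (2 * k + 1))"
proof -
  have "f sums suminf f" using assms(2) by (rule summable_sums)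
  then have "(\<lambda>n. sum f {n * 2..<n * 2 + 2}) sums suminf f" by (rule sums_group) simp
  moreover have "sum f {n * 2..<n * 2 + 2} = f (2 * n + 1)" for n
    unfolding sum_pair_block using assms(1)[of "2 * n"] by simp
  ultimately show ?thesis by (simp add: sums_iff)
qed

text \<open>The series with coefficients \<open>odds\<close> and \<open>evens\<close> are the
  counterparts of sinh and cosh; the Caputo derivative exchanges them up to the factor mu.\<close>

definition odds :: "real \<Rightarrow> nat \<Rightarrow> real"
  where "odds \<mu> k = (if odd k then \<mu> ^ k else 0)"

definition evens :: "real \<Rightarrow> nat \<Rightarrow> real"
  where "evens \<mu> k = (if even k then \<mu> ^ k else 0)"

lemma geo_odds [simp]: "geo (odds \<mu>)" and geo_evens [simp]: "geo (evens \<mu>)"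
  by (rule geo_bounded_mult[OF geo_power[of \<mu>]]; simp add: odds_def evens_def)+

text \<open>Log-convexity between x and x + 1 gives Gamma (x + a) <= x^a Gamma x. The exponent a is
  then replaced by 1, since only polynomial growth of the ratio matters.\<close>

lemma Gamma_ratio_le:
  fixes x a :: real
  assumes x: "1 \<le> x" and a: "0 < a" "a \<le> 1"
  shows "Gamma (x + a) \<le> x * Gamma x"
proof -
  have nz: "x \<notin> \<int>\<^sub>\<le>\<^sub>0" using x nonpos_Ints_nonpos[of x] by force
  have "(ln \<circ> Gamma) ((1 - a) *\<^sub>R x + a *\<^sub>R (x + 1)) \<le> (1 - a) * (ln \<circ> Gamma) x + a * (ln \<circ> Gamma) (x + 1)"
    using convex_onD[OF log_convex_Gamma_real, of a x "x + 1"] x a by auto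
  also have "(1 - a) *\<^sub>R x + a *\<^sub>R (x + 1) = x + a" by (simp add: algebra_simps)
  also have "(ln \<circ> Gamma) (x + 1) = ln x + (ln \<circ> Gamma) x"
    using x Gamma_plus1[OF nz] by (simp add: ln_mult)
  finally have "ln (Gamma (x + a)) \<le> ln (Gamma x) + a * ln x" by (simp add: algebra_simps)
  also have "\<dots> \<le> ln (Gamma x) + 1 * ln x"
    using x a by (intro add_left_mono mult_right_mono) auto
  also have "\<dots> = ln (x * Gamma x)" using x by (simp add: ln_mult)
  finally show ?thesis using x a by (subst (asm) ln_le_cancel_iff) auto
qed

text \<open>The cube accounts for two Gamma ratios and one weight 1 + k. A cube root of
  \<open>r\<close> reduces it to a linear factor, which Bernoulli's inequality controls.\<close>

lemma cube_times_power_bounded: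
  fixes r :: real
  assumes r: "0 < r" "r < 1"
  shows "\<exists>C>0. \<forall>k. (real k + 2) ^ 3 * r ^ k \<le> C"
proof -
  define s where "s = root 3 r"
  have s: "0 < s" "s < 1" "s ^ 3 = r" using r by (auto simp: s_def)
  define d where "d = 1 / s - 1"
  have d: "0 < d" using s by (simp add: d_def)
  define M where "M = 2 + 1 / d"
  have M: "0 < M" using d by (simp add: M_def add_pos_pos)
  have "(real k + 2) * s ^ k \<le> M" for k
  proof -
    have "1 + real k * d \<le> (1 + d) ^ k" using Bernoulli_inequality[of d k] d by simp
    also have "(1 + d) ^ k = 1 / s ^ k" by (simp add: d_def power_one_over)
    finally have *: "(1 + real k * d) * s ^ k \<le> 1" using s by (simp add: field_simps)
    have "real k + 2 \<le> M * (1 + real k * d)" using d by (simp add: M_def field_simps)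
    then have "(real k + 2) * s ^ k \<le> M * (1 + real k * d) * s ^ k" using s by (intro mult_right_mono) auto
    also have "\<dots> \<le> M * 1" unfolding mult.assoc using * M by (intro mult_left_mono) auto
    finally show ?thesis by simp
  qed
  then have "((real k + 2) * s ^ k) ^ 3 \<le> M ^ 3" for k using s by (intro power_mono) auto
  moreover have "((real k + 2) * s ^ k) ^ 3 = (real k + 2) ^ 3 * r ^ k" for k
    unfolding s(3) [symmetric] by (simp add: power_mult_distrib power_mult [symmetric] mult.commute)
  ultimately show ?thesis using M by (intro exI[of _ "M ^ 3"]) auto
qed

context
  fixes \<alpha> :: real
  assumes \<alpha>: "0 < \<alpha>"
begin

lemma mle_odd_even: "mle \<alpha> \<mu> t = mlp \<alpha> (evens \<mu>) t + mlp \<alpha> (odds \<mu>) t"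
  "mle \<alpha> (- \<mu>) t = mlp \<alpha> (evens \<mu>) t - mlp \<alpha> (odds \<mu>) t"
proof -
  have "mle \<alpha> \<mu> t = mlp \<alpha> (\<lambda>k. evens \<mu> k + odds \<mu> k) t"
    unfolding mle_def by (rule arg_cong[where f = "\<lambda>a. mlp \<alpha> a t"]) (auto simp: evens_def odds_def)
  then show "mle \<alpha> \<mu> t = mlp \<alpha> (evens \<mu>) t + mlp \<alpha> (odds \<mu>) t" by (simp add: mlp_add[OF \<alpha>])
  have "mle \<alpha> (- \<mu>) t = mlp \<alpha> (\<lambda>k. evens \<mu> k + (-1) * odds \<mu> k) t"
    unfolding mle_def by (rule arg_cong[where f = "\<lambda>a. mlp \<alpha> a t"]) (auto simp: evens_def odds_def)
  then show "mle \<alpha> (- \<mu>) t = mlp \<alpha> (evens \<mu>) t - mlp \<alpha> (odds \<mu>) t"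
    by (simp only: mlp_add[OF \<alpha> geo_evens geo_cmult[OF geo_odds]] mlp_cmult[OF \<alpha> geo_odds])
qed

text \<open>An odd index k = 2 j + 1 turns alpha k + 1 into 2 alpha j + (alpha + 1), the parameters
  that occur in \<open>C_fun\<close> and \<open>S_fun\<close>.\<close>

lemma mittag_leffler_eq_odds:
  assumes \<mu>: "0 < \<mu>"
  shows "\<mu> * (t powr \<alpha> * mittag_leffler (2 * \<alpha>) (\<alpha> + 1) (\<mu>\<^sup>2 * t powr (2 * \<alpha>))) = mlp \<alpha> (odds \<mu>) t"
proof -
  define z where "z = t powr \<alpha>"
  have sm: "summable (\<lambda>k. odds \<mu> k / Gamma (\<alpha> * real k + 1) * z ^ k)"
    by (rule mlp_summable[OF \<alpha>]) simp
  have z2: "t powr (2 * \<alpha>) = z\<^sup>2"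
    using powr_add[of t \<alpha> \<alpha>] by (simp add: z_def power2_eq_square)
  have "mlp \<alpha> (odds \<mu>) t = (\<Sum>k. odds \<mu> (2 * k + 1) / Gamma (\<alpha> * real (2 * k + 1) + 1) * z ^ (2 * k + 1))"
    unfolding mlp_def z_def [symmetric] by (rule sums_odd_part[OF _ sm]) (simp add: odds_def)
  also have "\<dots> = (\<Sum>k. (\<mu> * z) * ((\<mu>\<^sup>2 * z\<^sup>2) ^ k / Gamma (2 * \<alpha> * real k + (\<alpha> + 1))))"
    by (intro suminf_cong) (simp add: odds_def power_mult_distrib power_mult [symmetric] algebra_simps)
  also have "\<dots> = (\<mu> * z) * (\<Sum>k. (\<mu>\<^sup>2 * z\<^sup>2) ^ k / Gamma (2 * \<alpha> * real k + (\<alpha> + 1)))"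
  proof (rule suminf_mult)
    show "summable (\<lambda>k. (\<mu>\<^sup>2 * z\<^sup>2) ^ k / Gamma (2 * \<alpha> * real k + (\<alpha> + 1)))"
    \<comment> \<open>Summability is inherited from the odd series by cancelling
      \<open>\<mu> * z\<close>, so z = 0 is treated apart.\<close>
    proof (cases "z = 0")
      case True
      then show ?thesis by (intro summable_finite[of "{0}"]) auto
    next
      case False
      have "summable (\<lambda>k. (\<mu> * z) * ((\<mu>\<^sup>2 * z\<^sup>2) ^ k / Gamma (2 * \<alpha> * real k + (\<alpha> + 1))))"
      proof -
        have "(\<lambda>n. \<Sum>k\<in>{n * 2..<n * 2 + 2}. odds \<mu> k / Gamma (\<alpha> * real k + 1) * z ^ k) sums (\<Sum>k. odds \<mu> k / Gamma (\<alpha> * real k + 1) * z ^ k)"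
          by (rule sums_group[OF summable_sums[OF sm]]) simp
        moreover have "(\<Sum>k\<in>{n * 2..<n * 2 + 2}. odds \<mu> k / Gamma (\<alpha> * real k + 1) * z ^ k) = (\<mu> * z) * ((\<mu>\<^sup>2 * z\<^sup>2) ^ n / Gamma (2 * \<alpha> * real n + (\<alpha> + 1)))" for n
          unfolding sum_pair_block by (simp add: odds_def power_mult_distrib power_mult [symmetric] algebra_simps)
        ultimately show ?thesis by (simp add: sums_iff)
      qed
      then show ?thesis using False \<mu> by (subst (asm) summable_cmult_iff) auto
    qed
  qed
  finally show ?thesis unfolding mittag_leffler_def z2 by (simp add: z_def mult_ac)
qed

lemma odds_1_pos: assumes "0 < \<mu>" shows "0 < mlp \<alpha> (odds \<mu>) 1"
proof -
  have "0 < odds \<mu> 1 / Gamma (\<alpha> * real 1 + 1) * (1 powr \<alpha>) ^ 1"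
    using assms \<alpha> by (simp add: odds_def)
  also have "\<dots> \<le> mlp \<alpha> (odds \<mu>) 1"
  proof -
    define f where "f k = odds \<mu> k / Gamma (\<alpha> * real k + 1) * (1 powr \<alpha>) ^ k" for k
    have "summable f" unfolding f_def by (rule mlp_summable[OF \<alpha>]) simp
    moreover have "0 \<le> f k" for k
      using assms Gamma_index_pos[OF \<alpha>, of k] by (auto simp: f_def odds_def less_imp_le)
    ultimately have "sum f {1} \<le> suminf f" by (intro sum_le_suminf) auto
    then show ?thesis by (simp add: f_def [abs_def] mlp_def)
  qed
  finally show ?thesis .
qed

definition Sf :: "real \<Rightarrow> real \<Rightarrow> real" where "Sf \<mu> t = mlp \<alpha> (odds \<mu>) t / mlp \<alpha> (odds \<mu>) 1"
text \<open>The counterpart of cosh carries the normalisation of \<open>Sf\<close>, so that D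
  \<open>Sf\<close> = mu \<open>Kf\<close> and D \<open>Kf\<close> = mu \<open>Sf\<close> without
  further constants.\<close>

definition Kf :: "real \<Rightarrow> real \<Rightarrow> real" where "Kf \<mu> t = mlp \<alpha> (evens \<mu>) t / mlp \<alpha> (odds \<mu>) 1"

lemma S_fun_eq: assumes "0 < \<mu>" shows "S_fun \<alpha> \<mu> t = Sf \<mu> t"
proof -
  have "mlp \<alpha> (odds \<mu>) 1 = \<mu> * mittag_leffler (2 * \<alpha>) (\<alpha> + 1) (\<mu>\<^sup>2)"
    using mittag_leffler_eq_odds[OF assms, of 1] by simp
  then show ?thesis
    unfolding S_fun_def Sf_def mittag_leffler_eq_odds[OF assms, of t, symmetric] using assms by simp
qed

lemma C_fun_eq: assumes "0 < \<mu>" shows "C_fun \<alpha> \<mu> t = mle \<alpha> (- \<mu>) t - mle \<alpha> (- \<mu>) 1 * Sf \<mu> t"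
proof -
  have o1: "mlp \<alpha> (odds \<mu>) 1 = \<mu> * mittag_leffler (2 * \<alpha>) (\<alpha> + 1) (\<mu>\<^sup>2)"
    using mittag_leffler_eq_odds[OF assms, of 1] by simp
  have e1: "mittag_leffler \<alpha> 1 m = mle \<alpha> m 1" for m
    using mittag_leffler_eq_mle[of \<alpha> m 1] by simp
  have "C_fun \<alpha> \<mu> t = (mle \<alpha> \<mu> 1 * mle \<alpha> (- \<mu>) t - mle \<alpha> (- \<mu>) 1 * mle \<alpha> \<mu> t) / (2 * mlp \<alpha> (odds \<mu>) 1)"
    by (simp only: C_fun_def e1 mittag_leffler_eq_mle o1 mult.assoc)
  then show ?thesis
    unfolding mle_odd_even(1)[of \<mu>] mle_odd_even(2)[of \<mu>] Sf_def using odds_1_pos[OF assms] by (simp add: field_simps)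
qed

lemma Sf_0 [simp]: "Sf \<mu> 0 = 0"
  using \<alpha> by (simp add: Sf_def odds_def)

lemma Sf_1: "0 < \<mu> \<Longrightarrow> Sf \<mu> 1 = 1"
  using odds_1_pos[of \<mu>] by (simp add: Sf_def)

lemma odds_evens_nonneg: "0 < \<mu> \<Longrightarrow> 0 \<le> odds \<mu> k" "0 < \<mu> \<Longrightarrow> 0 \<le> evens \<mu> k"
  by (auto simp: odds_def evens_def)

lemma continuous_on_Sf: "continuous_on {0..} (Sf \<mu>)"
  unfolding Sf_def [abs_def] divide_inverse
  by (intro continuous_intros continuous_on_mlp \<alpha>) simp

lemma Sf_bounds:
  assumes \<mu>: "0 < \<mu>" and t: "0 \<le> t" "t \<le> 1"
  shows "0 \<le> Sf \<mu> t" "Sf \<mu> t \<le> 1"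
proof -
  have "0 \<le> mlp \<alpha> (odds \<mu>) t" "mlp \<alpha> (odds \<mu>) t \<le> mlp \<alpha> (odds \<mu>) 1"
    using t odds_evens_nonneg[OF \<mu>] by (auto intro!: mlp_nonneg mlp_mono \<alpha>)
  then show "0 \<le> Sf \<mu> t" "Sf \<mu> t \<le> 1" using odds_1_pos[OF \<mu>] by (auto simp: Sf_def)
qed

text \<open>From sinh = mu J^alpha cosh and cosh = 1 + mu J^alpha sinh, both shifts of coefficients.
  The nonzero forcing term x^alpha is what lets a multiple of \<open>Sf\<close> absorb the free
  constant in the uniqueness proof.\<close>

lemma Sf_integral_eq:
  assumes \<mu>: "0 < \<mu>" and x: "0 < x"
  shows "Sf \<mu> x = \<mu> / mlp \<alpha> (odds \<mu>) 1 * (x powr \<alpha> / Gamma (\<alpha> + 1)) + \<mu>\<^sup>2 * RL \<alpha> (RL \<alpha> (Sf \<mu>)) x"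
proof -
  define o1 where "o1 = mlp \<alpha> (odds \<mu>) 1"
  have o1: "0 < o1" using odds_1_pos[OF \<mu>] by (simp add: o1_def)
  have e1: "mlp \<alpha> (odds \<mu>) s = \<mu> * RL \<alpha> (mlp \<alpha> (evens \<mu>)) s" if "0 < s" for s
  proof -
    let ?b = "\<lambda>k. if k = 0 then 0 else evens \<mu> (k - 1)"
    have "\<mu> * RL \<alpha> (mlp \<alpha> (evens \<mu>)) s = mlp \<alpha> (\<lambda>k. \<mu> * ?b k) s"
      by (simp only: RL_mlp[OF \<alpha> geo_evens that] mlp_cmult[OF \<alpha> geo_shift[OF geo_evens]])
    also have "(\<lambda>k. \<mu> * ?b k) = odds \<mu>"
      by (auto simp: fun_eq_iff evens_def odds_def power_eq_if)
    finally show ?thesis ..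
  qed
  have e2: "mlp \<alpha> (evens \<mu>) s = 1 + \<mu> * RL \<alpha> (mlp \<alpha> (odds \<mu>)) s" if "0 < s" for s
  proof -
    let ?b = "\<lambda>k. if k = 0 then 0 else odds \<mu> (k - 1)"
    have "\<mu> * RL \<alpha> (mlp \<alpha> (odds \<mu>)) s = mlp \<alpha> (\<lambda>k. \<mu> * ?b k) s"
      by (simp only: RL_mlp[OF \<alpha> geo_odds that] mlp_cmult[OF \<alpha> geo_shift[OF geo_odds]])
    moreover have "1 = mlp \<alpha> (\<lambda>k. 0 ^ k) s"
      unfolding mlp_def by (subst suminf_finite[of "{0}"]) auto
    moreover have "mlp \<alpha> (\<lambda>k. 0 ^ k) s + mlp \<alpha> (\<lambda>k. \<mu> * ?b k) s = mlp \<alpha> (\<lambda>k. 0 ^ k + \<mu> * ?b k) s"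
      by (rule mlp_add[OF \<alpha>, symmetric]) (rule geo_power geo_cmult[OF geo_shift[OF geo_odds]])+
    moreover have "(\<lambda>k. 0 ^ k + \<mu> * ?b k) = evens \<mu>"
      by (auto simp: fun_eq_iff evens_def odds_def power_eq_if)
    ultimately show ?thesis by simp
  qed
  have io: "set_integrable lborel {0<..<s} (\<lambda>r. (s - r) powr (\<alpha> - 1) * mlp \<alpha> (odds \<mu>) r)"
    and ie: "set_integrable lborel {0<..<s} (\<lambda>r. (s - r) powr (\<alpha> - 1) * mlp \<alpha> (evens \<mu>) r)" if "0 < s" for s
    using that by (auto intro: RL_mlp(2) \<alpha>)
  have "mlp \<alpha> (odds \<mu>) x = \<mu> * RL \<alpha> (\<lambda>s. 1 + \<mu> * RL \<alpha> (mlp \<alpha> (odds \<mu>)) s) x"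
    unfolding e1[OF x] by (intro arg_cong[where f = "(*) \<mu>"] RL_cong e2) auto
  also have "RL \<alpha> (\<lambda>s. 1 + \<mu> * RL \<alpha> (mlp \<alpha> (odds \<mu>)) s) x = RL \<alpha> (\<lambda>s. 1) x + RL \<alpha> (\<lambda>s. \<mu> * RL \<alpha> (mlp \<alpha> (odds \<mu>)) s) x"
  proof (rule RL_add)
    show i1: "set_integrable lborel {0<..<x} (\<lambda>s. (x - s) powr (\<alpha> - 1) * 1)"
      using RL_one(2)[OF \<alpha> x] by simp
    have "set_integrable lborel {0<..<x} (\<lambda>s. (x - s) powr (\<alpha> - 1) * mlp \<alpha> (evens \<mu>) s - (x - s) powr (\<alpha> - 1) * 1)"
      by (rule set_integral_diff(1)[OF ie[OF x] i1])
    also have "?this \<longleftrightarrow> set_integrable lborel {0<..<x} (\<lambda>s. (x - s) powr (\<alpha> - 1) * (\<mu> * RL \<alpha> (mlp \<alpha> (odds \<mu>)) s))"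
      by (rule set_integrable_cong) (auto simp: e2 algebra_simps)
    finally show "set_integrable lborel {0<..<x} (\<lambda>s. (x - s) powr (\<alpha> - 1) * (\<mu> * RL \<alpha> (mlp \<alpha> (odds \<mu>)) s))" .
  qed
  finally have main: "mlp \<alpha> (odds \<mu>) x = \<mu> * (x powr \<alpha> / Gamma (\<alpha> + 1)) + \<mu>\<^sup>2 * RL \<alpha> (RL \<alpha> (mlp \<alpha> (odds \<mu>))) x"
    by (simp add: RL_cmult RL_one(1)[OF \<alpha> x] algebra_simps power2_eq_square)
  have "Sf \<mu> = (\<lambda>t. (1 / o1) * mlp \<alpha> (odds \<mu>) t)" by (simp add: Sf_def [abs_def] o1_def)
  then have "RL \<alpha> (Sf \<mu>) = RL \<alpha> (\<lambda>t. (1 / o1) * mlp \<alpha> (odds \<mu>) t)" by (rule arg_cong)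
  also have "\<dots> = (\<lambda>s. (1 / o1) * RL \<alpha> (mlp \<alpha> (odds \<mu>)) s)"
    by (rule ext) (rule RL_cmult)
  finally have "RL \<alpha> (RL \<alpha> (Sf \<mu>)) x = RL \<alpha> (\<lambda>s. (1 / o1) * RL \<alpha> (mlp \<alpha> (odds \<mu>)) s) x"
    by simp
  also have "\<dots> = (1 / o1) * RL \<alpha> (RL \<alpha> (mlp \<alpha> (odds \<mu>))) x" by (rule RL_cmult)
  finally show ?thesis
    using o1 main unfolding Sf_def o1_def [symmetric] by (simp add: add_divide_distrib)
qed

lemma Sf_has_derivative:
  assumes "0 < t"
  shows "(Sf \<mu> has_real_derivative mlp \<alpha> (\<lambda>k. \<alpha> * real k * odds \<mu> k) t / t / mlp \<alpha> (odds \<mu>) 1) (at t)"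
    and "(Kf \<mu> has_real_derivative mlp \<alpha> (\<lambda>k. \<alpha> * real k * evens \<mu> k) t / t / mlp \<alpha> (odds \<mu>) 1) (at t)"
  unfolding Sf_def [abs_def] Kf_def [abs_def]
  by (intro DERIV_cdivide mlp_has_derivative \<alpha> assms geo_odds geo_evens)+

lemma caputo_Sf:
  assumes \<alpha>1: "\<alpha> \<le> 1" and x: "0 < x"
  shows "caputo \<alpha> (Sf \<mu>) x = \<mu> * Kf \<mu> x" "has_caputo \<alpha> (Sf \<mu>) x"
    "caputo \<alpha> (Kf \<mu>) x = \<mu> * Sf \<mu> x" "has_caputo \<alpha> (Kf \<mu>) x"
proof -
  have e: "(\<lambda>k. odds \<mu> (Suc k)) = (\<lambda>k. \<mu> * evens \<mu> k)" "(\<lambda>k. evens \<mu> (Suc k)) = (\<lambda>k. \<mu> * odds \<mu> k)"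
    by (auto simp: odds_def evens_def fun_eq_iff)
  note o = caputo_mlp[OF \<alpha> \<alpha>1 geo_odds x, of \<mu>] and ev = caputo_mlp[OF \<alpha> \<alpha>1 geo_evens x, of \<mu>]
  show "caputo \<alpha> (Sf \<mu>) x = \<mu> * Kf \<mu> x" "has_caputo \<alpha> (Sf \<mu>) x"
    using caputo_cdivide[OF o(2)] o(1) by (simp_all add: Sf_def [abs_def] Kf_def e mlp_cmult[OF \<alpha>])
  show "caputo \<alpha> (Kf \<mu>) x = \<mu> * Sf \<mu> x" "has_caputo \<alpha> (Kf \<mu>) x"
    using caputo_cdivide[OF ev(2)] ev(1) by (simp_all add: Kf_def [abs_def] Sf_def e mlp_cmult[OF \<alpha>])
qed

text \<open>For t <= t1 < 1 the terms gain a factor r^k against those at 1. Raising the index by one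
  yields a factor 1 / mu at the price of a Gamma ratio of linear growth: one such step leads from
  even to odd indices, two lead from odd to odd ones. The gain r^k absorbs the polynomial
  factors.\<close>

lemma odds_evens_bound:
  assumes \<alpha>1: "\<alpha> \<le> 1" and t1: "0 < t1" "t1 < 1"
  obtains C where "0 < C"
    "\<And>\<mu> t. 0 < \<mu> \<Longrightarrow> 0 \<le> t \<Longrightarrow> t \<le> t1 \<Longrightarrow> mlp \<alpha> (\<lambda>k. (1 + real k) * evens \<mu> k) t \<le> C / \<mu> * mlp \<alpha> (odds \<mu>) 1"
    "\<And>\<mu> t. 0 < \<mu> \<Longrightarrow> 0 \<le> t \<Longrightarrow> t \<le> t1 \<Longrightarrow> mlp \<alpha> (\<lambda>k. (1 + real k) * odds \<mu> k) t \<le> C / \<mu>\<^sup>2 * mlp \<alpha> (odds \<mu>) 1"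
proof -
  define r where "r = t1 powr \<alpha>"
  have r: "0 < r" "r < 1" using t1 \<alpha> powr_less_mono2[of \<alpha> t1 1] by (auto simp: r_def)
  obtain C where C: "0 < C" "\<And>k. (real k + 2) ^ 3 * r ^ k \<le> C"
    using cube_times_power_bounded[OF r] by blast
  note Gp = Gamma_index_pos[OF \<alpha>]
  have ratio: "\<mu> ^ k / Gamma (\<alpha> * real k + 1) \<le> (real k + 1) / \<mu> * (\<mu> ^ Suc k / Gamma (\<alpha> * real (Suc k) + 1))" if \<mu>: "0 < \<mu>" for \<mu> k
  proof -
    have "Gamma (\<alpha> * real (Suc k) + 1) = Gamma (\<alpha> * real k + 1 + \<alpha>)" by (simp add: algebra_simps)
    also have "\<dots> \<le> (\<alpha> * real k + 1) * Gamma (\<alpha> * real k + 1)"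
      using \<alpha> \<alpha>1 by (intro Gamma_ratio_le) auto
    also have "\<dots> \<le> (real k + 1) * Gamma (\<alpha> * real k + 1)"
      using \<alpha>1 Gp[of k] mult_right_mono[of \<alpha> 1 "real k"] by (intro mult_right_mono) (auto simp: less_imp_le)
    finally have g: "Gamma (\<alpha> * real (Suc k) + 1) \<le> (real k + 1) * Gamma (\<alpha> * real k + 1)" .
    have "\<mu> ^ k / Gamma (\<alpha> * real k + 1) \<le> (real k + 1) * \<mu> ^ k / Gamma (\<alpha> * real (Suc k) + 1)"
      using mult_left_mono[OF g, of "\<mu> ^ k"] \<mu> Gp[of k] Gp[of "Suc k"]
      by (simp add: divide_le_eq mult_ac le_divide_eq del: of_nat_Suc)
    also have "\<dots> = (real k + 1) / \<mu> * (\<mu> ^ Suc k / Gamma (\<alpha> * real (Suc k) + 1))"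
      using \<mu> by simp
    finally show ?thesis .
  qed
  have tr: "(t powr \<alpha>) ^ k \<le> r ^ k" if "0 \<le> t" "t \<le> t1" for t k
    using that \<alpha> by (auto simp: r_def intro!: power_mono powr_mono2)
  have so: "summable (\<lambda>k. odds \<mu> k / Gamma (\<alpha> * real k + 1) * (1 powr \<alpha>) ^ k)" for \<mu>
    by (rule mlp_summable[OF \<alpha> geo_odds])
  note g1 = geo_Suc_index
  have E: "mlp \<alpha> (\<lambda>k. (1 + real k) * evens \<mu> k) t \<le> C / \<mu> * mlp \<alpha> (odds \<mu>) 1"
    if \<mu>: "0 < \<mu>" and t: "0 \<le> t" "t \<le> t1" for \<mu> t
  proof -
    let ?o = "\<lambda>k. odds \<mu> k / Gamma (\<alpha> * real k + 1) * (1 powr \<alpha>) ^ k"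
    have s1: "summable (\<lambda>k. ?o (Suc k))" using so by (subst summable_Suc_iff)
    have "mlp \<alpha> (\<lambda>k. (1 + real k) * evens \<mu> k) t \<le> (\<Sum>k. C / \<mu> * ?o (Suc k))"
      unfolding mlp_def
    proof (rule suminf_le)
      fix k
      show "(1 + real k) * evens \<mu> k / Gamma (\<alpha> * real k + 1) * (t powr \<alpha>) ^ k \<le> C / \<mu> * ?o (Suc k)"
      proof (cases "even k")
        case True
        define P where "P = \<mu> ^ Suc k / Gamma (\<alpha> * real (Suc k) + 1)"
        have P: "0 \<le> P" using \<mu> Gp[of "Suc k"] by (simp add: P_def less_imp_le)
        have "(1 + real k) * (\<mu> ^ k / Gamma (\<alpha> * real k + 1)) * (t powr \<alpha>) ^ k
            \<le> (1 + real k) * ((real k + 1) / \<mu> * P) * r ^ k"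
          using ratio[OF \<mu>, of k] tr[OF t, of k] \<mu> P r Gp[of k] unfolding P_def [symmetric]
          by (intro mult_mono) (auto simp: less_imp_le)
        also have "\<dots> = ((real k + 1)\<^sup>2 * r ^ k) * (P / \<mu>)" by (simp add: power2_eq_square add.commute)
        also have "\<dots> \<le> ((real k + 2) ^ 3 * r ^ k) * (P / \<mu>)"
        proof (intro mult_right_mono)
          have "(real k + 1)\<^sup>2 \<le> (real k + 2)\<^sup>2" by (intro power_mono) auto
          also have "\<dots> \<le> (real k + 2) ^ 3" by (intro power_increasing) auto
          finally show "(real k + 1)\<^sup>2 \<le> (real k + 2) ^ 3" .
        qed (use P \<mu> r in auto)
        also have "\<dots> \<le> C * (P / \<mu>)" using C(2)[of k] P \<mu> by (intro mult_right_mono) auto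
        finally show ?thesis using True \<mu> by (simp add: evens_def odds_def P_def)
      qed (use C \<mu> Gp[of "Suc k"] in \<open>simp add: evens_def odds_def\<close>)
    next
      show "summable (\<lambda>k. (1 + real k) * evens \<mu> k / Gamma (\<alpha> * real k + 1) * (t powr \<alpha>) ^ k)"
        by (rule mlp_summable[OF \<alpha> g1[OF geo_evens]])
      show "summable (\<lambda>k. C / \<mu> * ?o (Suc k))" using s1 by (rule summable_mult)
    qed
    also have "\<dots> = C / \<mu> * (\<Sum>k. ?o (Suc k))" using s1 by (rule suminf_mult)
    also have "(\<Sum>k. ?o (Suc k)) = mlp \<alpha> (odds \<mu>) 1"
      using suminf_split_head[OF so, of \<mu>] unfolding mlp_def by (simp add: odds_def)
    finally show ?thesis .
  qed
  have O: "mlp \<alpha> (\<lambda>k. (1 + real k) * odds \<mu> k) t \<le> C / \<mu>\<^sup>2 * mlp \<alpha> (odds \<mu>) 1"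
    if \<mu>: "0 < \<mu>" and t: "0 \<le> t" "t \<le> t1" for \<mu> t
  proof -
    let ?o = "\<lambda>k. odds \<mu> k / Gamma (\<alpha> * real k + 1) * (1 powr \<alpha>) ^ k"
    have s2: "summable (\<lambda>k. ?o (k + 2))" using so by (subst summable_iff_shift)
    have "mlp \<alpha> (\<lambda>k. (1 + real k) * odds \<mu> k) t \<le> (\<Sum>k. C / \<mu>\<^sup>2 * ?o (k + 2))"
      unfolding mlp_def
    proof (rule suminf_le)
      fix k
      show "(1 + real k) * odds \<mu> k / Gamma (\<alpha> * real k + 1) * (t powr \<alpha>) ^ k \<le> C / \<mu>\<^sup>2 * ?o (k + 2)"
      proof (cases "odd k")
        case True
        define P where "P = \<mu> ^ Suc (Suc k) / Gamma (\<alpha> * real (Suc (Suc k)) + 1)"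
        have P: "0 \<le> P" using \<mu> Gp[of "Suc (Suc k)"] by (simp add: P_def less_imp_le)
        have "\<mu> ^ k / Gamma (\<alpha> * real k + 1) \<le> (real k + 1) / \<mu> * (\<mu> ^ Suc k / Gamma (\<alpha> * real (Suc k) + 1))"
          by (rule ratio[OF \<mu>])
        also have "\<dots> \<le> (real k + 1) / \<mu> * ((real (Suc k) + 1) / \<mu> * P)"
          unfolding P_def using \<mu> by (intro mult_left_mono ratio) auto
        finally have rr: "\<mu> ^ k / Gamma (\<alpha> * real k + 1) \<le> (real k + 1) / \<mu> * ((real k + 2) / \<mu> * P)" by (simp add: add.commute)
        have "(1 + real k) * (\<mu> ^ k / Gamma (\<alpha> * real k + 1)) * (t powr \<alpha>) ^ k
            \<le> (1 + real k) * ((real k + 1) / \<mu> * ((real k + 2) / \<mu> * P)) * r ^ k"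
          using rr tr[OF t, of k] \<mu> P r Gp[of k] by (intro mult_mono) (auto simp: less_imp_le)
        also have "\<dots> = ((real k + 1)\<^sup>2 * (real k + 2) * r ^ k) * (P / \<mu>\<^sup>2)" by (simp add: power2_eq_square add.commute)
        also have "\<dots> \<le> ((real k + 2) ^ 3 * r ^ k) * (P / \<mu>\<^sup>2)"
        proof (intro mult_right_mono)
          have "(real k + 1)\<^sup>2 * (real k + 2) \<le> (real k + 2)\<^sup>2 * (real k + 2)" by (intro mult_right_mono power_mono) auto
          then show "(real k + 1)\<^sup>2 * (real k + 2) \<le> (real k + 2) ^ 3" by (simp add: power3_eq_cube power2_eq_square)
        qed (use P \<mu> r in auto)
        also have "\<dots> \<le> C * (P / \<mu>\<^sup>2)" using C(2)[of k] P \<mu> by (intro mult_right_mono) auto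
        finally show ?thesis using True by (simp add: odds_def P_def mult_ac)
      qed (simp add: odds_def)
    next
      show "summable (\<lambda>k. (1 + real k) * odds \<mu> k / Gamma (\<alpha> * real k + 1) * (t powr \<alpha>) ^ k)"
        by (rule mlp_summable[OF \<alpha> g1[OF geo_odds]])
      show "summable (\<lambda>k. C / \<mu>\<^sup>2 * ?o (k + 2))" using s2 by (rule summable_mult)
    qed
    also have "\<dots> = C / \<mu>\<^sup>2 * (\<Sum>k. ?o (k + 2))" using s2 by (rule suminf_mult)
    also have "\<dots> \<le> C / \<mu>\<^sup>2 * mlp \<alpha> (odds \<mu>) 1"
    proof (intro mult_left_mono)
      have "0 \<le> sum ?o {..<2}" using \<mu> Gp by (intro sum_nonneg) (auto simp: odds_def less_imp_le)
      then show "(\<Sum>k. ?o (k + 2)) \<le> mlp \<alpha> (odds \<mu>) 1"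
        unfolding mlp_def suminf_minus_initial_segment[OF so] by simp
    qed (use C in auto)
    finally show ?thesis .
  qed
  show ?thesis by (rule that[OF C(1) E O])
qed

text \<open>The weight 1 + k dominates both 1 and alpha k, so one estimate covers the functions and
  t times their derivatives.\<close>

lemma Sf_Kf_bounds:
  assumes \<alpha>1: "\<alpha> \<le> 1" and t1: "0 < t1" "t1 < 1"
  obtains C where "0 < C"
    "\<And>\<mu> t. 0 < \<mu> \<Longrightarrow> 0 < t \<Longrightarrow> t \<le> t1 \<Longrightarrow> 0 \<le> Sf \<mu> t \<and> Sf \<mu> t \<le> C / \<mu>\<^sup>2"
    "\<And>\<mu> t. 0 < \<mu> \<Longrightarrow> 0 < t \<Longrightarrow> t \<le> t1 \<Longrightarrow> 0 \<le> Kf \<mu> t \<and> Kf \<mu> t \<le> C / \<mu>"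
    "\<And>\<mu> t. 0 < \<mu> \<Longrightarrow> 0 < t \<Longrightarrow> t \<le> t1 \<Longrightarrow> 0 \<le> deriv (Sf \<mu>) t \<and> deriv (Sf \<mu>) t \<le> C / \<mu>\<^sup>2 / t"
    "\<And>\<mu> t. 0 < \<mu> \<Longrightarrow> 0 < t \<Longrightarrow> t \<le> t1 \<Longrightarrow> 0 \<le> deriv (Kf \<mu>) t \<and> deriv (Kf \<mu>) t \<le> C / \<mu> / t"
proof -
  obtain C where C: "0 < C"
    and E: "\<And>\<mu> t. 0 < \<mu> \<Longrightarrow> 0 \<le> t \<Longrightarrow> t \<le> t1 \<Longrightarrow> mlp \<alpha> (\<lambda>k. (1 + real k) * evens \<mu> k) t \<le> C / \<mu> * mlp \<alpha> (odds \<mu>) 1"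
    and O: "\<And>\<mu> t. 0 < \<mu> \<Longrightarrow> 0 \<le> t \<Longrightarrow> t \<le> t1 \<Longrightarrow> mlp \<alpha> (\<lambda>k. (1 + real k) * odds \<mu> k) t \<le> C / \<mu>\<^sup>2 * mlp \<alpha> (odds \<mu>) 1"
    using odds_evens_bound[OF assms] by blast
  note g1 = geo_Suc_index
  have o0: "0 \<le> odds \<mu> k" "0 \<le> evens \<mu> k" if "0 < \<mu>" for \<mu> k using odds_evens_nonneg[OF that] by auto
  have le: "\<alpha> * real k * a \<le> (1 + real k) * a" "a \<le> (1 + real k) * a" "0 \<le> \<alpha> * real k * a" if "0 \<le> a" for k a
  proof -
    have "\<alpha> * real k \<le> 1 * real k" using \<alpha>1 by (intro mult_right_mono) auto
    then show "\<alpha> * real k * a \<le> (1 + real k) * a" using that by (intro mult_right_mono) auto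
    show "a \<le> (1 + real k) * a" using that mult_right_mono[of 1 "1 + real k" a] by simp
    show "0 \<le> \<alpha> * real k * a" using that \<alpha> by simp
  qed
  have div: "0 \<le> a / o1 \<and> a / o1 \<le> B" if "0 \<le> a" "a \<le> B * o1" "0 < o1" for a o1 B :: real
    using that by (simp add: divide_le_eq)
  have divt: "0 \<le> a / t / o1 \<and> a / t / o1 \<le> B / t" if "0 \<le> a" "a \<le> B * o1" "0 < o1" "0 < t" for a o1 B t :: real
    using that by (simp add: divide_le_eq)
  show ?thesis
  proof (rule that[OF C])
    fix \<mu> t :: real assume \<mu>: "0 < \<mu>" and t: "0 < t" "t \<le> t1"
    note o1 = odds_1_pos[OF \<mu>]
    have O': "mlp \<alpha> (\<lambda>k. (1 + real k) * odds \<mu> k) t \<le> C / \<mu>\<^sup>2 * mlp \<alpha> (odds \<mu>) 1" using O[OF \<mu>] t by auto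
    have E': "mlp \<alpha> (\<lambda>k. (1 + real k) * evens \<mu> k) t \<le> C / \<mu> * mlp \<alpha> (odds \<mu>) 1" using E[OF \<mu>] t by auto
    show "0 \<le> Sf \<mu> t \<and> Sf \<mu> t \<le> C / \<mu>\<^sup>2"
      unfolding Sf_def
      by (intro div o1 order_trans[OF mlp_le O'] mlp_nonneg \<alpha> geo_odds g1 o0 \<mu> le)
    show "0 \<le> Kf \<mu> t \<and> Kf \<mu> t \<le> C / \<mu>"
      unfolding Kf_def
      by (intro div o1 order_trans[OF mlp_le E'] mlp_nonneg \<alpha> geo_evens g1 o0 \<mu> le)
    show "0 \<le> deriv (Sf \<mu>) t \<and> deriv (Sf \<mu>) t \<le> C / \<mu>\<^sup>2 / t"
      unfolding DERIV_imp_deriv[OF Sf_has_derivative(1)[OF t(1)]]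
      by (intro divt o1 order_trans[OF mlp_le O'] mlp_nonneg \<alpha> geo_odds g1 geo_times_index o0 \<mu> le t(1))
    show "0 \<le> deriv (Kf \<mu>) t \<and> deriv (Kf \<mu>) t \<le> C / \<mu> / t"
      unfolding DERIV_imp_deriv[OF Sf_has_derivative(2)[OF t(1)]]
      by (intro divt o1 order_trans[OF mlp_le E'] mlp_nonneg \<alpha> geo_evens g1 geo_times_index o0 \<mu> le t(1))
  qed
qed

end

section \<open>Interval functions with small second differences\<close>

text \<open>If the interval function \<open>b\<close> were nonzero, the smallness of its second differences would let
  its slope survive all halvings near some point. Nested intervals then lead to a point at which
  \<open>T x y / x\<close> stays away from 0.\<close>

lemma interval_function_nonpos:
  fixes b T :: "real \<Rightarrow> real \<Rightarrow> real"
  assumes s: "1 < s" and C: "0 \<le> C" and K: "0 \<le> K" and X: "0 < X"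
    and add: "\<And>p q r. lo \<le> p \<Longrightarrow> p \<le> q \<Longrightarrow> q \<le> r \<Longrightarrow> r \<le> hi \<Longrightarrow> b p r = b p q + b q r"
    and sd: "\<And>m l. 0 < l \<Longrightarrow> l < 1 \<Longrightarrow> lo \<le> m - l \<Longrightarrow> m + l \<le> hi \<Longrightarrow> \<bar>b m (m + l) - b (m - l) m\<bar> \<le> C * l powr s"
    and cont: "\<And>x. x \<in> {0<..<X} \<Longrightarrow> continuous_on {lo..hi} (T x)"
    and main: "\<And>p q x. lo \<le> p \<Longrightarrow> p < q \<Longrightarrow> q \<le> hi \<Longrightarrow> x \<in> {0<..<X} \<Longrightarrow> \<bar>b p q * x - integral {p..q} (T x)\<bar> \<le> K * x\<^sup>2"
    and lim: "\<And>y. y \<in> {lo..hi} \<Longrightarrow> ((\<lambda>x. T x y / x) \<longlongrightarrow> 0) (at_right 0)"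
    and pq: "lo \<le> p" "p < q" "q \<le> hi"
  shows "b p q \<le> 0"
proof (rule ccontr)
  assume "\<not> b p q \<le> 0"
  define \<sigma>0 where "\<sigma>0 = b p q / (q - p)"
  have \<sigma>0: "0 < \<sigma>0" using \<open>\<not> b p q \<le> 0\<close> pq by (simp add: \<sigma>0_def)
  \<comment> \<open>Half of the slope is kept in reserve for the correction in
    \<open>Good\<close>.\<close>
  define \<sigma> where "\<sigma> = \<sigma>0 / 2"
  have \<sigma>: "0 < \<sigma>" using \<sigma>0 by (simp add: \<sigma>_def)
  have two: "1 < 2 powr (s - 1)" using s powr_less_mono[of 0 "s - 1" "2::real"] by simp
  \<comment> \<open>Chosen so that D (2 l)^(s - 1) - D l^(s - 1) = (C / 2) l^(s - 1): the correction
    released by halving pays for the second difference, and \<open>Good\<close> passes to both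
    halves, not only to the steeper one.\<close>
  define D where "D = C / (2 * (2 powr (s - 1) - 1))"
  have D: "0 \<le> D" using C two by (simp add: D_def)
  define Good where "Good u v \<longleftrightarrow> lo \<le> u \<and> u < v \<and> v \<le> hi \<and> v - u < 1 \<and> (\<sigma> + D * (v - u) powr (s - 1)) * (v - u) \<le> b u v" for u v
  \<comment> \<open>Bisection towards the steeper half keeps the slope \<open>\<sigma>0\<close>; it
    is repeated until the interval is so short that the correction falls below
    \<open>\<sigma>\<close>.\<close>
  have start: "\<exists>u v. lo \<le> u \<and> u < v \<and> v \<le> hi \<and> v - u = (q - p) / 2 ^ n \<and> \<sigma>0 * (v - u) \<le> b u v" for n
  proof (induction n)
    case 0
    show ?case using pq by (intro exI[of _ p] exI[of _ q]) (simp add: \<sigma>0_def)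
  next
    case (Suc n)
    then obtain u v where uv: "lo \<le> u" "u < v" "v \<le> hi" "v - u = (q - p) / 2 ^ n" "\<sigma>0 * (v - u) \<le> b u v" by blast
    define m where "m = (u + v) / 2"
    have m: "u < m" "m < v" "m - u = (v - u) / 2" "v - m = (v - u) / 2" using uv by (auto simp: m_def field_simps)
    have "b u v = b u m + b m v" using uv m by (intro add) auto
    then have "\<sigma>0 * (v - u) / 2 \<le> b u m \<or> \<sigma>0 * (v - u) / 2 \<le> b m v" using uv by linarith
    then show ?case
    proof
      assume "\<sigma>0 * (v - u) / 2 \<le> b u m"
      then show ?thesis using uv m by (intro exI[of _ u] exI[of _ m]) simp
    next
      assume "\<sigma>0 * (v - u) / 2 \<le> b m v"
      then have "\<sigma>0 * (v - m) \<le> b m v" by (simp add: m(4))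
      moreover have "v - m = (q - p) / 2 ^ Suc n" using m(4) uv(4) by simp
      moreover have "lo \<le> m" using uv(1) m(1) by simp
      ultimately show ?thesis using uv(3) m(2) by blast
    qed
  qed
  have ex_good: "\<exists>u v. Good u v"
  proof -
    have lim0: "(\<lambda>n. (q - p) / 2 ^ n) \<longlonglongrightarrow> 0"
      using LIMSEQ_divide_realpow_zero[of 2 "q - p"] by simp
    then have "(\<lambda>n. D * ((q - p) / 2 ^ n) powr (s - 1)) \<longlonglongrightarrow> D * 0 powr (s - 1)"
      using s pq by (intro tendsto_intros) auto
    then have "(\<lambda>n. D * ((q - p) / 2 ^ n) powr (s - 1)) \<longlonglongrightarrow> 0" by simp
    then have "\<forall>\<^sub>F n in sequentially. D * ((q - p) / 2 ^ n) powr (s - 1) < \<sigma>" using \<sigma> by (rule order_tendstoD)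
    moreover have "\<forall>\<^sub>F n in sequentially. (q - p) / 2 ^ n < 1" using lim0 by (rule order_tendstoD) simp
    ultimately have "\<forall>\<^sub>F n in sequentially. D * ((q - p) / 2 ^ n) powr (s - 1) < \<sigma> \<and> (q - p) / 2 ^ n < 1"
      by (rule eventually_conj)
    then obtain n where n: "D * ((q - p) / 2 ^ n) powr (s - 1) < \<sigma>" "(q - p) / 2 ^ n < 1"
      using eventually_happens'[OF sequentially_bot] by blast
    from start[of n] obtain u v where uv: "lo \<le> u" "u < v" "v \<le> hi" "v - u = (q - p) / 2 ^ n" "\<sigma>0 * (v - u) \<le> b u v" by blast
    have "(\<sigma> + D * (v - u) powr (s - 1)) * (v - u) \<le> \<sigma>0 * (v - u)"
      using uv n by (intro mult_right_mono) (auto simp: \<sigma>_def)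
    then show ?thesis using uv n unfolding Good_def by force
  qed
  have half: "Good u ((u + v) / 2) \<and> Good ((u + v) / 2) v" if g: "Good u v" for u v
  proof -
    define m where "m = (u + v) / 2"
    define l where "l = (v - u) / 2"
    have uv: "lo \<le> u" "u < v" "v \<le> hi" "v - u < 1" "(\<sigma> + D * (v - u) powr (s - 1)) * (v - u) \<le> b u v"
      using g by (auto simp: Good_def)
    have l: "0 < l" "l < 1" "m - l = u" "m + l = v" "v - u = 2 * l" "m - u = l" "v - m = l"
      using uv by (auto simp: l_def m_def field_simps)
    have ad: "b u v = b u m + b m v" using uv l by (intro add) auto
    have "\<bar>b m v - b u m\<bar> \<le> C * l powr s" using sd[of l m] l uv by simp
    then have e: "b u v / 2 - C * l powr s / 2 \<le> b u m" "b u v / 2 - C * l powr s / 2 \<le> b m v"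
      using ad unfolding abs_le_iff by linarith+
    have ls: "l powr s = l * l powr (s - 1)"
      using l powr_add[of l 1 "s - 1"] by simp
    have "D * (2 * l) powr (s - 1) - D * l powr (s - 1) = D * (2 powr (s - 1) - 1) * l powr (s - 1)"
      using l by (simp add: powr_mult algebra_simps)
    also have "D * (2 powr (s - 1) - 1) = C / 2"
    proof -
      have "c / (2 * w) * w = c / 2" if "w \<noteq> 0" for c w :: real using that by simp
      from this[of "2 powr (s - 1) - 1" C] two show ?thesis unfolding D_def by linarith
    qed
    finally have de: "D * (2 * l) powr (s - 1) = D * l powr (s - 1) + C / 2 * l powr (s - 1)" by simp
    have "(\<sigma> + D * l powr (s - 1)) * l = (\<sigma> + D * (2 * l) powr (s - 1)) * (2 * l) / 2 - C * l powr s / 2"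
      unfolding de ls by (simp add: algebra_simps)
    also have "\<dots> \<le> b u v / 2 - C * l powr s / 2" using uv(5) unfolding l(5) by simp
    finally have "(\<sigma> + D * l powr (s - 1)) * l \<le> b u m" "(\<sigma> + D * l powr (s - 1)) * l \<le> b m v"
      using e by auto
    then show ?thesis using uv l unfolding Good_def m_def [symmetric] by auto
  qed
  \<comment> \<open>Since both halves stay good, bisection can follow any prescribed point
    \<open>y\<close>.\<close>
  have loc: "\<exists>u' v'. Good u' v' \<and> u \<le> u' \<and> v' \<le> v \<and> u' \<le> y \<and> y \<le> v' \<and> v' - u' = (v - u) / 2 ^ n"
    if "Good u v" "u \<le> y" "y \<le> v" for u v y n
  proof (induction n)
    case 0
    show ?case using that by (intro exI[of _ u] exI[of _ v]) simp
  next
    case (Suc n)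
    then obtain u' v' where w: "Good u' v'" "u \<le> u'" "v' \<le> v" "u' \<le> y" "y \<le> v'" "v' - u' = (v - u) / 2 ^ n" by blast
    have uv: "u' < v'" using w by (simp add: Good_def)
    have d: "(u' + v') / 2 - u' = (v - u) / 2 ^ Suc n" "v' - (u' + v') / 2 = (v - u) / 2 ^ Suc n"
      using w(6) by (auto simp: field_simps)
    show ?case
    proof (cases "y \<le> (u' + v') / 2")
      case True
      then show ?thesis using half[OF w(1)] w uv d by (intro exI[of _ u'] exI[of _ "(u' + v') / 2"]) auto
    next
      case False
      then show ?thesis using half[OF w(1)] w uv d by (intro exI[of _ "(u' + v') / 2"] exI[of _ v']) auto
    qed
  qed
  \<comment> \<open>The integral of T x over a good interval is close to its slope times x, so T x
    exceeds sigma x / 2 at some point, and by continuity on a short good interval around it; x can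
    be taken as small as desired.\<close>
  have step: "\<exists>u' v' x. Good u' v' \<and> u \<le> u' \<and> v' \<le> v \<and> 0 < x \<and> x < xb \<and> (\<forall>y\<in>{u'..v'}. \<sigma> / 2 * x \<le> T x y)"
    if g: "Good u v" and xb: "0 < xb" for u v xb
  proof -
    have uv: "lo \<le> u" "u < v" "v \<le> hi" "(\<sigma> + D * (v - u) powr (s - 1)) * (v - u) \<le> b u v"
      using g by (auto simp: Good_def)
    have bs: "\<sigma> * (v - u) \<le> b u v"
    proof -
      have "\<sigma> * (v - u) \<le> (\<sigma> + D * (v - u) powr (s - 1)) * (v - u)"
        using uv D by (intro mult_right_mono) auto
      then show ?thesis using uv(4) by (rule order_trans)
    qed
    \<comment> \<open>For x < E the error K x^2 is less than half of the main term sigma (v - u)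
      x.\<close>
    define E where "E = \<sigma> * (v - u) / (2 * (K + 1))"
    define x where "x = min (min xb X) E / 2"
    have pos: "0 < E" using \<sigma> uv K by (simp add: E_def)
    have x: "0 < x" "x < xb" "x < X" "x < E"
      using xb X pos by (auto simp: x_def min_def)
    have "(K + 1) * x < (K + 1) * E" using x(4) K by (intro mult_strict_left_mono) auto
    also have "(K + 1) * E = \<sigma> * (v - u) / 2"
      using K unfolding E_def by (simp only: times_divide_eq_right nonzero_mult_divide_mult_cancel_right mult.commute[of "K + 1"])
    finally have "(K + 1) * x < \<sigma> * (v - u) / 2" .
    then have Kx: "K * x < \<sigma> * (v - u) / 2" using x by (simp add: algebra_simps)
    have "K * x\<^sup>2 < \<sigma> * (v - u) / 2 * x"
      unfolding power2_eq_square mult.assoc [symmetric] using Kx x by (intro mult_strict_right_mono) auto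
    moreover have "\<sigma> * (v - u) * x \<le> b u v * x" using bs x by (intro mult_right_mono) auto
    moreover have "\<bar>b u v * x - integral {u..v} (T x)\<bar> \<le> K * x\<^sup>2" using main[of u v x] uv x by auto
    ultimately have I: "\<sigma> / 2 * x * (v - u) < integral {u..v} (T x)"
      by (simp add: abs_le_iff algebra_simps)
    have cT: "continuous_on {u..v} (T x)"
      using cont[of x] x uv by (auto intro: continuous_on_subset)
    have "\<exists>y\<in>{u..v}. \<sigma> / 2 * x < T x y"
    proof (rule ccontr)
      assume "\<not> ?thesis"
      then have "integral {u..v} (T x) \<le> integral {u..v} (\<lambda>y. \<sigma> / 2 * x)"
        by (intro integral_le integrable_continuous_real cT) (auto simp: not_less)
      then show False using I uv by (simp add: mult_ac)
    qed
    then obtain y where y: "y \<in> {u..v}" "\<sigma> / 2 * x < T x y" by blast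
    have "\<forall>\<^sub>F z in at y within {u..v}. \<sigma> / 2 * x < T x z"
      using cT y by (intro order_tendstoD(1)[of "T x" "T x y"]) (auto simp: continuous_on_def)
    then obtain \<delta> where \<delta>: "0 < \<delta>" "\<And>z. z \<in> {u..v} \<Longrightarrow> z \<noteq> y \<Longrightarrow> \<bar>z - y\<bar> < \<delta> \<Longrightarrow> \<sigma> / 2 * x < T x z"
      unfolding eventually_at dist_real_def by blast
    have "(\<lambda>n. (v - u) / 2 ^ n) \<longlonglongrightarrow> 0" using LIMSEQ_divide_realpow_zero[of 2 "v - u"] by simp
    then have "\<forall>\<^sub>F n in sequentially. (v - u) / 2 ^ n < \<delta>" using \<delta>(1) by (rule order_tendstoD)
    then obtain n where n: "(v - u) / 2 ^ n < \<delta>" using eventually_happens'[OF sequentially_bot] by blast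
    obtain u' v' where w: "Good u' v'" "u \<le> u'" "v' \<le> v" "u' \<le> y" "y \<le> v'" "v' - u' = (v - u) / 2 ^ n"
      using loc[OF g, of y n] y by auto
    have "\<sigma> / 2 * x \<le> T x z" if "z \<in> {u'..v'}" for z
    proof (cases "z = y")
      case False
      have "\<bar>z - y\<bar> \<le> v' - u'" using that w by auto
      then show ?thesis using \<delta>(2)[of z] False that w n by force
    qed (use y in simp)
    then show ?thesis using w x by blast
  qed
  define P where "P n w \<longleftrightarrow> (case w of (u, v, x) \<Rightarrow> Good u v \<and> 0 < x \<and> x < X / real (Suc n) \<and> (\<forall>y\<in>{u..v}. \<sigma> / 2 * x \<le> T x y))"
    for n :: nat and w :: "real \<times> real \<times> real"
  define Q where "Q n w w' \<longleftrightarrow> fst w \<le> fst w' \<and> fst (snd w') \<le> fst (snd w)"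
    for n :: nat and w w' :: "real \<times> real \<times> real"
  have "\<exists>f. \<forall>n. P n (f n) \<and> Q n (f n) (f (Suc n))"
  proof (rule dependent_nat_choice)
    obtain u v where "Good u v" using ex_good by blast
    then show "\<exists>w. P 0 w" using step[of u v X] X by (auto simp: P_def)
  next
    fix w n assume "P n w"
    moreover obtain u v x where w: "w = (u, v, x)" by (cases w) auto
    ultimately have "Good u v" by (simp add: P_def)
    from step[OF this, of "X / real (Suc (Suc n))"] X obtain u' v' x' where
      *: "Good u' v'" "u \<le> u'" "v' \<le> v" "0 < x'" "x' < X / real (Suc (Suc n))" "\<forall>y\<in>{u'..v'}. \<sigma> / 2 * x' \<le> T x' y"
      by auto
    then show "\<exists>w'. P (Suc n) w' \<and> Q n w w'"
      unfolding P_def Q_def w by (intro exI[of _ "(u', v', x')"]) auto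
  qed
  then obtain f where f: "\<And>n. P n (f n)" "\<And>n. Q n (f n) (f (Suc n))" by blast
  define u where "u n = fst (f n)" for n
  define v where "v n = fst (snd (f n))" for n
  define x where "x n = snd (snd (f n))" for n
  have w: "Good (u n) (v n)" "0 < x n" "x n < X / real (Suc n)" "\<And>y. y \<in> {u n..v n} \<Longrightarrow> \<sigma> / 2 * x n \<le> T (x n) y"
    "u n \<le> u (Suc n)" "v (Suc n) \<le> v n" for n
    using f(1)[of n] f(2)[of n] by (auto simp: P_def Q_def u_def v_def x_def split: prod.splits)
  \<comment> \<open>A common point of the nested intervals sees the slope sigma / 2 at all scales
    \<open>x n\<close>, against \<open>lim\<close>.\<close>
  have "\<Inter>(range (\<lambda>n. {u n..v n})) \<noteq> {}"
  proof (rule compact_nest)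
    show "{u n..v n} \<noteq> {}" for n using w(1)[of n] by (auto simp: Good_def)
    show "{u n..v n} \<subseteq> {u m..v m}" if "m \<le> n" for m n
    proof -
      have "u m \<le> u n" using lift_Suc_mono_le[of u] w(5) that by blast
      moreover have "v n \<le> v m" using lift_Suc_antimono_le[of v] w(6) that by blast
      ultimately show ?thesis by auto
    qed
  qed simp
  then obtain y where y: "\<And>n. y \<in> {u n..v n}" by blast
  have yI: "y \<in> {lo..hi}" using y[of 0] w(1)[of 0] by (auto simp: Good_def)
  have "(\<lambda>n. X / real (Suc n)) \<longlonglongrightarrow> 0"
    using tendsto_mult[OF tendsto_const[of X] LIMSEQ_inverse_real_of_nat] by (simp add: divide_inverse)
  then have x0: "x \<longlonglongrightarrow> 0"
    by (rule tendsto_sandwich[OF _ _ tendsto_const, rotated 2]) (use w in \<open>auto intro!: always_eventually less_imp_le\<close>)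
  moreover have "x n \<noteq> 0" for n using w(2)[of n] by simp
  ultimately have "filterlim x (at_right 0) sequentially"
    using w(2) by (auto simp: filterlim_at intro: always_eventually)
  then have "((\<lambda>n. T (x n) y / x n) \<longlonglongrightarrow> 0)"
    using filterlim_compose[OF lim[OF yI]] by blast
  then have "\<forall>\<^sub>F n in sequentially. T (x n) y / x n < \<sigma> / 2" using \<sigma> by (intro order_tendstoD) auto
  then obtain n where "T (x n) y / x n < \<sigma> / 2" using eventually_happens'[OF sequentially_bot] by blast
  moreover have "\<sigma> / 2 \<le> T (x n) y / x n" using w(4)[OF y, of n] w(2)[of n] by (simp add: le_divide_eq)
  ultimately show False by simp
qed

lemma interval_function_zero:
  fixes b T :: "real \<Rightarrow> real \<Rightarrow> real"
  assumes s: "1 < s" and C: "0 \<le> C" and K: "0 \<le> K" and X: "0 < X"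
    and add: "\<And>p q r. lo \<le> p \<Longrightarrow> p \<le> q \<Longrightarrow> q \<le> r \<Longrightarrow> r \<le> hi \<Longrightarrow> b p r = b p q + b q r"
    and sd: "\<And>m l. 0 < l \<Longrightarrow> l < 1 \<Longrightarrow> lo \<le> m - l \<Longrightarrow> m + l \<le> hi \<Longrightarrow> \<bar>b m (m + l) - b (m - l) m\<bar> \<le> C * l powr s"
    and cont: "\<And>x. x \<in> {0<..<X} \<Longrightarrow> continuous_on {lo..hi} (T x)"
    and main: "\<And>p q x. lo \<le> p \<Longrightarrow> p < q \<Longrightarrow> q \<le> hi \<Longrightarrow> x \<in> {0<..<X} \<Longrightarrow> \<bar>b p q * x - integral {p..q} (T x)\<bar> \<le> K * x\<^sup>2"
    and lim: "\<And>y. y \<in> {lo..hi} \<Longrightarrow> ((\<lambda>x. T x y / x) \<longlongrightarrow> 0) (at_right 0)"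
    and pq: "lo \<le> p" "p < q" "q \<le> hi"
  shows "b p q = 0"
proof (rule antisym)
  show "b p q \<le> 0"
    by (rule interval_function_nonpos[where s = s and C = C and K = K and X = X and T = T and lo = lo and hi = hi]) (fact assms)+
  have "- b p q \<le> 0"
  proof (rule interval_function_nonpos[where s = s and C = C and K = K and X = X and b = "\<lambda>p q. - b p q" and T = "\<lambda>x y. - T x y" and lo = lo and hi = hi])
    show "- b p r = - b p q + - b q r" if "lo \<le> p" "p \<le> q" "q \<le> r" "r \<le> hi" for p q r
      using add[OF that] by simp
    show "\<bar>- b m (m + l) - - b (m - l) m\<bar> \<le> C * l powr s" if "0 < l" "l < 1" "lo \<le> m - l" "m + l \<le> hi" for m l
      using sd[OF that] by (simp add: abs_minus_commute)
    show "continuous_on {lo..hi} (\<lambda>y. - T x y)" if "x \<in> {0<..<X}" for x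
      using cont[OF that] by (rule continuous_on_minus)
    show "\<bar>- b p q * x - integral {p..q} (\<lambda>y. - T x y)\<bar> \<le> K * x\<^sup>2" if "lo \<le> p" "p < q" "q \<le> hi" "x \<in> {0<..<X}" for p q x
      using main[OF that] by (simp add: integral_neg abs_minus_commute)
    show "((\<lambda>x. - T x y / x) \<longlongrightarrow> 0) (at_right 0)" if "y \<in> {lo..hi}" for y
      using tendsto_minus[OF lim[OF that]] by simp
  qed (fact s C K X pq)+
  then show "0 \<le> b p q" by simp
qed

section \<open>Integral representations on layers\<close>

lemma DERIV_imp_continuous_on:
  assumes "\<And>x. x \<in> S \<Longrightarrow> (f has_real_derivative f' x) (at x)"
  shows "continuous_on S f"
  using assms by (meson DERIV_isCont continuous_at_imp_continuous_on)

lemma RL_1_tendsto_0: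
  assumes X: "0 < X" and i: "set_integrable lborel {0<..<X} f"
  shows "(RL 1 f \<longlongrightarrow> 0) (at_right 0)"
proof -
  have int: "f integrable_on {0..X}"
    using set_borel_integral_eq_integral(1)[OF i] by (simp add: integrable_on_Icc_iff_Ioo)
  have eq: "RL 1 f z = integral {0..z} f" if "z \<in> {0<..<X}" for z
  proof -
    have "set_integrable lborel {0<..<z} f" by (rule set_integrable_subset[OF i]) (use that in auto)
    from set_borel_integral_eq_integral(2)[OF this] show ?thesis
      by (simp add: RL_1 integral_open_interval_real)
  qed
  have "continuous_on {0..X} (\<lambda>x. integral {0..x} f)"
    by (rule indefinite_integral_continuous_1[OF int])
  moreover have "0 \<in> {0..X}" using X by simp
  ultimately have "((\<lambda>x. integral {0..x} f) \<longlongrightarrow> integral {0..0} f) (at 0 within {0..X})"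
    unfolding continuous_on_def by (rule bspec)
  then have "((\<lambda>x. integral {0..x} f) \<longlongrightarrow> 0) (at_right 0)"
    using X by (simp add: at_within_Icc_at_right)
  moreover have "\<forall>\<^sub>F x in at_right 0. integral {0..x} f = RL 1 f x"
    using eventually_at_right_real[OF X] by eventually_elim (use eq in auto)
  ultimately show ?thesis by (rule Lim_transform_eventually)
qed

lemma set_borel_measurable_RL_1:
  assumes "\<And>x. x \<in> {0<..<X} \<Longrightarrow> set_integrable lborel {0<..<x} f" "continuous_on {0<..<X} f" "x \<le> X"
  shows "set_borel_measurable lborel {0<..<x} (RL 1 f)"
proof -
  have "continuous_on {0<..<X} (RL 1 f)"
    by (rule DERIV_imp_continuous_on) (rule RL_1_has_derivative[OF assms(1,2)])
  then have "continuous_on {0<..<x} (RL 1 f)" by (rule continuous_on_subset) (use assms in auto)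
  then show ?thesis unfolding set_borel_measurable_def
    using borel_measurable_continuous_on_indicator[of "{0<..<x}" "RL 1 f"] by simp
qed

lemma RL_1_integrable:
  assumes "0 < x" "set_integrable lborel {0<..<x} f"
  shows "set_integrable lborel {0<..<x} (RL 1 f)"
proof -
  have "set_integrable lborel {0<..<x} (\<lambda>s. (x - s) powr (1 - 1) * RL 1 f s)"
    by (rule RL_semigroup(2)) (use assms in auto)
  also have "?this \<longleftrightarrow> ?thesis" by (rule set_integrable_cong) auto
  finally show ?thesis .
qed

lemma RL_1_bounded:
  assumes "0 < x" "set_borel_measurable lborel {0<..<x} f" "\<And>s. s \<in> {0<..<x} \<Longrightarrow> \<bar>f s\<bar> \<le> M"
  shows "\<bar>RL 1 f x\<bar> \<le> M * x" "set_integrable lborel {0<..<x} f"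
proof -
  have "Gamma (2 :: real) = 1" using Gamma_fact[of 1, where 'a = real] by simp
  then show "\<bar>RL 1 f x\<bar> \<le> M * x" using RL_bounded(2)[of 1 x f M] assms by simp
  have "set_integrable lborel {0<..<x} (\<lambda>s. (x - s) powr (1 - 1) * f s)"
    using RL_bounded(1)[of 1 x f M] assms by simp
  also have "?this \<longleftrightarrow> set_integrable lborel {0<..<x} f" by (rule set_integrable_cong) auto
  finally show "set_integrable lborel {0<..<x} f" .
qed

text \<open>Taylor's formula at a base point x0 > 0. The remainder only involves [x0, x], where
  \<open>f\<close> is continuous; whatever is singular at 0 is stored in the two values at
  x0.\<close>

lemma RL_11_taylor:
  assumes i: "\<And>x. x \<in> {0<..<X} \<Longrightarrow> set_integrable lborel {0<..<x} f" and c: "continuous_on {0<..<X} f"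
    and x: "0 < x0" "x0 \<le> x" "x < X"
  shows "RL 1 (RL 1 f) x = RL 1 (RL 1 f) x0 + (x - x0) * RL 1 f x0 + integral {x0..x} (\<lambda>s. (x - s) * f s)"
proof -
  have d1: "(RL 1 f has_real_derivative f s) (at s)" if "s \<in> {0<..<X}" for s
    using RL_1_has_derivative[OF i c that] .
  have c1: "continuous_on {0<..<X} (RL 1 f)"
    by (rule DERIV_imp_continuous_on) (rule d1)
  have d2: "(RL 1 (RL 1 f) has_real_derivative RL 1 f s) (at s)" if "s \<in> {0<..<X}" for s
  proof (rule RL_1_has_derivative[OF _ c1 that])
    show "set_integrable lborel {0<..<z} (RL 1 f)" if "z \<in> {0<..<X}" for z
      using that by (intro RL_1_integrable i) auto
  qed
  have "((\<lambda>s. (x - s) * f s) has_integral (((x - x) * RL 1 f x + RL 1 (RL 1 f) x) - ((x - x0) * RL 1 f x0 + RL 1 (RL 1 f) x0))) {x0..x}"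
  proof (rule fundamental_theorem_of_calculus[OF x(2)])
    fix s assume s: "s \<in> {x0..x}"
    then have s': "s \<in> {0<..<X}" using x by auto
    have "((\<lambda>s. (x - s) * RL 1 f s + RL 1 (RL 1 f) s) has_real_derivative ((0 - 1) * RL 1 f s + f s * (x - s) + RL 1 f s)) (at s)"
      by (intro DERIV_add DERIV_mult DERIV_diff DERIV_const DERIV_ident d1 d2 s')
    then have "((\<lambda>s. (x - s) * RL 1 f s + RL 1 (RL 1 f) s) has_real_derivative ((x - s) * f s)) (at s)"
      by (simp add: mult.commute)
    then show "((\<lambda>s. (x - s) * RL 1 f s + RL 1 (RL 1 f) s) has_vector_derivative ((x - s) * f s)) (at s within {x0..x})"
      by (simp add: has_real_derivative_iff_has_vector_derivative [symmetric] has_field_derivative_at_within)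
  qed
  from integral_unique[OF this] show ?thesis by simp
qed

text \<open>\<open>RL 1 f\<close> tends to 0, and so does its mean over (0, x).\<close>

lemma RL_11_small:
  assumes i: "\<And>x. x \<in> {0<..<X} \<Longrightarrow> set_integrable lborel {0<..<x} f" and c: "continuous_on {0<..<X} f" and X: "0 < X"
  shows "((\<lambda>x. RL 1 (RL 1 f) x / x) \<longlongrightarrow> 0) (at_right 0)"
proof (rule tendstoI)
  fix e :: real assume e: "0 < e"
  have "(RL 1 f \<longlongrightarrow> 0) (at_right 0)" using RL_1_tendsto_0[of "X/2" f] i[of "X/2"] X by simp
  from tendstoD[OF this, of "e/2"] e have "\<forall>\<^sub>F s in at_right 0. \<bar>RL 1 f s\<bar> < e/2" by simp
  then obtain d where d: "0 < d" "\<And>s. 0 < s \<Longrightarrow> s < d \<Longrightarrow> \<bar>RL 1 f s\<bar> < e/2"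
    unfolding eventually_at_right_field by auto
  have "\<forall>\<^sub>F x in at_right 0. x \<in> {0<..<min d X}" using d X by (intro eventually_at_right_real) auto
  then show "\<forall>\<^sub>F x in at_right 0. dist (RL 1 (RL 1 f) x / x) 0 < e"
  proof eventually_elim
    case (elim x)
    have "\<bar>RL 1 (RL 1 f) x\<bar> \<le> e/2 * x"
    proof (rule RL_1_bounded(1))
      show "set_borel_measurable lborel {0<..<x} (RL 1 f)"
        by (rule set_borel_measurable_RL_1[OF i c]) (use elim in auto)
      show "\<bar>RL 1 f s\<bar> \<le> e/2" if "s \<in> {0<..<x}" for s using d(2)[of s] that elim by force
    qed (use elim in simp)
    also have "\<dots> < e * x" using e elim by simp
    finally show ?case using elim by (simp add: divide_less_eq)
  qed
qed

lemma continuous_RL_11_bounds: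
  assumes c: "continuous_on {0..1} f" and B: "\<And>s. s \<in> {0..1} \<Longrightarrow> \<bar>f s\<bar> \<le> B" and x: "x \<in> {0<..1}"
  shows "set_integrable lborel {0<..<x} f" "set_integrable lborel {0<..<x} (RL 1 f)" "\<bar>RL 1 (RL 1 f) x\<bar> \<le> B * x\<^sup>2"
proof -
  have mf: "set_borel_measurable lborel {0<..<z} f" if "z \<le> 1" for z
  proof -
    have "continuous_on {0<..<z} f" using c by (rule continuous_on_subset) (use that in auto)
    then show ?thesis unfolding set_borel_measurable_def
      using borel_measurable_continuous_on_indicator[of "{0<..<z}" f] by simp
  qed
  have B0: "0 \<le> B" using B[of 0] by simp
  have i: "set_integrable lborel {0<..<z} f" "\<bar>RL 1 f z\<bar> \<le> B * z" if "z \<in> {0<..1}" for z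
    using that RL_1_bounded[OF _ mf, of z B] B by auto
  show "set_integrable lborel {0<..<x} f" using i x by auto
  then show "set_integrable lborel {0<..<x} (RL 1 f)" using x by (intro RL_1_integrable) auto
  have "\<bar>RL 1 (RL 1 f) x\<bar> \<le> (B * x) * x"
  proof (rule RL_1_bounded(1))
    show "set_borel_measurable lborel {0<..<x} (RL 1 f)"
      by (rule set_borel_measurable_RL_1[where X = 1])
        (use i x c in \<open>auto intro: continuous_on_subset\<close>)
    show "\<bar>RL 1 f s\<bar> \<le> B * x" if "s \<in> {0<..<x}" for s
    proof -
      have "\<bar>RL 1 f s\<bar> \<le> B * s" using that x i(2)[of s] by auto
      also have "\<dots> \<le> B * x" using that B0 by (intro mult_left_mono) auto
      finally show ?thesis .
    qed
  qed (use x in auto)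
  then show "\<bar>RL 1 (RL 1 f) x\<bar> \<le> B * x\<^sup>2" by (simp add: power2_eq_square)
qed

lemma RL_11_diff:
  assumes "continuous_on {0..1} f" "continuous_on {0..1} g" "x \<in> {0<..1}"
  shows "RL 1 (RL 1 (\<lambda>s. f s - g s)) x = RL 1 (RL 1 f) x - RL 1 (RL 1 g) x"
proof -
  have bd: "\<exists>B. \<forall>s\<in>{0..1}. \<bar>h s\<bar> \<le> B" if "continuous_on {0..1} h" for h :: "real \<Rightarrow> real"
    using compact_imp_bounded[OF compact_continuous_image[OF that]] by (auto simp: bounded_iff)
  obtain B where B: "\<And>s. s \<in> {0..1} \<Longrightarrow> \<bar>f s\<bar> \<le> B" using bd[OF assms(1)] by blast
  obtain B' where B': "\<And>s. s \<in> {0..1} \<Longrightarrow> \<bar>g s\<bar> \<le> B'" using bd[OF assms(2)] by blast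
  have "RL 1 (RL 1 (\<lambda>s. f s - g s)) x = RL 1 (\<lambda>s. RL 1 f s - RL 1 g s) x"
  proof (rule RL_cong)
    fix s assume "s \<in> {0<..<x}"
    then have s: "s \<in> {0<..1}" using assms(3) by auto
    show "RL 1 (\<lambda>s. f s - g s) s = RL 1 f s - RL 1 g s"
      unfolding RL_1 by (intro set_integral_diff continuous_RL_11_bounds(1)[OF assms(1) B s] continuous_RL_11_bounds(1)[OF assms(2) B' s])
  qed
  also have "\<dots> = RL 1 (RL 1 f) x - RL 1 (RL 1 g) x"
    unfolding RL_1[of "\<lambda>s. RL 1 f s - RL 1 g s"] RL_1[of "RL 1 f"] RL_1[of "RL 1 g"]
    by (intro set_integral_diff continuous_RL_11_bounds(2)[OF assms(1) B assms(3)] continuous_RL_11_bounds(2)[OF assms(2) B' assms(3)])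
  finally show ?thesis .
qed

text \<open>Strict convexity at equally spaced points. The second difference annihilates affine
  functions of x but not x^r, which isolates the coefficient \<open>g0\<close> in
  \<open>layer_identity\<close>.\<close>

lemma powr_second_difference_pos:
  fixes r :: real assumes r: "1 < r"
  shows "0 < (3/4) powr r - 2 * (1/2) powr r + (1/4) powr r"
proof -
  have d: "((\<lambda>x. x powr r) has_real_derivative r * x powr (r - 1)) (at x)" if "0 < x" for x
    using that by (rule has_real_derivative_powr)
  obtain u where u: "1/4 < u" "u < 1/2" "(1/2) powr r - (1/4) powr r = (1/2 - 1/4) * (r * u powr (r - 1))"
    using MVT2[of "1/4" "1/2" "\<lambda>x. x powr r" "\<lambda>x. r * x powr (r - 1)"] d by auto
  obtain v where v: "1/2 < v" "v < 3/4" "(3/4) powr r - (1/2) powr r = (3/4 - 1/2) * (r * v powr (r - 1))"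
    using MVT2[of "1/2" "3/4" "\<lambda>x. x powr r" "\<lambda>x. r * x powr (r - 1)"] d by auto
  have "u powr (r - 1) < v powr (r - 1)" using u v r by (intro powr_less_mono2) auto
  then have "r * u powr (r - 1) < r * v powr (r - 1)" using r by simp
  then show ?thesis using u(3) v(3) by simp
qed

text \<open>On [x0, x] the order of integration can be exchanged. As \<open>h\<close> is the
  y-derivative of \<open>N\<close>, the integral of T over y and the twice integrated increment of
  \<open>N\<close> have the same remainder in Taylor's formula, so their difference is affine in
  x.\<close>

lemma layer_affine:
  fixes h N T :: "real \<Rightarrow> real \<Rightarrow> real" and J :: "real \<Rightarrow> real"
  assumes pq: "p \<le> q" and x: "0 < x0" "x0 \<le> x" "x < 1"
    and hc: "continuous_on ({x0..x} \<times> {p..q}) (\<lambda>(s, y). h s y)"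
    and Nh: "\<And>s y. s \<in> {x0..x} \<Longrightarrow> y \<in> {p..q} \<Longrightarrow> (N s has_real_derivative h s y) (at y within {p..q})"
    and Tc: "continuous_on {p..q} (T x0)" and Jc: "continuous_on {p..q} J"
    and taylor: "\<And>y. y \<in> {p..q} \<Longrightarrow> T x y = T x0 y + (x - x0) * J y + integral {x0..x} (\<lambda>s. (x - s) * h s y)"
    and \<delta>c: "continuous_on {0..1} (\<lambda>s. N s q - N s p)"
    and \<delta>i: "\<And>z. z \<in> {0<..<1} \<Longrightarrow> set_integrable lborel {0<..<z} (\<lambda>s. N s q - N s p)"
  shows "integral {p..q} (T x) - RL 1 (RL 1 (\<lambda>s. N s q - N s p)) x =
    (integral {p..q} (T x0) - RL 1 (RL 1 (\<lambda>s. N s q - N s p)) x0)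
      + (x - x0) * (integral {p..q} J - RL 1 (\<lambda>s. N s q - N s p) x0)"
proof -
  define \<delta>N where "\<delta>N s = N s q - N s p" for s
  define A where "A y = integral {x0..x} (\<lambda>s. (x - s) * h s y)" for y
  have hA: "continuous_on ({p..q} \<times> {x0..x}) (\<lambda>(y, s). (x - s) * h s y)"
  proof -
    have "continuous_on ({p..q} \<times> {x0..x}) (\<lambda>p. (\<lambda>(s, y). h s y) (snd p, fst p))"
      by (rule continuous_on_compose2[OF hc]) (auto intro!: continuous_intros)
    then show ?thesis by (auto simp: case_prod_unfold intro!: continuous_intros)
  qed
  have Ac: "continuous_on {p..q} A"
    unfolding A_def [abs_def] using integral_continuous_on_param[OF hA[unfolded cbox_interval [symmetric]]]
    by (simp add: cbox_interval)
  have "integral {p..q} (T x) = integral {p..q} (\<lambda>y. T x0 y + (x - x0) * J y + A y)"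
    using taylor by (intro integral_cong) (simp add: A_def)
  also have "\<dots> = integral {p..q} (T x0) + (x - x0) * integral {p..q} J + integral {p..q} A"
    using Tc Jc Ac by (simp add: integral_add integrable_continuous_real integrable_add continuous_intros)
  also have "integral {p..q} A = integral {x0..x} (\<lambda>s. integral {p..q} (\<lambda>y. (x - s) * h s y))"
  proof -
    have "continuous_on (cbox (p, x0) (q, x)) (\<lambda>(y, s). (x - s) * h s y)"
      using hA by (simp add: cbox_Pair_eq)
    from integral_swap_continuous[OF this] show ?thesis by (simp add: A_def [abs_def] cbox_interval)
  qed
  also have "\<dots> = integral {x0..x} (\<lambda>s. (x - s) * \<delta>N s)"
  proof (rule integral_cong)
    fix s assume s: "s \<in> {x0..x}"
    have "(h s has_integral N s q - N s p) {p..q}"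
      using Nh[OF s] by (intro fundamental_theorem_of_calculus pq)
        (simp add: has_real_derivative_iff_has_vector_derivative)
    then have "((\<lambda>y. (x - s) * h s y) has_integral (x - s) * \<delta>N s) {p..q}"
      unfolding \<delta>N_def by (rule has_integral_mult_right)
    then show "integral {p..q} (\<lambda>y. (x - s) * h s y) = (x - s) * \<delta>N s" by (rule integral_unique)
  qed
  finally have IT: "integral {p..q} (T x) = integral {p..q} (T x0) + (x - x0) * integral {p..q} J + integral {x0..x} (\<lambda>s. (x - s) * \<delta>N s)" .
  have "RL 1 (RL 1 \<delta>N) x = RL 1 (RL 1 \<delta>N) x0 + (x - x0) * RL 1 \<delta>N x0 + integral {x0..x} (\<lambda>s. (x - s) * \<delta>N s)"
    by (rule RL_11_taylor[where X = 1]) (use \<delta>i x \<delta>c in \<open>auto intro: continuous_on_subset simp: \<delta>N_def [abs_def]\<close>)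
  then show ?thesis using IT unfolding \<delta>N_def [abs_def] by (simp add: algebra_simps)
qed

text \<open>The formal computation integrates the representation of \<open>R\<close> in \<open>y\<close>. No bound on \<open>h\<close>
  near \<open>x = 0\<close> is available that is uniform in \<open>y\<close>, so the interchange is only known up to a term
  \<open>b p q * x\<close>; scaling \<open>x\<close> with the length of the interval shows that \<open>b\<close> has small second
  differences, hence vanishes.\<close>

lemma layer_identity:
  fixes h N R :: "real \<Rightarrow> real \<Rightarrow> real" and g0 :: "real \<Rightarrow> real"
  assumes \<alpha>: "0 < \<alpha>" "\<alpha> < 1"
    and hc: "continuous_on ({0<..<1} \<times> {lo..hi}) (\<lambda>(s, y). h s y)"
    and Nc: "continuous_on ({0..1} \<times> {lo..hi}) (\<lambda>(s, y). N s y)"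
    and Nh: "\<And>s y. s \<in> {0<..<1} \<Longrightarrow> y \<in> {lo..hi} \<Longrightarrow> (N s has_real_derivative h s y) (at y within {lo..hi})"
    and hi: "\<And>x y. x \<in> {0<..<1} \<Longrightarrow> y \<in> {lo..hi} \<Longrightarrow> set_integrable lborel {0<..<x} (\<lambda>s. h s y)"
    and R: "\<And>x y. x \<in> {0<..<1} \<Longrightarrow> y \<in> {lo..hi} \<Longrightarrow> R x y = g0 y * x powr (2 - \<alpha>) + RL 1 (RL 1 (\<lambda>s. h s y)) x"
    and M: "\<And>x y. x \<in> {0<..<1} \<Longrightarrow> y \<in> {lo..hi} \<Longrightarrow> \<bar>R x y\<bar> \<le> M * x powr (2 - 2 * \<alpha>)"
    and L: "\<And>x y z. x \<in> {0<..<1} \<Longrightarrow> y \<in> {lo..hi} \<Longrightarrow> z \<in> {lo..hi} \<Longrightarrow> \<bar>R x y - R x z\<bar> \<le> L * \<bar>y - z\<bar> * x powr (2 - 2 * \<alpha>)"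
    and L0: "0 \<le> L" and lohi: "lo < hi"
  shows "continuous_on {lo..hi} g0"
    and "\<And>x. x \<in> {0<..<1} \<Longrightarrow> integral {lo..hi} (\<lambda>y. R x y - g0 y * x powr (2 - \<alpha>)) = RL 1 (RL 1 (\<lambda>s. N s hi - N s lo)) x"
proof -
  define T where "T x y = RL 1 (RL 1 (\<lambda>s. h s y)) x" for x y
  define A where "A x0 x y = integral {x0..x} (\<lambda>s. (x - s) * h s y)" for x0 x y
  have hcs: "continuous_on {0<..<1} (\<lambda>s. h s y)" if "y \<in> {lo..hi}" for y
    using that by (intro continuous_on_compose2[OF hc, of _ "\<lambda>s. (s, y)", simplified]) (auto intro!: continuous_intros)
  have taylor: "T x y = T x0 y + (x - x0) * RL 1 (\<lambda>s. h s y) x0 + A x0 x y"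
    if "y \<in> {lo..hi}" "0 < x0" "x0 \<le> x" "x < 1" for x x0 y
    unfolding T_def A_def by (rule RL_11_taylor[where X = 1]) (use that hi hcs in auto)
  have hA: "continuous_on ({lo..hi} \<times> {x0..x}) (\<lambda>(y, s). (x - s) * h s y)" if "0 < x0" "x < 1" for x0 x
  proof -
    have "continuous_on ({lo..hi} \<times> {x0..x}) (\<lambda>p. (\<lambda>(s, y). h s y) (snd p, fst p))"
      by (rule continuous_on_compose2[OF hc]) (use that in \<open>auto intro!: continuous_intros\<close>)
    then show ?thesis by (auto simp: case_prod_unfold intro!: continuous_intros)
  qed
  have Ac: "continuous_on {lo..hi} (A x0 x)" if "0 < x0" "x < 1" for x0 x
    unfolding A_def [abs_def] using integral_continuous_on_param[OF hA[OF that, unfolded cbox_interval [symmetric]]]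
    by (simp add: cbox_interval)
  have Rc: "continuous_on {lo..hi} (R x)" if x: "x \<in> {0<..<1}" for x
  proof (rule lipschitz_on_continuous_on, rule lipschitz_onI)
    fix y z assume "y \<in> {lo..hi}" "z \<in> {lo..hi}"
    then show "dist (R x y) (R x z) \<le> (L * x powr (2 - 2 * \<alpha>)) * dist y z"
      using L[OF x, of y z] by (simp add: mult_ac dist_real_def)
  qed (use L0 in simp)
  show g0c: "continuous_on {lo..hi} g0"
  proof -
    \<comment> \<open>The second difference of Taylor's formula at 1/4, 1/2, 3/4 eliminates
      \<open>T (1/4)\<close> and the slope, and expresses \<open>g0\<close> through functions known
      to be continuous in y.\<close>
    define c where "c = (3/4) powr (2 - \<alpha>) - 2 * (1/2) powr (2 - \<alpha>) + (1/4) powr (2 - \<alpha>)"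
    have c: "0 < c" using powr_second_difference_pos[of "2 - \<alpha>"] \<alpha> by (simp add: c_def)
    have "g0 y = (R (3/4) y - 2 * R (1/2) y + R (1/4) y - (A (1/4) (3/4) y - 2 * A (1/4) (1/2) y)) / c"
      if y: "y \<in> {lo..hi}" for y
    proof -
      have "T (3/4) y - 2 * T (1/2) y + T (1/4) y = A (1/4) (3/4) y - 2 * A (1/4) (1/2) y"
        using taylor[OF y, of "1/4" "1/2"] taylor[OF y, of "1/4" "3/4"] by simp
      moreover have "R x y = g0 y * x powr (2 - \<alpha>) + T x y" if "x \<in> {0<..<1}" for x
        using R[OF that y] by (simp add: T_def)
      ultimately have "R (3/4) y - 2 * R (1/2) y + R (1/4) y = g0 y * c + (A (1/4) (3/4) y - 2 * A (1/4) (1/2) y)"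
        by (simp add: c_def algebra_simps)
      then show ?thesis using c by simp
    qed
    moreover have "continuous_on {lo..hi} (\<lambda>y. (R (3/4) y - 2 * R (1/2) y + R (1/4) y - (A (1/4) (3/4) y - 2 * A (1/4) (1/2) y)) / c)"
      using c by (intro continuous_intros Rc Ac) auto
    ultimately show ?thesis by (subst continuous_on_cong[OF refl]) auto
  qed
  have TR: "T x y = R x y - g0 y * x powr (2 - \<alpha>)" if "x \<in> {0<..<1}" "y \<in> {lo..hi}" for x y
    using R[OF that] by (simp add: T_def)
  have Tc: "continuous_on {lo..hi} (T x)" if "x \<in> {0<..<1}" for x
  proof -
    have "continuous_on {lo..hi} (\<lambda>y. R x y - g0 y * x powr (2 - \<alpha>))"
      by (intro continuous_intros Rc g0c that)
    then show ?thesis by (subst continuous_on_cong[OF refl TR[OF that]]) auto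
  qed
  have "bounded (g0 ` {lo..hi})" by (intro compact_imp_bounded compact_continuous_image g0c compact_Icc)
  then obtain G where "\<forall>z\<in>g0 ` {lo..hi}. norm z \<le> G" unfolding bounded_iff by blast
  then have G: "\<And>y. y \<in> {lo..hi} \<Longrightarrow> \<bar>g0 y\<bar> \<le> G" by auto
  have G0: "0 \<le> G" using G[of lo] lohi by auto
  have M0: "0 \<le> M"
  proof -
    have "0 \<le> M * (1/2) powr (2 - 2 * \<alpha>)" using M[of "1/2" lo] lohi by auto
    then show ?thesis by (simp add: zero_le_mult_iff)
  qed
  have "bounded ((\<lambda>(s, y). N s y) ` ({0..1} \<times> {lo..hi}))"
    by (intro compact_imp_bounded compact_continuous_image Nc compact_Times compact_Icc)
  then obtain B where "\<forall>z\<in>(\<lambda>(s, y). N s y) ` ({0..1} \<times> {lo..hi}). norm z \<le> B" unfolding bounded_iff by blast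
  then have B: "\<And>s y. s \<in> {0..1} \<Longrightarrow> y \<in> {lo..hi} \<Longrightarrow> \<bar>N s y\<bar> \<le> B" by fastforce
  have B0: "0 \<le> B" using B[of 0 lo] lohi by auto
  have Ncs: "continuous_on {0..1} (\<lambda>s. N s y)" if "y \<in> {lo..hi}" for y
    using that by (intro continuous_on_compose2[OF Nc, of _ "\<lambda>s. (s, y)", simplified]) (auto intro!: continuous_intros)
  define n where "n x y = RL 1 (RL 1 (\<lambda>s. N s y)) x" for x y
  have nd: "RL 1 (RL 1 (\<lambda>s. N s q - N s p)) x = n x q - n x p" if "p \<in> {lo..hi}" "q \<in> {lo..hi}" "x \<in> {0<..1}" for p q x
    unfolding n_def by (rule RL_11_diff) (use that Ncs in auto)
  have nb: "\<bar>n x q - n x p\<bar> \<le> (2 * B) * x\<^sup>2" if "p \<in> {lo..hi}" "q \<in> {lo..hi}" "x \<in> {0<..1}" for p q x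
    unfolding nd[OF that, symmetric]
  proof (rule continuous_RL_11_bounds(3))
    show "continuous_on {0..1} (\<lambda>s. N s q - N s p)" by (intro continuous_intros Ncs that)
    show "\<bar>N s q - N s p\<bar> \<le> 2 * B" if "s \<in> {0..1}" for s
      using B[OF that \<open>p \<in> _\<close>] B[OF that \<open>q \<in> _\<close>] by linarith
  qed (rule that)
  \<comment> \<open>The defect of the interchange of integrals: affine on every [x0, 1) and tending
    to 0 at 0, hence equal to \<open>b p q * x\<close>.\<close>
  define \<Delta> where "\<Delta> p q x = integral {p..q} (T x) - (n x q - n x p)" for p q x
  define b where "b p q = 2 * \<Delta> p q (1/2)" for p q
  have \<Delta>aff: "\<exists>c. \<forall>x. x0 \<le> x \<and> x < 1 \<longrightarrow> \<Delta> p q x = \<Delta> p q x0 + (x - x0) * c"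
    if pq: "lo \<le> p" "p \<le> q" "q \<le> hi" and x0: "0 < x0" "x0 < 1" for p q x0
  proof -
    have pq': "p \<in> {lo..hi}" "q \<in> {lo..hi}" using pq by auto
    define J where "J y = RL 1 (\<lambda>s. h s y) x0" for y
    define x1 where "x1 = (x0 + 1) / 2"
    have x1: "x0 < x1" "x1 < 1" using x0 by (auto simp: x1_def)
    \<comment> \<open>\<open>J\<close> is an integral from 0, where no bound on \<open>h\<close> is
      uniform in y. Solving Taylor's formula at a second point x1 for it shows its
      continuity.\<close>
    have Jeq: "J y = (T x1 y - T x0 y - A x0 x1 y) / (x1 - x0)" if "y \<in> {lo..hi}" for y
      using taylor[OF that x0(1), of x1] x1 by (simp add: J_def)
    have "continuous_on {lo..hi} (\<lambda>y. (T x1 y - T x0 y - A x0 x1 y) / (x1 - x0))"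
      using x0 x1 by (intro continuous_intros Tc Ac) auto
    then have Jc: "continuous_on {lo..hi} J" by (subst continuous_on_cong[OF refl Jeq]) auto
    define \<delta>N where "\<delta>N s = N s q - N s p" for s
    have \<delta>Nc: "continuous_on {0..1} \<delta>N" unfolding \<delta>N_def by (intro continuous_intros Ncs pq')
    have \<delta>Ni: "set_integrable lborel {0<..<x} \<delta>N" if "x \<in> {0<..<1}" for x
    proof (rule continuous_RL_11_bounds(1)[OF \<delta>Nc])
      show "\<bar>\<delta>N s\<bar> \<le> 2 * B" if "s \<in> {0..1}" for s
        using B[OF that pq'(1)] B[OF that pq'(2)] unfolding \<delta>N_def by linarith
    qed (use that in auto)
    have aff: "\<Delta> p q x = \<Delta> p q x0 + (x - x0) * (integral {p..q} J - RL 1 \<delta>N x0)" if x: "x0 \<le> x" "x < 1" for x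
    proof -
      have sub: "{p..q} \<subseteq> {lo..hi}" using pq by auto
      have xI: "x \<in> {0<..<1}" "x0 \<in> {0<..<1}" using x x0 by auto
      have "integral {p..q} (T x) - RL 1 (RL 1 \<delta>N) x =
          (integral {p..q} (T x0) - RL 1 (RL 1 \<delta>N) x0) + (x - x0) * (integral {p..q} J - RL 1 \<delta>N x0)"
        unfolding \<delta>N_def
      proof (rule layer_affine[where h = h])
        show "continuous_on ({x0..x} \<times> {p..q}) (\<lambda>(s, y). h s y)"
          using hc by (rule continuous_on_subset) (use sub x x0 in auto)
        show "continuous_on {p..q} (T x0)" "continuous_on {p..q} J"
          using Tc[OF xI(2)] Jc sub by (auto intro: continuous_on_subset)
        fix y assume "y \<in> {p..q}"
        then have y: "y \<in> {lo..hi}" using sub by blast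
        from taylor[OF y x0(1) x] show "T x y = T x0 y + (x - x0) * J y + integral {x0..x} (\<lambda>s. (x - s) * h s y)"
          by (simp only: J_def A_def)
        fix s assume "s \<in> {x0..x}"
        then have "s \<in> {0<..<1}" using x x0 by auto
        from DERIV_subset[OF Nh[OF this y] sub]
        show "(N s has_real_derivative h s y) (at y within {p..q})" .
      qed (use x x0 pq \<delta>Nc \<delta>Ni in \<open>auto simp: \<delta>N_def [symmetric]\<close>)
      moreover have "RL 1 (RL 1 \<delta>N) z = n z q - n z p" if "z \<in> {0<..<1}" for z
        unfolding \<delta>N_def by (rule nd[OF pq']) (use that in auto)
      note this[OF xI(1)] this[OF xI(2)]
      ultimately show ?thesis unfolding \<Delta>_def by simp
    qed
    then show ?thesis by blast
  qed
  have IT: "\<bar>integral {p..q} (T x)\<bar> \<le> (q - p) * (M * x powr (2 - 2 * \<alpha>) + G * x powr (2 - \<alpha>))"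
    if pq: "lo \<le> p" "p \<le> q" "q \<le> hi" and x: "x \<in> {0<..<1}" for p q x
  proof -
    have "norm (integral {p..q} (T x)) \<le> (M * x powr (2 - 2 * \<alpha>) + G * x powr (2 - \<alpha>)) * (q - p)"
    proof (rule integral_bound[OF pq(2)])
      show "continuous_on {p..q} (T x)" using Tc[OF x] by (rule continuous_on_subset) (use pq in auto)
      fix y assume "y \<in> {p..q}"
      then have y: "y \<in> {lo..hi}" using pq by auto
      have "\<bar>g0 y * x powr (2 - \<alpha>)\<bar> \<le> G * x powr (2 - \<alpha>)"
        using G[OF y] by (simp add: abs_mult mult_right_mono)
      then show "norm (T x y) \<le> M * x powr (2 - 2 * \<alpha>) + G * x powr (2 - \<alpha>)"
        using M[OF x y] unfolding TR[OF x y] by simp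
    qed
    then show ?thesis by (simp add: mult.commute)
  qed
  have \<Delta>0: "((\<Delta> p q) \<longlongrightarrow> 0) (at_right 0)" if pq: "lo \<le> p" "p \<le> q" "q \<le> hi" for p q
  proof (rule Lim_null_comparison)
    have pq': "p \<in> {lo..hi}" "q \<in> {lo..hi}" using pq by auto
    have "\<forall>\<^sub>F x in at_right 0. x \<in> {0<..<1::real}" by (rule eventually_at_right_real) simp
    then show "\<forall>\<^sub>F x in at_right 0. norm (\<Delta> p q x) \<le> (q - p) * (M * x powr (2 - 2 * \<alpha>) + G * x powr (2 - \<alpha>)) + 2 * B * x\<^sup>2"
    proof eventually_elim
      case (elim x)
      show ?case using IT[OF pq elim] nb[OF pq', of x] elim unfolding \<Delta>_def by simp
    qed
    have "((\<lambda>x. x powr r) \<longlongrightarrow> 0) (at_right 0)" if "0 < r" for r :: real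
    proof -
      have "((\<lambda>x::real. x powr r) \<longlongrightarrow> 0 powr r) (at_right 0)"
        using that eventually_mono[OF eventually_at_right_less[of "0::real"], of "\<lambda>x. 0 \<le> x"]
        by (intro tendsto_powr' tendsto_ident_at tendsto_const) auto
      then show ?thesis by simp
    qed
    note pw = this
    have "((\<lambda>x. (q - p) * (M * x powr (2 - 2 * \<alpha>) + G * x powr (2 - \<alpha>)) + 2 * B * x\<^sup>2) \<longlongrightarrow> (q - p) * (M * 0 + G * 0) + 2 * B * 0\<^sup>2) (at_right 0)"
      using \<alpha> by (intro tendsto_intros pw) auto
    then show "((\<lambda>x. (q - p) * (M * x powr (2 - 2 * \<alpha>) + G * x powr (2 - \<alpha>)) + 2 * B * x\<^sup>2) \<longlongrightarrow> 0) (at_right 0)" by simp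
  qed
  \<comment> \<open>The three-point identity expresses affine dependence without naming a slope, so
    x0 can tend to 0.\<close>
  have three: "x2 * \<Delta> p q x1 = x1 * \<Delta> p q x2" if pq: "lo \<le> p" "p \<le> q" "q \<le> hi" and x: "0 < x1" "x1 \<le> x2" "x2 < 1" for p q x1 x2
  proof -
    have "\<forall>\<^sub>F x0 in at_right 0. x0 \<in> {0<..<x1}" by (rule eventually_at_right_real) (use x in auto)
    then have ev: "\<forall>\<^sub>F x0 in at_right 0. (x2 - x1) * \<Delta> p q x0 + (x1 - x0) * \<Delta> p q x2 = (x2 - x0) * \<Delta> p q x1"
    proof eventually_elim
      case (elim x0)
      then obtain c where c: "\<And>x. x0 \<le> x \<Longrightarrow> x < 1 \<Longrightarrow> \<Delta> p q x = \<Delta> p q x0 + (x - x0) * c"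
        using \<Delta>aff[OF pq, of x0] x by auto
      have "\<Delta> p q x1 = \<Delta> p q x0 + (x1 - x0) * c" "\<Delta> p q x2 = \<Delta> p q x0 + (x2 - x0) * c"
        using c[of x1] c[of x2] elim x by auto
      then show ?case by (simp only:) (simp add: algebra_simps)
    qed
    have l1: "((\<lambda>x0. (x2 - x1) * \<Delta> p q x0 + (x1 - x0) * \<Delta> p q x2) \<longlongrightarrow> (x2 - x1) * 0 + (x1 - 0) * \<Delta> p q x2) (at_right 0)"
      by (intro tendsto_intros \<Delta>0 pq)
    have l2: "((\<lambda>x0. (x2 - x0) * \<Delta> p q x1) \<longlongrightarrow> (x2 - 0) * \<Delta> p q x1) (at_right 0)"
      by (intro tendsto_intros)
    have "(x2 - x1) * 0 + (x1 - 0) * \<Delta> p q x2 = (x2 - 0) * \<Delta> p q x1"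
      by (rule tendsto_unique[OF _ Lim_transform_eventually[OF l1 ev] l2]) simp
    then show ?thesis by simp
  qed
  have \<Delta>b: "\<Delta> p q x = b p q * x" if pq: "lo \<le> p" "p \<le> q" "q \<le> hi" and x: "x \<in> {0<..<1}" for p q x
    using three[OF pq, of x "1/2"] three[OF pq, of "1/2" x] x unfolding b_def
    by (cases "x \<le> 1/2") (auto simp: mult_ac)
  have bzero: "b lo hi = 0"
  \<comment> \<open>The exponent 1 / alpha exceeds 1. In the constant, 2 L and 4 G come from
    comparing T x with \<open>T x m\<close> on the two halves, 4 B from the increments of
    \<open>n\<close>.\<close>
  proof (rule interval_function_zero[where b = b and p = lo and q = hi and s = "1 / \<alpha>" and C = "2 * L + 4 * G + 4 * B" and K = "2 * B" and X = 1 and T = T and lo = lo and hi = hi])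
    show "1 < 1 / \<alpha>" "0 \<le> 2 * L + 4 * G + 4 * B" "0 \<le> 2 * B" "(0::real) < 1" "lo \<le> lo" "lo < hi" "hi \<le> hi"
      using \<alpha> L0 G0 B0 lohi by auto
    show "b p r = b p q + b q r" if "lo \<le> p" "p \<le> q" "q \<le> r" "r \<le> hi" for p q r
    proof -
      have "T (1/2) integrable_on {p..r}"
        using Tc[of "1/2"] that by (intro integrable_continuous_real) (auto intro: continuous_on_subset)
      from Henstock_Kurzweil_Integration.integral_combine[OF that(2,3) this] show ?thesis
        by (simp add: b_def \<Delta>_def)
    qed
    show "continuous_on {lo..hi} (T x)" if "x \<in> {0<..<1}" for x by (rule Tc[OF that])
    show "\<bar>b p q * x - integral {p..q} (T x)\<bar> \<le> 2 * B * x\<^sup>2" if "lo \<le> p" "p < q" "q \<le> hi" "x \<in> {0<..<1}" for p q x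
      using \<Delta>b[of p q x] nb[of p q x] that unfolding \<Delta>_def by auto
    show "((\<lambda>x. T x y / x) \<longlongrightarrow> 0) (at_right 0)" if "y \<in> {lo..hi}" for y
      unfolding T_def by (rule RL_11_small[where X = 1]) (use that hi hcs in auto)
    show "\<bar>b m (m + l) - b (m - l) m\<bar> \<le> (2 * L + 4 * G + 4 * B) * l powr (1 / \<alpha>)"
      if l: "0 < l" "l < 1" and ml: "lo \<le> m - l" "m + l \<le> hi" for m l
    proof -
      \<comment> \<open>The scale x^alpha = l balances the errors: l^2 x^(2 - 2 alpha) and l x^(2 -
        alpha) both equal x^2, and division by x leaves l^(1 / alpha).\<close>
      define x where "x = l powr (1 / \<alpha>)"
      have x: "x \<in> {0<..<1}" using l \<alpha> powr_less_mono2[of "1 / \<alpha>" l 1] by (auto simp: x_def)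
      have xa: "x powr \<alpha> = l" using l \<alpha> by (simp add: x_def powr_powr)
      define E where "E = L * l * x powr (2 - 2 * \<alpha>) + 2 * G * x powr (2 - \<alpha>)"
      have pw: "x powr (2 - \<alpha>) * l = x\<^sup>2" "x powr (2 - 2 * \<alpha>) * l * l = x\<^sup>2"
      proof -
        have "x powr (2 - \<alpha>) * x powr \<alpha> = x powr 2" unfolding powr_add [symmetric] by simp
        then show "x powr (2 - \<alpha>) * l = x\<^sup>2" using x by (simp add: xa)
        have "x powr (2 - 2 * \<alpha>) * x powr \<alpha> * x powr \<alpha> = x powr 2" unfolding powr_add [symmetric] by simp
        then show "x powr (2 - 2 * \<alpha>) * l * l = x\<^sup>2" using x by (simp add: xa)
      qed
      have mI: "m \<in> {lo..hi}" using ml l by auto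
      have near: "\<bar>integral {p..p + l} (T x) - l * T x m\<bar> \<le> E * l" if p: "lo \<le> p" "p + l \<le> hi" "m - l \<le> p" "p \<le> m" for p
      proof -
        have c: "continuous_on {p..p + l} (T x)" using Tc[OF x] by (rule continuous_on_subset) (use p in auto)
        have "integral {p..p + l} (T x) - l * T x m = integral {p..p + l} (\<lambda>y. T x y - T x m)"
          using c l by (subst integral_diff) (auto intro: integrable_continuous_real)
        also have "norm \<dots> \<le> E * (p + l - p)"
        proof (rule integral_bound)
          show "continuous_on {p..p + l} (\<lambda>y. T x y - T x m)" by (intro continuous_intros c)
          fix y assume yp: "y \<in> {p..p + l}"
          then have y: "y \<in> {lo..hi}" using p by auto
          have "\<bar>y - m\<bar> \<le> l" using yp p by auto
          then have "L * \<bar>y - m\<bar> * x powr (2 - 2 * \<alpha>) \<le> L * l * x powr (2 - 2 * \<alpha>)"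
            using L0 by (intro mult_right_mono mult_left_mono) auto
          then have r: "\<bar>R x y - R x m\<bar> \<le> L * l * x powr (2 - 2 * \<alpha>)" using L[OF x y mI] by simp
          have "\<bar>g0 y - g0 m\<bar> \<le> 2 * G" using G[OF y] G[OF mI] by linarith
          then have "\<bar>(g0 y - g0 m) * x powr (2 - \<alpha>)\<bar> \<le> 2 * G * x powr (2 - \<alpha>)"
            by (simp add: abs_mult mult_right_mono)
          then show "norm (T x y - T x m) \<le> E"
            using r unfolding TR[OF x y] TR[OF x mI] E_def real_norm_def by (simp add: abs_le_iff algebra_simps)
        qed (use l in auto)
        finally show ?thesis by simp
      qed
      have "\<bar>integral {m..m + l} (T x) - integral {m - l..m} (T x)\<bar> \<le> 2 * (E * l)"
        using near[of m] near[of "m - l"] ml l by (auto simp: abs_le_iff)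
      moreover have "\<bar>n x (m + l) - n x m\<bar> \<le> 2 * B * x\<^sup>2" "\<bar>n x m - n x (m - l)\<bar> \<le> 2 * B * x\<^sup>2"
        using nb[of m "m + l" x] nb[of "m - l" m x] x ml l by auto
      moreover have "(b m (m + l) - b (m - l) m) * x = \<Delta> m (m + l) x - \<Delta> (m - l) m x"
        using \<Delta>b[of m "m + l" x] \<Delta>b[of "m - l" m x] x ml l by (simp add: algebra_simps)
      ultimately have "\<bar>(b m (m + l) - b (m - l) m) * x\<bar> \<le> 2 * (E * l) + 4 * B * x\<^sup>2"
        unfolding \<Delta>_def by (simp add: abs_le_iff)
      also have "E * l = L * x\<^sup>2 + 2 * G * x\<^sup>2"
      proof -
        have "E * l = L * (x powr (2 - 2 * \<alpha>) * l * l) + 2 * G * (x powr (2 - \<alpha>) * l)"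
          by (simp add: E_def algebra_simps)
        then show ?thesis unfolding pw .
      qed
      also have "2 * (L * x\<^sup>2 + 2 * G * x\<^sup>2) + 4 * B * x\<^sup>2 = ((2 * L + 4 * G + 4 * B) * x) * x"
        by (simp add: power2_eq_square algebra_simps)
      finally have "\<bar>b m (m + l) - b (m - l) m\<bar> * x \<le> ((2 * L + 4 * G + 4 * B) * x) * x"
        using x by (simp add: abs_mult)
      then have "\<bar>b m (m + l) - b (m - l) m\<bar> \<le> (2 * L + 4 * G + 4 * B) * x"
        using x by (simp only: mult_le_cancel_right) auto
      then show ?thesis by (simp add: x_def)
    qed
  qed
  show "integral {lo..hi} (\<lambda>y. R x y - g0 y * x powr (2 - \<alpha>)) = RL 1 (RL 1 (\<lambda>s. N s hi - N s lo)) x"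
    if x: "x \<in> {0<..<1}" for x
  proof -
    have "integral {lo..hi} (\<lambda>y. R x y - g0 y * x powr (2 - \<alpha>)) = integral {lo..hi} (T x)"
      using TR[OF x] by (intro integral_cong) auto
    also have "\<dots> = n x hi - n x lo"
      using \<Delta>b[of lo hi x] bzero x lohi by (simp add: \<Delta>_def)
    also have "\<dots> = RL 1 (RL 1 (\<lambda>s. N s hi - N s lo)) x"
      using nd[of lo hi x] x lohi by simp
    finally show ?thesis .
  qed
qed

section \<open>Uniqueness for a single mode and completeness of the eigenfunctions\<close>

lemma set_borel_measurable_continuous:
  fixes f :: "real \<Rightarrow> real"
  assumes "continuous_on {a<..<b} f" shows "set_borel_measurable lborel {a<..<b} f"
  unfolding set_borel_measurable_def
  using borel_measurable_continuous_on_indicator[of "{a<..<b}" f] assms by simp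

text \<open>In contrast to \<open>RL_bounded\<close> the majorant is a function, as the Volterra
  iteration works with powers of s.\<close>

lemma RL_abs_le:
  assumes a: "0 < a"
    and m: "set_borel_measurable lborel {0<..<x} f"
    and g: "set_integrable lborel {0<..<x} (\<lambda>s. (x - s) powr (a - 1) * g s)"
    and le: "\<And>s. s \<in> {0<..<x} \<Longrightarrow> \<bar>f s\<bar> \<le> g s"
  shows "set_integrable lborel {0<..<x} (\<lambda>s. (x - s) powr (a - 1) * f s)"
    and "\<bar>RL a f x\<bar> \<le> RL a g x"
proof -
  show i: "set_integrable lborel {0<..<x} (\<lambda>s. (x - s) powr (a - 1) * f s)"
  proof (rule set_integrable_bound[OF g])
    have "(\<lambda>r. (x - r) powr (a - 1) * (indicator {0<..<x} r * f r)) \<in> borel_measurable lborel"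
      using m unfolding set_borel_measurable_def
      by (intro borel_measurable_times[of "\<lambda>r. (x - r) powr (a - 1)"]) simp_all
    then show "set_borel_measurable lborel {0<..<x} (\<lambda>s. (x - s) powr (a - 1) * f s)"
      by (simp add: set_borel_measurable_def mult_ac)
    show "AE s in lborel. s \<in> {0<..<x} \<longrightarrow> norm ((x - s) powr (a - 1) * f s) \<le> norm ((x - s) powr (a - 1) * g s)"
    proof (intro AE_I2 impI)
      fix s assume "s \<in> {0<..<x}"
      then have "\<bar>f s\<bar> \<le> \<bar>g s\<bar>" using le[of s] by linarith
      then show "norm ((x - s) powr (a - 1) * f s) \<le> norm ((x - s) powr (a - 1) * g s)"
        by (simp add: abs_mult mult_left_mono)
    qed
  qed
  have "\<bar>LBINT s:{0<..<x}. (x - s) powr (a - 1) * f s\<bar> \<le> (LBINT s:{0<..<x}. \<bar>(x - s) powr (a - 1) * f s\<bar>)"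
    using i set_integral_norm_bound[OF i] by simp
  also have "\<dots> \<le> (LBINT s:{0<..<x}. (x - s) powr (a - 1) * g s)"
  proof (intro set_integral_mono set_integrable_abs i g)
    fix s assume "s \<in> {0<..<x}"
    then show "\<bar>(x - s) powr (a - 1) * f s\<bar> \<le> (x - s) powr (a - 1) * g s"
      using le[of s] by (simp add: abs_mult mult_left_mono)
  qed
  finally show "\<bar>RL a f x\<bar> \<le> RL a g x"
    using Gamma_real_pos[OF a] by (simp add: RL_def abs_mult field_simps)
qed

text \<open>Iterating the equation gives |E x| <= M c^k x^(beta k) / Gamma(beta k + 1) for every k,
  a null sequence.\<close>

lemma volterra_zero:
  assumes \<beta>: "0 < \<beta>" and c: "0 \<le> c"
    and E: "continuous_on {0<..<1} E" and M: "\<And>x. x \<in> {0<..<1} \<Longrightarrow> \<bar>E x\<bar> \<le> M"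
    and eq: "\<And>x. x \<in> {0<..<1} \<Longrightarrow> E x = c * RL \<beta> E x"
    and x: "x \<in> {0<..<1}"
  shows "E x = 0"
proof -
  have bd: "\<bar>E x\<bar> \<le> M * c ^ k / Gamma (\<beta> * real k + 1) * x powr (\<beta> * real k)" if "x \<in> {0<..<1}" for x k
    using that
  proof (induction k arbitrary: x)
    case 0
    then show ?case using M[of x] by simp
  next
    case (Suc k)
    let ?C = "M * c ^ k / Gamma (\<beta> * real k + 1)"
    have b: "0 < \<beta> * real k + 1" using \<beta> by (simp add: add_nonneg_pos)
    have x0: "0 < x" using Suc.prems by simp
    have "\<bar>RL \<beta> E x\<bar> \<le> RL \<beta> (\<lambda>s. ?C * s powr (\<beta> * real k + 1 - 1)) x"
    proof (rule RL_abs_le[OF \<beta>])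
      have "continuous_on {0<..<x} E" using E by (rule continuous_on_subset) (use Suc.prems in auto)
      then show "set_borel_measurable lborel {0<..<x} E" by (rule set_borel_measurable_continuous)
      have "set_integrable lborel {0<..<x} (\<lambda>s. ?C * ((x - s) powr (\<beta> - 1) * s powr (\<beta> * real k + 1 - 1)))"
        by (rule set_integrable_mult_right) (rule RL_powr(2)[OF \<beta> b x0])
      then show "set_integrable lborel {0<..<x} (\<lambda>s. (x - s) powr (\<beta> - 1) * (?C * s powr (\<beta> * real k + 1 - 1)))"
        by (simp only: mult.left_commute)
      show "\<bar>E s\<bar> \<le> ?C * s powr (\<beta> * real k + 1 - 1)" if "s \<in> {0<..<x}" for s
        using Suc.IH[of s] that Suc.prems by simp
    qed
    also have "\<dots> = ?C * (Gamma (\<beta> * real k + 1) / Gamma (\<beta> + (\<beta> * real k + 1)) * x powr (\<beta> + (\<beta> * real k + 1) - 1))"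
      unfolding RL_cmult RL_powr(1)[OF \<beta> b x0] ..
    also have "\<dots> = M * c ^ k / Gamma (\<beta> * real (Suc k) + 1) * x powr (\<beta> * real (Suc k))"
      using Gamma_pos_nonzero[OF b] by (simp add: algebra_simps)
    finally have "c * \<bar>RL \<beta> E x\<bar> \<le> c * (M * c ^ k / Gamma (\<beta> * real (Suc k) + 1) * x powr (\<beta> * real (Suc k)))"
      using c by (rule mult_left_mono)
    then show ?case using eq[OF Suc.prems] c by (simp add: abs_mult mult_ac)
  qed
  have "summable (\<lambda>k. M * ((c * x powr \<beta>) ^ k / Gamma (\<beta> * real k + 1)))"
    using c by (intro summable_mult summable_power_div_Gamma \<beta>) auto
  then have "(\<lambda>k. M * ((c * x powr \<beta>) ^ k / Gamma (\<beta> * real k + 1))) \<longlonglongrightarrow> 0" by (rule summable_LIMSEQ_zero)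
  also have "(\<lambda>k. M * ((c * x powr \<beta>) ^ k / Gamma (\<beta> * real k + 1))) = (\<lambda>k. M * c ^ k / Gamma (\<beta> * real k + 1) * x powr (\<beta> * real k))"
    using x by (simp add: power_mult_distrib powr_powr [symmetric] powr_realpow mult_ac)
  finally have "(\<lambda>k. M * c ^ k / Gamma (\<beta> * real k + 1) * x powr (\<beta> * real k)) \<longlonglongrightarrow> 0" .
  then have "\<bar>E x\<bar> \<le> 0" by (rule LIMSEQ_le_const) (use bd[OF x] in blast)
  then show ?thesis by simp
qed

text \<open>The equation is given for the double integral of \<open>D\<close>, with an unknown
  constant \<open>\<gamma>\<close>. Subtracting the multiple k of \<open>Sf\<close> with the same
  forcing term leaves a homogeneous Volterra equation, whence D = k S, and the values at 1 force k =
  0.\<close>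

lemma mode_zero:
  fixes D :: "real \<Rightarrow> real"
  assumes \<alpha>: "0 < \<alpha>" and \<mu>: "0 < \<mu>"
    and D: "continuous_on {0..1} D" "D 0 = 0" "D 1 = 0"
    and eq: "\<And>x. x \<in> {0<..<1} \<Longrightarrow> RL 1 (RL 1 D) x = \<gamma> * x powr (2 + \<alpha>) + \<mu>\<^sup>2 * RL (2 * \<alpha>) (RL 1 (RL 1 D)) x"
    and x: "x \<in> {0..1}"
  shows "D x = 0"
proof -
  define S where "S = Sf \<alpha> \<mu>"
  have Sc: "continuous_on {0..1} S"
    unfolding S_def using continuous_on_Sf[OF \<alpha>] by (rule continuous_on_subset) auto
  have bd: "\<exists>B. \<forall>s\<in>{0..1}. \<bar>f s\<bar> \<le> B" if "continuous_on {0..1} f" for f :: "real \<Rightarrow> real"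
    using compact_imp_bounded[OF compact_continuous_image[OF that]] by (auto simp: bounded_iff)
  have J2: "continuous_on {0<..<1} (RL 1 (RL 1 f)) \<and> (\<exists>B. \<forall>x\<in>{0<..<1}. \<bar>RL 1 (RL 1 f) x\<bar> \<le> B) \<and>
      (\<forall>x\<in>{0<..<1}. set_integrable lborel {0<..<x} f) \<and>
      (\<forall>x\<in>{0<..<1}. (RL 1 f has_real_derivative f x) (at x)) \<and> (\<forall>x\<in>{0<..<1}. (RL 1 (RL 1 f) has_real_derivative RL 1 f x) (at x))"
    if f: "continuous_on {0..1} f" for f :: "real \<Rightarrow> real"
  proof -
    obtain B where B: "\<And>s. s \<in> {0..1} \<Longrightarrow> \<bar>f s\<bar> \<le> B" using bd[OF f] by blast
    have B0: "0 \<le> B" using B[of 0] by simp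
    have i: "set_integrable lborel {0<..<x} f" "set_integrable lborel {0<..<x} (RL 1 f)" "\<bar>RL 1 (RL 1 f) x\<bar> \<le> B * x\<^sup>2"
      if "x \<in> {0<..<1}" for x
      using continuous_RL_11_bounds[OF f B, of x] that by auto
    have fc: "continuous_on {0<..<1} f" using f by (rule continuous_on_subset) auto
    have d1: "(RL 1 f has_real_derivative f x) (at x)" if "x \<in> {0<..<1}" for x
      by (rule RL_1_has_derivative[OF i(1) fc that])
    have c1: "continuous_on {0<..<1} (RL 1 f)" by (rule DERIV_imp_continuous_on) (rule d1)
    have d2: "(RL 1 (RL 1 f) has_real_derivative RL 1 f x) (at x)" if "x \<in> {0<..<1}" for x
      by (rule RL_1_has_derivative[OF i(2) c1 that])
    have "\<bar>RL 1 (RL 1 f) x\<bar> \<le> B" if "x \<in> {0<..<1}" for x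
    proof -
      have "x\<^sup>2 \<le> 1" using that by (simp add: power_le_one)
      then have "B * x\<^sup>2 \<le> B * 1" using B0 by (intro mult_left_mono) auto
      then show ?thesis using i(3)[OF that] by simp
    qed
    moreover have "continuous_on {0<..<1} (RL 1 (RL 1 f))" by (rule DERIV_imp_continuous_on) (rule d2)
    ultimately show ?thesis using i d1 d2 by blast
  qed
  note JD = J2[OF D(1)] and JS = J2[OF Sc]
  have J2eq: "RL 1 (RL 1 f) x = RL 2 f x" if "0 < x" "set_integrable lborel {0<..<x} f" for f x
    using RL_semigroup(1)[of 1 1 x f] that by simp
  define c1 where "c1 = \<mu> / mlp \<alpha> (odds \<mu>) 1 / Gamma (\<alpha> + 3)"
  have c1: "c1 \<noteq> 0" using \<mu> odds_1_pos[OF \<alpha> \<mu>] \<alpha> by (simp add: c1_def)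
  have S2: "RL 1 (RL 1 S) x = c1 * x powr (2 + \<alpha>) + \<mu>\<^sup>2 * RL (2 * \<alpha>) (RL 1 (RL 1 S)) x" if x: "x \<in> {0<..<1}" for x
  proof -
    have x0: "0 < x" using x by simp
    have Si: "set_integrable lborel {0<..<s} S" if "s \<in> {0<..<1}" for s using JS that by blast
    have Sb: "set_integrable lborel {0<..<s} (\<lambda>r. (s - r) powr (a - 1) * S r)" if "s \<in> {0<..<1}" "0 < a" for s a
    proof (rule RL_bounded(1)[OF that(2), of s S 1])
      have "continuous_on {0<..<s} S" using Sc by (rule continuous_on_subset) (use that in auto)
      then show "set_borel_measurable lborel {0<..<s} S" by (rule set_borel_measurable_continuous)
      show "\<bar>S r\<bar> \<le> 1" if "r \<in> {0<..<s}" for r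
        using Sf_bounds[OF \<alpha> \<mu>, of r] that \<open>s \<in> {0<..<1}\<close> by (auto simp: S_def)
    qed (use that in auto)
    let ?k = "\<mu> / mlp \<alpha> (odds \<mu>) 1 / Gamma (\<alpha> + 1)"
    have S1: "S s = ?k * s powr (\<alpha> + 1 - 1) + \<mu>\<^sup>2 * RL (2 * \<alpha>) S s" if s: "s \<in> {0<..<1}" for s
    proof -
      have "RL \<alpha> (RL \<alpha> S) s = RL (\<alpha> + \<alpha>) S s"
        using s \<alpha> by (intro RL_semigroup_aux(1) Sb) auto
      then show ?thesis using Sf_integral_eq[OF \<alpha> \<mu>, of s] s by (simp add: S_def)
    qed
    have "RL 2 S x = RL 2 (\<lambda>s. ?k * s powr (\<alpha> + 1 - 1) + \<mu>\<^sup>2 * RL (2 * \<alpha>) S s) x"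
      by (rule RL_cong) (use S1 x in auto)
    also have "\<dots> = RL 2 (\<lambda>s. ?k * s powr (\<alpha> + 1 - 1)) x + RL 2 (\<lambda>s. \<mu>\<^sup>2 * RL (2 * \<alpha>) S s) x"
    proof (rule RL_add)
      have "set_integrable lborel {0<..<x} (\<lambda>s. ?k * ((x - s) powr (2 - 1) * s powr (\<alpha> + 1 - 1)))"
        using \<alpha> x0 by (intro set_integrable_mult_right RL_powr(2)) auto
      then show "set_integrable lborel {0<..<x} (\<lambda>s. (x - s) powr (2 - 1) * (?k * s powr (\<alpha> + 1 - 1)))"
        by (simp only: mult.left_commute)
      have "set_integrable lborel {0<..<x} (\<lambda>s. \<mu>\<^sup>2 * ((x - s) powr (2 - 1) * RL (2 * \<alpha>) S s))"
        using \<alpha> x0 Si[OF x] by (intro set_integrable_mult_right RL_semigroup(2)) auto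
      then show "set_integrable lborel {0<..<x} (\<lambda>s. (x - s) powr (2 - 1) * (\<mu>\<^sup>2 * RL (2 * \<alpha>) S s))"
        by (simp only: mult.left_commute)
    qed
    also have "RL 2 (\<lambda>s. ?k * s powr (\<alpha> + 1 - 1)) x = ?k * (Gamma (\<alpha> + 1) / Gamma (2 + (\<alpha> + 1)) * x powr (2 + (\<alpha> + 1) - 1))"
      unfolding RL_cmult using \<alpha> x0 by (subst RL_powr(1)) auto
    also have "\<dots> = c1 * x powr (2 + \<alpha>)"
      using \<alpha> Gamma_pos_nonzero[of "\<alpha> + 1"] by (simp add: c1_def algebra_simps)
    also have "RL 2 (\<lambda>s. \<mu>\<^sup>2 * RL (2 * \<alpha>) S s) x = \<mu>\<^sup>2 * RL (2 * \<alpha> + 2) S x"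
      unfolding RL_cmult using \<alpha> x0 Si[OF x] by (subst RL_semigroup(1)) (auto simp: add.commute)
    also have "RL (2 * \<alpha> + 2) S x = RL (2 * \<alpha>) (RL 2 S) x"
      using \<alpha> x0 Si[OF x] by (subst RL_semigroup(1)) auto
    also have "\<dots> = RL (2 * \<alpha>) (RL 1 (RL 1 S)) x"
      by (rule RL_cong) (use J2eq Si x in auto)
    finally show ?thesis using J2eq[OF x0 Si[OF x]] by simp
  qed
  define k where "k = \<gamma> / c1"
  define E where "E z = RL 1 (RL 1 D) z - k * RL 1 (RL 1 S) z" for z
  have Ec: "continuous_on {0<..<1} E" unfolding E_def using JD JS by (intro continuous_intros) auto
  obtain B1 B2 where B: "\<And>x. x \<in> {0<..<1} \<Longrightarrow> \<bar>RL 1 (RL 1 D) x\<bar> \<le> B1" "\<And>x. x \<in> {0<..<1} \<Longrightarrow> \<bar>RL 1 (RL 1 S) x\<bar> \<le> B2"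
    using JD JS by blast
  have EM: "\<bar>E x\<bar> \<le> B1 + \<bar>k\<bar> * B2" if "x \<in> {0<..<1}" for x
  proof -
    have "\<bar>k * RL 1 (RL 1 S) x\<bar> \<le> \<bar>k\<bar> * B2" using B(2)[OF that] by (simp add: abs_mult mult_left_mono)
    then show ?thesis using B(1)[OF that] unfolding E_def by linarith
  qed
  have Eeq: "E x = \<mu>\<^sup>2 * RL (2 * \<alpha>) E x" if x: "x \<in> {0<..<1}" for x
  proof -
    have int: "set_integrable lborel {0<..<x} (\<lambda>s. (x - s) powr (2 * \<alpha> - 1) * RL 1 (RL 1 f) s)"
      if f: "continuous_on {0<..<1} (RL 1 (RL 1 f))" "\<And>x. x \<in> {0<..<1} \<Longrightarrow> \<bar>RL 1 (RL 1 f) x\<bar> \<le> B" for f B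
    proof (rule RL_bounded(1)[of _ x _ B])
      have "continuous_on {0<..<x} (RL 1 (RL 1 f))" using f(1) by (rule continuous_on_subset) (use x in auto)
      then show "set_borel_measurable lborel {0<..<x} (RL 1 (RL 1 f))" by (rule set_borel_measurable_continuous)
    qed (use \<alpha> x f in auto)
    have "RL (2 * \<alpha>) E x = RL (2 * \<alpha>) (RL 1 (RL 1 D)) x - RL (2 * \<alpha>) (\<lambda>s. k * RL 1 (RL 1 S) s) x"
      unfolding E_def
    proof (rule RL_diff)
      show "set_integrable lborel {0<..<x} (\<lambda>s. (x - s) powr (2 * \<alpha> - 1) * RL 1 (RL 1 D) s)"
        by (rule int[OF _ B(1)]) (use JD in auto)
      have "set_integrable lborel {0<..<x} (\<lambda>s. k * ((x - s) powr (2 * \<alpha> - 1) * RL 1 (RL 1 S) s))"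
        by (rule set_integrable_mult_right, rule int[OF _ B(2)]) (use JS in auto)
      then show "set_integrable lborel {0<..<x} (\<lambda>s. (x - s) powr (2 * \<alpha> - 1) * (k * RL 1 (RL 1 S) s))"
        by (simp only: mult.left_commute)
    qed
    then have rE: "RL (2 * \<alpha>) E x = RL (2 * \<alpha>) (RL 1 (RL 1 D)) x - k * RL (2 * \<alpha>) (RL 1 (RL 1 S)) x"
      unfolding RL_cmult .
    have g: "\<gamma> = k * c1" using c1 by (simp add: k_def)
    have "d - k * s = m * (A - k * B)" if "d = \<gamma> * P + m * A" "s = c1 * P + m * B" for d s m A B P
      unfolding that g by (simp add: algebra_simps)
    from this[OF eq[OF x] S2[OF x]] show ?thesis unfolding rE by (simp only: E_def)
  qed
  have E0: "E x = 0" if "x \<in> {0<..<1}" for x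
    by (rule volterra_zero[OF _ _ Ec EM Eeq that]) (use \<alpha> in auto)
  \<comment> \<open>Differentiating E = 0 twice recovers D - k S from its double integral.\<close>
  have zero_deriv: "f' x = 0" if "\<And>x. x \<in> {0<..<1} \<Longrightarrow> f x = 0" "(f has_real_derivative f' x) (at x)" "x \<in> {0<..<1}" for f f' :: "real \<Rightarrow> real" and x
  proof -
    have "((\<lambda>x. 0) has_real_derivative f' x) (at x)"
      by (rule has_field_derivative_transform_within_open[OF that(2), of "{0<..<1}"]) (use that in auto)
    then show ?thesis using DERIV_const DERIV_unique by blast
  qed
  have E1: "RL 1 D x - k * RL 1 S x = 0" if "x \<in> {0<..<1}" for x
  proof (rule zero_deriv[of E "\<lambda>x. RL 1 D x - k * RL 1 S x", OF E0 _ that])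
    show "(E has_real_derivative RL 1 D x - k * RL 1 S x) (at x)"
      unfolding E_def using JD JS that by (intro DERIV_diff DERIV_cmult) auto
  qed
  have E2: "D x - k * S x = 0" if "x \<in> {0<..<1}" for x
  proof (rule zero_deriv[of "\<lambda>x. RL 1 D x - k * RL 1 S x" "\<lambda>x. D x - k * S x", OF E1 _ that])
    show "((\<lambda>x. RL 1 D x - k * RL 1 S x) has_real_derivative D x - k * S x) (at x)"
      using JD JS that by (intro DERIV_diff DERIV_cmult) auto
  qed
  have "D 1 - k * S 1 = 0"
  proof (rule continuous_constant_on_closure[of "{0<..<1}" "\<lambda>x. D x - k * S x"])
    show "continuous_on (closure {0<..<1}) (\<lambda>x. D x - k * S x)"
      by (simp, intro continuous_intros D Sc)
  qed (use E2 in auto)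
  then have "k = 0" using D Sf_1[OF \<alpha> \<mu>] by (simp add: S_def)
  then have "D x = 0" if "x \<in> {0<..<1}" for x using E2[OF that] by simp
  then show ?thesis using x D by (cases "x = 0 \<or> x = 1") auto
qed

section \<open>Completeness of the half-integer trigonometric system\<close>

lemma half_sum:
  fixes F :: real
  shows "c1 * c2 = (a + b) / 2 \<Longrightarrow> F * c1 * c2 = 1/2 * (F * a) + 1/2 * (F * b)"
    and "c1 * c2 = (a - b) / 2 \<Longrightarrow> F * c1 * c2 = 1/2 * (F * a) - 1/2 * (F * b)"
proof -
  assume e: "c1 * c2 = (a + b) / 2"
  show "F * c1 * c2 = 1/2 * (F * a) + 1/2 * (F * b)"
    unfolding mult.assoc e by (simp add: field_simps)
next
  assume e: "c1 * c2 = (a - b) / 2"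
  show "F * c1 * c2 = 1/2 * (F * a) - 1/2 * (F * b)"
    unfolding mult.assoc e by (simp add: field_simps)
qed

text \<open>An even continuous function on [-pi, pi] is a continuous function F of cos y, and
  \<open>g\<close> is orthogonal to all polynomials in cos y. Approximating F on [-1, 1] by
  polynomials makes the integral of g^2 arbitrarily small.\<close>

lemma even_cos_complete:
  fixes g :: "real \<Rightarrow> real"
  assumes g: "continuous_on {-pi..pi} g" and even: "\<And>y. g (- y) = g y"
    and orth: "\<And>k::nat. integral {-pi..pi} (\<lambda>y. g y * cos (real k * y)) = 0"
    and y: "y \<in> {-pi..pi}"
  shows "g y = 0"
proof -
  have int: "(\<lambda>y. g y * p y) integrable_on {-pi..pi}" if "continuous_on {-pi..pi} p" for p
    by (intro integrable_continuous_real continuous_intros g that)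
  \<comment> \<open>The extra factor cos (j y) closes the induction: the product formula trades one
    power of cos y for the frequencies j + 1 and j - 1.\<close>
  have pw: "integral {-pi..pi} (\<lambda>y. g y * (cos y ^ k * cos (real j * y))) = 0" for k j :: nat
  proof (induction k arbitrary: j)
    case 0
    then show ?case using orth[of j] by simp
  next
    case (Suc k)
    show ?case
    proof (cases j)
      case 0
      then show ?thesis using Suc.IH[of 1] by (simp add: mult_ac)
    next
      case (Suc i)
      have e: "g y * (cos y ^ Suc k * cos (real j * y)) =
        1/2 * (g y * (cos y ^ k * cos (real (Suc j) * y))) + 1/2 * (g y * (cos y ^ k * cos (real i * y)))" for y
      proof -
        have "cos y * cos (real j * y) = (cos (real (Suc j) * y) + cos (real i * y)) / 2"
          using cos_times_cos[of "real j * y" y] Suc by (simp add: algebra_simps)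
        from half_sum(1)[OF this, of "g y * cos y ^ k"] show ?thesis
          by (simp only: power_Suc mult_ac)
      qed
      have "integral {-pi..pi} (\<lambda>y. g y * (cos y ^ Suc k * cos (real j * y))) =
        integral {-pi..pi} (\<lambda>y. 1/2 * (g y * (cos y ^ k * cos (real (Suc j) * y)))) +
        integral {-pi..pi} (\<lambda>y. 1/2 * (g y * (cos y ^ k * cos (real i * y))))"
        unfolding e by (intro integral_add integrable_on_mult_right int continuous_intros)
      then show ?thesis using Suc.IH[of "Suc j"] Suc.IH[of i] by simp
    qed
  qed
  define F where "F t = g (arccos t)" for t
  have Fc: "continuous_on {-1..1} F"
    unfolding F_def by (rule continuous_on_compose2[OF g]) (auto intro!: continuous_intros arccos_bounded simp: arccos_lbound order_trans[OF _ arccos_lbound] arccos_ubound)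
  have gF: "g y = F (cos y)" if "y \<in> {-pi..pi}" for y
    using that even[of y] by (cases "0 \<le> y") (auto simp: F_def arccos_cos arccos_cos2)
  have "bounded (g ` {-pi..pi})" by (intro compact_imp_bounded compact_continuous_image g compact_Icc)
  then obtain B where "\<forall>z\<in>g ` {-pi..pi}. norm z \<le> B" unfolding bounded_iff by blast
  then have B: "\<And>y. y \<in> {-pi..pi} \<Longrightarrow> \<bar>g y\<bar> \<le> B" by auto
  have B0: "0 \<le> B" using B[of 0] by auto
  have small: "integral {-pi..pi} (\<lambda>y. g y * g y) \<le> e" if e: "0 < e" for e
  proof -
    define d where "d = e / (2 * pi * (B + 1))"
    have d: "0 < d" using e B0 by (simp add: d_def)
    obtain P where P: "real_polynomial_function P" "\<And>t. t \<in> {-1..1} \<Longrightarrow> \<bar>F t - P t\<bar> < d"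
      using Stone_Weierstrass_real_polynomial_function[OF compact_Icc Fc d] by blast
    obtain a n where Pa: "P = (\<lambda>t. \<Sum>i\<le>n. a i * t ^ i)"
      using P(1) unfolding real_polynomial_function_iff_sum by blast
    have Pc: "continuous_on {-pi..pi} (\<lambda>y. P (cos y))" unfolding Pa by (intro continuous_intros)
    have "integral {-pi..pi} (\<lambda>y. g y * P (cos y)) = integral {-pi..pi} (\<lambda>y. \<Sum>i\<le>n. a i * (g y * (cos y ^ i * cos (real 0 * y))))"
      unfolding Pa by (simp add: sum_distrib_left mult_ac)
    also have "\<dots> = (\<Sum>i\<le>n. integral {-pi..pi} (\<lambda>y. a i * (g y * (cos y ^ i * cos (real 0 * y)))))"
      by (intro integral_sum integrable_on_mult_right int continuous_intros) auto
    also have "\<dots> = 0" unfolding integral_mult_right pw by simp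
    finally have z: "integral {-pi..pi} (\<lambda>y. g y * P (cos y)) = 0" .
    have "integral {-pi..pi} (\<lambda>y. g y * g y) = integral {-pi..pi} (\<lambda>y. g y * g y) - integral {-pi..pi} (\<lambda>y. g y * P (cos y))"
      using z by simp
    also have "\<dots> = integral {-pi..pi} (\<lambda>y. g y * g y - g y * P (cos y))"
      by (intro integral_diff [symmetric] int g Pc)
    also have "norm \<dots> \<le> B * d * (pi - - pi)"
    proof (rule integral_bound)
      show "continuous_on {-pi..pi} (\<lambda>y. g y * g y - g y * P (cos y))" by (intro continuous_intros g Pc)
      fix y assume y: "y \<in> {-pi..pi}"
      have "\<bar>g y - P (cos y)\<bar> \<le> d" using P(2)[of "cos y"] gF[OF y] by (simp add: less_imp_le)
      then have "\<bar>g y\<bar> * \<bar>g y - P (cos y)\<bar> \<le> B * d" using B[OF y] B0 by (intro mult_mono) auto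
      then show "norm (g y * g y - g y * P (cos y)) \<le> B * d"
        by (simp add: right_diff_distrib [symmetric] abs_mult)
    qed simp
    also have "B * d * (pi - - pi) \<le> e"
    proof -
      have "d * (2 * pi * (B + 1)) = e" using B0 unfolding d_def by (subst nonzero_eq_divide_eq [symmetric]) auto
      moreover have "B * d * (pi - - pi) \<le> d * (2 * pi * (B + 1))" using d by (simp add: algebra_simps)
      ultimately show ?thesis by simp
    qed
    finally show ?thesis by (simp add: abs_le_iff)
  qed
  have "integral {-pi..pi} (\<lambda>y. g y * g y) \<le> 0" by (rule field_le_epsilon) (use small in auto)
  moreover have "0 \<le> integral {-pi..pi} (\<lambda>y. g y * g y)" by (intro integral_nonneg int g) auto
  ultimately have "((\<lambda>y. g y * g y) has_integral 0) (cbox (-pi) pi)"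
    using integrable_integral[OF int[OF g]] by (simp add: cbox_interval)
  then have "g y * g y = 0"
  proof (rule has_integral_0_cbox_imp_0[rotated 2])
    have "0 \<in> box (- pi) pi" by (simp add: box_real)
    then show "box (- pi) pi \<noteq> {}" by blast
  qed (use y g in \<open>auto intro!: continuous_intros simp: cbox_interval\<close>)
  then show ?thesis by simp
qed

lemma continuous_on_Y [continuous_intros]:
  fixes f :: "'a :: t2_space \<Rightarrow> real"
  shows "continuous_on S f \<Longrightarrow> continuous_on S (\<lambda>x. Y n (f x))"
proof -
  assume f: "continuous_on S f"
  have "continuous_on S (\<lambda>x. cos (c * f x))" "continuous_on S (\<lambda>x. sin (c * f x))" for c
    by (intro continuous_on_cos continuous_on_sin continuous_on_mult_left f)+
  then show ?thesis by (cases "even n") (simp_all add: Y_def)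
qed

lemma Y_reflect: "Y n (- y) = (if even n then 1 else - 1) * Y n y"
  by (simp add: Y_def)

lemma integral_reflect_pi: "integral {-pi..pi} (\<lambda>y. f (- y)) = integral {-pi..pi} f" for f :: "real \<Rightarrow> real"
  using Henstock_Kurzweil_Integration.integral_reflect_real[of pi "-pi" f] by simp

text \<open>The even part of \<open>f\<close> times cos (y / 2) and the odd part times sin (y / 2)
  are even, and product formulas turn the half-integer frequencies into integer ones. The cosine
  factor vanishes only at the endpoints, which continuity recovers, the sine factor only at 0, where
  the odd part is 0 anyway.\<close>

lemma Y_complete:
  fixes f :: "real \<Rightarrow> real"
  assumes f: "continuous_on {-pi..pi} f" and orth: "\<And>n. integral {-pi..pi} (\<lambda>y. f y * Y n y) = 0"
    and y: "y \<in> {-pi..pi}"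
  shows "f y = 0"
proof -
  have fr: "continuous_on {-pi..pi} (\<lambda>y. f (- y))"
    by (rule continuous_on_compose2[OF f]) (auto intro!: continuous_intros)
  have int: "(\<lambda>y. f y * p y) integrable_on {-pi..pi}" "(\<lambda>y. f (- y) * p y) integrable_on {-pi..pi}" if "continuous_on {-pi..pi} p" for p
    by (intro integrable_continuous_real continuous_intros f fr that)+
  have orth': "integral {-pi..pi} (\<lambda>y. f (- y) * Y n y) = 0" for n
  proof -
    have "integral {-pi..pi} (\<lambda>y. f (- y) * Y n y) = integral {-pi..pi} (\<lambda>y. f y * Y n (- y))"
      using integral_reflect_pi[of "\<lambda>y. f y * Y n (- y)"] by simp
    also have "\<dots> = integral {-pi..pi} (\<lambda>y. (if even n then 1 else - 1) * (f y * Y n y))"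
      by (simp add: Y_reflect)
    also have "\<dots> = (if even n then 1 else - 1) * integral {-pi..pi} (\<lambda>y. f y * Y n y)"
      by (rule integral_mult_right)
    finally show ?thesis using orth by simp
  qed
  have oc: "integral {-pi..pi} (\<lambda>y. (f y + f (- y)) * cos ((real k + 1/2) * y)) = 0" for k :: nat
  proof -
    have Ye: "cos ((real k + 1/2) * y) = Y (2 * k) y" for y by (simp add: Y_def)
    have "integral {-pi..pi} (\<lambda>y. f y * Y (2 * k) y + f (- y) * Y (2 * k) y) = 0"
      using integral_add[OF int(1) int(2), of "Y (2 * k)" "Y (2 * k)"] orth orth' by (simp add: continuous_intros)
    then show ?thesis unfolding Ye by (simp add: distrib_right)
  qed
  have os: "integral {-pi..pi} (\<lambda>y. (f y - f (- y)) * sin ((real k + 1/2) * y)) = 0" for k :: nat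
  proof -
    have Ye: "sin ((real k + 1/2) * y) = Y (2 * k + 1) y" for y by (simp add: Y_def)
    have "integral {-pi..pi} (\<lambda>y. f y * Y (2 * k + 1) y - f (- y) * Y (2 * k + 1) y) = 0"
      using integral_diff[OF int(1) int(2), of "Y (2 * k + 1)" "Y (2 * k + 1)"] orth orth' by (simp add: continuous_intros)
    then show ?thesis unfolding Ye by (simp add: left_diff_distrib)
  qed
  have E: "(f y + f (- y)) * cos (y / 2) = 0" if "y \<in> {-pi..pi}" for y
  proof (rule even_cos_complete[OF _ _ _ that])
    show "continuous_on {-pi..pi} (\<lambda>y. (f y + f (- y)) * cos (y / 2))" by (intro continuous_intros f fr) auto
    fix k :: nat
    show "integral {-pi..pi} (\<lambda>y. (f y + f (- y)) * cos (y / 2) * cos (real k * y)) = 0"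
    proof (cases k)
      case 0
      then show ?thesis using oc[of 0] by simp
    next
      case (Suc i)
      have e: "(f y + f (- y)) * cos (y / 2) * cos (real k * y) =
        1/2 * ((f y + f (- y)) * cos ((real k + 1/2) * y)) + 1/2 * ((f y + f (- y)) * cos ((real i + 1/2) * y))" for y
      proof -
        have a1: "real k * y - y / 2 = (real i + 1/2) * y" "real k * y + y / 2 = (real k + 1/2) * y"
          using Suc by (auto simp: algebra_simps)
        have "cos (y / 2) * cos (real k * y) = (cos ((real k + 1/2) * y) + cos ((real i + 1/2) * y)) / 2"
          using cos_times_cos[of "real k * y" "y / 2"] unfolding a1 by (simp add: mult.commute add.commute)
        then show ?thesis by (rule half_sum)
      qed
      show ?thesis unfolding e
        using oc[of k] oc[of i] integral_add[of "\<lambda>y. 1/2 * ((f y + f (- y)) * cos ((real k + 1/2) * y))" "{-pi..pi}" "\<lambda>y. 1/2 * ((f y + f (- y)) * cos ((real i + 1/2) * y))"]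
        by (simp add: integrable_continuous_real continuous_intros f fr)
    qed
  qed simp
  have O: "(f y - f (- y)) * sin (y / 2) = 0" if "y \<in> {-pi..pi}" for y
  proof (rule even_cos_complete[OF _ _ _ that])
    show "continuous_on {-pi..pi} (\<lambda>y. (f y - f (- y)) * sin (y / 2))" by (intro continuous_intros f fr) auto
    show "(f (- y) - f (- (- y))) * sin (- y / 2) = (f y - f (- y)) * sin (y / 2)" for y
      by (simp add: algebra_simps)
    fix k :: nat
    show "integral {-pi..pi} (\<lambda>y. (f y - f (- y)) * sin (y / 2) * cos (real k * y)) = 0"
    proof (cases k)
      case 0
      then show ?thesis using os[of 0] by simp
    next
      case (Suc i)
      have e: "(f y - f (- y)) * sin (y / 2) * cos (real k * y) =
        1/2 * ((f y - f (- y)) * sin ((real k + 1/2) * y)) - 1/2 * ((f y - f (- y)) * sin ((real i + 1/2) * y))" for y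
      proof -
        have a1: "real k * y - y / 2 = (real i + 1/2) * y" "real k * y + y / 2 = (real k + 1/2) * y"
          using Suc by (auto simp: algebra_simps)
        have "sin (y / 2) * cos (real k * y) = (sin ((real k + 1/2) * y) - sin ((real i + 1/2) * y)) / 2"
          using cos_times_sin[of "real k * y" "y / 2"] unfolding a1 by (simp add: mult.commute)
        then show ?thesis by (rule half_sum)
      qed
      show ?thesis unfolding e
        using os[of k] os[of i] integral_diff[of "\<lambda>y. 1/2 * ((f y - f (- y)) * sin ((real k + 1/2) * y))" "{-pi..pi}" "\<lambda>y. 1/2 * ((f y - f (- y)) * sin ((real i + 1/2) * y))"]
        by (simp add: integrable_continuous_real continuous_intros f fr)
    qed
  qed
  have inner: "f y = 0" if y: "y \<in> {-pi<..<pi}" for y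
  proof -
    have "0 < cos (y / 2)" using y by (intro cos_gt_zero_pi) auto
    then have 1: "f y + f (- y) = 0" using E[of y] y by auto
    show ?thesis
    proof (cases "y = 0")
      case False
      have "sin (y / 2) \<noteq> 0"
      proof (cases "0 < y")
        case True then show ?thesis using y sin_gt_zero[of "y / 2"] by auto
      next
        case False
        then have "0 < sin (- (y / 2))" using y \<open>y \<noteq> 0\<close> by (intro sin_gt_zero) auto
        then show ?thesis by simp
      qed
      then have "f y - f (- y) = 0" using O[of y] y by auto
      then show ?thesis using 1 by simp
    qed (use 1 in simp)
  qed
  show ?thesis
    by (rule continuous_constant_on_closure[of "{-pi<..<pi}" f 0]) (use f inner y in auto)
qed

section \<open>The modes of a regular solution\<close>

lemma closure_Omega: "closure Omega = {0..1} \<times> {-pi..pi}"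
  by (simp add: Omega_def closure_Times)

lemma continuous_on_section:
  assumes "continuous_on (A \<times> B) (\<lambda>(x, y). f x y)"
  shows "y \<in> B \<Longrightarrow> continuous_on A (\<lambda>x. f x y)" and "x \<in> A \<Longrightarrow> continuous_on B (f x)"
proof -
  show "continuous_on A (\<lambda>x. f x y)" if "y \<in> B"
  proof -
    have c: "continuous_on A (\<lambda>x. (x, y))" by (intro continuous_intros)
    have s: "(\<lambda>x. (x, y)) ` A \<subseteq> A \<times> B" using that by auto
    from continuous_on_compose2[OF assms c s] show ?thesis by simp
  qed
  show "continuous_on B (f x)" if "x \<in> A"
  proof -
    have c: "continuous_on B (\<lambda>y. (x, y))" by (intro continuous_intros)
    have s: "(\<lambda>y. (x, y)) ` B \<subseteq> A \<times> B" using that by auto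
    from continuous_on_compose2[OF assms c s] show ?thesis by simp
  qed
qed

lemma continuous_on_compact_bounded2:
  fixes f :: "real \<Rightarrow> real \<Rightarrow> real"
  assumes "continuous_on (A \<times> B) (\<lambda>(x, y). f x y)" "compact A" "compact B"
  obtains K where "0 \<le> K" "\<And>x y. x \<in> A \<Longrightarrow> y \<in> B \<Longrightarrow> \<bar>f x y\<bar> \<le> K"
proof -
  have "bounded ((\<lambda>(x, y). f x y) ` (A \<times> B))"
    by (intro compact_imp_bounded compact_continuous_image assms compact_Times)
  then obtain K where "\<forall>z\<in>(\<lambda>(x, y). f x y) ` (A \<times> B). norm z \<le> K" unfolding bounded_iff by blast
  then have K: "\<And>x y. x \<in> A \<Longrightarrow> y \<in> B \<Longrightarrow> \<bar>f x y\<bar> \<le> K" by fastforce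
  show ?thesis by (rule that[of "max K 0"]) (use K in \<open>auto simp: le_max_iff_disj\<close>)
qed

lemma continuous_on_Lipschitz_snd:
  fixes F :: "real \<Rightarrow> real \<Rightarrow> real"
  assumes c: "\<And>y. y \<in> B \<Longrightarrow> continuous_on A (\<lambda>s. F s y)"
    and L: "\<And>s y z. s \<in> A \<Longrightarrow> y \<in> B \<Longrightarrow> z \<in> B \<Longrightarrow> \<bar>F s y - F s z\<bar> \<le> L * \<bar>y - z\<bar>" and L0: "0 \<le> L"
  shows "continuous_on (A \<times> B) (\<lambda>(s, y). F s y)"
  unfolding continuous_on_iff
proof (intro ballI allI impI)
  fix p and e :: real assume p: "p \<in> A \<times> B" and e: "0 < e"
  obtain s0 y0 where p0: "p = (s0, y0)" "s0 \<in> A" "y0 \<in> B" using p by auto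
  obtain d where d: "0 < d" "\<And>s. s \<in> A \<Longrightarrow> dist s s0 < d \<Longrightarrow> dist (F s y0) (F s0 y0) < e / 2"
    using c[OF p0(3)] p0(2) e unfolding continuous_on_iff by (meson half_gt_zero)
  define d' where "d' = min d (e / (2 * (L + 1)))"
  have d': "0 < d'" using d e L0 by (simp add: d'_def)
  show "\<exists>d>0. \<forall>x\<in>A \<times> B. dist x p < d \<longrightarrow> dist (case x of (s, y) \<Rightarrow> F s y) (case p of (s, y) \<Rightarrow> F s y) < e"
  proof (intro exI[of _ d'] conjI d' ballI impI)
    fix q assume q: "q \<in> A \<times> B" "dist q p < d'"
    obtain s y where q0: "q = (s, y)" "s \<in> A" "y \<in> B" using q by auto
    have "dist s s0 < d'" "dist y y0 < d'"
      using q(2) dist_fst_le[of q p] dist_snd_le[of q p] by (auto simp: q0 p0)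
    then have 1: "dist s s0 < d" and 2: "dist y y0 < e / (2 * (L + 1))" by (auto simp: d'_def)
    have "dist y y0 * (2 * (L + 1)) < e"
      using 2 L0 by (subst (asm) pos_less_divide_eq) auto
    then have "(L + 1) * \<bar>y - y0\<bar> < e / 2" by (simp add: dist_real_def algebra_simps)
    moreover have "\<bar>F s y - F s y0\<bar> \<le> (L + 1) * \<bar>y - y0\<bar>"
      using L[OF q0(2,3) p0(3)] by (simp add: distrib_right)
    ultimately have "\<bar>F s y - F s y0\<bar> < e / 2" by simp
    then show "dist (case q of (s, y) \<Rightarrow> F s y) (case p of (s, y) \<Rightarrow> F s y) < e"
      using d(2)[OF q0(2) 1] abs_triangle_ineq[of "F s y - F s y0" "F s y0 - F s0 y0"]
      by (simp add: q0 p0 dist_real_def)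
  qed
qed

text \<open>Unlike in \<open>layer_identity\<close> the exchange is direct: \<open>Q\<close> is
  bounded on the closed rectangle, so the kernel times a constant dominates.\<close>

lemma RL_integral_swap:
  fixes Q :: "real \<Rightarrow> real \<Rightarrow> real"
  assumes a: "0 < a" and x: "0 < x" "x \<le> 1" and Q: "continuous_on ({0..1} \<times> {-pi..pi}) (\<lambda>(s, y). Q s y)"
  shows "RL a (\<lambda>s. integral {-pi..pi} (Q s)) x = integral {-pi..pi} (\<lambda>y. RL a (\<lambda>s. Q s y) x)"
proof -
  obtain B where B0: "0 \<le> B" and B: "\<And>s y. s \<in> {0..1} \<Longrightarrow> y \<in> {-pi..pi} \<Longrightarrow> \<bar>Q s y\<bar> \<le> B"
    using continuous_on_compact_bounded2[OF Q compact_Icc compact_Icc] by blast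
  define k where "k s = indicator {0<..<x} s * (x - s) powr (a - 1)" for s
  define G where "G = (\<lambda>(s, y). B * k s * indicator {-pi..pi} y)"
  define F where "F = (\<lambda>(s, y). k s * (indicator ({0..1} \<times> {-pi..pi}) (s, y) * Q s y))"
  have k: "integrable lborel k" using RL_one(2)[OF a x(1)] by (simp add: set_integrable_def k_def [abs_def])
  have km [measurable]: "k \<in> borel_measurable lborel" using k by simp
  have k0: "0 \<le> k s" for s by (simp add: k_def)
  have Gi: "integrable (lborel \<Otimes>\<^sub>M lborel) G"
  proof (rule lborel_pair.Fubini_integrable)
    show "G \<in> borel_measurable (lborel \<Otimes>\<^sub>M lborel)" unfolding G_def by measurable
    have "(LINT y|lborel. norm (G (s, y))) = (B * (2 * pi)) * k s" for s
      using B0 k0[of s] by (simp add: G_def abs_mult)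
    then show "integrable lborel (\<lambda>s. LINT y|lborel. norm (G (s, y)))" using k by simp
    show "AE s in lborel. integrable lborel (\<lambda>y. G (s, y))" by (simp add: G_def)
  qed
  have Fm: "F \<in> borel_measurable (lborel \<Otimes>\<^sub>M lborel)"
  proof -
    have "(\<lambda>p. indicator ({0..1} \<times> {-pi..pi}) p *\<^sub>R (\<lambda>(s, y). Q s y) p) \<in> borel_measurable borel"
      by (rule borel_measurable_continuous_on_indicator[OF _ Q]) (simp add: borel_closed closed_Times)
    then have "(\<lambda>p. indicator ({0..1} \<times> {-pi..pi}) p *\<^sub>R (\<lambda>(s, y). Q s y) p) \<in> borel_measurable (lborel \<Otimes>\<^sub>M lborel)"
      by (simp add: lborel_prod)
    moreover have "(\<lambda>p. k (fst p)) \<in> borel_measurable (lborel \<Otimes>\<^sub>M lborel)" by measurable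
    ultimately have "(\<lambda>p. k (fst p) * (indicator ({0..1} \<times> {-pi..pi}) p *\<^sub>R (\<lambda>(s, y). Q s y) p)) \<in> borel_measurable (lborel \<Otimes>\<^sub>M lborel)"
      by (rule borel_measurable_times[rotated])
    then show ?thesis by (simp add: F_def case_prod_unfold)
  qed
  have FG: "norm (F p) \<le> norm (G p)" for p
  proof (cases p)
    case (Pair s y)
    show ?thesis
    proof (cases "(s, y) \<in> {0..1} \<times> {-pi..pi}")
      case True
      then have "\<bar>Q s y\<bar> \<le> B" using B by auto
      then have "k s * \<bar>Q s y\<bar> \<le> k s * B" using k0[of s] by (rule mult_left_mono)
      then show ?thesis using True k0[of s] B0 Pair by (simp add: F_def G_def abs_mult mult.commute)
    qed (use Pair in \<open>simp add: F_def\<close>)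
  qed
  have Fi: "integrable (lborel \<Otimes>\<^sub>M lborel) F" by (rule Bochner_Integration.integrable_bound[OF Gi Fm]) (use FG in auto)
  have Qi: "set_integrable lborel {-pi..pi} (Q s)" if "s \<in> {0..1}" for s
    by (rule borel_integrable_atLeastAtMost') (rule continuous_on_section(2)[OF Q that])
  have 1: "(LINT y|lborel. F (s, y)) = indicator {0<..<x} s * ((x - s) powr (a - 1) * integral {-pi..pi} (Q s))" for s
  proof (cases "s \<in> {0<..<x}")
    case True
    then have s: "s \<in> {0..1}" using x by auto
    have "(LINT y|lborel. F (s, y)) = (LINT y|lborel. (x - s) powr (a - 1) * (indicator {-pi..pi} y *\<^sub>R Q s y))"
      using True s by (intro Bochner_Integration.integral_cong) (auto simp: F_def k_def indicator_def)
    also have "\<dots> = (x - s) powr (a - 1) * (LBINT y:{-pi..pi}. Q s y)" by (simp add: set_lebesgue_integral_def)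
    finally show ?thesis using True set_borel_integral_eq_integral(2)[OF Qi[OF s]] by simp
  qed (simp add: F_def k_def)
  have 2: "(LINT s|lborel. F (s, y)) = indicator {-pi..pi} y * (Gamma a * RL a (\<lambda>s. Q s y) x)" for y
  proof (cases "y \<in> {-pi..pi}")
    case True
    have "(LINT s|lborel. F (s, y)) = (LINT s|lborel. indicator {0<..<x} s *\<^sub>R ((x - s) powr (a - 1) * Q s y))"
      using True x by (intro Bochner_Integration.integral_cong) (auto simp: F_def k_def indicator_def)
    then show ?thesis using True a by (simp add: RL_def set_lebesgue_integral_def)
  next
    case False
    then have "F (s, y) = 0" for s by (simp add: F_def)
    then show ?thesis using False by simp
  qed
  have "integrable lborel (\<lambda>y. LINT s|lborel. F (s, y))"
    using lborel_pair.integrable_snd[of "\<lambda>s y. F (s, y)"] Fi by simp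
  then have si: "set_integrable lborel {-pi..pi} (\<lambda>y. Gamma a * RL a (\<lambda>s. Q s y) x)"
    unfolding 2 by (simp add: set_integrable_def)
  have "(LINT s|lborel. LINT y|lborel. F (s, y)) = (LINT y|lborel. LINT s|lborel. F (s, y))"
    using lborel_pair.Fubini_integral[of "\<lambda>s y. F (s, y)"] Fi by simp
  then have "(LBINT s:{0<..<x}. (x - s) powr (a - 1) * integral {-pi..pi} (Q s)) = (LBINT y:{-pi..pi}. Gamma a * RL a (\<lambda>s. Q s y) x)"
    unfolding 1 2 set_lebesgue_integral_def by simp
  also have "\<dots> = integral {-pi..pi} (\<lambda>y. Gamma a * RL a (\<lambda>s. Q s y) x)"
    by (rule set_borel_integral_eq_integral(2)[OF si])
  also have "\<dots> = Gamma a * integral {-pi..pi} (\<lambda>y. RL a (\<lambda>s. Q s y) x)" by (rule integral_mult_right)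
  finally show ?thesis using a by (simp add: RL_def)
qed

definition kap :: "nat \<Rightarrow> real" where "kap n = real (n div 2) + 1/2"
definition Yd :: "nat \<Rightarrow> real \<Rightarrow> real"
  where "Yd n y = (if even n then - kap n * sin (kap n * y) else kap n * cos (kap n * y))"

lemma Y_kap: "Y n y = (if even n then cos (kap n * y) else sin (kap n * y))"
  by (simp add: Y_def kap_def)

lemma Y_has_derivative: "(Y n has_real_derivative Yd n y) (at y within S)"
  by (cases "even n") (auto simp: Y_kap [abs_def] Yd_def intro!: derivative_eq_intros)

lemma Yd_has_derivative: "(Yd n has_real_derivative - (kap n)\<^sup>2 * Y n y) (at y within S)"
  by (cases "even n") (auto simp: Y_kap Yd_def [abs_def] power2_eq_square intro!: derivative_eq_intros)

lemma continuous_on_Yd [continuous_intros]: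
  fixes f :: "'a :: t2_space \<Rightarrow> real"
  assumes f: "continuous_on S f" shows "continuous_on S (\<lambda>x. Yd n (f x))"
proof -
  have "continuous_on S (\<lambda>x. d * cos (c * f x))" "continuous_on S (\<lambda>x. d * sin (c * f x))" for c d
    by (intro continuous_on_cos continuous_on_sin continuous_on_mult_left f)+
  from this(1)[of "kap n" "kap n"] this(2)[of "- kap n" "kap n"] show ?thesis
    by (cases "even n") (simp_all add: Yd_def)
qed

lemma Y_bounded: "\<bar>Y n y\<bar> \<le> 1"
  by (simp add: Y_def)

lemma kap_pos: "0 < kap n" by (simp add: kap_def)

lemma Yd_bounded: "\<bar>Yd n y\<bar> \<le> kap n"
  using kap_pos[of n] by (simp add: Yd_def abs_mult)

lemma Y_at_pi: "Y n (- pi) = (if even n then 1 else - 1) * Y n pi" "even n \<Longrightarrow> Y n pi = 0"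
    "Yd n (- pi) = (if even n then - 1 else 1) * Yd n pi" "odd n \<Longrightarrow> Yd n pi = 0"
proof -
  have "cos (kap n * pi) = 0" by (simp add: kap_def distrib_right cos_add)
  then show "even n \<Longrightarrow> Y n pi = 0" "odd n \<Longrightarrow> Yd n pi = 0" by (auto simp: Y_kap Yd_def)
  show "Y n (- pi) = (if even n then 1 else - 1) * Y n pi" "Yd n (- pi) = (if even n then - 1 else 1) * Yd n pi"
    by (simp_all add: Y_kap Yd_def)
qed

lemma mu_squared: "\<bar>\<epsilon>\<bar> < 1 \<Longrightarrow> (mu \<epsilon> c n)\<^sup>2 = (1 - (if even n then 1 else - 1) * \<epsilon>) * (kap n)\<^sup>2 + c\<^sup>2"
  by (simp add: mu_def eigenval_def kap_def)

lemma mu_pos: "\<bar>\<epsilon>\<bar> < 1 \<Longrightarrow> 0 < mu \<epsilon> c n"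
  using kap_pos[of n] by (simp add: mu_def eigenval_def kap_def add_pos_nonneg)

definition mode :: "(real \<Rightarrow> real \<Rightarrow> real) \<Rightarrow> nat \<Rightarrow> real \<Rightarrow> real"
  where "mode v n x = integral {-pi..pi} (\<lambda>y. Y n y * v x y)"

text \<open>A \<open>y\<close>-primitive of \<open>Y n y * h0 s y\<close> that is continuous up to the boundary of the rectangle.\<close>

definition prim :: "real \<Rightarrow> real \<Rightarrow> (real \<Rightarrow> real \<Rightarrow> real) \<Rightarrow> nat \<Rightarrow> real \<Rightarrow> real \<Rightarrow> real"
  where "prim \<epsilon> c v n s y = - Y n y * partial_y v s y - \<epsilon> * Y n y * partial_y v s (- y) + Yd n y * v s y - \<epsilon> * Yd n y * v s (- y)
    + integral {-pi..y} (\<lambda>t. ((kap n)\<^sup>2 + c\<^sup>2) * (Y n t * v s t) - \<epsilon> * (kap n)\<^sup>2 * (Y n t * v s (- t)))"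

context
  fixes \<alpha> \<epsilon> c :: real and \<phi> \<psi> :: "real \<Rightarrow> real" and v :: "real \<Rightarrow> real \<Rightarrow> real"
  assumes \<alpha>: "0 < \<alpha>" "\<alpha> \<le> 1" and \<epsilon>: "\<bar>\<epsilon>\<bar> < 1" and sol: "problem_solution \<alpha> \<epsilon> c \<phi> \<psi> v"
begin

abbreviation (input) "h0 \<equiv> caputo_x \<alpha> (caputo_x \<alpha> v)"
abbreviation (input) "p \<equiv> partial_y v"

lemma sol_continuous: "continuous_on ({0..1} \<times> {-pi..pi}) (\<lambda>(x, y). v x y)"
  using sol by (simp add: problem_solution_def regular_solution_def closure_Omega)

lemma sol_partial_y_continuous: "continuous_on ({0..1} \<times> {-pi..pi}) (\<lambda>(x, y). p x y)"
  using sol by (simp add: problem_solution_def closure_Omega)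

lemma sol_partial_y: "x \<in> {0..1} \<Longrightarrow> y \<in> {-pi..pi} \<Longrightarrow> (v x has_real_derivative p x y) (at y within {-pi..pi})"
  using sol by (auto simp: problem_solution_def closure_Omega partial_y_def deriv_within_def
      has_real_derivative_iff_has_vector_derivative differentiable_def
      intro!: vector_derivative_works[THEN iffD1])

lemma sol_boundary: "x \<in> {0..1} \<Longrightarrow> v x (- pi) = - v x pi" "x \<in> {0..1} \<Longrightarrow> p x (- pi) = - p x pi"
    "y \<in> {-pi..pi} \<Longrightarrow> v 0 y = \<phi> y" "y \<in> {-pi..pi} \<Longrightarrow> v 1 y = \<psi> y"
  using sol by (auto simp: problem_solution_def)

text \<open>\<open>partial_yy\<close> differentiates \<open>deriv\<close>, while
  \<open>partial_y\<close> is the derivative within the closed interval; the two first derivatives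
  agree at interior points.\<close>

lemma sol_partial_yy:
  assumes x: "x \<in> {0<..<1}" and y: "y \<in> {-pi<..<pi}"
  shows "(p x has_real_derivative partial_yy v x y) (at y)"
proof -
  have eq: "deriv (v x) z = p x z" if z: "z \<in> {-pi<..<pi}" for z
  proof -
    have "(v x has_real_derivative p x z) (at z within {-pi..pi})" using sol_partial_y[of x z] x z by auto
    then have "(v x has_real_derivative p x z) (at z)" using z at_within_interior[of z "{-pi..pi}"] by simp
    then show ?thesis by (rule DERIV_imp_deriv)
  qed
  have "deriv (v x) differentiable (at y)"
    using sol x y by (auto simp: problem_solution_def regular_solution_def Omega_def)
  then have "(deriv (v x) has_real_derivative partial_yy v x y) (at y)"
    by (simp add: partial_yy_def DERIV_deriv_iff_real_differentiable)
  then show ?thesis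
    by (rule has_field_derivative_transform_within_open[where S = "{-pi<..<pi}"]) (use y eq in auto)
qed

lemma sol_equation:
  "x \<in> {0<..<1} \<Longrightarrow> y \<in> {-pi<..<pi} \<Longrightarrow> h0 x y = - partial_yy v x y + \<epsilon> * partial_yy v x (- y) + c\<^sup>2 * v x y"
proof -
  assume "x \<in> {0<..<1}" "y \<in> {-pi<..<pi}"
  then have xy: "(x, y) \<in> Omega" by (simp add: Omega_def)
  have "\<forall>(x, y)\<in>Omega. h0 x y + partial_yy v x y - \<epsilon> * partial_yy v x (- y) - c\<^sup>2 * v x y = 0"
    using sol unfolding problem_solution_def regular_solution_def by blast
  from bspec[OF this xy] show ?thesis by simp
qed

lemma sol_h_continuous: "continuous_on ({0<..<1} \<times> {-pi<..<pi}) (\<lambda>(x, y). h0 x y)"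
  using sol by (simp add: problem_solution_def regular_solution_def Omega_def)

lemma sol_has_caputo:
  "x \<in> {0<..<1} \<Longrightarrow> y \<in> {-pi<..<pi} \<Longrightarrow> has_caputo \<alpha> (\<lambda>s. v s y) x"
  "x \<in> {0<..<1} \<Longrightarrow> y \<in> {-pi<..<pi} \<Longrightarrow> has_caputo \<alpha> (\<lambda>s. caputo_x \<alpha> v s y) x"
  using sol by (auto simp: problem_solution_def regular_solution_def Omega_def has_caputo_x_def)

lemma mode_continuous: "continuous_on {0..1} (mode v n)"
proof -
  have "continuous_on ({0..1} \<times> cbox (-pi) pi) (\<lambda>(x, y). Y n y * v x y)"
    using sol_continuous by (auto simp: case_prod_unfold cbox_interval intro!: continuous_intros)
  from integral_continuous_on_param[OF this] show ?thesis by (simp add: mode_def [abs_def] cbox_interval)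
qed

lemma reflect_continuous:
  assumes "continuous_on ({0..1} \<times> {-pi..pi}) (\<lambda>(x, y). f x y)"
  shows "continuous_on ({0..1} \<times> {-pi..pi}) (\<lambda>(x, y). f x (- y))"
proof -
  have c: "continuous_on ({0..1} \<times> {-pi..pi}) (\<lambda>p. (fst p, - snd p))"
    by (intro continuous_intros)
  have s: "(\<lambda>p. (fst p, - snd p)) ` ({0..1} \<times> {-pi..pi}) \<subseteq> {0..1} \<times> {-pi..pi}" by auto
  from continuous_on_compose2[OF assms c s] show ?thesis by (simp add: case_prod_unfold)
qed

lemma prim_integrand_continuous:
  "continuous_on ({0..1} \<times> {-pi..pi}) (\<lambda>(s, t). ((kap n)\<^sup>2 + c\<^sup>2) * (Y n t * v s t) - \<epsilon> * (kap n)\<^sup>2 * (Y n t * v s (- t)))"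
  using sol_continuous reflect_continuous[OF sol_continuous]
  by (auto simp: case_prod_unfold intro!: continuous_intros)

lemma prim_continuous: "continuous_on ({0..1} \<times> {-pi..pi}) (\<lambda>(s, y). prim \<epsilon> c v n s y)"
proof -
  let ?f = "\<lambda>s t. ((kap n)\<^sup>2 + c\<^sup>2) * (Y n t * v s t) - \<epsilon> * (kap n)\<^sup>2 * (Y n t * v s (- t))"
  note fc = prim_integrand_continuous[of n]
  obtain K where K: "0 \<le> K" "\<And>s t. s \<in> {0..1} \<Longrightarrow> t \<in> {-pi..pi} \<Longrightarrow> \<bar>?f s t\<bar> \<le> K"
    using continuous_on_compact_bounded2[OF fc compact_Icc compact_Icc] by blast
  have "continuous_on ({0..1} \<times> {-pi..pi}) (\<lambda>(s, y). integral {-pi..y} (?f s))"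
  proof (rule continuous_on_Lipschitz_snd[where L = K])
    fix y assume y: "y \<in> {-pi..pi}"
    have "continuous_on ({0..1} \<times> cbox (-pi) y) (\<lambda>(s, t). ?f s t)"
      using fc by (rule continuous_on_subset) (use y in auto)
    from integral_continuous_on_param[OF this] show "continuous_on {0..1} (\<lambda>s. integral {-pi..y} (?f s))"
      by (simp add: cbox_interval)
  next
    fix s y z :: real assume s: "s \<in> {0..1}" and yz: "y \<in> {-pi..pi}" "z \<in> {-pi..pi}"
    have *: "\<bar>integral {-pi..b} (?f s) - integral {-pi..a} (?f s)\<bar> \<le> K * (b - a)" if ab: "a \<le> b" "a \<in> {-pi..pi}" "b \<in> {-pi..pi}" for a b
    proof -
      have cs: "continuous_on {-pi..pi} (?f s)" by (rule continuous_on_section(2)[OF fc s])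
      have "?f s integrable_on {-pi..b}"
        by (intro integrable_continuous_real continuous_on_subset[OF cs]) (use ab in auto)
      then have "integral {-pi..b} (?f s) - integral {-pi..a} (?f s) = integral {a..b} (?f s)"
        using Henstock_Kurzweil_Integration.integral_combine[of "-pi" a b "?f s"] ab by auto
      also have "norm \<dots> \<le> K * (b - a)"
        by (intro integral_bound continuous_on_subset[OF cs] ab) (use K(2)[OF s] ab in auto)
      finally show ?thesis by simp
    qed
    show "\<bar>integral {-pi..y} (?f s) - integral {-pi..z} (?f s)\<bar> \<le> K * \<bar>y - z\<bar>"
      using *[of y z] *[of z y] yz by (cases "y \<le> z") (auto simp: abs_minus_commute)
  qed (rule K(1))
  then show ?thesis
    using sol_continuous reflect_continuous[OF sol_continuous] sol_partial_y_continuous reflect_continuous[OF sol_partial_y_continuous]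
    unfolding prim_def by (auto simp: case_prod_unfold intro!: continuous_intros)
qed

text \<open>The equation expresses the double Caputo derivative through v_yy at y and at -y.
  Integrating \<open>Y n\<close> times these by parts twice yields the four products in
  \<open>prim\<close> and, under the integral, terms free of derivatives of
  \<open>v\<close>.\<close>

lemma prim_has_derivative:
  assumes s: "s \<in> {0<..<1}" and y: "y \<in> {-pi<..<pi}"
  shows "(prim \<epsilon> c v n s has_real_derivative Y n y * h0 s y) (at y)"
proof -
  let ?f = "\<lambda>t. ((kap n)\<^sup>2 + c\<^sup>2) * (Y n t * v s t) - \<epsilon> * (kap n)\<^sup>2 * (Y n t * v s (- t))"
  have s1: "s \<in> {0..1}" using s by auto
  have dv: "(v s has_real_derivative p s z) (at z)" if "z \<in> {-pi<..<pi}" for z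
    using sol_partial_y[OF s1, of z] that at_within_interior[of z "{-pi..pi}"] by simp
  have y': "- y \<in> {-pi<..<pi}" using y by auto
  have dvr: "((\<lambda>y. v s (- y)) has_real_derivative - p s (- y)) (at y)"
    using DERIV_chain2[OF dv[OF y'] DERIV_minus[OF DERIV_ident]] by simp
  have dpr: "((\<lambda>y. p s (- y)) has_real_derivative - partial_yy v s (- y)) (at y)"
    using DERIV_chain2[OF sol_partial_yy[OF s y'] DERIV_minus[OF DERIV_ident]] by simp
  have fc: "continuous_on {-pi..pi} ?f" by (rule continuous_on_section(2)[OF prim_integrand_continuous s1])
  have "((\<lambda>y. integral {-pi..y} ?f) has_real_derivative ?f y) (at y within {-pi..pi})"
    using integral_has_vector_derivative[OF fc, of y] y by (simp add: has_real_derivative_iff_has_vector_derivative)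
  then have di: "((\<lambda>y. integral {-pi..y} ?f) has_real_derivative ?f y) (at y)"
    using y at_within_interior[of y "{-pi..pi}"] by simp
  have "(prim \<epsilon> c v n s has_real_derivative
     - (Yd n y * p s y + Y n y * partial_yy v s y)
     - \<epsilon> * (Yd n y * p s (- y) + Y n y * (- partial_yy v s (- y)))
     + (- (kap n)\<^sup>2 * Y n y * v s y + Yd n y * p s y)
     - \<epsilon> * (- (kap n)\<^sup>2 * Y n y * v s (- y) + Yd n y * (- p s (- y))) + ?f y) (at y)"
    unfolding prim_def [abs_def]
    by (rule derivative_eq_intros Y_has_derivative Yd_has_derivative dv[OF y] dvr dpr di sol_partial_yy[OF s y] refl | simp add: algebra_simps)+
  then show ?thesis unfolding sol_equation[OF s y] by (simp add: algebra_simps)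
qed

text \<open>A product of two antiperiodic functions takes the same value at both ends, so only the
  integral survives. There reflection multiplies \<open>Y n\<close> by a sign sigma, and the factor
  becomes (1 - sigma epsilon) kap^2 + c^2 = mu^2.\<close>

lemma prim_boundary: "s \<in> {0..1} \<Longrightarrow> prim \<epsilon> c v n s pi - prim \<epsilon> c v n s (- pi) = (mu \<epsilon> c n)\<^sup>2 * mode v n s"
proof -
  assume s: "s \<in> {0..1}"
  have vc: "continuous_on {-pi..pi} (v s)" "continuous_on {-pi..pi} (\<lambda>y. v s (- y))"
    using continuous_on_section(2)[OF sol_continuous s] continuous_on_section(2)[OF reflect_continuous[OF sol_continuous] s] by auto
  have "integral {-pi..pi} (\<lambda>t. Y n t * v s (- t)) = integral {-pi..pi} (\<lambda>t. Y n (- t) * v s t)"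
    using integral_reflect_pi[of "\<lambda>t. Y n (- t) * v s t"] by simp
  also have "\<dots> = integral {-pi..pi} (\<lambda>t. (if even n then 1 else - 1) * (Y n t * v s t))"
    by (simp add: Y_reflect)
  also have "\<dots> = (if even n then 1 else - 1) * mode v n s" unfolding mode_def by (rule integral_mult_right)
  finally have r: "integral {-pi..pi} (\<lambda>t. Y n t * v s (- t)) = (if even n then 1 else - 1) * mode v n s" .
  have "integral {-pi..pi} (\<lambda>t. ((kap n)\<^sup>2 + c\<^sup>2) * (Y n t * v s t) - \<epsilon> * (kap n)\<^sup>2 * (Y n t * v s (- t))) =
     integral {-pi..pi} (\<lambda>t. ((kap n)\<^sup>2 + c\<^sup>2) * (Y n t * v s t)) - integral {-pi..pi} (\<lambda>t. \<epsilon> * (kap n)\<^sup>2 * (Y n t * v s (- t)))"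
    by (intro integral_diff integrable_continuous_real continuous_intros vc)
  also have "\<dots> = ((kap n)\<^sup>2 + c\<^sup>2) * mode v n s - \<epsilon> * (kap n)\<^sup>2 * ((if even n then 1 else - 1) * mode v n s)"
    unfolding integral_mult_right r mode_def ..
  also have "\<dots> = (mu \<epsilon> c n)\<^sup>2 * mode v n s" unfolding mu_squared[OF \<epsilon>] by (simp add: algebra_simps)
  finally show ?thesis
    unfolding prim_def using sol_boundary(1,2)[OF s] Y_at_pi[of n] by (cases "even n") (simp_all add: algebra_simps)
qed

end

section \<open>From the equation in the rectangle to an equation for each mode\<close>

lemma bounded_continuous_integrable:
  fixes f :: "real \<Rightarrow> real"
  assumes "0 < a" "x \<in> {0<..1}" "continuous_on {0..1} f"
  shows "set_integrable lborel {0<..<x} (\<lambda>s. (x - s) powr (a - 1) * f s)"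
proof -
  have "bounded (f ` {0..1})" by (intro compact_imp_bounded compact_continuous_image assms compact_Icc)
  then obtain K where "\<forall>z\<in>f ` {0..1}. norm z \<le> K" unfolding bounded_iff by blast
  then have K: "\<bar>f s\<bar> \<le> K" if "s \<in> {0..1}" for s using that by auto
  show ?thesis
  proof (rule RL_bounded(1)[of _ _ _ K])
    show "set_borel_measurable lborel {0<..<x} f"
      by (rule set_borel_measurable_continuous, rule continuous_on_subset[OF assms(3)]) (use assms in auto)
  qed (use assms K in auto)
qed

lemma continuous_integrable:
  fixes f :: "real \<Rightarrow> real"
  assumes "x \<in> {0<..1}" "continuous_on {0..1} f"
  shows "set_integrable lborel {0<..<x} f"
proof -
  have "set_integrable lborel {0<..<x} (\<lambda>s. (x - s) powr (1 - 1) * f s)"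
    by (rule bounded_continuous_integrable) (use assms in auto)
  also have "?this \<longleftrightarrow> ?thesis" by (rule set_integrable_cong) auto
  finally show ?thesis .
qed

lemma RL_11_eq_RL_2: "0 < x \<Longrightarrow> set_integrable lborel {0<..<x} f \<Longrightarrow> RL 1 (RL 1 f) x = RL 2 f x"
  using RL_semigroup(1)[of 1 1 x f] by simp

lemma integral_symmetric_tendsto:
  fixes f :: "real \<Rightarrow> real"
  assumes f: "continuous_on {-pi..pi} f" and e: "\<And>k. 0 < e k" "\<And>k. e k < pi" "e \<longlonglongrightarrow> pi"
  shows "(\<lambda>k. integral {- e k..e k} f) \<longlonglongrightarrow> integral {-pi..pi} f"
proof -
  have e': "e k \<in> {-pi..pi}" "- e k \<in> {-pi..pi}" for k using e(1)[of k] e(2)[of k] by auto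
  have fi: "f integrable_on {-pi..pi}" by (rule integrable_continuous_real[OF f])
  have F: "continuous_on {-pi..pi} (\<lambda>y. integral {-pi..y} f)" by (rule indefinite_integral_continuous_1[OF fi])
  have "(\<lambda>k. integral {-pi..e k} f) \<longlonglongrightarrow> integral {-pi..pi} f"
    by (rule continuous_on_tendsto_compose[OF F e(3)]) (use e' in simp_all)
  moreover have "(\<lambda>k. integral {-pi..- e k} f) \<longlonglongrightarrow> integral {-pi..-pi} f"
    by (rule continuous_on_tendsto_compose[OF F tendsto_minus[OF e(3)]]) (use e' in simp_all)
  ultimately have "(\<lambda>k. integral {-pi..e k} f - integral {-pi..- e k} f) \<longlonglongrightarrow> integral {-pi..pi} f - integral {-pi..-pi} f"
    by (rule tendsto_diff)
  moreover have "integral {-pi..e k} f - integral {-pi..- e k} f = integral {- e k..e k} f" for k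
  proof -
    have "f integrable_on {-pi..e k}" by (rule integrable_subinterval_real[OF fi]) (use e in \<open>auto intro: less_imp_le\<close>)
    then show ?thesis
      using Henstock_Kurzweil_Integration.integral_combine[of "-pi" "- e k" "e k" f] e(1)[of k] e(2)[of k] by auto
  qed
  ultimately show ?thesis by simp
qed

lemma RL_11_continuous_param:
  fixes N :: "real \<Rightarrow> real \<Rightarrow> real"
  assumes N: "continuous_on ({0..1} \<times> {-pi..pi}) (\<lambda>(s, y). N s y)" and x: "x \<in> {0<..1}"
  shows "continuous_on {-pi..pi} (\<lambda>y. RL 1 (RL 1 (\<lambda>s. N s y)) x)"
  unfolding continuous_on_iff
proof (intro ballI allI impI)
  fix y0 e :: real assume y0: "y0 \<in> {-pi..pi}" and e: "0 < e"
  have "uniformly_continuous_on ({0..1} \<times> {-pi..pi}) (\<lambda>(s, y). N s y)"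
    by (rule compact_uniformly_continuous[OF N]) (intro compact_Times compact_Icc)
  then obtain d where d: "0 < d" "\<And>p q. p \<in> {0..1} \<times> {-pi..pi} \<Longrightarrow> q \<in> {0..1} \<times> {-pi..pi} \<Longrightarrow> dist q p < d \<Longrightarrow>
      dist ((\<lambda>(s, y). N s y) q) ((\<lambda>(s, y). N s y) p) < e / 2"
    using e unfolding uniformly_continuous_on_def by (meson half_gt_zero)
  show "\<exists>d>0. \<forall>y\<in>{-pi..pi}. dist y y0 < d \<longrightarrow> dist (RL 1 (RL 1 (\<lambda>s. N s y)) x) (RL 1 (RL 1 (\<lambda>s. N s y0)) x) < e"
  proof (intro exI[of _ d] conjI ballI impI d(1))
    fix y assume y: "y \<in> {-pi..pi}" "dist y y0 < d"
    have c: "continuous_on {0..1} (\<lambda>s. N s y)" "continuous_on {0..1} (\<lambda>s. N s y0)"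
      using continuous_on_section(1)[OF N] y y0 by auto
    have "\<bar>RL 1 (RL 1 (\<lambda>s. N s y - N s y0)) x\<bar> \<le> e / 2 * x\<^sup>2"
    proof (rule continuous_RL_11_bounds(3))
      show "continuous_on {0..1} (\<lambda>s. N s y - N s y0)" by (intro continuous_intros c)
      fix s :: real assume s: "s \<in> {0..1}"
      have "dist (s, y) (s, y0) < d" using y(2) by (simp add: dist_Pair_Pair)
      then show "\<bar>N s y - N s y0\<bar> \<le> e / 2"
        using d(2)[of "(s, y0)" "(s, y)"] s y y0 by (simp add: dist_real_def less_imp_le)
    qed (rule x)
    also have "\<dots> < e"
    proof -
      have "x\<^sup>2 \<le> 1" using x by (simp add: power_le_one)
      then have "e / 2 * x\<^sup>2 \<le> e / 2 * 1" using e by (intro mult_left_mono) auto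
      then show ?thesis using e by simp
    qed
    finally show "dist (RL 1 (RL 1 (\<lambda>s. N s y)) x) (RL 1 (RL 1 (\<lambda>s. N s y0)) x) < e"
      unfolding RL_11_diff[OF c x] by (simp add: dist_real_def)
  qed
qed

context
  fixes \<alpha> \<epsilon> c :: real and \<phi> \<psi> :: "real \<Rightarrow> real" and v :: "real \<Rightarrow> real \<Rightarrow> real"
  assumes \<alpha>: "0 < \<alpha>" "\<alpha> \<le> 1" and \<epsilon>: "\<bar>\<epsilon>\<bar> < 1" and sol: "problem_solution \<alpha> \<epsilon> c \<phi> \<psi> v"
begin

lemmas vc = sol_continuous[OF \<alpha> \<epsilon> sol]

text \<open>\<open>caputo_integrated\<close> is used twice: with g = D v and h = D D v it gives J^(1
  - alpha) (v - v 0) = J g and J^(1 - alpha) (g - g0) = J h. Applying J^(1 - alpha) to the first and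
  commuting yields the formula. \<open>G\<close> carries the limit g0 of g at 0, about whose
  dependence on y nothing is known at this stage.\<close>

lemma sol_representation:
  assumes \<alpha>1: "\<alpha> < 1" and y: "y \<in> {-pi<..<pi}"
  shows "\<exists>G. \<forall>x\<in>{0<..<1}. set_integrable lborel {0<..<x} (\<lambda>s. caputo_x \<alpha> (caputo_x \<alpha> v) s y) \<and>
    RL (2 - 2 * \<alpha>) (\<lambda>s. v s y - v 0 y) x = G * x powr (2 - \<alpha>) + RL 1 (RL 1 (\<lambda>s. caputo_x \<alpha> (caputo_x \<alpha> v) s y)) x"
proof -
  define f where "f s = v s y" for s
  define g where "g s = caputo_x \<alpha> v s y" for s
  define h where "h s = caputo_x \<alpha> (caputo_x \<alpha> v) s y" for s
  have gcap: "caputo \<alpha> f = g" and hcap: "caputo \<alpha> g = h"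
    by (simp_all add: fun_eq_iff f_def [abs_def] g_def [abs_def] h_def caputo_x_def [abs_def])
  have fc: "continuous_on {0..1} f" unfolding f_def using continuous_on_section(1)[OF vc, of y] y by auto
  obtain f0 where f0: "(f \<longlongrightarrow> f0) (at_right 0)"
    "\<And>x. x \<in> {0<..<1} \<Longrightarrow> set_integrable lborel {0<..<x} (\<lambda>s. (x - s) powr (- \<alpha>) * (f s - f0))"
    "\<And>x. x \<in> {0<..<1} \<Longrightarrow> set_integrable lborel {0<..<x} g"
    "\<And>x. x \<in> {0<..<1} \<Longrightarrow> RL (1 - \<alpha>) (\<lambda>s. f s - f0) x = RL 1 g x"
    using caputo_integrated[OF \<alpha>(1) \<alpha>1, of 1 f] sol_has_caputo(1)[OF \<alpha> \<epsilon> sol _ y] unfolding gcap f_def by auto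
  obtain g0 where g0:
    "\<And>x. x \<in> {0<..<1} \<Longrightarrow> set_integrable lborel {0<..<x} (\<lambda>s. (x - s) powr (- \<alpha>) * (g s - g0))"
    "\<And>x. x \<in> {0<..<1} \<Longrightarrow> set_integrable lborel {0<..<x} h"
    "\<And>x. x \<in> {0<..<1} \<Longrightarrow> RL (1 - \<alpha>) (\<lambda>s. g s - g0) x = RL 1 h x"
  proof -
    have hg: "has_caputo \<alpha> g x" if "x \<in> {0<..<1}" for x
      unfolding g_def by (rule sol_has_caputo(2)[OF \<alpha> \<epsilon> sol that y])
    show thesis
    proof (rule caputo_integrated[OF \<alpha>(1) \<alpha>1 zero_less_one hg])
      fix g1
      assume "\<And>x. x \<in> {0<..<1} \<Longrightarrow> set_integrable lborel {0<..<x} (\<lambda>s. (x - s) powr (- \<alpha>) * (g s - g1))"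
        "\<And>x. x \<in> {0<..<1} \<Longrightarrow> set_integrable lborel {0<..<x} (caputo \<alpha> g)"
        "\<And>x. x \<in> {0<..<1} \<Longrightarrow> RL (1 - \<alpha>) (\<lambda>s. g s - g1) x = RL 1 (caputo \<alpha> g) x"
      then show thesis unfolding hcap by (rule that)
    qed
  qed
  \<comment> \<open>Continuity of \<open>v\<close> on the closed rectangle identifies the limit at 0
    with the boundary value.\<close>
  have "(f \<longlongrightarrow> f 0) (at 0 within {0..1})" using fc by (auto simp: continuous_on_def)
  then have "(f \<longlongrightarrow> f 0) (at_right 0)" by (simp add: at_within_Icc_at_right)
  then have f00: "f0 = f 0" using f0(1) tendsto_unique[of "at_right 0"] by (metis trivial_limit_at_right_real)
  have a1: "0 < 1 - \<alpha>" using \<alpha>1 by simp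
  have R: "RL (2 - 2 * \<alpha>) (\<lambda>s. f s - f 0) x = g0 / (Gamma (2 - \<alpha>) * (2 - \<alpha>)) * x powr (2 - \<alpha>) + RL 1 (RL 1 h) x" if x: "x \<in> {0<..<1}" for x
  proof -
    have x0: "0 < x" using x by simp
    have "RL (2 - 2 * \<alpha>) (\<lambda>s. f s - f 0) x = RL (1 - \<alpha>) (RL (1 - \<alpha>) (\<lambda>s. f s - f 0)) x"
    proof -
      have "set_integrable lborel {0<..<x} (\<lambda>s. (x - s) powr ((1 - \<alpha>) + (1 - \<alpha>) - 1) * (f s - f 0))"
        by (rule bounded_continuous_integrable) (use a1 x in \<open>auto intro!: continuous_intros fc\<close>)
      from RL_semigroup_aux(1)[OF a1 a1 x0 this] show ?thesis by (simp add: algebra_simps)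
    qed
    also have "\<dots> = RL (1 - \<alpha>) (RL 1 g) x"
      by (rule RL_cong) (use f0(4) x f00 in auto)
    also have "\<dots> = RL (1 - \<alpha> + 1) g x"
      using a1 x0 f0(3)[OF x] by (intro RL_semigroup(1)) auto
    also have "\<dots> = RL 1 (RL (1 - \<alpha>) g) x"
      using a1 x0 f0(3)[OF x] by (subst RL_semigroup(1)) (auto simp: add.commute)
    also have "\<dots> = RL 1 (\<lambda>s. RL 1 h s + g0 * (s powr (2 - \<alpha> - 1) / Gamma (2 - \<alpha>))) x"
    proof (rule RL_cong)
      fix s assume "s \<in> {0<..<x}"
      then have s: "s \<in> {0<..<1}" using x by auto
      have "RL (1 - \<alpha>) g s = RL (1 - \<alpha>) (\<lambda>r. (g r - g0) + g0 * 1) s" by simp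
      also have "\<dots> = RL (1 - \<alpha>) (\<lambda>r. g r - g0) s + RL (1 - \<alpha>) (\<lambda>r. g0 * 1) s"
        using g0(1)[OF s] RL_one(2)[OF a1, of s] s by (intro RL_add) auto
      also have "\<dots> = RL 1 h s + g0 * (s powr (2 - \<alpha> - 1) / Gamma (2 - \<alpha>))"
        unfolding RL_cmult using g0(3)[OF s] RL_one(1)[OF a1, of s] s by simp
      finally show "RL (1 - \<alpha>) g s = RL 1 h s + g0 * (s powr (2 - \<alpha> - 1) / Gamma (2 - \<alpha>))" .
    qed
    also have "\<dots> = RL 1 (RL 1 h) x + RL 1 (\<lambda>s. g0 / Gamma (2 - \<alpha>) * s powr (2 - \<alpha> - 1)) x"
    proof -
      have "set_integrable lborel {0<..<x} (\<lambda>s. (x - s) powr (1 - 1) * RL 1 h s)"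
        using x0 g0(2)[OF x] by (intro RL_semigroup(2)) auto
      moreover have "set_integrable lborel {0<..<x} (\<lambda>s. g0 / Gamma (2 - \<alpha>) * ((x - s) powr (1 - 1) * s powr (2 - \<alpha> - 1)))"
        using \<alpha>1 x0 by (intro set_integrable_mult_right RL_powr(2)) auto
      ultimately show ?thesis by (subst RL_add [symmetric]) (auto simp: mult_ac)
    qed
    also have "RL 1 (\<lambda>s. g0 / Gamma (2 - \<alpha>) * s powr (2 - \<alpha> - 1)) x = g0 / Gamma (2 - \<alpha>) * (Gamma (2 - \<alpha>) / Gamma (1 + (2 - \<alpha>)) * x powr (1 + (2 - \<alpha>) - 1))"
      unfolding RL_cmult using \<alpha>1 x0 by (subst RL_powr(1)) auto
    also have "Gamma (1 + (2 - \<alpha>)) = (2 - \<alpha>) * Gamma (2 - \<alpha>)"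
    proof -
      have "2 - \<alpha> \<notin> \<int>\<^sub>\<le>\<^sub>0" using nonpos_Ints_nonpos[of "2 - \<alpha>"] \<alpha>1 by force
      then show ?thesis using Gamma_plus1[of "2 - \<alpha>"] by (simp add: add.commute)
    qed
    finally show ?thesis using \<alpha>1 by (simp add: mult_ac)
  qed
  then show ?thesis using g0(2) unfolding f_def h_def by blast
qed

text \<open>\<open>layer_identity\<close> is applied to \<open>Y n\<close> times the representation
  on the layers [-e k, e k], since the double Caputo derivative is only controlled inside the
  rectangle. As e k tends to pi all other terms converge, so the constants \<open>\<gamma> k\<close>
  do too, although \<open>G0\<close> is not controlled near the boundary.\<close>

lemma mode_fractional:
  assumes \<alpha>1: "\<alpha> < 1"
  shows "\<exists>\<gamma>. \<forall>x\<in>{0<..<1}. RL (2 - 2 * \<alpha>) (\<lambda>s. mode v n s - mode v n 0) x =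
    \<gamma> * x powr (2 - \<alpha>) + (mu \<epsilon> c n)\<^sup>2 * RL 1 (RL 1 (mode v n)) x"
proof -
  define h where "h s y = caputo_x \<alpha> (caputo_x \<alpha> v) s y" for s y
  define R0 where "R0 x y = RL (2 - 2 * \<alpha>) (\<lambda>s. v s y - v 0 y) x" for x y
  obtain G0 where G0: "\<And>x y. y \<in> {-pi<..<pi} \<Longrightarrow> x \<in> {0<..<1} \<Longrightarrow> set_integrable lborel {0<..<x} (\<lambda>s. h s y)"
     "\<And>x y. y \<in> {-pi<..<pi} \<Longrightarrow> x \<in> {0<..<1} \<Longrightarrow> R0 x y = G0 y * x powr (2 - \<alpha>) + RL 1 (RL 1 (\<lambda>s. h s y)) x"
    using sol_representation[OF \<alpha>1] unfolding h_def R0_def by metis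
  define N where "N = prim \<epsilon> c v n"
  note Nc = prim_continuous[OF \<alpha> \<epsilon> sol, of n, folded N_def]
  have a2: "0 < 2 - 2 * \<alpha>" using \<alpha>1 by simp
  define \<Gamma> where "\<Gamma> = Gamma (2 - 2 * \<alpha> + 1)"
  have \<Gamma>: "0 < \<Gamma>" unfolding \<Gamma>_def using a2 by (intro Gamma_real_pos) simp
  obtain B where B: "0 \<le> B" "\<And>x y. x \<in> {0..1} \<Longrightarrow> y \<in> {-pi..pi} \<Longrightarrow> \<bar>v x y\<bar> \<le> B"
    using continuous_on_compact_bounded2[OF vc compact_Icc compact_Icc] by blast
  obtain L where L: "0 \<le> L" "\<And>x y. x \<in> {0..1} \<Longrightarrow> y \<in> {-pi..pi} \<Longrightarrow> \<bar>partial_y v x y\<bar> \<le> L"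
    using continuous_on_compact_bounded2[OF sol_partial_y_continuous[OF \<alpha> \<epsilon> sol] compact_Icc compact_Icc] by blast
  have vL: "\<bar>v s y - v s z\<bar> \<le> L * \<bar>y - z\<bar>" if s: "s \<in> {0..1}" and yz: "y \<in> {-pi..pi}" "z \<in> {-pi..pi}" for s y z
  proof -
    have "norm (v s y - v s z) \<le> L * norm (y - z)"
      by (rule field_differentiable_bound[OF convex_real_interval(5)[of "-pi" pi] sol_partial_y[OF \<alpha> \<epsilon> sol s]])
        (use L(2)[OF s] yz in auto)
    then show ?thesis by simp
  qed
  have v0c: "continuous_on {0..1} (\<lambda>s. v s y - v 0 y)" if "y \<in> {-pi..pi}" for y
    using continuous_on_section(1)[OF vc that] by (intro continuous_intros)
  have meas: "set_borel_measurable lborel {0<..<x} f" if "continuous_on {0..1} f" "x \<in> {0<..<1}" for f :: "real \<Rightarrow> real" and x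
    by (rule set_borel_measurable_continuous, rule continuous_on_subset[OF that(1)]) (use that in auto)
  have R0b: "\<bar>R0 x y\<bar> \<le> 2 * B / \<Gamma> * x powr (2 - 2 * \<alpha>)" if x: "x \<in> {0<..<1}" and y: "y \<in> {-pi..pi}" for x y
  proof -
    have "\<bar>v s y - v 0 y\<bar> \<le> 2 * B" if "s \<in> {0<..<x}" for s
      using B(2)[of s y] B(2)[of 0 y] that x y by auto
    then have "\<bar>R0 x y\<bar> \<le> 2 * B * x powr (2 - 2 * \<alpha>) / Gamma (2 - 2 * \<alpha> + 1)"
      unfolding R0_def using x by (intro RL_bounded(2) a2 meas v0c y) auto
    then show ?thesis by (simp add: \<Gamma>_def)
  qed
  have R0L: "\<bar>R0 x y - R0 x z\<bar> \<le> 2 * L / \<Gamma> * \<bar>y - z\<bar> * x powr (2 - 2 * \<alpha>)" if x: "x \<in> {0<..<1}" and yz: "y \<in> {-pi..pi}" "z \<in> {-pi..pi}" for x y z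
  proof -
    have "R0 x y - R0 x z = RL (2 - 2 * \<alpha>) (\<lambda>s. (v s y - v 0 y) - (v s z - v 0 z)) x"
      unfolding R0_def using x by (intro RL_diff [symmetric] bounded_continuous_integrable a2 v0c yz) auto
    also have "\<bar>\<dots>\<bar> \<le> 2 * L * \<bar>y - z\<bar> * x powr (2 - 2 * \<alpha>) / Gamma (2 - 2 * \<alpha> + 1)"
    proof (rule RL_bounded(2)[OF a2])
      show "set_borel_measurable lborel {0<..<x} (\<lambda>s. (v s y - v 0 y) - (v s z - v 0 z))"
        by (intro meas x continuous_on_diff v0c yz)
      fix s assume "s \<in> {0<..<x}"
      then have s: "s \<in> {0..1}" "(0::real) \<in> {0..1}" using x by auto
      show "\<bar>(v s y - v 0 y) - (v s z - v 0 z)\<bar> \<le> 2 * L * \<bar>y - z\<bar>"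
        using vL[OF s(1) yz] vL[OF s(2) yz] by linarith
    qed (use x in simp)
    finally show ?thesis by (simp add: \<Gamma>_def)
  qed
  define R where "R x y = Y n y * R0 x y" for x y
  define M where "M = 2 * B / \<Gamma>"
  define L' where "L' = 2 * L / \<Gamma> + kap n * M"
  have M0: "0 \<le> M" using B \<Gamma> by (simp add: M_def)
  have L'0: "0 \<le> L'" using L \<Gamma> M0 kap_pos[of n] by (simp add: L'_def)
  have YL: "\<bar>Y n y - Y n z\<bar> \<le> kap n * \<bar>y - z\<bar>" for y z
  proof -
    have "norm (Y n y - Y n z) \<le> kap n * norm (y - z)"
      by (rule field_differentiable_bound[OF convex_UNIV Y_has_derivative]) (use Yd_bounded in auto)
    then show ?thesis by simp
  qed
  have Rb: "\<bar>R x y\<bar> \<le> M * x powr (2 - 2 * \<alpha>)" if "x \<in> {0<..<1}" "y \<in> {-pi..pi}" for x y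
  proof -
    have "\<bar>Y n y\<bar> * \<bar>R0 x y\<bar> \<le> 1 * (M * x powr (2 - 2 * \<alpha>))"
      using Y_bounded[of n y] R0b[OF that] by (intro mult_mono) (auto simp: M_def)
    then show ?thesis by (simp add: R_def abs_mult)
  qed
  have RL': "\<bar>R x y - R x z\<bar> \<le> L' * \<bar>y - z\<bar> * x powr (2 - 2 * \<alpha>)" if x: "x \<in> {0<..<1}" and yz: "y \<in> {-pi..pi}" "z \<in> {-pi..pi}" for x y z
  proof -
    have "R x y - R x z = Y n y * (R0 x y - R0 x z) + (Y n y - Y n z) * R0 x z" by (simp add: R_def algebra_simps)
    moreover have "\<bar>Y n y * (R0 x y - R0 x z)\<bar> \<le> 1 * (2 * L / \<Gamma> * \<bar>y - z\<bar> * x powr (2 - 2 * \<alpha>))"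
      unfolding abs_mult using Y_bounded[of n y] R0L[OF x yz] by (intro mult_mono) auto
    moreover have "\<bar>(Y n y - Y n z) * R0 x z\<bar> \<le> (kap n * \<bar>y - z\<bar>) * (M * x powr (2 - 2 * \<alpha>))"
      unfolding abs_mult using YL[of y z] R0b[OF x yz(2)] kap_pos[of n] by (intro mult_mono) (auto simp: M_def)
    ultimately have "\<bar>R x y - R x z\<bar> \<le> 2 * L / \<Gamma> * \<bar>y - z\<bar> * x powr (2 - 2 * \<alpha>) + (kap n * \<bar>y - z\<bar>) * (M * x powr (2 - 2 * \<alpha>))"
      by linarith
    also have "\<dots> = L' * \<bar>y - z\<bar> * x powr (2 - 2 * \<alpha>)" by (simp add: L'_def algebra_simps)
    finally show ?thesis .
  qed
  have Rc: "continuous_on {-pi..pi} (R x)" if x: "x \<in> {0<..<1}" for x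
  proof (rule lipschitz_on_continuous_on, rule lipschitz_onI)
    fix y z assume "y \<in> {-pi..pi}" "z \<in> {-pi..pi}"
    then show "dist (R x y) (R x z) \<le> (L' * x powr (2 - 2 * \<alpha>)) * dist y z"
      using RL'[OF x, of y z] by (simp add: mult_ac dist_real_def)
  qed (use L'0 in simp)
  \<comment> \<open>The shift by 2 makes already the first layer nontrivial: e 0 = pi / 2.\<close>
  define e where "e k = pi * (1 - 1 / real (k + 2))" for k :: nat
  have e: "0 < e k" "e k < pi" for k
  proof -
    have "0 < 1 - 1 / real (k + 2)" "1 - 1 / real (k + 2) < 1" by auto
    then show "0 < e k" "e k < pi"
      using mult_pos_pos[OF pi_gt_zero] mult_strict_left_mono[OF _ pi_gt_zero, of "1 - 1 / real (k + 2)" 1]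
      unfolding e_def by auto
  qed
  have e': "e k \<in> {-pi..pi}" "- e k \<in> {-pi..pi}" for k using e[of k] by auto
  have el: "e \<longlonglongrightarrow> pi"
  proof -
    have "(\<lambda>k. 1 / real (k + 2)) \<longlonglongrightarrow> 0"
      using LIMSEQ_ignore_initial_segment[OF lim_1_over_n, of 2] by simp
    then have "(\<lambda>k. pi * (1 - 1 / real (k + 2))) \<longlonglongrightarrow> pi * (1 - 0)" by (intro tendsto_intros)
    then show ?thesis by (simp add: e_def [abs_def])
  qed
  define \<gamma> where "\<gamma> k = integral {- e k..e k} (\<lambda>y. Y n y * G0 y)" for k
  define nn where "nn x y = RL 1 (RL 1 (\<lambda>s. N s y)) x" for x y
  have id: "integral {- e k..e k} (R x) = \<gamma> k * x powr (2 - \<alpha>) + (nn x (e k) - nn x (- e k))" if x: "x \<in> {0<..<1}" for k x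
  proof -
    have sub: "{- e k..e k} \<subseteq> {-pi<..<pi}" using e[of k] by auto
    then have sub': "{- e k..e k} \<subseteq> {-pi..pi}" by (auto simp: subset_eq less_imp_le)
    have hc: "continuous_on ({0<..<1} \<times> {- e k..e k}) (\<lambda>(s, y). Y n y * h s y)"
    proof -
      have "continuous_on ({0<..<1} \<times> {- e k..e k}) (\<lambda>(s, y). h s y)"
        unfolding h_def using sol_h_continuous[OF \<alpha> \<epsilon> sol] by (rule continuous_on_subset) (use sub in auto)
      then show ?thesis by (auto simp: case_prod_unfold intro!: continuous_intros)
    qed
    have li: "continuous_on {- e k..e k} (\<lambda>y. Y n y * G0 y)"
      "integral {- e k..e k} (\<lambda>y. R x y - Y n y * G0 y * x powr (2 - \<alpha>)) = RL 1 (RL 1 (\<lambda>s. N s (e k) - N s (- e k))) x"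
    proof -
      have Ncs: "continuous_on ({0..1} \<times> {- e k..e k}) (\<lambda>(s, y). N s y)"
        using Nc by (rule continuous_on_subset) (use sub' in auto)
      have Nh: "(N s has_real_derivative Y n y * h s y) (at y within {- e k..e k})" if "s \<in> {0<..<1}" "y \<in> {- e k..e k}" for s y
      proof -
        have "y \<in> {-pi<..<pi}" using that sub by blast
        from prim_has_derivative[OF \<alpha> \<epsilon> sol that(1) this, of n] show ?thesis
          unfolding N_def h_def by (rule has_field_derivative_at_within)
      qed
      have hi: "set_integrable lborel {0<..<x} (\<lambda>s. Y n y * h s y)" if "x \<in> {0<..<1}" "y \<in> {- e k..e k}" for x y
        using G0(1)[OF _ that(1), of y] that sub by auto
      have Re: "R x y = Y n y * G0 y * x powr (2 - \<alpha>) + RL 1 (RL 1 (\<lambda>s. Y n y * h s y)) x" if "x \<in> {0<..<1}" "y \<in> {- e k..e k}" for x y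
      proof -
        have "RL 1 (\<lambda>s. Y n y * h s y) = (\<lambda>x. Y n y * RL 1 (\<lambda>s. h s y) x)" by (rule ext) (rule RL_cmult)
        then have "RL 1 (RL 1 (\<lambda>s. Y n y * h s y)) x = Y n y * RL 1 (RL 1 (\<lambda>s. h s y)) x" by (simp add: RL_cmult)
        moreover have "y \<in> {-pi<..<pi}" using that sub by blast
        ultimately show ?thesis using G0(2)[OF _ that(1), of y] by (simp add: R_def algebra_simps)
      qed
      have Mb: "\<bar>R x y\<bar> \<le> M * x powr (2 - 2 * \<alpha>)" if "x \<in> {0<..<1}" "y \<in> {- e k..e k}" for x y
        using Rb[OF that(1), of y] that sub' by blast
      have Lb: "\<bar>R x y - R x z\<bar> \<le> L' * \<bar>y - z\<bar> * x powr (2 - 2 * \<alpha>)" if "x \<in> {0<..<1}" "y \<in> {- e k..e k}" "z \<in> {- e k..e k}" for x y z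
        using RL'[OF that(1), of y z] that sub' by blast
      have ek: "- e k < e k" using e(1)[of k] by simp
      show "continuous_on {- e k..e k} (\<lambda>y. Y n y * G0 y)"
        by (rule layer_identity(1)[OF \<alpha>(1) \<alpha>1 hc Ncs Nh hi Re Mb Lb L'0 ek])
      show "integral {- e k..e k} (\<lambda>y. R x y - Y n y * G0 y * x powr (2 - \<alpha>)) = RL 1 (RL 1 (\<lambda>s. N s (e k) - N s (- e k))) x"
        by (rule layer_identity(2)[OF \<alpha>(1) \<alpha>1 hc Ncs Nh hi Re Mb Lb L'0 ek x])
    qed
    have "integral {- e k..e k} (\<lambda>y. R x y - Y n y * G0 y * x powr (2 - \<alpha>)) =
        integral {- e k..e k} (R x) - integral {- e k..e k} (\<lambda>y. Y n y * G0 y * x powr (2 - \<alpha>))"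
      by (intro integral_diff integrable_continuous_real continuous_on_mult_right li(1) continuous_on_subset[OF Rc[OF x] sub'])
    also have "integral {- e k..e k} (\<lambda>y. Y n y * G0 y * x powr (2 - \<alpha>)) = \<gamma> k * x powr (2 - \<alpha>)"
      unfolding \<gamma>_def by (rule integral_mult_left)
    finally have "integral {- e k..e k} (R x) - \<gamma> k * x powr (2 - \<alpha>) = RL 1 (RL 1 (\<lambda>s. N s (e k) - N s (- e k))) x"
      using li(2) by simp
    also have "\<dots> = nn x (e k) - nn x (- e k)"
      unfolding nn_def using continuous_on_section(1)[OF Nc] sub' e[of k] x by (intro RL_11_diff) auto
    finally show ?thesis by simp
  qed
  have lim: "(\<lambda>k. integral {- e k..e k} (R x) - (nn x (e k) - nn x (- e k))) \<longlonglongrightarrow> integral {-pi..pi} (R x) - (nn x pi - nn x (- pi))"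
    if x: "x \<in> {0<..<1}" for x
  proof -
    have nc: "continuous_on {-pi..pi} (nn x)" unfolding nn_def by (rule RL_11_continuous_param[OF Nc]) (use x in auto)
    have "(\<lambda>k. nn x (e k)) \<longlonglongrightarrow> nn x pi"
      by (rule continuous_on_tendsto_compose[OF nc el]) (use e' in simp_all)
    moreover have "(\<lambda>k. nn x (- e k)) \<longlonglongrightarrow> nn x (- pi)"
      by (rule continuous_on_tendsto_compose[OF nc tendsto_minus[OF el]]) (use e' in simp_all)
    ultimately show ?thesis by (intro tendsto_diff integral_symmetric_tendsto Rc x e el)
  qed
  \<comment> \<open>The limit of the constants, found by solving the identity at x = 1/2; it then
    serves every x.\<close>
  define \<gamma>l where "\<gamma>l = (integral {-pi..pi} (R (1/2)) - (nn (1/2) pi - nn (1/2) (- pi))) / (1/2) powr (2 - \<alpha>)"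
  have \<gamma>lim: "\<gamma> \<longlonglongrightarrow> \<gamma>l"
  proof -
    have "(\<lambda>k. (integral {- e k..e k} (R (1/2)) - (nn (1/2) (e k) - nn (1/2) (- e k))) / (1/2) powr (2 - \<alpha>)) \<longlonglongrightarrow> \<gamma>l"
      unfolding \<gamma>l_def by (intro tendsto_divide lim tendsto_const) auto
    then show ?thesis using id[of "1/2"] by simp
  qed
  have Rint: "integral {-pi..pi} (R x) = \<gamma>l * x powr (2 - \<alpha>) + (nn x pi - nn x (- pi))" if x: "x \<in> {0<..<1}" for x
  proof -
    have "(\<lambda>k. integral {- e k..e k} (R x) - (nn x (e k) - nn x (- e k))) \<longlonglongrightarrow> \<gamma>l * x powr (2 - \<alpha>)"
      using tendsto_mult[OF \<gamma>lim tendsto_const[of "x powr (2 - \<alpha>)"]] id[OF x] by simp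
    then have "integral {-pi..pi} (R x) - (nn x pi - nn x (- pi)) = \<gamma>l * x powr (2 - \<alpha>)"
      using LIMSEQ_unique[OF lim[OF x]] by blast
    then show ?thesis by simp
  qed
  have "RL (2 - 2 * \<alpha>) (\<lambda>s. mode v n s - mode v n 0) x = \<gamma>l * x powr (2 - \<alpha>) + (mu \<epsilon> c n)\<^sup>2 * RL 1 (RL 1 (mode v n)) x"
    if x: "x \<in> {0<..<1}" for x
  proof -
    have pm: "pi \<in> {-pi..pi}" "- pi \<in> {-pi..pi}" by auto
    have vcs: "continuous_on {-pi..pi} (v s)" if "s \<in> {0..1}" for s using continuous_on_section(2)[OF vc that] .
    have "mode v n s - mode v n 0 = integral {-pi..pi} (\<lambda>y. Y n y * (v s y - v 0 y))" if "s \<in> {0..1}" for s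
    proof -
      have "mode v n s - mode v n 0 = integral {-pi..pi} (\<lambda>y. Y n y * v s y - Y n y * v 0 y)"
        unfolding mode_def by (intro integral_diff [symmetric] integrable_continuous_real continuous_intros vcs that) auto
      then show ?thesis by (simp add: right_diff_distrib)
    qed
    then have "RL (2 - 2 * \<alpha>) (\<lambda>s. mode v n s - mode v n 0) x = RL (2 - 2 * \<alpha>) (\<lambda>s. integral {-pi..pi} (\<lambda>y. Y n y * (v s y - v 0 y))) x"
      using x by (intro RL_cong) auto
    also have "\<dots> = integral {-pi..pi} (\<lambda>y. RL (2 - 2 * \<alpha>) (\<lambda>s. Y n y * (v s y - v 0 y)) x)"
    proof (rule RL_integral_swap[OF a2])
      have "continuous_on {-pi..pi} (v 0)" by (rule vcs) simp
      then have "continuous_on ({0..1::real} \<times> {-pi..pi}) (\<lambda>p. v 0 (snd p))"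
        by (rule continuous_on_compose2) (auto intro!: continuous_intros)
      then show "continuous_on ({0..1} \<times> {-pi..pi}) (\<lambda>(s, y). Y n y * (v s y - v 0 y))"
        using vc by (auto simp: case_prod_unfold intro!: continuous_intros)
    qed (use x in auto)
    also have "\<dots> = integral {-pi..pi} (R x)" by (simp add: RL_cmult R_def [abs_def] R0_def)
    also have "\<dots> = \<gamma>l * x powr (2 - \<alpha>) + (nn x pi - nn x (- pi))" by (rule Rint[OF x])
    also have "nn x pi - nn x (- pi) = RL 1 (RL 1 (\<lambda>s. N s pi - N s (- pi))) x"
      unfolding nn_def using continuous_on_section(1)[OF Nc] pm x by (intro RL_11_diff [symmetric]) auto
    also have "\<dots> = RL 1 (RL 1 (\<lambda>s. (mu \<epsilon> c n)\<^sup>2 * mode v n s)) x"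
      unfolding N_def using prim_boundary[OF \<alpha> \<epsilon> sol, of _ n] x by (intro RL_cong) auto
    also have "\<dots> = (mu \<epsilon> c n)\<^sup>2 * RL 1 (RL 1 (mode v n)) x"
    proof -
      have "RL 1 (\<lambda>s. (mu \<epsilon> c n)\<^sup>2 * mode v n s) = (\<lambda>s. (mu \<epsilon> c n)\<^sup>2 * RL 1 (mode v n) s)" by (rule ext) (rule RL_cmult)
      then show ?thesis by (simp add: RL_cmult)
    qed
    finally show ?thesis .
  qed
  then show ?thesis by blast
qed

text \<open>\<open>mode_equation\<close> applies this with order 2 to the power 1 of s, and with
  order 2 alpha to the power 2 - alpha, which is why \<open>\<beta>\<close> and \<open>r\<close>
  stay generic.\<close>

lemma mode_RL_11:
  fixes r \<beta> \<gamma> :: real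
  assumes x: "x \<in> {0<..<1}" and \<beta>: "0 < \<beta>" and r: "0 < r"
    and eq: "\<And>s. s \<in> {0<..<1} \<Longrightarrow> f s = \<gamma> * s powr (r - 1) + k * RL 1 (RL 1 (mode v n)) s"
  shows "RL \<beta> f x = \<gamma> * Gamma r / Gamma (\<beta> + r) * x powr (\<beta> + r - 1) + k * RL \<beta> (RL 1 (RL 1 (mode v n))) x"
proof -
  have x0: "0 < x" using x by simp
  have Wi: "set_integrable lborel {0<..<s} (mode v n)" if "s \<in> {0<..<1}" for s
    by (rule continuous_integrable[OF _ mode_continuous[OF \<alpha> \<epsilon> sol]]) (use that in auto)
  have "RL \<beta> f x = RL \<beta> (\<lambda>s. \<gamma> * s powr (r - 1) + k * RL 1 (RL 1 (mode v n)) s) x"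
    by (rule RL_cong) (use eq x in auto)
  also have "\<dots> = RL \<beta> (\<lambda>s. \<gamma> * s powr (r - 1)) x + RL \<beta> (\<lambda>s. k * RL 1 (RL 1 (mode v n)) s) x"
  proof (rule RL_add)
    have "set_integrable lborel {0<..<x} (\<lambda>s. \<gamma> * ((x - s) powr (\<beta> - 1) * s powr (r - 1)))"
      using \<beta> r x0 by (intro set_integrable_mult_right RL_powr(2)) auto
    then show "set_integrable lborel {0<..<x} (\<lambda>s. (x - s) powr (\<beta> - 1) * (\<gamma> * s powr (r - 1)))"
      by (simp only: mult.left_commute)
    have "set_integrable lborel {0<..<x} (\<lambda>s. (x - s) powr (\<beta> - 1) * RL 2 (mode v n) s)"
      using \<beta> x0 Wi[OF x] by (intro RL_semigroup(2)) auto
    also have "?this \<longleftrightarrow> set_integrable lborel {0<..<x} (\<lambda>s. (x - s) powr (\<beta> - 1) * RL 1 (RL 1 (mode v n)) s)"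
      by (rule set_integrable_cong) (use RL_11_eq_RL_2 Wi x in auto)
    finally have "set_integrable lborel {0<..<x} (\<lambda>s. k * ((x - s) powr (\<beta> - 1) * RL 1 (RL 1 (mode v n)) s))"
      by (rule set_integrable_mult_right)
    then show "set_integrable lborel {0<..<x} (\<lambda>s. (x - s) powr (\<beta> - 1) * (k * RL 1 (RL 1 (mode v n)) s))"
      by (simp only: mult.left_commute)
  qed
  also have "\<dots> = \<gamma> * Gamma r / Gamma (\<beta> + r) * x powr (\<beta> + r - 1) + k * RL \<beta> (RL 1 (RL 1 (mode v n))) x"
    unfolding RL_cmult using RL_powr(1)[OF \<beta> r x0] by simp
  finally show ?thesis .
qed

text \<open>For alpha = 1 the order 2 - 2 alpha is 0, and the mode itself replaces its fractional
  integral. The defect \<open>\<Delta>\<close> of the formal computation is again affine in x, and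
  here it may remain: its value at 0 is \<open>mode v n 0\<close>, its linear part is the term with
  \<open>\<gamma>\<close>. The exponent is written 2 - 1 to match \<open>mode_RL_11\<close>.\<close>

lemma mode_classical:
  assumes \<alpha>1: "\<alpha> = 1"
  shows "\<exists>\<gamma>. \<forall>x\<in>{0<..<1}. mode v n x - mode v n 0 = \<gamma> * x powr (2 - 1) + (mu \<epsilon> c n)\<^sup>2 * RL 1 (RL 1 (mode v n)) x"
proof -
  define g where "g s y = caputo_x \<alpha> v s y" for s y
  define h where "h s y = caputo_x \<alpha> (caputo_x \<alpha> v) s y" for s y
  define N where "N = prim \<epsilon> c v n"
  define W where "W = mode v n"
  note Nc = prim_continuous[OF \<alpha> \<epsilon> sol, of n, folded N_def]
  note Wc = mode_continuous[OF \<alpha> \<epsilon> sol, of n, folded W_def]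
  have dv: "((\<lambda>s. v s y) has_real_derivative g s y) (at s)" if "s \<in> {0<..<1}" "y \<in> {-pi<..<pi}" for s y
    using sol_has_caputo(1)[OF \<alpha> \<epsilon> sol that] \<alpha>1
    by (simp add: has_caputo_def g_def caputo_x_def caputo_def DERIV_deriv_iff_real_differentiable)
  have dg: "((\<lambda>s. g s y) has_real_derivative h s y) (at s)" if "s \<in> {0<..<1}" "y \<in> {-pi<..<pi}" for s y
    using sol_has_caputo(2)[OF \<alpha> \<epsilon> sol that] \<alpha>1
    by (simp add: has_caputo_def g_def h_def caputo_x_def caputo_def DERIV_deriv_iff_real_differentiable)
  have gc: "continuous_on ({0<..<1} \<times> {-pi<..<pi}) (\<lambda>(x, y). g x y)"
    using sol by (simp add: g_def problem_solution_def regular_solution_def Omega_def)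
  note hc = sol_h_continuous[OF \<alpha> \<epsilon> sol, folded h_def]
  have taylor: "v x y = v x0 y + (x - x0) * g x0 y + integral {x0..x} (\<lambda>s. (x - s) * h s y)"
    if y: "y \<in> {-pi<..<pi}" and x: "0 < x0" "x0 \<le> x" "x < 1" for x x0 y
  proof -
    have "((\<lambda>s. (x - s) * h s y) has_integral (((x - x) * g x y + v x y) - ((x - x0) * g x0 y + v x0 y))) {x0..x}"
    proof (rule fundamental_theorem_of_calculus[OF x(2)])
      fix s assume "s \<in> {x0..x}"
      then have s: "s \<in> {0<..<1}" using x by auto
      have "((\<lambda>s. (x - s) * g s y + v s y) has_real_derivative ((0 - 1) * g s y + h s y * (x - s) + g s y)) (at s)"
        by (intro DERIV_add DERIV_mult DERIV_diff DERIV_const DERIV_ident dg dv s y)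
      then have "((\<lambda>s. (x - s) * g s y + v s y) has_real_derivative ((x - s) * h s y)) (at s)"
        by (simp add: mult.commute)
      then show "((\<lambda>s. (x - s) * g s y + v s y) has_vector_derivative ((x - s) * h s y)) (at s within {x0..x})"
        by (simp add: has_real_derivative_iff_has_vector_derivative [symmetric] has_field_derivative_at_within)
    qed
    from integral_unique[OF this] show ?thesis by simp
  qed
  define e where "e k = pi * (1 - 1 / real (k + 2))" for k :: nat
  have e: "0 < e k" "e k < pi" for k
  proof -
    have "0 < 1 - 1 / real (k + 2)" "1 - 1 / real (k + 2) < 1" by auto
    then show "0 < e k" "e k < pi"
      using mult_pos_pos[OF pi_gt_zero] mult_strict_left_mono[OF _ pi_gt_zero, of "1 - 1 / real (k + 2)" 1]
      unfolding e_def by auto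
  qed
  have e': "e k \<in> {-pi..pi}" "- e k \<in> {-pi..pi}" for k using e[of k] by auto
  have el: "e \<longlonglongrightarrow> pi"
  proof -
    have "(\<lambda>k. 1 / real (k + 2)) \<longlonglongrightarrow> 0"
      using LIMSEQ_ignore_initial_segment[OF lim_1_over_n, of 2] by simp
    then have "(\<lambda>k. pi * (1 - 1 / real (k + 2))) \<longlonglongrightarrow> pi * (1 - 0)" by (intro tendsto_intros)
    then show ?thesis by (simp add: e_def [abs_def])
  qed
  define nn where "nn x y = RL 1 (RL 1 (\<lambda>s. N s y)) x" for x y
  define \<Delta>k where "\<Delta>k k x = integral {- e k..e k} (\<lambda>y. Y n y * v x y) - (nn x (e k) - nn x (- e k))" for k x
  define \<Delta> where "\<Delta> x = W x - (mu \<epsilon> c n)\<^sup>2 * RL 1 (RL 1 W) x" for x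
  have Ns: "continuous_on {0..1} (\<lambda>s. N s y)" if "y \<in> {-pi..pi}" for y
    by (rule continuous_on_section(1)[OF Nc that])
  have affk: "\<exists>c. \<forall>x. x0 \<le> x \<and> x < 1 \<longrightarrow> \<Delta>k k x = \<Delta>k k x0 + (x - x0) * c" if x0: "0 < x0" "x0 < 1" for x0 k
  proof -
    have sub: "{- e k..e k} \<subseteq> {-pi<..<pi}" using e[of k] by auto
    have sub': "{- e k..e k} \<subseteq> {-pi..pi}" using e'[of k] by auto
    have nd: "RL 1 (RL 1 (\<lambda>s. N s (e k) - N s (- e k))) x = nn x (e k) - nn x (- e k)" if "x \<in> {0<..1}" for x
      unfolding nn_def by (rule RL_11_diff[OF Ns Ns that]) (use e' in auto)
    have "\<Delta>k k x = \<Delta>k k x0 + (x - x0) * (integral {- e k..e k} (\<lambda>y. Y n y * g x0 y) - RL 1 (\<lambda>s. N s (e k) - N s (- e k)) x0)"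
      if x: "x0 \<le> x" "x < 1" for x
    proof -
      have "integral {- e k..e k} (\<lambda>y. Y n y * v x y) - RL 1 (RL 1 (\<lambda>s. N s (e k) - N s (- e k))) x =
        (integral {- e k..e k} (\<lambda>y. Y n y * v x0 y) - RL 1 (RL 1 (\<lambda>s. N s (e k) - N s (- e k))) x0)
        + (x - x0) * (integral {- e k..e k} (\<lambda>y. Y n y * g x0 y) - RL 1 (\<lambda>s. N s (e k) - N s (- e k)) x0)"
      proof (rule layer_affine[where T = "\<lambda>x y. Y n y * v x y" and h = "\<lambda>s y. Y n y * h s y"])
        show "- e k \<le> e k" using e(1)[of k] by simp
        have "continuous_on ({x0..x} \<times> {- e k..e k}) (\<lambda>(s, y). h s y)"
          unfolding h_def using sol_h_continuous[OF \<alpha> \<epsilon> sol] by (rule continuous_on_subset) (use sub x0 x in auto)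
        then show "continuous_on ({x0..x} \<times> {- e k..e k}) (\<lambda>(s, y). Y n y * h s y)"
          by (auto simp: case_prod_unfold intro!: continuous_intros)
        have xI: "x0 \<in> {0..1}" "x0 \<in> {0<..<1}" using x0 by auto
        have "continuous_on {- e k..e k} (v x0)"
          using continuous_on_section(2)[OF vc xI(1)] sub' by (rule continuous_on_subset)
        then show "continuous_on {- e k..e k} (\<lambda>y. Y n y * v x0 y)" by (intro continuous_intros)
        have "continuous_on {- e k..e k} (g x0)"
          using continuous_on_section(2)[OF gc xI(2)] sub by (rule continuous_on_subset)
        then show "continuous_on {- e k..e k} (\<lambda>y. Y n y * g x0 y)" by (intro continuous_intros)
        show "continuous_on {0..1} (\<lambda>s. N s (e k) - N s (- e k))"
          by (intro continuous_on_diff Ns e')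
        then show "set_integrable lborel {0<..<z} (\<lambda>s. N s (e k) - N s (- e k))" if "z \<in> {0<..<1}" for z
          by (rule continuous_integrable[rotated]) (use that in auto)
        fix y assume "y \<in> {- e k..e k}"
        then have y: "y \<in> {-pi<..<pi}" using sub by blast
        show "Y n y * v x y = Y n y * v x0 y + (x - x0) * (Y n y * g x0 y) + integral {x0..x} (\<lambda>s. (x - s) * (Y n y * h s y))"
        proof -
          have "integral {x0..x} (\<lambda>s. (x - s) * (Y n y * h s y)) = Y n y * integral {x0..x} (\<lambda>s. (x - s) * h s y)"
            unfolding integral_mult_right [symmetric] by (simp add: mult_ac)
          moreover have "w * (a + b * z + i) = w * a + b * (w * z) + w * i" for w a b z i :: real
            by (simp add: algebra_simps)
          ultimately show ?thesis unfolding taylor[OF y x0(1) x] by simp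
        qed
        fix s assume "s \<in> {x0..x}"
        then have s: "s \<in> {0<..<1}" using x x0 by auto
        from prim_has_derivative[OF \<alpha> \<epsilon> sol s y, of n]
        show "(N s has_real_derivative Y n y * h s y) (at y within {- e k..e k})"
          unfolding N_def h_def by (rule has_field_derivative_at_within)
      qed (use x x0 in auto)
      moreover have "x \<in> {0<..1}" "x0 \<in> {0<..1}" using x x0 by auto
      note nd[OF this(1)] nd[OF this(2)]
      ultimately show ?thesis unfolding \<Delta>k_def by simp
    qed
    then show ?thesis by blast
  qed
  have lim: "(\<lambda>k. \<Delta>k k x) \<longlonglongrightarrow> \<Delta> x" if x: "x \<in> {0<..<1}" for x
  proof -
    have nc: "continuous_on {-pi..pi} (nn x)" unfolding nn_def by (rule RL_11_continuous_param[OF Nc]) (use x in auto)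
    have "(\<lambda>k. nn x (e k)) \<longlonglongrightarrow> nn x pi"
      by (rule continuous_on_tendsto_compose[OF nc el]) (use e' in simp_all)
    moreover have "(\<lambda>k. nn x (- e k)) \<longlonglongrightarrow> nn x (- pi)"
      by (rule continuous_on_tendsto_compose[OF nc tendsto_minus[OF el]]) (use e' in simp_all)
    moreover have "continuous_on {-pi..pi} (\<lambda>y. Y n y * v x y)"
      using continuous_on_section(2)[OF vc, of x] x by (intro continuous_intros) auto
    ultimately have "(\<lambda>k. \<Delta>k k x) \<longlonglongrightarrow> integral {-pi..pi} (\<lambda>y. Y n y * v x y) - (nn x pi - nn x (- pi))"
      unfolding \<Delta>k_def by (intro tendsto_diff integral_symmetric_tendsto e el)
    also have "nn x pi - nn x (- pi) = RL 1 (RL 1 (\<lambda>s. N s pi - N s (- pi))) x"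
      unfolding nn_def by (rule RL_11_diff [symmetric]) (use x in \<open>auto intro!: Ns\<close>)
    also have "\<dots> = RL 1 (RL 1 (\<lambda>s. (mu \<epsilon> c n)\<^sup>2 * W s)) x"
      unfolding N_def W_def using prim_boundary[OF \<alpha> \<epsilon> sol, of _ n] x by (intro RL_cong) auto
    also have "\<dots> = (mu \<epsilon> c n)\<^sup>2 * RL 1 (RL 1 W) x"
    proof -
      have "RL 1 (\<lambda>s. (mu \<epsilon> c n)\<^sup>2 * W s) = (\<lambda>s. (mu \<epsilon> c n)\<^sup>2 * RL 1 W s)" by (rule ext) (rule RL_cmult)
      then show ?thesis by (simp add: RL_cmult)
    qed
    finally show ?thesis by (simp add: \<Delta>_def W_def mode_def)
  qed
  \<comment> \<open>The three-point identity is linear in the defect, hence survives the limit in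
    which the layers exhaust the interval, without convergence of their slopes.\<close>
  have three: "(x2 - x1) * \<Delta> x0 + (x1 - x0) * \<Delta> x2 = (x2 - x0) * \<Delta> x1" if x: "0 < x0" "x0 \<le> x1" "x1 \<le> x2" "x2 < 1" for x0 x1 x2
  proof -
    have eq: "(x2 - x1) * \<Delta>k k x0 + (x1 - x0) * \<Delta>k k x2 = (x2 - x0) * \<Delta>k k x1" for k
    proof -
      obtain c where c: "\<And>x. x0 \<le> x \<Longrightarrow> x < 1 \<Longrightarrow> \<Delta>k k x = \<Delta>k k x0 + (x - x0) * c"
        using affk[of x0 k] x by auto
      have "\<Delta>k k x1 = \<Delta>k k x0 + (x1 - x0) * c" "\<Delta>k k x2 = \<Delta>k k x0 + (x2 - x0) * c"
        using c[of x1] c[of x2] x by auto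
      then show ?thesis by (simp only:) (simp add: algebra_simps)
    qed
    have "(\<lambda>k. (x2 - x1) * \<Delta>k k x0 + (x1 - x0) * \<Delta>k k x2) \<longlonglongrightarrow> (x2 - x1) * \<Delta> x0 + (x1 - x0) * \<Delta> x2"
      using x by (intro tendsto_intros lim) auto
    moreover have "(\<lambda>k. (x2 - x0) * \<Delta>k k x1) \<longlonglongrightarrow> (x2 - x0) * \<Delta> x1"
      using x by (intro tendsto_intros lim) auto
    ultimately show ?thesis unfolding eq by (rule LIMSEQ_unique)
  qed
  have \<Delta>0: "(\<Delta> \<longlongrightarrow> W 0) (at_right 0)"
  proof -
    have "bounded (W ` {0..1})" by (intro compact_imp_bounded compact_continuous_image Wc compact_Icc)
    then obtain K where "\<forall>z\<in>W ` {0..1}. norm z \<le> K" unfolding bounded_iff by blast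
    then have K: "\<And>s. s \<in> {0..1} \<Longrightarrow> \<bar>W s\<bar> \<le> K" by auto
    have "(W \<longlongrightarrow> W 0) (at 0 within {0..1})" using Wc by (auto simp: continuous_on_def)
    then have W0: "(W \<longlongrightarrow> W 0) (at_right 0)" by (simp add: at_within_Icc_at_right)
    have "(RL 1 (RL 1 W) \<longlongrightarrow> 0) (at_right 0)"
    proof (rule Lim_null_comparison)
      have "\<forall>\<^sub>F x in at_right 0. x \<in> {0<..<1::real}" by (rule eventually_at_right_real) simp
      then show "\<forall>\<^sub>F x in at_right 0. norm (RL 1 (RL 1 W) x) \<le> K * x\<^sup>2"
        by eventually_elim (use continuous_RL_11_bounds(3)[OF Wc K] in auto)
      have "((\<lambda>x. K * x\<^sup>2) \<longlongrightarrow> K * 0\<^sup>2) (at_right (0::real))" by (intro tendsto_intros)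
      then show "((\<lambda>x. K * x\<^sup>2) \<longlongrightarrow> 0) (at_right (0::real))" by simp
    qed
    then have "((\<lambda>x. W x - (mu \<epsilon> c n)\<^sup>2 * RL 1 (RL 1 W) x) \<longlongrightarrow> W 0 - (mu \<epsilon> c n)\<^sup>2 * 0) (at_right 0)"
      by (intro tendsto_intros W0)
    then show ?thesis by (simp add: \<Delta>_def [abs_def])
  qed
  have two: "(x2 - x1) * W 0 + x1 * \<Delta> x2 = x2 * \<Delta> x1" if x: "0 < x1" "x1 \<le> x2" "x2 < 1" for x1 x2
  proof -
    have "\<forall>\<^sub>F x0 in at_right 0. x0 \<in> {0<..<x1}" by (rule eventually_at_right_real) (use x in auto)
    then have ev: "\<forall>\<^sub>F x0 in at_right 0. (x2 - x1) * \<Delta> x0 + (x1 - x0) * \<Delta> x2 = (x2 - x0) * \<Delta> x1"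
      by eventually_elim (use three x in auto)
    have l1: "((\<lambda>x0. (x2 - x1) * \<Delta> x0 + (x1 - x0) * \<Delta> x2) \<longlongrightarrow> (x2 - x1) * W 0 + (x1 - 0) * \<Delta> x2) (at_right 0)"
      by (intro tendsto_intros \<Delta>0)
    have l2: "((\<lambda>x0. (x2 - x0) * \<Delta> x1) \<longlongrightarrow> (x2 - 0) * \<Delta> x1) (at_right 0)"
      by (intro tendsto_intros)
    have "(x2 - x1) * W 0 + (x1 - 0) * \<Delta> x2 = (x2 - 0) * \<Delta> x1"
      by (rule tendsto_unique[OF _ Lim_transform_eventually[OF l1 ev] l2]) simp
    then show ?thesis by simp
  qed
  have fin: "\<Delta> x - W 0 = (2 * (\<Delta> (1/2) - W 0)) * x powr (2 - 1)" if x: "x \<in> {0<..<1}" for x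
    using two[of x "1/2"] two[of "1/2" x] x by (cases "x \<le> 1/2") (auto simp: algebra_simps)
  then have "W x - W 0 = (2 * (\<Delta> (1/2) - W 0)) * x powr (2 - 1) + (mu \<epsilon> c n)\<^sup>2 * RL 1 (RL 1 W) x" if "x \<in> {0<..<1}" for x
  proof -
    have "\<Delta> x - W 0 = (2 * (\<Delta> (1/2) - W 0)) * x powr (2 - 1)" by (rule fin[OF that])
    then show ?thesis using \<Delta>_def[of x] by linarith
  qed
  then show ?thesis unfolding W_def by blast
qed

text \<open>J^(2 alpha) applied to the fractional identity, and J^2 applied to the classical one,
  give both cases the same form: J^2 on the left and a free multiple of x^(2 + alpha) on the
  right.\<close>

lemma mode_equation:
  "\<exists>\<gamma>. \<forall>x\<in>{0<..<1}. RL 1 (RL 1 (\<lambda>s. mode v n s - mode v n 0)) x =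
    \<gamma> * x powr (2 + \<alpha>) + (mu \<epsilon> c n)\<^sup>2 * RL (2 * \<alpha>) (RL 1 (RL 1 (mode v n))) x"
proof -
  have Wi: "set_integrable lborel {0<..<x} (\<lambda>s. mode v n s - mode v n 0)" if "x \<in> {0<..<1}" for x
    by (rule continuous_integrable) (use that mode_continuous[OF \<alpha> \<epsilon> sol, of n] in \<open>auto intro!: continuous_intros\<close>)
  show ?thesis
  proof (cases "\<alpha> = 1")
    case True
    from mode_classical[OF this, of n] obtain \<gamma> where
      \<gamma>: "\<And>x. x \<in> {0<..<1} \<Longrightarrow> mode v n x - mode v n 0 = \<gamma> * x powr (2 - 1) + (mu \<epsilon> c n)\<^sup>2 * RL 1 (RL 1 (mode v n)) x"
      by blast
    have "RL 1 (RL 1 (\<lambda>s. mode v n s - mode v n 0)) x = (\<gamma> * Gamma 2 / Gamma (2 + 2)) * x powr (2 + \<alpha>) + (mu \<epsilon> c n)\<^sup>2 * RL (2 * \<alpha>) (RL 1 (RL 1 (mode v n))) x"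
      if x: "x \<in> {0<..<1}" for x
    proof -
      have "RL 1 (RL 1 (\<lambda>s. mode v n s - mode v n 0)) x = RL 2 (\<lambda>s. mode v n s - mode v n 0) x"
        using x by (intro RL_11_eq_RL_2 Wi) auto
      also have "\<dots> = \<gamma> * Gamma 2 / Gamma (2 + 2) * x powr (2 + 2 - 1) + (mu \<epsilon> c n)\<^sup>2 * RL 2 (RL 1 (RL 1 (mode v n))) x"
        by (rule mode_RL_11[OF x _ _ \<gamma>]) auto
      finally show ?thesis using True by simp
    qed
    then show ?thesis by blast
  next
    case False
    then have \<alpha>1: "\<alpha> < 1" using \<alpha> by simp
    from mode_fractional[OF this, of n] obtain \<gamma> where
      \<gamma>: "\<And>x. x \<in> {0<..<1} \<Longrightarrow> RL (2 - 2 * \<alpha>) (\<lambda>s. mode v n s - mode v n 0) x = \<gamma> * x powr (2 - \<alpha>) + (mu \<epsilon> c n)\<^sup>2 * RL 1 (RL 1 (mode v n)) x"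
      by blast
    have "RL 1 (RL 1 (\<lambda>s. mode v n s - mode v n 0)) x = (\<gamma> * Gamma (3 - \<alpha>) / Gamma (2 * \<alpha> + (3 - \<alpha>))) * x powr (2 + \<alpha>) + (mu \<epsilon> c n)\<^sup>2 * RL (2 * \<alpha>) (RL 1 (RL 1 (mode v n))) x"
      if x: "x \<in> {0<..<1}" for x
    proof -
      have "RL 1 (RL 1 (\<lambda>s. mode v n s - mode v n 0)) x = RL 2 (\<lambda>s. mode v n s - mode v n 0) x"
        using x by (intro RL_11_eq_RL_2 Wi) auto
      also have "\<dots> = RL (2 * \<alpha> + (2 - 2 * \<alpha>)) (\<lambda>s. mode v n s - mode v n 0) x" by simp
      also have "\<dots> = RL (2 * \<alpha>) (RL (2 - 2 * \<alpha>) (\<lambda>s. mode v n s - mode v n 0)) x"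
        using x \<alpha> \<alpha>1 by (intro RL_semigroup(1) [symmetric] Wi) auto
      also have "\<dots> = \<gamma> * Gamma (3 - \<alpha>) / Gamma (2 * \<alpha> + (3 - \<alpha>)) * x powr (2 * \<alpha> + (3 - \<alpha>) - 1) + (mu \<epsilon> c n)\<^sup>2 * RL (2 * \<alpha>) (RL 1 (RL 1 (mode v n))) x"
        by (rule mode_RL_11[OF x]) (use \<alpha> \<alpha>1 \<gamma> in auto)
      also have "2 * \<alpha> + (3 - \<alpha>) - 1 = 2 + \<alpha>" by simp
      finally show ?thesis .
    qed
    then show ?thesis by blast
  qed
qed

end

lemma problem_solution_unique:
  assumes \<alpha>: "0 < \<alpha>" "\<alpha> \<le> 1" and \<epsilon>: "\<bar>\<epsilon>\<bar> < 1"
    and v: "problem_solution \<alpha> \<epsilon> c \<phi> \<psi> v" and u: "problem_solution \<alpha> \<epsilon> c \<phi> \<psi> u"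
    and xy: "(x, y) \<in> closure Omega"
  shows "v x y = u x y"
proof -
  have xy: "x \<in> {0..1}" "y \<in> {-pi..pi}" using xy by (auto simp: closure_Omega)
  note vc = sol_continuous[OF \<alpha> \<epsilon> v] and uc = sol_continuous[OF \<alpha> \<epsilon> u]
  have modes: "mode v n s - mode u n s = 0" if s: "s \<in> {0..1}" for n s
  proof -
    note Vc = mode_continuous[OF \<alpha> \<epsilon> v, of n] and Uc = mode_continuous[OF \<alpha> \<epsilon> u, of n]
    have b0: "mode v n 0 = mode u n 0"
      unfolding mode_def using sol_boundary(3)[OF \<alpha> \<epsilon> v] sol_boundary(3)[OF \<alpha> \<epsilon> u] by (intro integral_cong) simp
    have b1: "mode v n 1 = mode u n 1"
      unfolding mode_def using sol_boundary(4)[OF \<alpha> \<epsilon> v] sol_boundary(4)[OF \<alpha> \<epsilon> u] by (intro integral_cong) simp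
    obtain \<gamma>v where \<gamma>v: "\<And>x. x \<in> {0<..<1} \<Longrightarrow> RL 1 (RL 1 (\<lambda>s. mode v n s - mode v n 0)) x =
      \<gamma>v * x powr (2 + \<alpha>) + (mu \<epsilon> c n)\<^sup>2 * RL (2 * \<alpha>) (RL 1 (RL 1 (mode v n))) x"
      using mode_equation[OF \<alpha> \<epsilon> v, of n] by blast
    obtain \<gamma>u where \<gamma>u: "\<And>x. x \<in> {0<..<1} \<Longrightarrow> RL 1 (RL 1 (\<lambda>s. mode u n s - mode u n 0)) x =
      \<gamma>u * x powr (2 + \<alpha>) + (mu \<epsilon> c n)\<^sup>2 * RL (2 * \<alpha>) (RL 1 (RL 1 (mode u n))) x"
      using mode_equation[OF \<alpha> \<epsilon> u, of n] by blast
    define D where "D s = mode v n s - mode u n s" for s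
    have Dd: "RL 1 (RL 1 D) x = RL 1 (RL 1 (mode v n)) x - RL 1 (RL 1 (mode u n)) x" if "x \<in> {0<..<1}" for x
      unfolding D_def by (rule RL_11_diff[OF Vc Uc]) (use that in auto)
    have J2c: "set_integrable lborel {0<..<x} (\<lambda>s. (x - s) powr (2 * \<alpha> - 1) * RL 1 (RL 1 f) s)"
      if f: "continuous_on {0..1} f" and x: "x \<in> {0<..<1}" for f x
    proof -
      have fi: "set_integrable lborel {0<..<s} f" if "s \<in> {0<..<1}" for s
        by (rule continuous_integrable[OF _ f]) (use that in auto)
      have "set_integrable lborel {0<..<x} (\<lambda>s. (x - s) powr (2 * \<alpha> - 1) * RL 2 f s)"
        using \<alpha> x fi[OF x] by (intro RL_semigroup(2)) auto
      also have "?this \<longleftrightarrow> ?thesis"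
        by (rule set_integrable_cong) (use RL_11_eq_RL_2 fi x in auto)
      finally show ?thesis .
    qed
    have "D s = 0"
    proof (rule mode_zero[OF \<alpha>(1) mu_pos[OF \<epsilon>, of c n] _ _ _ _ s, where \<gamma> = "\<gamma>v - \<gamma>u"])
      show "continuous_on {0..1} D" unfolding D_def by (intro continuous_intros Vc Uc)
      show "D 0 = 0" "D 1 = 0" using b0 b1 by (auto simp: D_def)
      fix x :: real assume x: "x \<in> {0<..<1}"
      \<comment> \<open>The two modes agree at 0, so their initial values can be inserted and the
        two equations subtracted.\<close>
      have "D = (\<lambda>s. (mode v n s - mode v n 0) - (mode u n s - mode u n 0))" by (auto simp: D_def b0)
      then have "RL 1 (RL 1 D) x = RL 1 (RL 1 (\<lambda>s. mode v n s - mode v n 0)) x - RL 1 (RL 1 (\<lambda>s. mode u n s - mode u n 0)) x"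
        using x by (simp only:) (intro RL_11_diff continuous_intros Vc Uc, auto)
      note 1 = this
      have "RL (2 * \<alpha>) (RL 1 (RL 1 D)) x = RL (2 * \<alpha>) (\<lambda>s. RL 1 (RL 1 (mode v n)) s - RL 1 (RL 1 (mode u n)) s) x"
        using x Dd by (intro RL_cong) auto
      also have "\<dots> = RL (2 * \<alpha>) (RL 1 (RL 1 (mode v n))) x - RL (2 * \<alpha>) (RL 1 (RL 1 (mode u n))) x"
        by (intro RL_diff J2c Vc Uc x)
      finally have 2: "RL (2 * \<alpha>) (RL 1 (RL 1 D)) x = RL (2 * \<alpha>) (RL 1 (RL 1 (mode v n))) x - RL (2 * \<alpha>) (RL 1 (RL 1 (mode u n))) x" .
      have "(gv * P + m * A) - (gu * P + m * B) = (gv - gu) * P + m * (A - B)" for gv gu P m A B :: real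
        by (simp add: algebra_simps)
      then show "RL 1 (RL 1 D) x = (\<gamma>v - \<gamma>u) * x powr (2 + \<alpha>) + (mu \<epsilon> c n)\<^sup>2 * RL (2 * \<alpha>) (RL 1 (RL 1 D)) x"
        unfolding 1 2 \<gamma>v[OF x] \<gamma>u[OF x] .
    qed
    then show ?thesis by (simp add: D_def)
  qed
  have vs: "continuous_on {-pi..pi} (v x)" "continuous_on {-pi..pi} (u x)"
    using continuous_on_section(2)[OF vc xy(1)] continuous_on_section(2)[OF uc xy(1)] by auto
  have "v x y - u x y = 0"
  proof (rule Y_complete[of "\<lambda>y. v x y - u x y"])
    show "continuous_on {-pi..pi} (\<lambda>y. v x y - u x y)" by (intro continuous_intros vs)
    fix n
    have "integral {-pi..pi} (\<lambda>y. (v x y - u x y) * Y n y) = integral {-pi..pi} (\<lambda>y. Y n y * v x y - Y n y * u x y)"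
      by (simp add: algebra_simps)
    also have "\<dots> = mode v n x - mode u n x"
      unfolding mode_def by (intro integral_diff integrable_continuous_real continuous_intros vs)
    finally show "integral {-pi..pi} (\<lambda>y. (v x y - u x y) * Y n y) = 0" using modes[OF xy(1)] by simp
  qed (rule xy(2))
  then show ?thesis by simp
qed

section \<open>Fourier coefficients\<close>

definition Yint :: "(real \<Rightarrow> real) \<Rightarrow> nat \<Rightarrow> real"
  where "Yint f n = integral {-pi..pi} (\<lambda>y. f y * Y n y)"

text \<open>Two integrations by parts; products of two antiperiodic functions leave no boundary
  terms.\<close>

lemma Yint_second_derivative:
  assumes f1: "\<And>y. y \<in> {-pi..pi} \<Longrightarrow> (f has_real_derivative f1 y) (at y within {-pi..pi})"
    and f2: "\<And>y. y \<in> {-pi..pi} \<Longrightarrow> (f1 has_real_derivative f2 y) (at y within {-pi..pi})"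
    and f2c: "continuous_on {-pi..pi} f2"
    and b: "f (- pi) = - f pi" "f1 (- pi) = - f1 pi"
  shows "Yint f2 n = - (kap n)\<^sup>2 * Yint f n"
proof -
  have fc: "continuous_on {-pi..pi} f" by (rule DERIV_continuous_on) (rule f1)
  have "((\<lambda>y. f2 y * Y n y - f y * (- (kap n)\<^sup>2 * Y n y)) has_integral
     ((f1 pi * Y n pi - f pi * Yd n pi) - (f1 (- pi) * Y n (- pi) - f (- pi) * Yd n (- pi)))) {-pi..pi}"
  proof (rule fundamental_theorem_of_calculus)
    fix y assume y: "y \<in> {-pi..pi}"
    have "((\<lambda>y. f1 y * Y n y - f y * Yd n y) has_real_derivative
      ((f2 y * Y n y + Yd n y * f1 y) - (f1 y * Yd n y + (- (kap n)\<^sup>2 * Y n y) * f y))) (at y within {-pi..pi})"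
      by (intro DERIV_diff DERIV_mult f1 f2 Y_has_derivative Yd_has_derivative y)
    then show "((\<lambda>y. f1 y * Y n y - f y * Yd n y) has_vector_derivative (f2 y * Y n y - f y * (- (kap n)\<^sup>2 * Y n y))) (at y within {-pi..pi})"
      by (simp add: has_real_derivative_iff_has_vector_derivative [symmetric] algebra_simps)
  qed simp
  moreover have "(f1 pi * Y n pi - f pi * Yd n pi) - (f1 (- pi) * Y n (- pi) - f (- pi) * Yd n (- pi)) = 0"
    using Y_at_pi[of n] b by (cases "even n") simp_all
  ultimately have "integral {-pi..pi} (\<lambda>y. f2 y * Y n y - f y * (- (kap n)\<^sup>2 * Y n y)) = 0"
    by (simp add: integral_unique)
  also have "integral {-pi..pi} (\<lambda>y. f2 y * Y n y - f y * (- (kap n)\<^sup>2 * Y n y)) =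
      Yint f2 n - integral {-pi..pi} (\<lambda>y. - (kap n)\<^sup>2 * (f y * Y n y))"
    unfolding Yint_def by (subst integral_diff [symmetric])
      (auto intro!: integrable_continuous_real continuous_intros fc f2c simp: mult_ac)
  also have "integral {-pi..pi} (\<lambda>y. - (kap n)\<^sup>2 * (f y * Y n y)) = - (kap n)\<^sup>2 * Yint f n"
    unfolding Yint_def by (rule integral_mult_right)
  finally show ?thesis by simp
qed

lemma Y_antiperiodic: "Y n (- pi) = - Y n pi" "Yd n (- pi) = - Yd n pi"
  using Y_at_pi[of n] by (cases "even n"; simp)+

text \<open>Different frequencies: symmetry of the second derivative under antiperiodic conditions.
  Sine against cosine of the same frequency: parity. For the norm, the derivative of Y Y' integrates
  to 0, so Y'^2 and kap^2 Y^2 have equal integrals, and their sum is the constant kap^2.\<close>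

lemma Y_orthogonal: "Yint (Y m) n = (if m = n then pi else 0)"
proof -
  have s: "Yint (\<lambda>y. - (kap m)\<^sup>2 * Y m y) n = - (kap n)\<^sup>2 * Yint (Y m) n"
    by (rule Yint_second_derivative[where f = "Y m" and ?f1.0 = "Yd m", OF Y_has_derivative Yd_has_derivative _ Y_antiperiodic])
      (intro continuous_intros)
  have "Yint (\<lambda>y. - (kap m)\<^sup>2 * Y m y) n = integral {-pi..pi} (\<lambda>y. - (kap m)\<^sup>2 * (Y m y * Y n y))"
    unfolding Yint_def by (simp only: mult.assoc)
  also have "\<dots> = - (kap m)\<^sup>2 * Yint (Y m) n" unfolding Yint_def by (rule integral_mult_right)
  finally have k: "(kap m)\<^sup>2 * Yint (Y m) n = (kap n)\<^sup>2 * Yint (Y m) n" using s by simp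
  show ?thesis
  proof (cases "kap m = kap n")
    case False
    then have "(kap m)\<^sup>2 \<noteq> (kap n)\<^sup>2" using kap_pos[of m] kap_pos[of n] by (simp add: power2_eq_iff)
    then show ?thesis using k False by auto
  next
    case True
    then have d: "m div 2 = n div 2" by (simp add: kap_def)
    show ?thesis
    proof (cases "m = n")
      case False
      then have p: "even m \<noteq> even n"
      proof -
        have "m mod 2 \<noteq> n mod 2" using d False by (metis div_mult_mod_eq)
        then show ?thesis by (auto simp: even_iff_mod_2_eq_zero)
      qed
      have "Yint (Y m) n = integral {-pi..pi} (\<lambda>y. Y m (- y) * Y n (- y))"
        unfolding Yint_def using integral_reflect_pi[of "\<lambda>y. Y m y * Y n y"] by simp
      also have "\<dots> = integral {-pi..pi} (\<lambda>y. - (Y m y * Y n y))"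
        unfolding Y_reflect[of m] Y_reflect[of n] using p by (cases "even m") auto
      also have "\<dots> = - Yint (Y m) n" unfolding Yint_def by simp
      finally show ?thesis using False by simp
    next
      case True
      have sq: "(kap n)\<^sup>2 * (Y n y * Y n y) + Yd n y * Yd n y = (kap n)\<^sup>2" for y
      proof -
        have "(sin (kap n * y))\<^sup>2 + (cos (kap n * y))\<^sup>2 = 1" by simp
        then show ?thesis by (cases "even n") (auto simp: Y_kap Yd_def power2_eq_square algebra_simps simp flip: distrib_left)
      qed
      have "((\<lambda>y. Yd n y * Yd n y + Y n y * (- (kap n)\<^sup>2 * Y n y)) has_integral (Y n pi * Yd n pi - Y n (- pi) * Yd n (- pi))) {-pi..pi}"
      proof (rule fundamental_theorem_of_calculus)
        fix y
        have "((\<lambda>y. Y n y * Yd n y) has_real_derivative (Yd n y * Yd n y + (- (kap n)\<^sup>2 * Y n y) * Y n y)) (at y within {-pi..pi})"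
          by (intro DERIV_mult Y_has_derivative Yd_has_derivative)
        then show "((\<lambda>y. Y n y * Yd n y) has_vector_derivative (Yd n y * Yd n y + Y n y * (- (kap n)\<^sup>2 * Y n y))) (at y within {-pi..pi})"
          by (simp add: has_real_derivative_iff_has_vector_derivative [symmetric] mult_ac)
      qed simp
      note hi = this
      have "Yd n y * Yd n y + Y n y * (- (kap n)\<^sup>2 * Y n y) = (kap n)\<^sup>2 - 2 * (kap n)\<^sup>2 * (Y n y * Y n y)" for y
        using sq[of y] by (simp add: algebra_simps)
      then have eq: "(\<lambda>y. Yd n y * Yd n y + Y n y * (- (kap n)\<^sup>2 * Y n y)) = (\<lambda>y. (kap n)\<^sup>2 - 2 * (kap n)\<^sup>2 * (Y n y * Y n y))"
        by (rule ext)
      have "integral {-pi..pi} (\<lambda>y. (kap n)\<^sup>2 - 2 * (kap n)\<^sup>2 * (Y n y * Y n y)) = 0"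
        unfolding integral_unique[OF hi[unfolded eq]] by (simp add: Y_antiperiodic)
      also have "integral {-pi..pi} (\<lambda>y. (kap n)\<^sup>2 - 2 * (kap n)\<^sup>2 * (Y n y * Y n y)) =
        integral {-pi..pi} (\<lambda>y. (kap n)\<^sup>2) - integral {-pi..pi} (\<lambda>y. 2 * (kap n)\<^sup>2 * (Y n y * Y n y))"
        by (intro integral_diff integrable_continuous_real continuous_intros)
      also have "integral {-pi..pi} (\<lambda>y. 2 * (kap n)\<^sup>2 * (Y n y * Y n y)) = 2 * (kap n)\<^sup>2 * Yint (Y n) n"
        unfolding Yint_def by (rule integral_mult_right)
      finally have "2 * (kap n)\<^sup>2 * (pi - Yint (Y n) n) = 0" by (simp add: algebra_simps)
      then show ?thesis using True kap_pos[of n] by simp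
    qed
  qed
qed

lemma fourier_coeff_eq:
  assumes "continuous_on {-pi..pi} f"
  shows "fourier_coeff f n = Yint f n / pi"
proof -
  have "(LBINT y:{-pi..pi}. f y * Y n y) = Yint f n"
    unfolding Yint_def by (intro set_borel_integral_eq_integral(2) borel_integrable_atLeastAtMost' continuous_intros assms)
  moreover have "(LBINT y:{-pi..pi}. (Y n y)\<^sup>2) = integral {-pi..pi} (\<lambda>y. (Y n y)\<^sup>2)"
    by (intro set_borel_integral_eq_integral(2) borel_integrable_atLeastAtMost' continuous_intros)
  ultimately show ?thesis
    using Y_orthogonal[of n n] by (simp add: fourier_coeff_def Yint_def power2_eq_square)
qed

lemma Yint_bessel:
  assumes f: "continuous_on {-pi..pi} f"
  shows "summable (\<lambda>n. (Yint f n)\<^sup>2)"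
proof (rule bounded_imp_summable)
  fix N
  define a where "a n = Yint f n / pi" for n
  define g where "g y = (\<Sum>n\<le>N. a n * Y n y)" for y
  have gc: "continuous_on {-pi..pi} g" unfolding g_def by (intro continuous_intros)
  have lin: "integral {-pi..pi} (\<lambda>y. h y * g y) = (\<Sum>n\<le>N. a n * Yint h n)" if h: "continuous_on {-pi..pi} h" for h
  proof -
    have "integral {-pi..pi} (\<lambda>y. h y * g y) = integral {-pi..pi} (\<lambda>y. \<Sum>n\<le>N. a n * (h y * Y n y))"
      by (simp add: g_def sum_distrib_left mult_ac)
    also have "\<dots> = (\<Sum>n\<le>N. integral {-pi..pi} (\<lambda>y. a n * (h y * Y n y)))"
      by (intro integral_sum integrable_continuous_real continuous_intros h) auto
    also have "\<dots> = (\<Sum>n\<le>N. a n * Yint h n)" unfolding Yint_def integral_mult_right ..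
    finally show ?thesis .
  qed
  have Yg: "Yint g n = a n * pi" if "n \<le> N" for n
  proof -
    have "Yint g n = integral {-pi..pi} (\<lambda>y. Y n y * g y)" by (simp add: Yint_def mult.commute)
    also have "\<dots> = (\<Sum>k\<le>N. a k * Yint (Y n) k)" by (rule lin) (intro continuous_intros)
    also have "\<dots> = (\<Sum>k\<le>N. if k = n then a k * pi else 0)"
      by (intro sum.cong) (auto simp: Y_orthogonal)
    also have "\<dots> = a n * pi" using that by simp
    finally show ?thesis .
  qed
  have fg: "integral {-pi..pi} (\<lambda>y. f y * g y) = (\<Sum>n\<le>N. pi * (a n)\<^sup>2)"
    unfolding lin[OF f] by (intro sum.cong) (auto simp: a_def power2_eq_square)
  have gg: "integral {-pi..pi} (\<lambda>y. g y * g y) = (\<Sum>n\<le>N. pi * (a n)\<^sup>2)"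
    unfolding lin[OF gc] by (intro sum.cong) (auto simp: Yg power2_eq_square)
  have "0 \<le> integral {-pi..pi} (\<lambda>y. (f y - g y) * (f y - g y))"
    by (intro integral_nonneg integrable_continuous_real continuous_intros f gc) auto
  also have "integral {-pi..pi} (\<lambda>y. (f y - g y) * (f y - g y)) = integral {-pi..pi} (\<lambda>y. (f y * f y - 2 * (f y * g y)) + g y * g y)"
    by (simp add: algebra_simps)
  also have "\<dots> = integral {-pi..pi} (\<lambda>y. f y * f y - 2 * (f y * g y)) + integral {-pi..pi} (\<lambda>y. g y * g y)"
    by (intro integral_add integrable_continuous_real continuous_intros f gc)
  also have "integral {-pi..pi} (\<lambda>y. f y * f y - 2 * (f y * g y)) = integral {-pi..pi} (\<lambda>y. f y * f y) - integral {-pi..pi} (\<lambda>y. 2 * (f y * g y))"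
    by (intro integral_diff integrable_continuous_real continuous_intros f gc)
  also have "integral {-pi..pi} (\<lambda>y. 2 * (f y * g y)) = 2 * integral {-pi..pi} (\<lambda>y. f y * g y)" by (rule integral_mult_right)
  finally have "(\<Sum>n\<le>N. pi * (a n)\<^sup>2) \<le> integral {-pi..pi} (\<lambda>y. f y * f y)" using fg gg by simp
  then have "(\<Sum>n\<le>N. (Yint f n)\<^sup>2) / pi \<le> integral {-pi..pi} (\<lambda>y. f y * f y)"
    by (simp add: a_def power_divide power2_eq_square sum_divide_distrib)
  then show "(\<Sum>n\<le>N. (Yint f n)\<^sup>2) \<le> integral {-pi..pi} (\<lambda>y. f y * f y) * pi"
    by (simp add: divide_le_eq)
qed simp

lemma summable_inverse_kap: "summable (\<lambda>n. 1 / (kap n)\<^sup>2)"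
proof (rule summable_comparison_test')
  have "summable (\<lambda>n. inverse (real n ^ 2))" by (rule inverse_power_summable) simp
  then have "summable (\<lambda>n. inverse (real (Suc n) ^ 2))" by (subst summable_Suc_iff)
  then show "summable (\<lambda>n. 16 * inverse (real (Suc n) ^ 2))" by (rule summable_mult)
  fix n :: nat assume "0 \<le> n"
  \<comment> \<open>Every frequency belongs to two indices, which leads to the lower bound (n + 1) /
    4 for \<open>kap n\<close>.\<close>
  have "real n = 2 * real (n div 2) + real (n mod 2)" by (metis of_nat_add of_nat_mult of_nat_numeral mult_div_mod_eq)
  moreover have "real (n mod 2) \<le> 1" by simp
  ultimately have "real (Suc n) / 4 \<le> kap n" by (simp add: kap_def)
  then have "(real (Suc n) / 4)\<^sup>2 \<le> (kap n)\<^sup>2" by (intro power_mono) auto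
  then have "inverse ((kap n)\<^sup>2) \<le> inverse ((real (Suc n) / 4)\<^sup>2)" by (intro le_imp_inverse_le) auto
  also have "inverse ((real (Suc n) / 4)\<^sup>2) = 16 * inverse (real (Suc n) ^ 2)"
    unfolding power_divide by (simp add: inverse_eq_divide)
  finally show "norm (1 / (kap n)\<^sup>2) \<le> 16 * inverse (real (Suc n) ^ 2)"
    unfolding inverse_eq_divide by simp
qed

text \<open>Two derivatives multiply the coefficients by kap^2 up to sign, so kap times a
  coefficient of f is, in modulus, that of f'' divided by kap: a product of two square-summable
  sequences.\<close>

lemma fourier_coeff_summable:
  assumes f1: "\<And>y. y \<in> {-pi..pi} \<Longrightarrow> (f has_real_derivative f1 y) (at y within {-pi..pi})"
    and f2: "\<And>y. y \<in> {-pi..pi} \<Longrightarrow> (f1 has_real_derivative f2 y) (at y within {-pi..pi})"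
    and f2c: "continuous_on {-pi..pi} f2"
    and b: "f (- pi) = - f pi" "f1 (- pi) = - f1 pi"
  shows "summable (\<lambda>n. kap n * \<bar>fourier_coeff f n\<bar>)"
proof (rule summable_comparison_test')
  show "summable (\<lambda>n. (Yint f2 n)\<^sup>2 + 1 / (kap n)\<^sup>2)"
    by (intro summable_add Yint_bessel f2c summable_inverse_kap)
  fix n :: nat assume "0 \<le> n"
  have fc: "continuous_on {-pi..pi} f" by (rule DERIV_continuous_on) (rule f1)
  have k: "0 < kap n" by (rule kap_pos)
  have e: "Yint f2 n = - (kap n)\<^sup>2 * Yint f n"
    by (rule Yint_second_derivative[where f = f and ?f1.0 = f1]) (fact assms)+
  have "kap n * \<bar>fourier_coeff f n\<bar> = kap n * \<bar>Yint f n\<bar> / pi" by (simp add: fourier_coeff_eq[OF fc])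
  also have "\<dots> \<le> kap n * \<bar>Yint f n\<bar>"
  proof -
    have "1 \<le> pi" using pi_gt3 by simp
    then show ?thesis using divide_left_mono[of 1 pi "kap n * \<bar>Yint f n\<bar>"] k by simp
  qed
  also have "\<dots> = \<bar>Yint f2 n\<bar> * (1 / kap n)"
    unfolding e using k by (simp add: abs_mult power2_eq_square)
  also have "\<dots> \<le> (Yint f2 n)\<^sup>2 + 1 / (kap n)\<^sup>2"
  proof -
    have am: "p * q \<le> p\<^sup>2 + q\<^sup>2" if "0 \<le> p" "0 \<le> q" for p q :: real
    proof -
      have "0 \<le> (p - q)\<^sup>2 + p * q" using that by simp
      moreover have "0 \<le> p * q" using that by simp
      ultimately show ?thesis by (simp add: power2_eq_square algebra_simps)
    qed
    from am[of "\<bar>Yint f2 n\<bar>" "1 / kap n"] k show ?thesis by (simp add: power_divide)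
  qed
  finally show "norm (kap n * \<bar>fourier_coeff f n\<bar>) \<le> (Yint f2 n)\<^sup>2 + 1 / (kap n)\<^sup>2" using k by simp
qed

text \<open>The series converges uniformly, so its sum has the coefficients of \<open>f\<close>, and
  completeness identifies the two.\<close>

lemma fourier_series_eq:
  assumes f: "continuous_on {-pi..pi} f" and s: "summable (\<lambda>n. kap n * \<bar>fourier_coeff f n\<bar>)"
    and y: "y \<in> {-pi..pi}"
  shows "(\<Sum>n. fourier_coeff f n * Y n y) = f y"
proof -
  have s1: "summable (\<lambda>n. \<bar>fourier_coeff f n\<bar>)"
  proof (rule summable_comparison_test')
    show "summable (\<lambda>n. 2 * (kap n * \<bar>fourier_coeff f n\<bar>))" using s by (rule summable_mult)
    fix n :: nat assume "0 \<le> n"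
    have "1 * \<bar>fourier_coeff f n\<bar> \<le> (2 * kap n) * \<bar>fourier_coeff f n\<bar>"
      by (intro mult_right_mono) (auto simp: kap_def)
    then show "norm \<bar>fourier_coeff f n\<bar> \<le> 2 * (kap n * \<bar>fourier_coeff f n\<bar>)" by simp
  qed
  define G where "G y = (\<Sum>n. fourier_coeff f n * Y n y)" for y
  have bound: "norm (fourier_coeff f n * Y n y * w) \<le> \<bar>fourier_coeff f n\<bar>" if "\<bar>w\<bar> \<le> 1" for n y w
  proof -
    have "\<bar>Y n y\<bar> * \<bar>w\<bar> \<le> 1 * 1" using Y_bounded[of n y] that by (intro mult_mono) auto
    then have "\<bar>fourier_coeff f n\<bar> * (\<bar>Y n y\<bar> * \<bar>w\<bar>) \<le> \<bar>fourier_coeff f n\<bar> * 1" by (intro mult_left_mono) auto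
    then show ?thesis by (simp add: abs_mult mult.assoc)
  qed
  have ul: "uniform_limit {-pi..pi} (\<lambda>N y. \<Sum>n<N. fourier_coeff f n * Y n y) G sequentially"
    unfolding G_def by (rule Weierstrass_m_test[OF _ s1]) (use bound[of 1] in simp)
  have Gc: "continuous_on {-pi..pi} G"
    by (rule uniform_limit_theorem[OF _ ul]) (auto intro!: always_eventually continuous_intros)
  have "Yint G m = pi * fourier_coeff f m" for m
  proof -
    have sm: "summable (\<lambda>n. fourier_coeff f n * Y n y)" for y
      by (rule summable_comparison_test'[OF s1]) (use bound[of 1] in simp)
    have "uniform_limit {-pi..pi} (\<lambda>N y. \<Sum>n<N. fourier_coeff f n * Y n y * Y m y) (\<lambda>y. \<Sum>n. fourier_coeff f n * Y n y * Y m y) sequentially"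
      by (rule Weierstrass_m_test[OF _ s1]) (rule bound[OF Y_bounded])
    then have ul2: "uniform_limit (cbox (-pi) pi) (\<lambda>N y. \<Sum>n<N. fourier_coeff f n * Y n y * Y m y) (\<lambda>y. G y * Y m y) sequentially"
      unfolding G_def by (simp add: suminf_mult2 [OF sm, symmetric] cbox_interval)
    have "(\<lambda>N. integral (cbox (-pi) pi) (\<lambda>y. \<Sum>n<N. fourier_coeff f n * Y n y * Y m y)) \<longlonglongrightarrow> integral (cbox (-pi) pi) (\<lambda>y. G y * Y m y)"
    proof -
      have cn: "continuous_on (cbox (-pi) pi) (\<lambda>y. \<Sum>n<N. fourier_coeff f n * Y n y * Y m y)" for N
        by (intro continuous_intros)
      obtain I J where IJ: "\<And>N. ((\<lambda>y. \<Sum>n<N. fourier_coeff f n * Y n y * Y m y) has_integral I N) (cbox (-pi) pi)"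
        "((\<lambda>y. G y * Y m y) has_integral J) (cbox (-pi) pi)" "I \<longlonglongrightarrow> J"
        using uniform_limit_integral_cbox[OF ul2 cn sequentially_bot] by blast
      then show ?thesis unfolding integral_unique[OF IJ(1)] integral_unique[OF IJ(2)] by simp
    qed
    moreover have "integral (cbox (-pi) pi) (\<lambda>y. \<Sum>n<N. fourier_coeff f n * Y n y * Y m y) = (\<Sum>n<N. fourier_coeff f n * Yint (Y n) m)" for N
    proof -
      have "integral {-pi..pi} (\<lambda>y. \<Sum>n<N. fourier_coeff f n * (Y n y * Y m y)) = (\<Sum>n<N. integral {-pi..pi} (\<lambda>y. fourier_coeff f n * (Y n y * Y m y)))"
        by (intro integral_sum integrable_continuous_real continuous_intros) auto
      then show ?thesis unfolding Yint_def integral_mult_right by (simp add: cbox_interval mult.assoc)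
    qed
    ultimately have "(\<lambda>n. fourier_coeff f n * Yint (Y n) m) sums Yint G m"
      by (simp add: sums_def Yint_def cbox_interval)
    moreover have "(\<lambda>n. fourier_coeff f n * Yint (Y n) m) sums (\<Sum>n\<in>{m}. fourier_coeff f n * Yint (Y n) m)"
      by (rule sums_finite) (auto simp: Y_orthogonal)
    ultimately have "Yint G m = (\<Sum>n\<in>{m}. fourier_coeff f n * Yint (Y n) m)" by (rule sums_unique2)
    then show ?thesis by (simp add: Y_orthogonal)
  qed
  moreover have "Yint f m = pi * fourier_coeff f m" for m by (simp add: fourier_coeff_eq[OF f])
  ultimately have z: "Yint f m - Yint G m = 0" for m by simp
  have "f y - G y = 0"
  proof (rule Y_complete[of "\<lambda>y. f y - G y", OF _ _ y])
    show "continuous_on {-pi..pi} (\<lambda>y. f y - G y)" by (intro continuous_intros f Gc)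
    fix m
    have "integral {-pi..pi} (\<lambda>y. (f y - G y) * Y m y) = integral {-pi..pi} (\<lambda>y. f y * Y m y - G y * Y m y)"
      by (simp add: left_diff_distrib)
    also have "\<dots> = Yint f m - Yint G m"
      unfolding Yint_def by (intro integral_diff integrable_continuous_real continuous_intros f Gc)
    finally show "integral {-pi..pi} (\<lambda>y. (f y - G y) * Y m y) = 0" using z by simp
  qed
  then show ?thesis by (simp add: G_def)
qed

lemma hoelder_space_fourier:
  assumes f: "f \<in> hoelder_space m \<delta> {-pi..pi}" and m: "2 \<le> m"
    and b: "f (- pi) = - f pi" "deriv_within {-pi..pi} f (- pi) = - deriv_within {-pi..pi} f pi"
  shows "continuous_on {-pi..pi} f" "summable (\<lambda>n. kap n * \<bar>fourier_coeff f n\<bar>)"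
proof -
  let ?D = "deriv_within {-pi..pi}"
  have df: "(g has_real_derivative ?D g y) (at y within {-pi..pi})" if "g differentiable_on {-pi..pi}" "y \<in> {-pi..pi}" for g y
    using that by (auto simp: differentiable_on_def deriv_within_def has_real_derivative_iff_has_vector_derivative
        differentiable_def intro!: vector_derivative_works[THEN iffD1])
  have d: "(?D ^^ i) f differentiable_on {-pi..pi}" if "i < m" for i
    using f that by (auto simp: hoelder_space_def)
  have d0: "f differentiable_on {-pi..pi}" using d[of 0] m by simp
  have d1: "?D f differentiable_on {-pi..pi}" using d[of 1] m by simp
  \<comment> \<open>For m = 2 the second derivative is the top one, whose continuity is part of the
    space; for larger m it is differentiable.\<close>
  have c2: "continuous_on {-pi..pi} (?D (?D f))"
  proof (cases "m = 2")
    case True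
    then show ?thesis using f by (auto simp: hoelder_space_def numeral_2_eq_2)
  next
    case False
    then have "(?D ^^ 2) f differentiable_on {-pi..pi}" using d[of 2] m by simp
    then show ?thesis by (auto simp: numeral_2_eq_2 intro: differentiable_imp_continuous_on)
  qed
  show "continuous_on {-pi..pi} f" using d0 by (rule differentiable_imp_continuous_on)
  show "summable (\<lambda>n. kap n * \<bar>fourier_coeff f n\<bar>)"
    by (rule fourier_coeff_summable[OF df[OF d0] df[OF d1] c2 b])
qed

section \<open>Termwise Caputo differentiation\<close>

lemma caputo_cong_interval:
  assumes "\<And>s. s \<in> {0<..<1} \<Longrightarrow> f s = g s" and x: "x \<in> {0<..<1}"
  shows "caputo \<alpha> f x = caputo \<alpha> g x" and "has_caputo \<alpha> f x \<longleftrightarrow> has_caputo \<alpha> g x"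
proof -
  have ev: "\<forall>\<^sub>F z in nhds s. f z = g z" if s: "s \<in> {0<..<1}" for s
  proof -
    have "\<forall>\<^sub>F z in nhds s. z \<in> {0<..<1}" using s by (intro eventually_nhds_in_open) auto
    then show ?thesis by eventually_elim (rule assms(1))
  qed
  have d: "deriv f s = deriv g s" if "s \<in> {0<..<1}" for s
    by (rule deriv_cong_ev[OF ev[OF that] refl])
  have df: "f differentiable (at s) \<longleftrightarrow> g differentiable (at s)" if "s \<in> {0<..<1}" for s
    unfolding real_differentiable_def using DERIV_cong_ev[OF refl ev[OF that] refl] by simp
  have sub: "s \<in> {0<..<1}" if "s \<in> {0<..<x}" for s using that x by auto
  have "set_integrable lborel {0<..<x} (\<lambda>s. (x - s) powr (- \<alpha>) * deriv f s) \<longleftrightarrow>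
      set_integrable lborel {0<..<x} (\<lambda>s. (x - s) powr (- \<alpha>) * deriv g s)"
    by (rule set_integrable_cong) (use d sub in auto)
  moreover have "(\<forall>s\<in>{0<..<x}. f differentiable (at s)) \<longleftrightarrow> (\<forall>s\<in>{0<..<x}. g differentiable (at s))"
    using df sub by blast
  ultimately show "has_caputo \<alpha> f x \<longleftrightarrow> has_caputo \<alpha> g x" using df[OF x] by (simp add: has_caputo_def)
  have "(LBINT s:{0<..<x}. (x - s) powr (- \<alpha>) * deriv f s) = (LBINT s:{0<..<x}. (x - s) powr (- \<alpha>) * deriv g s)"
    by (rule set_lebesgue_integral_cong) (use d sub in auto)
  then show "caputo \<alpha> f x = caputo \<alpha> g x" using d[OF x] by (simp add: caputo_def)
qed

text \<open>For an integrand of one sign the integral of the modulus is the modulus of the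
  integral.\<close>

lemma caputo_abs_mass:
  assumes \<alpha>: "0 < \<alpha>" "\<alpha> < 1" and f: "has_caputo \<alpha> f x"
    and sgn: "(\<forall>s\<in>{0<..<x}. 0 \<le> deriv f s) \<or> (\<forall>s\<in>{0<..<x}. deriv f s \<le> 0)"
  shows "(LBINT s:{0<..<x}. (x - s) powr (- \<alpha>) * \<bar>deriv f s\<bar>) = Gamma (1 - \<alpha>) * \<bar>caputo \<alpha> f x\<bar>"
    and "set_integrable lborel {0<..<x} (\<lambda>s. (x - s) powr (- \<alpha>) * \<bar>deriv f s\<bar>)"
proof -
  have i: "set_integrable lborel {0<..<x} (\<lambda>s. (x - s) powr (- \<alpha>) * deriv f s)"
    using f \<alpha> by (simp add: has_caputo_def)
  from set_integrable_abs[OF i] show "set_integrable lborel {0<..<x} (\<lambda>s. (x - s) powr (- \<alpha>) * \<bar>deriv f s\<bar>)"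
    by (simp add: abs_mult)
  have G: "Gamma (1 - \<alpha>) * caputo \<alpha> f x = (LBINT s:{0<..<x}. (x - s) powr (- \<alpha>) * deriv f s)"
    using \<alpha> by (simp add: caputo_def)
  have Gp: "0 < Gamma (1 - \<alpha>)" using \<alpha> by simp
  have nn: "0 \<le> (LBINT s:{0<..<x}. (x - s) powr (- \<alpha>) * \<bar>deriv f s\<bar>)"
    unfolding set_lebesgue_integral_def by (intro integral_nonneg_AE AE_I2) (auto simp: indicator_def)
  obtain \<sigma> :: real where \<sigma>: "\<bar>\<sigma>\<bar> = 1" "\<And>s. s \<in> {0<..<x} \<Longrightarrow> \<bar>deriv f s\<bar> = \<sigma> * deriv f s"
    using sgn
  proof
    assume "\<forall>s\<in>{0<..<x}. 0 \<le> deriv f s" then show thesis using that[of 1] by simp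
  next
    assume "\<forall>s\<in>{0<..<x}. deriv f s \<le> 0" then show thesis using that[of "- 1"] by simp
  qed
  have "(LBINT s:{0<..<x}. (x - s) powr (- \<alpha>) * \<bar>deriv f s\<bar>) = (LBINT s:{0<..<x}. \<sigma> * ((x - s) powr (- \<alpha>) * deriv f s))"
    by (rule set_lebesgue_integral_cong) (use \<sigma>(2) in \<open>auto simp: mult_ac\<close>)
  also have "\<dots> = \<sigma> * (Gamma (1 - \<alpha>) * caputo \<alpha> f x)" unfolding G by simp
  finally have e: "(LBINT s:{0<..<x}. (x - s) powr (- \<alpha>) * \<bar>deriv f s\<bar>) = \<sigma> * (Gamma (1 - \<alpha>) * caputo \<alpha> f x)" .
  have "\<sigma> * (Gamma (1 - \<alpha>) * caputo \<alpha> f x) = \<bar>\<sigma> * (Gamma (1 - \<alpha>) * caputo \<alpha> f x)\<bar>" using nn e by simp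
  also have "\<dots> = Gamma (1 - \<alpha>) * \<bar>caputo \<alpha> f x\<bar>" using \<sigma>(1) Gp by (simp add: abs_mult)
  finally show "(LBINT s:{0<..<x}. (x - s) powr (- \<alpha>) * \<bar>deriv f s\<bar>) = Gamma (1 - \<alpha>) * \<bar>caputo \<alpha> f x\<bar>" using e by simp
qed

text \<open>Two exchanges: bounds on compact subintervals of (0, 1) give the derivative of the sum,
  and summable masses of the integrands give its Caputo integral, which reaches down to 0, where the
  derivatives may blow up.\<close>

lemma caputo_series:
  fixes f :: "nat \<Rightarrow> real \<Rightarrow> real"
  assumes \<alpha>: "0 < \<alpha>" "\<alpha> \<le> 1"
    and hc: "\<And>n x. x \<in> {0<..<1} \<Longrightarrow> has_caputo \<alpha> (f n) x"
    and db: "\<And>a b. 0 < a \<Longrightarrow> a < b \<Longrightarrow> b < 1 \<Longrightarrow> \<exists>M. summable M \<and> (\<forall>n. \<forall>x\<in>{a..b}. \<bar>deriv (f n) x\<bar> \<le> M n)"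
    and sm: "\<And>x. x \<in> {0<..<1} \<Longrightarrow> summable (\<lambda>n. f n x)"
    and mass: "\<alpha> < 1 \<Longrightarrow> x \<in> {0<..<1} \<Longrightarrow> summable (\<lambda>n. LBINT s:{0<..<x}. (x - s) powr (- \<alpha>) * \<bar>deriv (f n) s\<bar>)"
    and x: "x \<in> {0<..<1}"
  shows "caputo \<alpha> (\<lambda>s. \<Sum>n. f n s) x = (\<Sum>n. caputo \<alpha> (f n) x)" and "has_caputo \<alpha> (\<lambda>s. \<Sum>n. f n s) x"
proof -
  have df: "(f n has_real_derivative deriv (f n) s) (at s)" if "s \<in> {0<..<1}" for n s
  proof -
    define z where "z = (s + 1) / 2"
    have "z \<in> {0<..<1}" "s \<in> {0<..<z}" using that by (auto simp: z_def)
    then have "f n differentiable (at s)" using hc[of z n] hc[OF that, of n] by (auto simp: has_caputo_def split: if_splits)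
    then show ?thesis by (simp add: DERIV_deriv_iff_real_differentiable)
  qed
  have D: "summable (\<lambda>n. \<bar>deriv (f n) s\<bar>) \<and> ((\<lambda>s. \<Sum>n. f n s) has_real_derivative (\<Sum>n. deriv (f n) s)) (at s)" if s: "s \<in> {0<..<1}" for s
  proof -
    define a b where "a = s / 2" and "b = (s + 1) / 2"
    have ab: "0 < a" "a < b" "b < 1" "s \<in> {a<..<b}" using s by (auto simp: a_def b_def)
    obtain M where M: "summable M" "\<And>n x. x \<in> {a..b} \<Longrightarrow> \<bar>deriv (f n) x\<bar> \<le> M n" using db[OF ab(1-3)] by blast
    have 1: "summable (\<lambda>n. \<bar>deriv (f n) s\<bar>)"
      by (rule summable_comparison_test'[OF M(1)]) (use M(2)[of s] ab in auto)
    have 2: "uniformly_convergent_on {a..b} (\<lambda>N x. \<Sum>n<N. deriv (f n) x)"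
      by (rule Weierstrass_m_test'[OF _ M(1)]) (use M(2) in simp)
    have "((\<lambda>s. \<Sum>n. f n s) has_real_derivative (\<Sum>n. deriv (f n) s)) (at s)"
    proof (rule has_field_derivative_series'(2)[of "{a..b}" f "\<lambda>n x. deriv (f n) x" s])
      show "(f n has_real_derivative deriv (f n) z) (at z within {a..b})" if "z \<in> {a..b}" for n z
        by (rule has_field_derivative_at_within, rule df) (use that ab in auto)
      show "summable (\<lambda>n. f n s)" by (rule sm[OF s])
    qed (use 2 ab in auto)
    then show ?thesis using 1 by simp
  qed
  then have dS: "deriv (\<lambda>s. \<Sum>n. f n s) s = (\<Sum>n. deriv (f n) s)" "(\<lambda>s. \<Sum>n. f n s) differentiable (at s)" if "s \<in> {0<..<1}" for s
    using that by (auto simp: DERIV_imp_deriv real_differentiable_def)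
  have "caputo \<alpha> (\<lambda>s. \<Sum>n. f n s) x = (\<Sum>n. caputo \<alpha> (f n) x) \<and> has_caputo \<alpha> (\<lambda>s. \<Sum>n. f n s) x"
  proof (cases "\<alpha> = 1")
    case True
    then show ?thesis using dS[OF x] by (simp add: caputo_def has_caputo_def)
  next
    case False
    with \<alpha> have \<alpha>1: "\<alpha> < 1" by simp
    define h where "h n s = indicator {0<..<x} s *\<^sub>R ((x - s) powr (- \<alpha>) * deriv (f n) s)" for n s
    have sub: "s \<in> {0<..<1}" if "s \<in> {0<..<x}" for s using that x by auto
    have i1: "integrable lborel (h n)" for n
      using hc[OF x, of n] False by (simp add: has_caputo_def h_def [abs_def] set_integrable_def)
    have i2: "AE s in lborel. summable (\<lambda>n. norm (h n s))"
    proof (rule AE_I2)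
      fix s show "summable (\<lambda>n. norm (h n s))"
        using D[OF sub, of s] by (cases "s \<in> {0<..<x}") (auto simp: h_def abs_mult intro!: summable_mult)
    qed
    have i3: "summable (\<lambda>n. LINT s|lborel. norm (h n s))"
      using mass[OF \<alpha>1 x] by (simp add: h_def abs_mult set_lebesgue_integral_def)
    have eq: "(\<Sum>n. h n s) = indicator {0<..<x} s *\<^sub>R ((x - s) powr (- \<alpha>) * deriv (\<lambda>s. \<Sum>n. f n s) s)" for s
    proof (cases "s \<in> {0<..<x}")
      case True
      have "summable (\<lambda>n. deriv (f n) s)" by (rule summable_rabs_cancel[OF conjunct1[OF D[OF sub[OF True]]]])
      then show ?thesis using True dS(1)[OF sub[OF True]] by (simp add: h_def suminf_mult)
    qed (simp add: h_def)
    have "set_integrable lborel {0<..<x} (\<lambda>s. (x - s) powr (- \<alpha>) * deriv (\<lambda>s. \<Sum>n. f n s) s)"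
      using integrable_suminf[OF i1 i2 i3] unfolding eq by (simp add: set_integrable_def)
    then have "has_caputo \<alpha> (\<lambda>s. \<Sum>n. f n s) x" using False dS(2)[OF sub] by (simp add: has_caputo_def)
    moreover have "(LBINT s:{0<..<x}. (x - s) powr (- \<alpha>) * deriv (\<lambda>s. \<Sum>n. f n s) s) = (\<Sum>n. integral\<^sup>L lborel (h n))"
      using integral_suminf[OF i1 i2 i3] unfolding eq by (simp add: set_lebesgue_integral_def)
    then have "caputo \<alpha> (\<lambda>s. \<Sum>n. f n s) x = (\<Sum>n. integral\<^sup>L lborel (h n)) / Gamma (1 - \<alpha>)"
      using False by (simp add: caputo_def)
    moreover have "(\<Sum>n. integral\<^sup>L lborel (h n)) / Gamma (1 - \<alpha>) = (\<Sum>n. integral\<^sup>L lborel (h n) / Gamma (1 - \<alpha>))"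
      by (rule suminf_divide [symmetric]) (rule summable_integral[OF i1 i2 i3])
    moreover have "caputo \<alpha> (f n) x = integral\<^sup>L lborel (h n) / Gamma (1 - \<alpha>)" for n
      using False by (simp add: caputo_def h_def [abs_def] set_lebesgue_integral_def)
    ultimately show ?thesis by simp
  qed
  then show "caputo \<alpha> (\<lambda>s. \<Sum>n. f n s) x = (\<Sum>n. caputo \<alpha> (f n) x)" and "has_caputo \<alpha> (\<lambda>s. \<Sum>n. f n s) x" by auto
qed

text \<open>A series \<open>\<Sum>n. p n * e n + q n * z n\<close> whose \<open>e n\<close> are decreasing and \<open>z n\<close> increasing
  can be differentiated termwise as soon as the Caputo derivatives are absolutely summable: for
  monotone functions the latter control the mass of the Caputo integrand.\<close>

lemma caputo_monotone_series:
  fixes e z :: "nat \<Rightarrow> real \<Rightarrow> real" and p q :: "nat \<Rightarrow> real"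
  assumes \<alpha>: "0 < \<alpha>" "\<alpha> \<le> 1"
    and he: "\<And>n x. x \<in> {0<..<1} \<Longrightarrow> has_caputo \<alpha> (e n) x" and hz: "\<And>n x. x \<in> {0<..<1} \<Longrightarrow> has_caputo \<alpha> (z n) x"
    and de: "\<And>n x. x \<in> {0<..<1} \<Longrightarrow> deriv (e n) x \<le> 0" and dz: "\<And>n x. x \<in> {0<..<1} \<Longrightarrow> 0 \<le> deriv (z n) x"
    and bd: "\<And>a b. 0 < a \<Longrightarrow> a < b \<Longrightarrow> b < 1 \<Longrightarrow> \<exists>M. summable M \<and>
      (\<forall>n. \<forall>x\<in>{a..b}. \<bar>p n * deriv (e n) x\<bar> + \<bar>q n * deriv (z n) x\<bar> + \<bar>p n * e n x + q n * z n x\<bar>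
        + \<bar>p n * caputo \<alpha> (e n) x\<bar> + \<bar>q n * caputo \<alpha> (z n) x\<bar> \<le> M n)"
    and x: "x \<in> {0<..<1}"
  shows "caputo \<alpha> (\<lambda>s. \<Sum>n. p n * e n s + q n * z n s) x = (\<Sum>n. p n * caputo \<alpha> (e n) x + q n * caputo \<alpha> (z n) x)"
    and "has_caputo \<alpha> (\<lambda>s. \<Sum>n. p n * e n s + q n * z n s) x"
proof -
  define f where "f n s = p n * e n s + q n * z n s" for n s
  have dif: "e n differentiable (at s)" "z n differentiable (at s)" if "s \<in> {0<..<1}" for n s
  proof -
    define w where "w = (s + 1) / 2"
    have "w \<in> {0<..<1}" "s \<in> {0<..<w}" using that by (auto simp: w_def)
    then show "e n differentiable (at s)" "z n differentiable (at s)"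
      using he[of w n] he[OF that, of n] hz[of w n] hz[OF that, of n] by (auto simp: has_caputo_def split: if_splits)
  qed
  have df: "deriv (f n) s = p n * deriv (e n) s + q n * deriv (z n) s" if "s \<in> {0<..<1}" for n s
    unfolding f_def using dif[OF that, of n]
    by (intro DERIV_imp_deriv DERIV_add DERIV_cmult) (simp_all add: DERIV_deriv_iff_real_differentiable)
  have cf: "caputo \<alpha> (f n) s = p n * caputo \<alpha> (e n) s + q n * caputo \<alpha> (z n) s" "has_caputo \<alpha> (f n) s" if "s \<in> {0<..<1}" for n s
    unfolding f_def by (intro caputo_linear he hz that)+
  have pt: "\<exists>M. summable M \<and> (\<forall>n. \<bar>f n s\<bar> \<le> M n \<and> \<bar>p n * caputo \<alpha> (e n) s\<bar> + \<bar>q n * caputo \<alpha> (z n) s\<bar> \<le> M n)" if s: "s \<in> {0<..<1}" for s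
  proof -
    obtain M where M: "summable M" "\<And>n x. x \<in> {s/2..s} \<Longrightarrow> \<bar>p n * deriv (e n) x\<bar> + \<bar>q n * deriv (z n) x\<bar> + \<bar>p n * e n x + q n * z n x\<bar>
        + \<bar>p n * caputo \<alpha> (e n) x\<bar> + \<bar>q n * caputo \<alpha> (z n) x\<bar> \<le> M n"
      using bd[of "s/2" s] s by auto
    have "\<bar>f n s\<bar> \<le> M n \<and> \<bar>p n * caputo \<alpha> (e n) s\<bar> + \<bar>q n * caputo \<alpha> (z n) s\<bar> \<le> M n" for n
      using M(2)[of s n] s unfolding f_def by auto
    then show ?thesis using M(1) by blast
  qed
  have series: "caputo \<alpha> (\<lambda>s. \<Sum>n. f n s) x = (\<Sum>n. caputo \<alpha> (f n) x)" "has_caputo \<alpha> (\<lambda>s. \<Sum>n. f n s) x"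
  proof -
    have db: "\<exists>M. summable M \<and> (\<forall>n. \<forall>x\<in>{a..b}. \<bar>deriv (f n) x\<bar> \<le> M n)" if ab: "0 < a" "a < b" "b < 1" for a b
    proof -
      have le: "A \<le> m" if "A + B + C + D \<le> m" "0 \<le> B" "0 \<le> C" "0 \<le> D" for A B C D m :: real using that by linarith
      obtain M where M: "summable M" "\<And>n x. x \<in> {a..b} \<Longrightarrow> \<bar>p n * deriv (e n) x\<bar> + \<bar>q n * deriv (z n) x\<bar> + \<bar>p n * e n x + q n * z n x\<bar>
        + \<bar>p n * caputo \<alpha> (e n) x\<bar> + \<bar>q n * caputo \<alpha> (z n) x\<bar> \<le> M n"
        using bd[OF ab] by blast
      have "\<bar>deriv (f n) x\<bar> \<le> M n" if "x \<in> {a..b}" for n x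
      proof -
        have x1: "x \<in> {0<..<1}" using that ab by auto
        have "\<bar>deriv (f n) x\<bar> \<le> \<bar>p n * deriv (e n) x\<bar> + \<bar>q n * deriv (z n) x\<bar>"
          unfolding df[OF x1] by (rule abs_triangle_ineq)
        also have "\<dots> \<le> M n" by (rule le[OF M(2)[OF that]]) auto
        finally show ?thesis .
      qed
      with M(1) show ?thesis by (intro exI[of _ M]) auto
    qed
    have sm: "summable (\<lambda>n. f n s)" if "s \<in> {0<..<1}" for s
      using pt[OF that] summable_comparison_test'[of _ 0 "\<lambda>n. f n s"] by (metis real_norm_def)
    have mass: "summable (\<lambda>n. LBINT r:{0<..<s}. (s - r) powr (- \<alpha>) * \<bar>deriv (f n) r\<bar>)" if \<alpha>1: "\<alpha> < 1" and s: "s \<in> {0<..<1}" for s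
    proof -
      obtain M where M: "summable M" "\<And>n. \<bar>p n * caputo \<alpha> (e n) s\<bar> + \<bar>q n * caputo \<alpha> (z n) s\<bar> \<le> M n" using pt[OF s] by blast
      have Gp: "0 < Gamma (1 - \<alpha>)" using \<alpha>1 by simp
      show ?thesis
      proof (rule summable_comparison_test')
        show "summable (\<lambda>n. Gamma (1 - \<alpha>) * M n)" using M(1) by (rule summable_mult)
        fix n :: nat assume "0 \<le> n"
        have sub: "r \<in> {0<..<1}" if "r \<in> {0<..<s}" for r using that s by auto
        \<comment> \<open>\<open>p n\<close> and \<open>q n\<close> have arbitrary signs, so
          \<open>f n\<close> need not be monotone; the two families are estimated
          separately.\<close>
        note me = caputo_abs_mass[OF \<alpha>(1) \<alpha>1 he[OF s, of n]] and mz = caputo_abs_mass[OF \<alpha>(1) \<alpha>1 hz[OF s, of n]]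
        have me: "(LBINT r:{0<..<s}. (s - r) powr (- \<alpha>) * \<bar>deriv (e n) r\<bar>) = Gamma (1 - \<alpha>) * \<bar>caputo \<alpha> (e n) s\<bar>"
            "set_integrable lborel {0<..<s} (\<lambda>r. (s - r) powr (- \<alpha>) * \<bar>deriv (e n) r\<bar>)"
          and mz: "(LBINT r:{0<..<s}. (s - r) powr (- \<alpha>) * \<bar>deriv (z n) r\<bar>) = Gamma (1 - \<alpha>) * \<bar>caputo \<alpha> (z n) s\<bar>"
            "set_integrable lborel {0<..<s} (\<lambda>r. (s - r) powr (- \<alpha>) * \<bar>deriv (z n) r\<bar>)"
          using me mz de dz sub by blast+
        have ie: "set_integrable lborel {0<..<s} (\<lambda>r. \<bar>p n\<bar> * ((s - r) powr (- \<alpha>) * \<bar>deriv (e n) r\<bar>))"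
          and iz: "set_integrable lborel {0<..<s} (\<lambda>r. \<bar>q n\<bar> * ((s - r) powr (- \<alpha>) * \<bar>deriv (z n) r\<bar>))"
          using me(2) mz(2) by (auto intro!: set_integrable_mult_right)
        have fi: "set_integrable lborel {0<..<s} (\<lambda>r. (s - r) powr (- \<alpha>) * \<bar>deriv (f n) r\<bar>)"
          using cf(2)[OF s, of n] \<alpha>1 set_integrable_abs[of lborel "{0<..<s}" "\<lambda>r. (s - r) powr (- \<alpha>) * deriv (f n) r"]
          by (simp add: has_caputo_def abs_mult)
        have "(LBINT r:{0<..<s}. (s - r) powr (- \<alpha>) * \<bar>deriv (f n) r\<bar>) \<le>
          (LBINT r:{0<..<s}. \<bar>p n\<bar> * ((s - r) powr (- \<alpha>) * \<bar>deriv (e n) r\<bar>) + \<bar>q n\<bar> * ((s - r) powr (- \<alpha>) * \<bar>deriv (z n) r\<bar>))"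
        proof (rule set_integral_mono[OF fi set_integral_add(1)[OF ie iz]])
          fix r assume "r \<in> {0<..<s}"
          then have "\<bar>deriv (f n) r\<bar> \<le> \<bar>p n\<bar> * \<bar>deriv (e n) r\<bar> + \<bar>q n\<bar> * \<bar>deriv (z n) r\<bar>"
            using df[OF sub, of r n] abs_triangle_ineq[of "p n * deriv (e n) r" "q n * deriv (z n) r"] by (simp add: abs_mult)
          then have "(s - r) powr (- \<alpha>) * \<bar>deriv (f n) r\<bar> \<le> (s - r) powr (- \<alpha>) * (\<bar>p n\<bar> * \<bar>deriv (e n) r\<bar> + \<bar>q n\<bar> * \<bar>deriv (z n) r\<bar>)"
            by (intro mult_left_mono) auto
          then show "(s - r) powr (- \<alpha>) * \<bar>deriv (f n) r\<bar> \<le> \<bar>p n\<bar> * ((s - r) powr (- \<alpha>) * \<bar>deriv (e n) r\<bar>) + \<bar>q n\<bar> * ((s - r) powr (- \<alpha>) * \<bar>deriv (z n) r\<bar>)"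
            by (simp add: algebra_simps)
        qed
        also have "\<dots> = \<bar>p n\<bar> * (Gamma (1 - \<alpha>) * \<bar>caputo \<alpha> (e n) s\<bar>) + \<bar>q n\<bar> * (Gamma (1 - \<alpha>) * \<bar>caputo \<alpha> (z n) s\<bar>)"
          unfolding set_integral_add(2)[OF ie iz] by (simp add: me(1) mz(1))
        also have "\<dots> = Gamma (1 - \<alpha>) * (\<bar>p n * caputo \<alpha> (e n) s\<bar> + \<bar>q n * caputo \<alpha> (z n) s\<bar>)"
          by (simp add: abs_mult algebra_simps)
        also have "\<dots> \<le> Gamma (1 - \<alpha>) * M n" using M(2)[of n] Gp by (intro mult_left_mono) auto
        finally have le: "(LBINT r:{0<..<s}. (s - r) powr (- \<alpha>) * \<bar>deriv (f n) r\<bar>) \<le> Gamma (1 - \<alpha>) * M n" .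
        moreover have "0 \<le> (LBINT r:{0<..<s}. (s - r) powr (- \<alpha>) * \<bar>deriv (f n) r\<bar>)"
          unfolding set_lebesgue_integral_def by (intro integral_nonneg_AE AE_I2) (auto simp: indicator_def)
        ultimately show "norm (LBINT r:{0<..<s}. (s - r) powr (- \<alpha>) * \<bar>deriv (f n) r\<bar>) \<le> Gamma (1 - \<alpha>) * M n" by simp
      qed
    qed
    show "caputo \<alpha> (\<lambda>s. \<Sum>n. f n s) x = (\<Sum>n. caputo \<alpha> (f n) x)"
      by (rule caputo_series(1)[OF \<alpha> cf(2) db sm mass x])
    show "has_caputo \<alpha> (\<lambda>s. \<Sum>n. f n s) x"
      by (rule caputo_series(2)[OF \<alpha> cf(2) db sm mass x])
  qed
  then show "caputo \<alpha> (\<lambda>s. \<Sum>n. p n * e n s + q n * z n s) x = (\<Sum>n. p n * caputo \<alpha> (e n) x + q n * caputo \<alpha> (z n) x)"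
    and "has_caputo \<alpha> (\<lambda>s. \<Sum>n. p n * e n s + q n * z n s) x"
    using cf(1)[OF x] by (simp_all add: f_def)
qed

text \<open>The majorants may depend on the distance of x from 0 and 1, so the limit is taken on a
  neighbourhood of each point.\<close>

lemma series_continuous_on_Omega:
  fixes T :: "nat \<Rightarrow> real \<Rightarrow> real \<Rightarrow> real"
  assumes c: "\<And>n. continuous_on Omega (\<lambda>(x, y). T n x y)"
    and bd: "\<And>a b. 0 < a \<Longrightarrow> a < b \<Longrightarrow> b < 1 \<Longrightarrow> \<exists>M. summable M \<and> (\<forall>n. \<forall>x\<in>{a..b}. \<forall>y. \<bar>T n x y\<bar> \<le> M n)"
  shows "continuous_on Omega (\<lambda>(x, y). \<Sum>n. T n x y)"
proof -
  have "continuous (at p) (\<lambda>(x, y). \<Sum>n. T n x y)" if p: "p \<in> Omega" for p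
  proof -
    obtain x0 y0 where p0: "p = (x0, y0)" "0 < x0" "x0 < 1" using p by (auto simp: Omega_def)
    define a b where "a = x0 / 2" and "b = (x0 + 1) / 2"
    have ab: "0 < a" "a < x0" "x0 < b" "b < 1" using p0 by (auto simp: a_def b_def)
    obtain M where M: "summable M" "\<And>n x y. x \<in> {a..b} \<Longrightarrow> \<bar>T n x y\<bar> \<le> M n" using bd[of a b] ab by auto
    define U :: "(real \<times> real) set" where "U = {a<..<b} \<times> {-pi<..<pi}"
    have U: "open U" "p \<in> U" "U \<subseteq> Omega" using p ab by (auto simp: U_def p0 Omega_def open_Times)
    have "uniform_limit U (\<lambda>N p. \<Sum>n<N. (\<lambda>(x, y). T n x y) p) (\<lambda>p. \<Sum>n. (\<lambda>(x, y). T n x y) p) sequentially"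
      by (rule Weierstrass_m_test[OF _ M(1)]) (use M(2) in \<open>auto simp: U_def\<close>)
    then have "continuous_on U (\<lambda>p. \<Sum>n. (\<lambda>(x, y). T n x y) p)"
      by (rule uniform_limit_theorem[rotated])
        (auto intro!: always_eventually continuous_on_sum continuous_on_subset[OF c U(3)])
    then have "continuous_on U (\<lambda>(x, y). \<Sum>n. T n x y)" by (simp add: case_prod_unfold)
    then show ?thesis using U by (simp add: continuous_on_eq_continuous_at)
  qed
  then show ?thesis by (simp add: continuous_at_imp_continuous_on)
qed

section \<open>Existence\<close>

lemma continuous_on_series:
  fixes f :: "nat \<Rightarrow> 'a :: topological_space \<Rightarrow> real"
  assumes "\<And>n. continuous_on S (f n)" "\<And>n x. x \<in> S \<Longrightarrow> \<bar>f n x\<bar> \<le> M n" "summable M"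
  shows "continuous_on S (\<lambda>x. \<Sum>n. f n x)"
proof -
  have "uniform_limit S (\<lambda>N x. \<Sum>n<N. f n x) (\<lambda>x. \<Sum>n. f n x) sequentially"
    by (rule Weierstrass_m_test[OF _ assms(3)]) (use assms(2) in simp)
  then show ?thesis
    by (rule uniform_limit_theorem[rotated]) (auto intro!: always_eventually continuous_on_sum assms(1))
qed

lemma has_derivative_series_UNIV:
  fixes f f' :: "nat \<Rightarrow> real \<Rightarrow> real"
  assumes "\<And>n y. (f n has_real_derivative f' n y) (at y)" "\<And>n y. \<bar>f' n y\<bar> \<le> M n" "summable M"
    and "summable (\<lambda>n. f n y)"
  shows "((\<lambda>y. \<Sum>n. f n y) has_real_derivative (\<Sum>n. f' n y)) (at y)"
proof (rule has_field_derivative_series'(2)[of UNIV f f' y])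
  show "uniformly_convergent_on UNIV (\<lambda>N x. \<Sum>n<N. f' n x)"
    by (rule Weierstrass_m_test'[OF _ assms(3)]) (use assms(2) in simp)
qed (use assms in auto)

lemma kap_ge_half: "1 / 2 \<le> kap n" by (simp add: kap_def)

lemma abs_mult_Y_le: "\<bar>a * Y n y\<bar> \<le> \<bar>a\<bar>"
  unfolding abs_mult by (rule mult_left_le) (use Y_bounded[of n y] in auto)

lemma abs_mult_Yd_le: "\<bar>a * Yd n y\<bar> \<le> kap n * \<bar>a\<bar>"
  using mult_left_mono[OF Yd_bounded[of n y], of "\<bar>a\<bar>"] by (simp add: abs_mult mult.commute)

lemma continuous_on_Omega_fst:
  assumes "continuous_on {0..} f" shows "continuous_on Omega (\<lambda>p. f (fst p))"
  by (rule continuous_on_compose2[OF assms]) (auto simp: Omega_def intro!: continuous_intros)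

lemma Omega_memD: "(x, y) \<in> Omega \<Longrightarrow> x \<in> {0<..<1}" by (auto simp: Omega_def)

text \<open>The basis is \<open>mle\<close> and \<open>Sf\<close> rather than \<open>C_fun\<close>
  and \<open>S_fun\<close>, because decay and monotonicity are established for these two
  separately.\<close>

definition radial :: "real \<Rightarrow> real \<Rightarrow> real \<Rightarrow> (nat \<Rightarrow> real) \<Rightarrow> (nat \<Rightarrow> real) \<Rightarrow> nat \<Rightarrow> real \<Rightarrow> real"
  where "radial \<alpha> \<epsilon> c A B n x = A n * mle \<alpha> (- mu \<epsilon> c n) x + B n * Sf \<alpha> (mu \<epsilon> c n) x"

definition mode_series :: "real \<Rightarrow> real \<Rightarrow> real \<Rightarrow> (nat \<Rightarrow> real) \<Rightarrow> (nat \<Rightarrow> real) \<Rightarrow> real \<Rightarrow> real \<Rightarrow> real"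
  where "mode_series \<alpha> \<epsilon> c A B x y = (\<Sum>n. radial \<alpha> \<epsilon> c A B n x * Y n y)"

context
  fixes \<alpha> \<epsilon> c :: real and A B :: "nat \<Rightarrow> real"
  assumes \<alpha>: "0 < \<alpha>" "\<alpha> \<le> 1" and \<epsilon>: "\<bar>\<epsilon>\<bar> < 1"
    and AB: "summable (\<lambda>n. kap n * (\<bar>A n\<bar> + \<bar>B n\<bar>))"
begin

abbreviation (input) "\<mu> \<equiv> mu \<epsilon> c"
abbreviation (input) "e n \<equiv> mle \<alpha> (- mu \<epsilon> c n)"
abbreviation (input) "S n \<equiv> Sf \<alpha> (mu \<epsilon> c n)"
abbreviation (input) "K n \<equiv> Kf \<alpha> (mu \<epsilon> c n)"
abbreviation (input) "X \<equiv> radial \<alpha> \<epsilon> c A B"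
abbreviation (input) "u \<equiv> mode_series \<alpha> \<epsilon> c A B"

lemma mu_kap_bounds:
  obtains l L where "0 < l" "\<And>n. l * kap n \<le> \<mu> n" "0 < L" "\<And>n. \<mu> n \<le> L * kap n"
proof (rule that[of "sqrt (1 - \<bar>\<epsilon>\<bar>)" "sqrt (2 + 4 * c\<^sup>2)"])
  show "0 < sqrt (1 - \<bar>\<epsilon>\<bar>)" using \<epsilon> by simp
  show "0 < sqrt (2 + 4 * c\<^sup>2)" by (simp add: add_pos_nonneg)
  fix n :: nat
  define \<sigma> :: real where "\<sigma> = (if even n then 1 else - 1)"
  have sg: "\<bar>\<epsilon>\<bar> \<ge> \<sigma> * \<epsilon>" "\<bar>\<epsilon>\<bar> \<ge> - (\<sigma> * \<epsilon>)" by (auto simp: \<sigma>_def)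
  have m: "(\<mu> n)\<^sup>2 = (1 - \<sigma> * \<epsilon>) * (kap n)\<^sup>2 + c\<^sup>2" unfolding \<sigma>_def by (rule mu_squared[OF \<epsilon>])
  have "(1 - \<bar>\<epsilon>\<bar>) * (kap n)\<^sup>2 \<le> (1 - \<sigma> * \<epsilon>) * (kap n)\<^sup>2" using sg by (intro mult_right_mono) auto
  then have "(1 - \<bar>\<epsilon>\<bar>) * (kap n)\<^sup>2 \<le> (\<mu> n)\<^sup>2" unfolding m by (rule add_increasing2[rotated]) simp
  then have "(sqrt (1 - \<bar>\<epsilon>\<bar>) * kap n)\<^sup>2 \<le> (\<mu> n)\<^sup>2" using \<epsilon> by (simp add: power_mult_distrib)
  then show "sqrt (1 - \<bar>\<epsilon>\<bar>) * kap n \<le> \<mu> n"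
    by (rule power2_le_imp_le) (use mu_pos[OF \<epsilon>, of c n] in simp)
  have "(1 - \<sigma> * \<epsilon>) * (kap n)\<^sup>2 \<le> 2 * (kap n)\<^sup>2" using sg \<epsilon> by (intro mult_right_mono) auto
  \<comment> \<open>As \<open>kap n\<close> is at least 1/2, c^2 is absorbed into 4 c^2
    kap^2.\<close>
  moreover have "c\<^sup>2 * 1 \<le> c\<^sup>2 * (4 * (kap n)\<^sup>2)"
    using power_mono[OF kap_ge_half[of n], of 2] by (intro mult_left_mono) (auto simp: power_divide)
  ultimately have "(\<mu> n)\<^sup>2 \<le> (sqrt (2 + 4 * c\<^sup>2) * kap n)\<^sup>2"
    unfolding m power_mult_distrib by (simp add: algebra_simps)
  then show "\<mu> n \<le> sqrt (2 + 4 * c\<^sup>2) * kap n"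
    by (rule power2_le_imp_le) (use kap_pos[of n] in simp)
qed

text \<open>One factor kap is what the coefficients can pay for. Away from x = 0, mu times
  \<open>mle\<close> is bounded, so a second factor mu or kap costs one kap; away from x = 1,
  \<open>Sf\<close> gains mu^(-2) and \<open>Kf\<close> gains mu^(-1). The list collects what occurs
  in the value, both Caputo derivatives and the second y-derivative of the series, together with the
  x-derivatives needed for termwise differentiation.\<close>

lemma mode_bounds:
  assumes ab: "0 < a" "a < b" "b < 1"
  shows "\<exists>M. \<forall>n. \<forall>x\<in>{a..b}. \<forall>q\<in>{e n x, S n x, \<mu> n * e n x, \<mu> n * K n x, (\<mu> n)\<^sup>2 * e n x, (\<mu> n)\<^sup>2 * S n x,
      deriv (e n) x, deriv (S n) x, \<mu> n * deriv (e n) x, \<mu> n * deriv (K n) x, (kap n)\<^sup>2 * e n x, (kap n)\<^sup>2 * S n x}.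
      \<bar>q\<bar> \<le> M * kap n"
proof -
  obtain l L where lL: "0 < l" "\<And>n. l * kap n \<le> \<mu> n" "0 < L" "\<And>n. \<mu> n \<le> L * kap n" using mu_kap_bounds by blast
  have b0: "0 < b" using ab by simp
  obtain C where C: "0 < C"
    "\<And>\<mu> t. 0 < \<mu> \<Longrightarrow> 0 < t \<Longrightarrow> t \<le> b \<Longrightarrow> 0 \<le> Sf \<alpha> \<mu> t \<and> Sf \<alpha> \<mu> t \<le> C / \<mu>\<^sup>2"
    "\<And>\<mu> t. 0 < \<mu> \<Longrightarrow> 0 < t \<Longrightarrow> t \<le> b \<Longrightarrow> 0 \<le> Kf \<alpha> \<mu> t \<and> Kf \<alpha> \<mu> t \<le> C / \<mu>"
    "\<And>\<mu> t. 0 < \<mu> \<Longrightarrow> 0 < t \<Longrightarrow> t \<le> b \<Longrightarrow> 0 \<le> deriv (Sf \<alpha> \<mu>) t \<and> deriv (Sf \<alpha> \<mu>) t \<le> C / \<mu>\<^sup>2 / t"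
    "\<And>\<mu> t. 0 < \<mu> \<Longrightarrow> 0 < t \<Longrightarrow> t \<le> b \<Longrightarrow> 0 \<le> deriv (Kf \<alpha> \<mu>) t \<and> deriv (Kf \<alpha> \<mu>) t \<le> C / \<mu> / t"
    using Sf_Kf_bounds[OF \<alpha>(1) \<alpha>(2) b0 ab(3)] by blast
  define G where "G = Gamma (\<alpha> + 1) / a powr \<alpha>"
  have G: "0 < G" using \<alpha> ab by (simp add: G_def)
  \<comment> \<open>A bound for the scaled quantities before comparison with \<open>kap n\<close>: 1
    for \<open>mle\<close> and \<open>Sf\<close>, G for mu times \<open>mle\<close>, alpha / a for
    the derivative of \<open>mle\<close>, C and C / a for the scaled \<open>Sf\<close>,
    \<open>Kf\<close> and their derivatives.\<close>
  define Q where "Q = 1 + G + \<alpha> / a + C + C / a"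
  have Q: "1 \<le> Q" "G \<le> Q" "\<alpha> / a \<le> Q" "C \<le> Q" "C / a \<le> Q"
    using G C(1) \<alpha> ab by (auto simp: Q_def add_nonneg_nonneg)
  define M where "M = 2 * Q + L * Q + Q / l + 8 * (Q / l\<^sup>2)"
  have parts: "0 \<le> Q" "0 \<le> L * Q" "0 \<le> Q / l" "0 \<le> Q / l\<^sup>2" using Q(1) lL by auto
  have M: "2 * Q \<le> M" "L * Q \<le> M" "Q / l \<le> M" "2 * (Q / l\<^sup>2) \<le> M" "8 * (Q / l\<^sup>2) \<le> M"
    unfolding M_def using parts by linarith+
  have two: "v \<le> 2 * v * kap n" if "0 \<le> v" for v n
    using mult_left_mono[OF kap_ge_half[of n], of "2 * v"] that by simp
  have up: "v \<le> M * kap n" if "v \<le> w * kap n" "w \<le> M" for v w n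
    using that mult_right_mono[OF that(2), of "kap n"] kap_pos[of n] by linarith
  have const: "v \<le> M * kap n" if "v \<le> Q" for v n
    by (rule up[OF _ M(1)]) (use that two[OF parts(1), of n] in linarith)
  have main: "\<bar>q\<bar> \<le> M * kap n" if x: "x \<in> {a..b}" and q: "q \<in> {e n x, S n x, \<mu> n * e n x, \<mu> n * K n x, (\<mu> n)\<^sup>2 * e n x, (\<mu> n)\<^sup>2 * S n x,
      deriv (e n) x, deriv (S n) x, \<mu> n * deriv (e n) x, \<mu> n * deriv (K n) x, (kap n)\<^sup>2 * e n x, (kap n)\<^sup>2 * S n x}" for n x q
  proof -
    have x0: "0 < x" "x \<le> b" "0 \<le> x" "x \<le> 1" "a \<le> x" using x ab by auto
    note mp = mu_pos[OF \<epsilon>, of c n]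
    have kp: "0 < kap n" by (rule kap_pos)
    have ea: "0 \<le> e n x" "e n x \<le> 1"
      by (rule mle_nonneg[OF \<alpha> mp x0(3)], rule mle_le_1[OF \<alpha> mp x0(3)])
    have sa: "0 \<le> S n x" "S n x \<le> 1"
      by (rule Sf_bounds(1)[OF \<alpha>(1) mp x0(3,4)], rule Sf_bounds(2)[OF \<alpha>(1) mp x0(3,4)])
    have me: "\<mu> n * e n x \<le> Q"
    proof -
      have "\<mu> n * e n x \<le> \<mu> n * (Gamma (\<alpha> + 1) / (\<mu> n * x powr \<alpha>))"
        using mle_decay[OF \<alpha> mp x0(1)] mp by (intro mult_left_mono) auto
      also have "\<dots> = Gamma (\<alpha> + 1) / x powr \<alpha>" using mp by simp
      also have "\<dots> \<le> G" unfolding G_def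
        using \<alpha> ab x0 by (intro divide_left_mono powr_mono2) auto
      finally show ?thesis using Q(2) by linarith
    qed
    have mK: "0 \<le> K n x" "\<mu> n * K n x \<le> Q"
    proof -
      have "\<mu> n * K n x \<le> \<mu> n * (C / \<mu> n)" using C(3)[OF mp x0(1,2)] mp by (intro mult_left_mono) auto
      then show "\<mu> n * K n x \<le> Q" using mp Q(4) by simp
      show "0 \<le> K n x" using C(3)[OF mp x0(1,2)] by simp
    qed
    have mS: "(\<mu> n)\<^sup>2 * S n x \<le> Q"
    proof -
      have "(\<mu> n)\<^sup>2 * S n x \<le> (\<mu> n)\<^sup>2 * (C / (\<mu> n)\<^sup>2)" using C(2)[OF mp x0(1,2)] by (intro mult_left_mono) auto
      then show ?thesis using mp Q(4) by simp
    qed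
    have de: "\<bar>deriv (e n) x\<bar> \<le> Q"
    proof -
      have "\<bar>deriv (e n) x\<bar> = \<bar>mlp \<alpha> (\<lambda>k. \<alpha> * real k * (- \<mu> n) ^ k) x\<bar> / x"
        using DERIV_imp_deriv[OF mle_has_derivative[OF \<alpha>(1) x0(1), of "- \<mu> n"]] x0 by simp
      also have "\<dots> \<le> \<alpha> / x" using mle_deriv_bound[OF \<alpha> mp x0(1)] x0 by (intro divide_right_mono) auto
      also have "\<dots> \<le> \<alpha> / a" using \<alpha> ab x0 by (intro divide_left_mono) auto
      finally show ?thesis using Q(3) by linarith
    qed
    have Cx: "C / x \<le> Q"
    proof -
      have "C / x \<le> C / a" using C(1) ab x0 by (intro divide_left_mono) auto
      then show ?thesis using Q(5) by linarith
    qed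
    have dK: "0 \<le> deriv (K n) x" "\<mu> n * deriv (K n) x \<le> Q"
    proof -
      have "\<mu> n * deriv (K n) x \<le> \<mu> n * (C / \<mu> n / x)" using C(5)[OF mp x0(1,2)] mp by (intro mult_left_mono) auto
      then show "\<mu> n * deriv (K n) x \<le> Q" using mp Cx by simp
      show "0 \<le> deriv (K n) x" using C(5)[OF mp x0(1,2)] by simp
    qed
    have dS: "0 \<le> deriv (S n) x" "(\<mu> n)\<^sup>2 * deriv (S n) x \<le> Q"
    proof -
      have "(\<mu> n)\<^sup>2 * deriv (S n) x \<le> (\<mu> n)\<^sup>2 * (C / (\<mu> n)\<^sup>2 / x)" using C(4)[OF mp x0(1,2)] by (intro mult_left_mono) auto
      then show "(\<mu> n)\<^sup>2 * deriv (S n) x \<le> Q" using mp Cx by simp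
      show "0 \<le> deriv (S n) x" using C(4)[OF mp x0(1,2)] by simp
    qed
    have kS: "(kap n)\<^sup>2 * v \<le> Q / l\<^sup>2" if v: "0 \<le> v" "(\<mu> n)\<^sup>2 * v \<le> Q" for v
    proof -
      have "(l * kap n)\<^sup>2 \<le> (\<mu> n)\<^sup>2" using lL(1) kp lL(2)[of n] by (intro power_mono) auto
      then have "(l * kap n)\<^sup>2 * v \<le> (\<mu> n)\<^sup>2 * v" using v(1) by (rule mult_right_mono)
      then have "l\<^sup>2 * ((kap n)\<^sup>2 * v) \<le> Q" using v(2) by (simp add: power_mult_distrib mult.assoc)
      then show ?thesis using lL(1) by (simp add: pos_le_divide_eq mult.commute)
    qed
    have Lk: "\<mu> n * v \<le> M * kap n" if "0 \<le> v" "v \<le> Q" for v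
    proof -
      have "\<mu> n * v \<le> (L * kap n) * Q" using that lL(3) lL(4)[of n] kp by (intro mult_mono) auto
      then show ?thesis by (intro up[OF _ M(2)]) (simp add: mult_ac)
    qed
    have k1: "(kap n)\<^sup>2 * e n x \<le> M * kap n"
    proof (rule up[OF _ M(3)])
      have "l * kap n * e n x \<le> \<mu> n * e n x" using ea(1) lL(2) by (intro mult_right_mono) auto
      then have "l * (kap n * e n x) \<le> Q" using me by (simp add: mult.assoc)
      then have "kap n * e n x \<le> Q / l" using lL(1) by (simp add: pos_le_divide_eq mult.commute)
      then have "kap n * (kap n * e n x) \<le> kap n * (Q / l)" using kp by (intro mult_left_mono) auto
      then show "(kap n)\<^sup>2 * e n x \<le> Q / l * kap n" by (simp add: power2_eq_square mult_ac)
    qed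
    have k2: "v \<le> M * kap n" if "v \<le> Q / l\<^sup>2" for v
      by (rule up[OF _ M(4)]) (use that two[OF parts(4), of n] in linarith)
    have dS1: "deriv (S n) x \<le> M * kap n"
    proof -
      have "1 \<le> 4 * (kap n)\<^sup>2" using power_mono[OF kap_ge_half[of n], of 2] by (simp add: power_divide)
      then have "1 * deriv (S n) x \<le> (4 * (kap n)\<^sup>2) * deriv (S n) x" using dS(1) by (rule mult_right_mono)
      also have "\<dots> \<le> 4 * (Q / l\<^sup>2)" using kS[OF dS] by simp
      also have "\<dots> \<le> 4 * (Q / l\<^sup>2) * (2 * kap n)" using parts(4) two[of "4 * (Q / l\<^sup>2)" n] by simp
      also have "\<dots> = (8 * (Q / l\<^sup>2)) * kap n" by simp
      finally show ?thesis by (intro up[OF _ M(5)]) simp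
    qed
    consider "q = e n x" | "q = S n x" | "q = \<mu> n * e n x" | "q = \<mu> n * K n x" | "q = (\<mu> n)\<^sup>2 * e n x" | "q = (\<mu> n)\<^sup>2 * S n x"
      | "q = deriv (e n) x" | "q = deriv (S n) x" | "q = \<mu> n * deriv (e n) x" | "q = \<mu> n * deriv (K n) x"
      | "q = (kap n)\<^sup>2 * e n x" | "q = (kap n)\<^sup>2 * S n x" using q by blast
    then show ?thesis
    proof cases
      case 1 then show ?thesis using const[of "e n x" n] ea Q(1) by simp
    next
      case 2 then show ?thesis using const[of "S n x" n] sa Q(1) by simp
    next
      case 3 then show ?thesis using const[OF me, of n] ea mp by simp
    next
      case 4 then show ?thesis using const[OF mK(2), of n] mK(1) mp by simp
    next
      case 5 then show ?thesis using Lk[OF _ me] ea mp by (simp add: power2_eq_square mult.assoc)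
    next
      case 6 then show ?thesis using const[OF mS, of n] sa by simp
    next
      case 7 then show ?thesis using const[OF de, of n] by simp
    next
      case 8 then show ?thesis using dS1 dS(1) by simp
    next
      case 9 then show ?thesis using Lk[OF _ de] mp by (simp add: abs_mult)
    next
      case 10 then show ?thesis using const[OF dK(2), of n] dK(1) mp by simp
    next
      case 11 then show ?thesis using k1 ea by simp
    next
      case 12 then show ?thesis using k2[OF kS[OF sa(1) mS]] sa by simp
    qed
  qed
  then show ?thesis by blast
qed

lemma AB_summable: "summable (\<lambda>n. \<bar>A n\<bar> + \<bar>B n\<bar>)"
proof (rule summable_comparison_test')
  show "summable (\<lambda>n. 2 * (kap n * (\<bar>A n\<bar> + \<bar>B n\<bar>)))" using AB by (rule summable_mult)
  fix n :: nat assume "0 \<le> n"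
  have "1 * (\<bar>A n\<bar> + \<bar>B n\<bar>) \<le> (2 * kap n) * (\<bar>A n\<bar> + \<bar>B n\<bar>)"
    using kap_ge_half[of n] by (intro mult_right_mono) auto
  then show "norm (\<bar>A n\<bar> + \<bar>B n\<bar>) \<le> 2 * (kap n * (\<bar>A n\<bar> + \<bar>B n\<bar>))" by simp
qed

lemma radial_bound: "x \<in> {0..1} \<Longrightarrow> \<bar>X n x\<bar> \<le> \<bar>A n\<bar> + \<bar>B n\<bar>"
proof -
  assume x: "x \<in> {0..1}"
  then have x0: "0 \<le> x" "x \<le> 1" by auto
  note mp = mu_pos[OF \<epsilon>, of c n]
  have "\<bar>e n x\<bar> \<le> 1" using mle_nonneg[OF \<alpha> mp x0(1)] mle_le_1[OF \<alpha> mp x0(1)] by simp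
  then have "\<bar>A n * e n x\<bar> \<le> \<bar>A n\<bar>" unfolding abs_mult by (rule mult_left_le) simp
  moreover have "\<bar>S n x\<bar> \<le> 1" using Sf_bounds[OF \<alpha>(1) mp x0] by simp
  then have "\<bar>B n * S n x\<bar> \<le> \<bar>B n\<bar>" unfolding abs_mult by (rule mult_left_le) simp
  ultimately show ?thesis unfolding radial_def using abs_triangle_ineq[of "A n * e n x" "B n * S n x"] by linarith
qed

lemma mode_series_summable: "x \<in> {0..1} \<Longrightarrow> summable (\<lambda>n. X n x * Y n y)"
  by (rule summable_comparison_test'[OF AB_summable])
    (use order_trans[OF abs_mult_Y_le radial_bound] in simp)

lemma radial_Yd_bound: "x \<in> {0..1} \<Longrightarrow> \<bar>X n x * Yd n y\<bar> \<le> kap n * (\<bar>A n\<bar> + \<bar>B n\<bar>)"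
  by (rule order_trans[OF abs_mult_Yd_le mult_left_mono[OF radial_bound]]) (auto simp: less_imp_le kap_pos)

lemma radial_continuous: "continuous_on {0..1} (X n)"
  unfolding radial_def [abs_def]
  by (intro continuous_intros continuous_on_subset[OF continuous_on_mle[OF \<alpha>(1)]]
      continuous_on_subset[OF continuous_on_Sf[OF \<alpha>(1)]]) auto

lemma radial_Y_continuous:
  "continuous_on ({0..1} \<times> {-pi..pi}) (\<lambda>(x, y). X n x * Y n y)"
  "continuous_on ({0..1} \<times> {-pi..pi}) (\<lambda>(x, y). X n x * Yd n y)"
  unfolding case_prod_unfold
  by (intro continuous_intros continuous_on_compose2[OF radial_continuous]; auto)+

lemma mode_series_continuous: "continuous_on ({0..1} \<times> {-pi..pi}) (\<lambda>(x, y). u x y)"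
proof -
  have "continuous_on ({0..1} \<times> {-pi..pi}) (\<lambda>p. \<Sum>n. (\<lambda>(x, y). X n x * Y n y) p)"
    by (rule continuous_on_series[OF radial_Y_continuous(1) _ AB_summable])
      (use order_trans[OF abs_mult_Y_le radial_bound] in auto)
  then show ?thesis by (simp add: mode_series_def case_prod_unfold)
qed

lemma mode_series_has_derivative:
  assumes x: "x \<in> {0..1}"
  shows "(u x has_real_derivative (\<Sum>n. X n x * Yd n y)) (at y)"
  unfolding mode_series_def [abs_def]
proof (rule has_derivative_series_UNIV[where M = "\<lambda>n. kap n * (\<bar>A n\<bar> + \<bar>B n\<bar>)"])
  show "((\<lambda>y. X n x * Y n y) has_real_derivative X n x * Yd n y) (at y)" for n y
    by (intro DERIV_cmult Y_has_derivative)
qed (use radial_Yd_bound[OF x] AB mode_series_summable[OF x] in auto)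

lemma mode_series_partial_y:
  assumes x: "x \<in> {0..1}" and y: "y \<in> {-pi..pi}"
  shows "u x differentiable (at y within {-pi..pi})" "partial_y u x y = (\<Sum>n. X n x * Yd n y)"
proof -
  have d: "(u x has_vector_derivative (\<Sum>n. X n x * Yd n y)) (at y within {-pi..pi})"
    using has_field_derivative_at_within[OF mode_series_has_derivative[OF x]]
    by (simp add: has_real_derivative_iff_has_vector_derivative)
  then show "u x differentiable (at y within {-pi..pi})" by (rule differentiableI_vector)
  show "partial_y u x y = (\<Sum>n. X n x * Yd n y)"
    unfolding partial_y_def deriv_within_def
    by (rule vector_derivative_within_cbox[of "-pi" pi, unfolded cbox_interval]) (use y d in auto)
qed

lemma mode_series_partial_y_continuous:
  "continuous_on ({0..1} \<times> {-pi..pi}) (\<lambda>(x, y). partial_y u x y)"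
proof -
  have "continuous_on ({0..1} \<times> {-pi..pi}) (\<lambda>p. \<Sum>n. (\<lambda>(x, y). X n x * Yd n y) p)"
    by (rule continuous_on_series[OF radial_Y_continuous(2) _ AB]) (use radial_Yd_bound in auto)
  then show ?thesis
    by (rule continuous_on_eq) (auto simp: mode_series_partial_y)
qed

text \<open>One summable majorant for every pairing, so that a later proof can draw several
  estimates from the same sequence.\<close>

lemma mode_terms_bound:
  assumes ab: "0 < a" "a < b" "b < 1"
  shows "\<exists>M. summable M \<and> (\<forall>n. \<forall>x\<in>{a..b}. \<forall>v\<in>{e n x, \<mu> n * e n x, (\<mu> n)\<^sup>2 * e n x, deriv (e n) x, \<mu> n * deriv (e n) x, (kap n)\<^sup>2 * e n x}.
     \<forall>w\<in>{S n x, \<mu> n * K n x, (\<mu> n)\<^sup>2 * S n x, deriv (S n) x, \<mu> n * deriv (K n) x, (kap n)\<^sup>2 * S n x}.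
     \<forall>y. \<bar>A n * Y n y * v\<bar> + \<bar>B n * Y n y * w\<bar> \<le> M n)"
proof -
  obtain M where M: "\<forall>n. \<forall>x\<in>{a..b}. \<forall>q\<in>{e n x, S n x, \<mu> n * e n x, \<mu> n * K n x, (\<mu> n)\<^sup>2 * e n x, (\<mu> n)\<^sup>2 * S n x,
      deriv (e n) x, deriv (S n) x, \<mu> n * deriv (e n) x, \<mu> n * deriv (K n) x, (kap n)\<^sup>2 * e n x, (kap n)\<^sup>2 * S n x}.
      \<bar>q\<bar> \<le> M * kap n" using mode_bounds[OF ab] by blast
  have le: "\<bar>A n * Y n y * v\<bar> + \<bar>B n * Y n y * w\<bar> \<le> M * (kap n * (\<bar>A n\<bar> + \<bar>B n\<bar>))"
    if "\<bar>v\<bar> \<le> M * kap n" "\<bar>w\<bar> \<le> M * kap n" for n y v w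
  proof -
    have "\<bar>d * Y n y * t\<bar> \<le> \<bar>d\<bar> * (M * kap n)" if "\<bar>t\<bar> \<le> M * kap n" for d t
      using mult_mono[OF abs_mult_Y_le[of d n y] that] by (simp add: abs_mult)
    from this[OF that(1), of "A n"] this[OF that(2), of "B n"] show ?thesis by (simp add: algebra_simps)
  qed
  show ?thesis
    by (intro exI[of _ "\<lambda>n. M * (kap n * (\<bar>A n\<bar> + \<bar>B n\<bar>))"] conjI summable_mult AB allI ballI le)
      (use M in blast)+
qed

lemma mode_series_yy:
  assumes x: "x \<in> {0<..<1}"
  shows "deriv (u x) differentiable (at y)"
    and "partial_yy u x y = (\<Sum>n. X n x * (- (kap n)\<^sup>2 * Y n y))"
    and "summable (\<lambda>n. X n x * (- (kap n)\<^sup>2 * Y n y))"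
proof -
  have x': "x \<in> {0..1}" using x by simp
  have "0 < x / 2" "x / 2 < x" "x < 1" "x \<in> {x/2..x}" using x by auto
  then obtain M where M: "summable M" "\<And>n y. \<bar>A n * Y n y * ((kap n)\<^sup>2 * e n x)\<bar> + \<bar>B n * Y n y * ((kap n)\<^sup>2 * S n x)\<bar> \<le> M n"
    using mode_terms_bound[of "x / 2" x] by blast
  have b: "\<bar>X n x * (- (kap n)\<^sup>2 * Y n y)\<bar> \<le> M n" for n y
  proof -
    have "X n x * (- (kap n)\<^sup>2 * Y n y) = - (A n * Y n y * ((kap n)\<^sup>2 * e n x) + B n * Y n y * ((kap n)\<^sup>2 * S n x))"
      by (simp add: radial_def algebra_simps)
    then show ?thesis
      using order_trans[OF abs_triangle_ineq M(2)[where n = n and y = y]] by (simp only: abs_minus_cancel)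
  qed
  show sm: "summable (\<lambda>n. X n x * (- (kap n)\<^sup>2 * Y n y))" for y
    by (rule summable_comparison_test'[OF M(1)]) (use b in simp)
  have du: "deriv (u x) = (\<lambda>y. \<Sum>n. X n x * Yd n y)"
    by (rule ext, rule DERIV_imp_deriv, rule mode_series_has_derivative[OF x'])
  have "((\<lambda>y. \<Sum>n. X n x * Yd n y) has_real_derivative (\<Sum>n. X n x * (- (kap n)\<^sup>2 * Y n y))) (at y)"
  proof (rule has_derivative_series_UNIV[where M = M])
    show "((\<lambda>y. X n x * Yd n y) has_real_derivative X n x * (- (kap n)\<^sup>2 * Y n y)) (at y)" for n y
      by (intro DERIV_cmult Yd_has_derivative)
    show "summable (\<lambda>n. X n x * Yd n y)"
      by (rule summable_comparison_test'[OF AB]) (use radial_Yd_bound[OF x'] in simp)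
  qed (use M(1) b in auto)
  then show "deriv (u x) differentiable (at y)" "partial_yy u x y = (\<Sum>n. X n x * (- (kap n)\<^sup>2 * Y n y))"
    unfolding partial_yy_def du by (auto simp: real_differentiable_def DERIV_imp_deriv)
qed

lemma mode_deriv_signs:
  assumes x: "x \<in> {0<..<1}"
  shows "deriv (e n) x \<le> 0" "0 \<le> deriv (S n) x" "0 \<le> deriv (K n) x"
proof -
  have x0: "0 < x" "x < 1" using x by auto
  note mp = mu_pos[OF \<epsilon>, of c n]
  show "deriv (e n) x \<le> 0"
    using DERIV_imp_deriv[OF mle_has_derivative[OF \<alpha>(1) x0(1), of "- \<mu> n"]] mle_deriv_nonpos[OF \<alpha> mp x0(1)] x0
    by (simp add: divide_nonpos_pos)
  show "0 \<le> deriv (S n) x" "0 \<le> deriv (K n) x"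
    using Sf_Kf_bounds[OF \<alpha> x0] mp x0(1) order_refl by metis+
qed

lemma mode_caputo:
  assumes x: "x \<in> {0<..<1}"
  shows "caputo \<alpha> (e n) x = - \<mu> n * e n x" "has_caputo \<alpha> (e n) x"
    "caputo \<alpha> (S n) x = \<mu> n * K n x" "has_caputo \<alpha> (S n) x"
    "caputo \<alpha> (K n) x = \<mu> n * S n x" "has_caputo \<alpha> (K n) x"
  using caputo_mle[OF \<alpha>, of x "- \<mu> n"] caputo_Sf[OF \<alpha>, of x "\<mu> n"] x by auto

lemma mode_series_caputo:
  assumes x: "x \<in> {0<..<1}"
  shows "caputo_x \<alpha> u x y = (\<Sum>n. - (\<mu> n * (A n * Y n y)) * e n x + \<mu> n * (B n * Y n y) * K n x)"
    and "has_caputo_x \<alpha> u x y"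
proof -
  have bd: "\<exists>M. summable M \<and> (\<forall>n. \<forall>x\<in>{a..b}. \<bar>A n * Y n y * deriv (e n) x\<bar> + \<bar>B n * Y n y * deriv (S n) x\<bar>
      + \<bar>A n * Y n y * e n x + B n * Y n y * S n x\<bar> + \<bar>A n * Y n y * caputo \<alpha> (e n) x\<bar> + \<bar>B n * Y n y * caputo \<alpha> (S n) x\<bar> \<le> M n)"
    if ab: "0 < a" "a < b" "b < 1" for a b
  proof -
    obtain M where M: "summable M" "\<And>n x. x \<in> {a..b} \<Longrightarrow> \<bar>A n * Y n y * deriv (e n) x\<bar> + \<bar>B n * Y n y * deriv (S n) x\<bar> \<le> M n"
      "\<And>n x. x \<in> {a..b} \<Longrightarrow> \<bar>A n * Y n y * e n x\<bar> + \<bar>B n * Y n y * S n x\<bar> \<le> M n"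
      "\<And>n x. x \<in> {a..b} \<Longrightarrow> \<bar>A n * Y n y * (\<mu> n * e n x)\<bar> + \<bar>B n * Y n y * (\<mu> n * K n x)\<bar> \<le> M n"
      using mode_terms_bound[OF ab] by blast
    show ?thesis
    proof (intro exI[of _ "\<lambda>n. M n + M n + M n"] conjI summable_add M(1) allI ballI)
      fix n x assume xab: "x \<in> {a..b}"
      then have x: "x \<in> {0<..<1}" using ab by auto
      have "\<bar>A n * Y n y * caputo \<alpha> (e n) x\<bar> = \<bar>A n * Y n y * (\<mu> n * e n x)\<bar>"
        unfolding mode_caputo(1)[OF x] by simp
      moreover note order_trans[OF abs_triangle_ineq M(3)[OF xab]] M(2)[OF xab, of n] M(4)[OF xab, of n]
      ultimately show "\<bar>A n * Y n y * deriv (e n) x\<bar> + \<bar>B n * Y n y * deriv (S n) x\<bar>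
          + \<bar>A n * Y n y * e n x + B n * Y n y * S n x\<bar> + \<bar>A n * Y n y * caputo \<alpha> (e n) x\<bar> + \<bar>B n * Y n y * caputo \<alpha> (S n) x\<bar>
          \<le> M n + M n + M n"
        unfolding mode_caputo(3)[OF x] add.assoc by (smt (verit))
    qed
  qed
  have eq: "(\<lambda>s. u s y) = (\<lambda>s. \<Sum>n. A n * Y n y * e n s + B n * Y n y * S n s)"
    unfolding mode_series_def radial_def by (intro ext suminf_cong) (simp add: algebra_simps)
  note r = caputo_monotone_series[OF \<alpha> mode_caputo(2) mode_caputo(4) mode_deriv_signs(1,2) bd x]
  show "has_caputo_x \<alpha> u x y" unfolding has_caputo_x_def eq by (rule r(2))
  have "caputo_x \<alpha> u x y = (\<Sum>n. A n * Y n y * caputo \<alpha> (e n) x + B n * Y n y * caputo \<alpha> (S n) x)"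
    unfolding caputo_x_def eq by (rule r(1))
  also have "\<dots> = (\<Sum>n. - (\<mu> n * (A n * Y n y)) * e n x + \<mu> n * (B n * Y n y) * K n x)"
    unfolding mode_caputo(1)[OF x] mode_caputo(3)[OF x] by (intro suminf_cong) (simp add: algebra_simps)
  finally show "caputo_x \<alpha> u x y = (\<Sum>n. - (\<mu> n * (A n * Y n y)) * e n x + \<mu> n * (B n * Y n y) * K n x)" .
qed

lemma mode_series_caputo_caputo:
  assumes x: "x \<in> {0<..<1}"
  shows "caputo_x \<alpha> (caputo_x \<alpha> u) x y = (\<Sum>n. (\<mu> n)\<^sup>2 * (X n x * Y n y))"
    and "has_caputo_x \<alpha> (caputo_x \<alpha> u) x y"
proof -
  have bd: "\<exists>M. summable M \<and> (\<forall>n. \<forall>x\<in>{a..b}. \<bar>- (\<mu> n * (A n * Y n y)) * deriv (e n) x\<bar> + \<bar>\<mu> n * (B n * Y n y) * deriv (K n) x\<bar>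
      + \<bar>- (\<mu> n * (A n * Y n y)) * e n x + \<mu> n * (B n * Y n y) * K n x\<bar> + \<bar>- (\<mu> n * (A n * Y n y)) * caputo \<alpha> (e n) x\<bar>
      + \<bar>\<mu> n * (B n * Y n y) * caputo \<alpha> (K n) x\<bar> \<le> M n)"
    if ab: "0 < a" "a < b" "b < 1" for a b
  proof -
    obtain M where M: "summable M" "\<And>n x. x \<in> {a..b} \<Longrightarrow> \<bar>A n * Y n y * (\<mu> n * deriv (e n) x)\<bar> + \<bar>B n * Y n y * (\<mu> n * deriv (K n) x)\<bar> \<le> M n"
      "\<And>n x. x \<in> {a..b} \<Longrightarrow> \<bar>A n * Y n y * (\<mu> n * e n x)\<bar> + \<bar>B n * Y n y * (\<mu> n * K n x)\<bar> \<le> M n"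
      "\<And>n x. x \<in> {a..b} \<Longrightarrow> \<bar>A n * Y n y * ((\<mu> n)\<^sup>2 * e n x)\<bar> + \<bar>B n * Y n y * ((\<mu> n)\<^sup>2 * S n x)\<bar> \<le> M n"
      using mode_terms_bound[OF ab] by blast
    show ?thesis
    proof (intro exI[of _ "\<lambda>n. M n + M n + M n"] conjI summable_add M(1) allI ballI)
      fix n x assume xab: "x \<in> {a..b}"
      then have x: "x \<in> {0<..<1}" using ab by auto
      have m1: "\<bar>- (\<mu> n * (A n * Y n y)) * v\<bar> = \<bar>A n * Y n y * (\<mu> n * v)\<bar>"
        and m2: "\<bar>\<mu> n * (B n * Y n y) * v\<bar> = \<bar>B n * Y n y * (\<mu> n * v)\<bar>" for v by (simp_all add: abs_mult)
      have c1: "\<bar>A n * Y n y * (\<mu> n * caputo \<alpha> (e n) x)\<bar> = \<bar>A n * Y n y * ((\<mu> n)\<^sup>2 * e n x)\<bar>"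
        unfolding mode_caputo(1)[OF x] by (simp add: abs_mult power2_eq_square)
      have c2: "\<bar>B n * Y n y * (\<mu> n * caputo \<alpha> (K n) x)\<bar> = \<bar>B n * Y n y * ((\<mu> n)\<^sup>2 * S n x)\<bar>"
        unfolding mode_caputo(5)[OF x] by (simp add: abs_mult power2_eq_square)
      have "\<bar>- (\<mu> n * (A n * Y n y)) * e n x + \<mu> n * (B n * Y n y) * K n x\<bar> \<le> M n"
        using order_trans[OF abs_triangle_ineq, of "- (\<mu> n * (A n * Y n y)) * e n x" "\<mu> n * (B n * Y n y) * K n x" "M n"]
          M(3)[OF xab, of n] unfolding m1 m2 by blast
      moreover have "p1 + p2 + t + q1 + q2 \<le> m + m + m" if "p1 + p2 \<le> m" "q1 + q2 \<le> m" "t \<le> m" for p1 p2 q1 q2 t m :: real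
        using that by linarith
      ultimately show "\<bar>- (\<mu> n * (A n * Y n y)) * deriv (e n) x\<bar> + \<bar>\<mu> n * (B n * Y n y) * deriv (K n) x\<bar>
        + \<bar>- (\<mu> n * (A n * Y n y)) * e n x + \<mu> n * (B n * Y n y) * K n x\<bar> + \<bar>- (\<mu> n * (A n * Y n y)) * caputo \<alpha> (e n) x\<bar>
        + \<bar>\<mu> n * (B n * Y n y) * caputo \<alpha> (K n) x\<bar> \<le> M n + M n + M n"
        using M(2)[OF xab, of n] M(4)[OF xab, of n] unfolding m1 m2 c1 c2 by blast
    qed
  qed
  note r = caputo_monotone_series[OF \<alpha> mode_caputo(2) mode_caputo(6) mode_deriv_signs(1,3) bd x]
  let ?V = "\<lambda>s. \<Sum>n. - (\<mu> n * (A n * Y n y)) * e n s + \<mu> n * (B n * Y n y) * K n s"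
  \<comment> \<open>The inner Caputo derivative is known as a series only for 0 < x < 1, but the
    outer one looks at no other points.\<close>
  have cg: "caputo \<alpha> (\<lambda>s. caputo_x \<alpha> u s y) x = caputo \<alpha> ?V x"
    "has_caputo \<alpha> (\<lambda>s. caputo_x \<alpha> u s y) x \<longleftrightarrow> has_caputo \<alpha> ?V x"
    by (rule caputo_cong_interval(1)[OF mode_series_caputo(1) x] caputo_cong_interval(2)[OF mode_series_caputo(1) x], assumption)+
  show "has_caputo_x \<alpha> (caputo_x \<alpha> u) x y" unfolding has_caputo_x_def cg(2) by (rule r(2))
  have "caputo_x \<alpha> (caputo_x \<alpha> u) x y = (\<Sum>n. - (\<mu> n * (A n * Y n y)) * caputo \<alpha> (e n) x + \<mu> n * (B n * Y n y) * caputo \<alpha> (K n) x)"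
    unfolding caputo_x_def [of \<alpha> "caputo_x \<alpha> u"] cg(1) by (rule r(1))
  also have "\<dots> = (\<Sum>n. (\<mu> n)\<^sup>2 * (X n x * Y n y))"
    unfolding mode_caputo(1)[OF x] mode_caputo(5)[OF x]
    by (intro suminf_cong) (simp add: radial_def power2_eq_square algebra_simps)
  finally show "caputo_x \<alpha> (caputo_x \<alpha> u) x y = (\<Sum>n. (\<mu> n)\<^sup>2 * (X n x * Y n y))" .
qed

lemma mode_Omega_continuous:
  "continuous_on Omega (\<lambda>p. e n (fst p))" "continuous_on Omega (\<lambda>p. S n (fst p))" "continuous_on Omega (\<lambda>p. K n (fst p))"
proof -
  have "continuous_on {0..} (K n)"
    unfolding Kf_def [OF \<alpha>(1), abs_def] divide_inverse by (intro continuous_intros continuous_on_mlp \<alpha>) simp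
  then show "continuous_on Omega (\<lambda>p. K n (fst p))" by (rule continuous_on_Omega_fst)
qed (intro continuous_on_Omega_fst continuous_on_mle continuous_on_Sf \<alpha>)+

lemma mode_series_caputo_continuous: "continuous_on Omega (\<lambda>(x, y). caputo_x \<alpha> u x y)"
proof -
  have "continuous_on Omega (\<lambda>(x, y). \<Sum>n. - (\<mu> n * (A n * Y n y)) * e n x + \<mu> n * (B n * Y n y) * K n x)"
  proof (rule series_continuous_on_Omega)
    show "continuous_on Omega (\<lambda>(x, y). - (\<mu> n * (A n * Y n y)) * e n x + \<mu> n * (B n * Y n y) * K n x)" for n
      unfolding case_prod_unfold by (intro continuous_intros mode_Omega_continuous)
    fix a b :: real assume ab: "0 < a" "a < b" "b < 1"
    obtain M where M: "summable M" "\<And>n x y. x \<in> {a..b} \<Longrightarrow> \<bar>A n * Y n y * (\<mu> n * e n x)\<bar> + \<bar>B n * Y n y * (\<mu> n * K n x)\<bar> \<le> M n"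
      using mode_terms_bound[OF ab] by blast
    have "\<bar>- (\<mu> n * (A n * Y n y)) * e n x + \<mu> n * (B n * Y n y) * K n x\<bar> \<le> M n" if "x \<in> {a..b}" for n x y
    proof -
      have "\<bar>- (\<mu> n * (A n * Y n y)) * e n x\<bar> = \<bar>A n * Y n y * (\<mu> n * e n x)\<bar>"
        "\<bar>\<mu> n * (B n * Y n y) * K n x\<bar> = \<bar>B n * Y n y * (\<mu> n * K n x)\<bar>" by (simp_all add: abs_mult)
      then show ?thesis
        using order_trans[OF abs_triangle_ineq, of "- (\<mu> n * (A n * Y n y)) * e n x" "\<mu> n * (B n * Y n y) * K n x" "M n"]
          M(2)[OF that, of n y] by simp
    qed
    with M(1) show "\<exists>M. summable M \<and> (\<forall>n. \<forall>x\<in>{a..b}. \<forall>y.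
        \<bar>- (\<mu> n * (A n * Y n y)) * e n x + \<mu> n * (B n * Y n y) * K n x\<bar> \<le> M n)" by blast
  qed
  then show ?thesis
    by (rule continuous_on_eq) (auto dest!: Omega_memD simp: mode_series_caputo(1))
qed

text \<open>Treats at once mu^2, for the second Caputo derivative, and kap^2, for the second
  y-derivative; \<open>d\<close> carries the sign.\<close>

lemma radial_squared_continuous:
  assumes d: "\<And>n x y. \<bar>d n\<bar> * \<bar>X n x * Y n y\<bar> \<le> \<bar>A n * Y n y * (r n * e n x)\<bar> + \<bar>B n * Y n y * (r n * S n x)\<bar>"
    and r: "r = (\<lambda>n. (\<mu> n)\<^sup>2) \<or> r = (\<lambda>n. (kap n)\<^sup>2)"
  shows "continuous_on Omega (\<lambda>(x, y). \<Sum>n. d n * (X n x * Y n y))"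
    and "x \<in> {0<..<1} \<Longrightarrow> summable (\<lambda>n. d n * (X n x * Y n y))"
proof -
  have bd: "\<exists>M. summable M \<and> (\<forall>n. \<forall>x\<in>{a..b}. \<forall>y. \<bar>d n * (X n x * Y n y)\<bar> \<le> M n)"
    if ab: "0 < a" "a < b" "b < 1" for a b
  proof -
    obtain M where M: "summable M" "\<And>n x y. x \<in> {a..b} \<Longrightarrow> \<bar>A n * Y n y * (r n * e n x)\<bar> + \<bar>B n * Y n y * (r n * S n x)\<bar> \<le> M n"
      using mode_terms_bound[OF ab] r by blast
    have "\<bar>d n * (X n x * Y n y)\<bar> \<le> M n" if "x \<in> {a..b}" for n x y
      using order_trans[OF d M(2)[OF that]] by (simp add: abs_mult)
    with M(1) show ?thesis by blast
  qed
  show "continuous_on Omega (\<lambda>(x, y). \<Sum>n. d n * (X n x * Y n y))"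
  proof (rule series_continuous_on_Omega[OF _ bd])
    show "continuous_on Omega (\<lambda>(x, y). d n * (X n x * Y n y))" for n
      unfolding case_prod_unfold radial_def by (intro continuous_intros mode_Omega_continuous)
  qed
  assume x: "x \<in> {0<..<1}"
  then obtain M where M: "summable M" "\<And>n. \<bar>d n * (X n x * Y n y)\<bar> \<le> M n"
    using bd[of "x / 2" x] by auto
  then show "summable (\<lambda>n. d n * (X n x * Y n y))"
    by (intro summable_comparison_test'[OF M(1)]) simp
qed

lemma radial_scaled_bound:
  "0 \<le> r \<Longrightarrow> r * \<bar>X n x * Y n y\<bar> \<le> \<bar>A n * Y n y * (r * e n x)\<bar> + \<bar>B n * Y n y * (r * S n x)\<bar>"
proof -
  assume r: "0 \<le> r"
  have "r * \<bar>X n x * Y n y\<bar> = \<bar>r * (X n x * Y n y)\<bar>" using r by (simp add: abs_mult)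
  also have "r * (X n x * Y n y) = A n * Y n y * (r * e n x) + B n * Y n y * (r * S n x)"
    by (simp add: radial_def algebra_simps)
  finally show ?thesis using abs_triangle_ineq by simp
qed

lemma mode_series_yy_eq:
  "x \<in> {0<..<1} \<Longrightarrow> partial_yy u x y = (\<Sum>n. - (kap n)\<^sup>2 * (X n x * Y n y))"
  unfolding mode_series_yy(2) by (simp add: mult_ac)

lemma mode_series_regular: "regular_solution \<alpha> \<epsilon> c u"
proof -
  have mu2: "\<bar>(\<mu> n)\<^sup>2\<bar> * \<bar>X n x * Y n y\<bar> \<le> \<bar>A n * Y n y * ((\<mu> n)\<^sup>2 * e n x)\<bar> + \<bar>B n * Y n y * ((\<mu> n)\<^sup>2 * S n x)\<bar>" for n x y
    using radial_scaled_bound[of "(\<mu> n)\<^sup>2"] by simp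
  have kap2: "\<bar>- (kap n)\<^sup>2\<bar> * \<bar>X n x * Y n y\<bar> \<le> \<bar>A n * Y n y * ((kap n)\<^sup>2 * e n x)\<bar> + \<bar>B n * Y n y * ((kap n)\<^sup>2 * S n x)\<bar>" for n x y
    using radial_scaled_bound[of "(kap n)\<^sup>2"] by simp
  note m = radial_squared_continuous[where d = "\<lambda>n. (\<mu> n)\<^sup>2", OF mu2 disjI1[OF refl]]
  note k = radial_squared_continuous[where d = "\<lambda>n. - (kap n)\<^sup>2", OF kap2 disjI2[OF refl]]
  have cc: "continuous_on Omega (\<lambda>(x, y). caputo_x \<alpha> (caputo_x \<alpha> u) x y)"
    by (rule continuous_on_eq[OF m(1)]) (auto dest!: Omega_memD simp: mode_series_caputo_caputo(1))
  have yy: "continuous_on Omega (\<lambda>(x, y). partial_yy u x y)"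
    by (rule continuous_on_eq[OF k(1)]) (auto dest!: Omega_memD simp: mode_series_yy_eq)
  have eq: "caputo_x \<alpha> (caputo_x \<alpha> u) x y + partial_yy u x y - \<epsilon> * partial_yy u x (- y) - c\<^sup>2 * u x y = 0"
    if x: "x \<in> {0<..<1}" for x y
  proof -
    note s1 = m(2)[OF x, of y] and s2 = k(2)[OF x, of y] and s3 = summable_mult[OF k(2)[OF x, of "- y"], of \<epsilon>]
    have x': "x \<in> {0..1}" using x by simp
    have s4: "summable (\<lambda>n. c\<^sup>2 * (X n x * Y n y))" by (rule summable_mult[OF mode_series_summable[OF x']])
    have "caputo_x \<alpha> (caputo_x \<alpha> u) x y + partial_yy u x y - \<epsilon> * partial_yy u x (- y) - c\<^sup>2 * u x y =
      (\<Sum>n. (\<mu> n)\<^sup>2 * (X n x * Y n y)) + (\<Sum>n. - (kap n)\<^sup>2 * (X n x * Y n y))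
        - (\<Sum>n. \<epsilon> * (- (kap n)\<^sup>2 * (X n x * Y n (- y)))) - (\<Sum>n. c\<^sup>2 * (X n x * Y n y))"
      unfolding mode_series_caputo_caputo(1)[OF x] mode_series_yy_eq[OF x] mode_series_def
        suminf_mult[OF k(2)[OF x, of "- y"]] suminf_mult[OF mode_series_summable[OF x']] ..
    also have "\<dots> = (\<Sum>n. (\<mu> n)\<^sup>2 * (X n x * Y n y) + - (kap n)\<^sup>2 * (X n x * Y n y)
        - \<epsilon> * (- (kap n)\<^sup>2 * (X n x * Y n (- y))) - c\<^sup>2 * (X n x * Y n y))"
      unfolding suminf_add[OF s1 s2] suminf_diff[OF summable_add[OF s1 s2] s3]
        suminf_diff[OF summable_diff[OF summable_add[OF s1 s2] s3] s4] ..
    \<comment> \<open>Each term has the factor mu^2 - kap^2 + sigma epsilon kap^2 - c^2 = 0, where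
      sigma is the sign of \<open>Y n\<close> under reflection.\<close>
    also have "\<dots> = (\<Sum>n. 0)"
      unfolding mu_squared[OF \<epsilon>] Y_reflect by (intro suminf_cong) (simp add: algebra_simps)
    finally show ?thesis by simp
  qed
  have "u x differentiable (at y)" if "x \<in> {0<..<1}" for x y
    using mode_series_has_derivative[of x y] that by (auto simp: real_differentiable_def)
  then show ?thesis
    unfolding regular_solution_def closure_Omega
    using mode_series_continuous mode_series_caputo(2) mode_series_caputo_continuous mode_series_caputo_caputo(2)
      cc yy eq mode_series_yy(1) by (auto dest!: Omega_memD)
qed

lemma mode_series_solution:
  assumes \<phi>: "\<And>y. y \<in> {-pi..pi} \<Longrightarrow> (\<Sum>n. A n * Y n y) = \<phi> y"
    and \<psi>: "\<And>y. y \<in> {-pi..pi} \<Longrightarrow> (\<Sum>n. (A n * mle \<alpha> (- mu \<epsilon> c n) 1 + B n) * Y n y) = \<psi> y"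
  shows "problem_solution \<alpha> \<epsilon> c \<phi> \<psi> u"
proof -
  have u0: "u 0 y = (\<Sum>n. A n * Y n y)" for y
    by (simp add: mode_series_def radial_def mle_0[OF \<alpha>(1)] Sf_0[OF \<alpha>(1)])
  have u1: "u 1 y = (\<Sum>n. (A n * mle \<alpha> (- mu \<epsilon> c n) 1 + B n) * Y n y)" for y
    by (simp add: mode_series_def radial_def Sf_1[OF \<alpha>(1) mu_pos[OF \<epsilon>]])
  have p0: "u x (- pi) = - u x pi" if "x \<in> {0..1}" for x
    unfolding mode_series_def Y_antiperiodic using suminf_minus[OF mode_series_summable[OF that, of pi]] by simp
  have p1: "partial_y u x (- pi) = - partial_y u x pi" if x: "x \<in> {0..1}" for x
  proof -
    have "summable (\<lambda>n. X n x * Yd n pi)"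
      by (rule summable_comparison_test'[OF AB]) (use radial_Yd_bound[OF x] in simp)
    then show ?thesis using mode_series_partial_y(2)[OF x, of pi] mode_series_partial_y(2)[OF x, of "- pi"]
      by (simp add: Y_antiperiodic suminf_minus)
  qed
  show ?thesis
    unfolding problem_solution_def closure_Omega
    using mode_series_regular mode_series_partial_y(1) mode_series_partial_y_continuous u0 u1 \<phi> \<psi> p0 p1 by auto
qed

end

section \<open>Return to the functions C and S\<close>

lemma radial_eq_series_term:
  assumes "0 < \<alpha>" "\<bar>\<epsilon>\<bar> < 1"
  shows "radial \<alpha> \<epsilon> c (fourier_coeff \<phi>) (\<lambda>n. fourier_coeff \<psi> n - fourier_coeff \<phi> n * mle \<alpha> (- mu \<epsilon> c n) 1) n x * Y n y
    = series_term \<alpha> \<epsilon> c \<phi> \<psi> n x y"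
  unfolding radial_def series_term_def C_fun_eq[OF assms(1) mu_pos[OF assms(2)]] S_fun_eq[OF assms(1) mu_pos[OF assms(2)]]
  by (simp add: algebra_simps)

lemma suminf_even_odd:
  fixes f :: "nat \<Rightarrow> real"
  assumes "summable (\<lambda>n. \<bar>f n\<bar>)"
  shows "summable (\<lambda>k. f (2 * k))" "summable (\<lambda>k. f (2 * k + 1))"
    and "suminf f = (\<Sum>k. f (2 * k)) + (\<Sum>k. f (2 * k + 1))"
proof -
  have sub: "summable (\<lambda>k. f (g k))" if "inj g" for g :: "nat \<Rightarrow> nat"
    using summable_reindex[OF assms that] summable_rabs_cancel[of "\<lambda>k. f (g k)"] by (simp add: o_def)
  show e: "summable (\<lambda>k. f (2 * k))" by (rule sub) (simp add: inj_def)
  show o: "summable (\<lambda>k. f (2 * k + 1))" by (rule sub) (simp add: inj_def)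
  have "f sums suminf f" by (rule summable_sums[OF summable_rabs_cancel[OF assms]])
  then have "(\<lambda>k. sum f {k * 2..<k * 2 + 2}) sums suminf f" by (rule sums_group) simp
  then have "(\<lambda>k. f (2 * k) + f (2 * k + 1)) sums suminf f" by (simp only: sum_pair_block)
  moreover have "(\<lambda>k. f (2 * k) + f (2 * k + 1)) sums ((\<Sum>k. f (2 * k)) + (\<Sum>k. f (2 * k + 1)))"
    by (intro sums_add summable_sums e o)
  ultimately show "suminf f = (\<Sum>k. f (2 * k)) + (\<Sum>k. f (2 * k + 1))" by (rule sums_unique2)
qed

theorem theorem4:
  fixes \<alpha> c \<epsilon> \<delta> :: real and \<phi> \<psi> :: "real \<Rightarrow> real"
  assumes "0 < \<alpha>" "\<alpha> \<le> 1" "\<bar>\<epsilon>\<bar> < 1" "0 < \<delta>" "\<delta> < 1"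
    and "\<phi> \<in> hoelder_space 3 \<delta> {-pi..pi}"
    and "\<psi> \<in> hoelder_space 2 \<delta> {-pi..pi}"
    and "\<phi> (-pi) = - \<phi> pi"
    and "deriv_within {-pi..pi} \<phi> (-pi) = - deriv_within {-pi..pi} \<phi> pi"
    and "\<psi> (-pi) = - \<psi> pi"
    and "deriv_within {-pi..pi} \<psi> (-pi) = - deriv_within {-pi..pi} \<psi> pi"
  shows "\<exists>u. problem_solution \<alpha> \<epsilon> c \<phi> \<psi> u
    \<and> (\<forall>v. problem_solution \<alpha> \<epsilon> c \<phi> \<psi> v \<longrightarrow> (\<forall>(x, y)\<in>closure Omega. v x y = u x y))
    \<and> (\<forall>(x, y)\<in>closure Omega.
          summable (\<lambda>k. series_term \<alpha> \<epsilon> c \<phi> \<psi> (2 * k) x y)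
        \<and> summable (\<lambda>k. series_term \<alpha> \<epsilon> c \<phi> \<psi> (2 * k + 1) x y)
        \<and> u x y = (\<Sum>k. series_term \<alpha> \<epsilon> c \<phi> \<psi> (2 * k) x y)
                + (\<Sum>k. series_term \<alpha> \<epsilon> c \<phi> \<psi> (2 * k + 1) x y))"
proof -
  \<comment> \<open>At x = 0 \<open>Sf\<close> vanishes and \<open>mle\<close> is 1; at x = 1
    \<open>Sf\<close> is 1, so \<open>B\<close> is the coefficient of \<open>\<psi>\<close> minus
    what \<open>mle\<close> already contributes.\<close>
  define A B where "A = fourier_coeff \<phi>" and "B n = fourier_coeff \<psi> n - A n * mle \<alpha> (- mu \<epsilon> c n) 1" for n
  have two: "2 \<le> (3 :: nat)" "2 \<le> (2 :: nat)" by simp_all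
  note \<phi> = hoelder_space_fourier[OF assms(6) two(1) assms(8,9)]
  note \<psi> = hoelder_space_fourier[OF assms(7) two(2) assms(10,11)]
  have AB: "summable (\<lambda>n. kap n * (\<bar>A n\<bar> + \<bar>B n\<bar>))"
  proof (rule summable_comparison_test')
    show "summable (\<lambda>n. 2 * (kap n * \<bar>fourier_coeff \<phi> n\<bar>) + kap n * \<bar>fourier_coeff \<psi> n\<bar>)"
      by (intro summable_add summable_mult \<phi>(2) \<psi>(2))
    fix n :: nat assume "0 \<le> n"
    note mp = mu_pos[OF assms(3), of c n]
    have "\<bar>mle \<alpha> (- mu \<epsilon> c n) 1\<bar> \<le> 1"
      using mle_nonneg[OF assms(1,2) mp, of 1] mle_le_1[OF assms(1,2) mp, of 1] by simp
    then have "\<bar>A n * mle \<alpha> (- mu \<epsilon> c n) 1\<bar> \<le> \<bar>A n\<bar>" unfolding abs_mult by (rule mult_left_le) simp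
    then have "\<bar>A n\<bar> + \<bar>B n\<bar> \<le> 2 * \<bar>A n\<bar> + \<bar>fourier_coeff \<psi> n\<bar>"
      using abs_triangle_ineq4[of "fourier_coeff \<psi> n" "A n * mle \<alpha> (- mu \<epsilon> c n) 1"] by (simp add: B_def)
    then have "kap n * (\<bar>A n\<bar> + \<bar>B n\<bar>) \<le> kap n * (2 * \<bar>A n\<bar> + \<bar>fourier_coeff \<psi> n\<bar>)"
      by (rule mult_left_mono) (simp add: less_imp_le kap_pos)
    then show "norm (kap n * (\<bar>A n\<bar> + \<bar>B n\<bar>)) \<le> 2 * (kap n * \<bar>fourier_coeff \<phi> n\<bar>) + kap n * \<bar>fourier_coeff \<psi> n\<bar>"
      using kap_pos[of n] by (simp add: A_def abs_mult algebra_simps)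
  qed
  define u where "u = mode_series \<alpha> \<epsilon> c A B"
  have sol: "problem_solution \<alpha> \<epsilon> c \<phi> \<psi> u"
    unfolding u_def
  proof (rule mode_series_solution[OF assms(1-3) AB])
    fix y :: real assume y: "y \<in> {-pi..pi}"
    show "(\<Sum>n. A n * Y n y) = \<phi> y" unfolding A_def by (rule fourier_series_eq[OF \<phi> y])
    show "(\<Sum>n. (A n * mle \<alpha> (- mu \<epsilon> c n) 1 + B n) * Y n y) = \<psi> y"
      using fourier_series_eq[OF \<psi> y] by (simp add: B_def)
  qed
  have X: "radial \<alpha> \<epsilon> c A B n x * Y n y = series_term \<alpha> \<epsilon> c \<phi> \<psi> n x y" for n x y
    unfolding A_def B_def [abs_def] by (rule radial_eq_series_term[OF assms(1,3)])
  have series: "summable (\<lambda>k. series_term \<alpha> \<epsilon> c \<phi> \<psi> (2 * k) x y) \<and> summable (\<lambda>k. series_term \<alpha> \<epsilon> c \<phi> \<psi> (2 * k + 1) x y)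
      \<and> u x y = (\<Sum>k. series_term \<alpha> \<epsilon> c \<phi> \<psi> (2 * k) x y) + (\<Sum>k. series_term \<alpha> \<epsilon> c \<phi> \<psi> (2 * k + 1) x y)"
    if xy: "(x, y) \<in> closure Omega" for x y
  proof -
    have x: "x \<in> {0..1}" using xy by (simp add: closure_Omega)
    have "summable (\<lambda>n. \<bar>series_term \<alpha> \<epsilon> c \<phi> \<psi> n x y\<bar>)"
      unfolding X [symmetric]
      by (rule summable_comparison_test'[OF AB_summable[OF assms(1-3) AB]])
        (use order_trans[OF abs_mult_Y_le radial_bound[OF assms(1-3) AB x]] in simp)
    from suminf_even_odd[OF this] show ?thesis by (simp add: u_def mode_series_def X)
  qed
  show ?thesis
  proof (intro exI[of _ u] conjI allI impI)
    show "\<forall>(x, y)\<in>closure Omega. v x y = u x y" if "problem_solution \<alpha> \<epsilon> c \<phi> \<psi> v" for v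
      using problem_solution_unique[OF assms(1-3) that sol] by auto
  qed (use sol series in auto)
qed

end
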